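(* Let $X_1,X_2,\dots$ be a short-memory linear process $X_i=\sum_{j=0}^\infty\psi_j\eta_{i-j}$, let $1\le q<2$, and let $\mathcal F$ be a bounded subset of $\mathcal W_q[0,1]$ (the space of functions on $[0,1]$ with bounded $q$-variation). Then there exists a version of the isonormal Gaussian process $\nu$ restricted to $\mathcal F$ with values in a separable subset of $\ell^\infty(\mathcal F)$, which is measurable for the Borel sets on its range, and $$n^{-1/2}\nu_n\xrightarrow{\mathscr D^*}\sigma_\eta A_\psi\,\nu\qquad\text{in }\ell^\infty(\mathcal F)\text{ as }n\to\infty .$$
   Context: Short-memory linear process: $(\eta_j)_{j\in\mathbb Z}$ are i.i.d. real random variables on a probability space $(\Omega,\mathcal A,\mathsf P)$ with mean zero and finite variance $\sigma_\eta^2=\mathsf E\eta_1^2\neq0$ ($\sigma_\eta>0$); $(\psi_j)_{j\ge0}$ are real numbers with $\sum_{j\ge0}|\psi_j|<\infty$ and $A_\psi:=\sum_{j\ge0}\psi_j\ne0$; and $X_i=\sum_{j=0}^\infty\psi_j\eta_{i-j}$ for $i\in\mathbb Z$. Weighted sums: for $f:[0,1]\to\mathbb R$ and $n\ge1$, $\nu_n(f):=\sum_{i=1}^nX_if(i/n)$, and $\nu_n=\{\nu_n(f):f\in\mathcal F\}$. $q$-variation: $v_q(g)=v_q(g;[0,1])=\sup\{\sum_{i=1}^m|g(t_i)-g(t_{i-1})|^q:0=t_0<\dots<t_m=1,\ m\ge1\}$; $\mathcal W_q[0,1]$ is the set of $g:[0,1]\to\mathbb R$ with $v_q(g)<\infty$,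 with norm $\|g\|_{[q]}=\sup_{t\in[0,1]}|g(t)|+v_q(g)^{1/q}$; "bounded" refers to this norm. $\ell^\infty(\mathcal F)$: the Banach space of bounded functions $\mu:\mathcal F\to\mathbb R$ with norm $\|\mu\|_{\mathcal F}=\sup_{f\in\mathcal F}|\mu(f)|$. Isonormal Gaussian process $\nu$: a centred Gaussian process indexed by $f\in\mathcal L^2([0,1],\lambda)$ ($\lambda$ Lebesgue measure) with $\mathsf E[\nu(f)\nu(g)]=\int_0^1fg\,d\lambda$. Convergence in outer distribution: let $\mathbb E$ be a metric space, let $Z_n$ be (arbitrary) functions from probability spaces $(\Omega_n,\mathcal A_n,P_n)$ into $\mathbb E$, $n\ge0$, where $Z_0$ takes values in a separable subset of $\mathbb E$ and is measurable for the Borel sets on its range. Then $Z_n\xrightarrow{\mathscr D^*}Z_0$ means $\lim_{n\to\infty}E^*h(Z_n)=Eh(Z_0)$ for every bounded continuous $h:\mathbb E\to\mathbb R$, where $E^*T=\inf\{EU:U\text{ measurable},\ EU\text{ exists},\ U\ge T\}$ is the outer integral. *)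

theory Defs
  imports "HOL-Probability.Probability"
begin

text \<open>
  The innovations are square integrable, hence integrable since the space has measure one.
  The defining series of the process converges absolutely almost surely, but in general not
  everywhere, so it is required to have the sum \<open>X i\<close> almost surely.
\<close>

definition iid_innovations :: "'a measure \<Rightarrow> (int \<Rightarrow> 'a \<Rightarrow> real) \<Rightarrow> bool" where
  "iid_innovations M \<eta> \<longleftrightarrow>
     prob_space.indep_vars M (\<lambda>_. borel) \<eta> UNIV \<and>
     (\<forall>j. distr M borel (\<eta> j) = distr M borel (\<eta> 1)) \<and>
     integrable M (\<lambda>\<omega>. (\<eta> 1 \<omega>)\<^sup>2) \<and>
     (\<integral>\<omega>. \<eta> 1 \<omega> \<partial>M) = 0 \<and>
     (\<integral>\<omega>. (\<eta> 1 \<omega>)\<^sup>2 \<partial>M) \<noteq> 0"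

definition short_memory_linear_process ::
    "'a measure \<Rightarrow> (int \<Rightarrow> 'a \<Rightarrow> real) \<Rightarrow> (nat \<Rightarrow> real) \<Rightarrow> (int \<Rightarrow> 'a \<Rightarrow> real) \<Rightarrow> bool" where
  "short_memory_linear_process M \<eta> \<psi> X \<longleftrightarrow>
     iid_innovations M \<eta> \<and>
     summable (\<lambda>j. \<bar>\<psi> j\<bar>) \<and> (\<Sum>j. \<psi> j) \<noteq> 0 \<and>
     (\<forall>i. X i \<in> borel_measurable M \<and>
          (AE \<omega> in M. (\<lambda>j. \<psi> j * \<eta> (i - int j) \<omega>) sums X i \<omega>))"

definition weighted_sum :: "(int \<Rightarrow> 'a \<Rightarrow> real) \<Rightarrow> nat \<Rightarrow> (real \<Rightarrow> real) \<Rightarrow> 'a \<Rightarrow> real" where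
  "weighted_sum X n f \<omega> = (\<Sum>i=1..n. X (int i) \<omega> * f (real i / real n))"

text \<open>
  Functions on \<open>[0,1]\<close> are the elements of \<open>extensional {0..1}\<close>, so that distinct elements
  differ at some point of \<open>[0,1]\<close>.
\<close>

definition q_variation :: "real \<Rightarrow> (real \<Rightarrow> real) \<Rightarrow> ennreal" where
  "q_variation q g =
     (SUP (m, t) \<in> {(m :: nat, t :: nat \<Rightarrow> real).
          m \<ge> 1 \<and> t 0 = 0 \<and> t m = 1 \<and> (\<forall>i<m. t i < t (Suc i))}.
        \<Sum>i=1..m. ennreal (\<bar>g (t i) - g (t (i - 1))\<bar> powr q))"

definition Wq :: "real \<Rightarrow> (real \<Rightarrow> real) set" where
  "Wq q = {g \<in> extensional {0..1}. q_variation q g < \<infinity>}"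

definition Wq_norm :: "real \<Rightarrow> (real \<Rightarrow> real) \<Rightarrow> real" where
  "Wq_norm q g = (SUP t\<in>{0..1}. \<bar>g t\<bar>) + enn2real (q_variation q g) powr (1 / q)"

definition Wq_bounded :: "real \<Rightarrow> (real \<Rightarrow> real) set \<Rightarrow> bool" where
  "Wq_bounded q F \<longleftrightarrow> F \<subseteq> Wq q \<and> (\<exists>C. \<forall>f\<in>F. Wq_norm q f \<le> C)"

text \<open>
  The degenerate normal law is allowed. An isonormal process needs no larger sample space
  than \<open>nat \<Rightarrow> real\<close>: the space of square-integrable functions on \<open>[0,1]\<close> is separable, so
  the process can be built from a sequence of independent standard normal variables.
\<close>

definition centred_gaussian_rv :: "'b measure \<Rightarrow> ('b \<Rightarrow> real) \<Rightarrow> bool" where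
  "centred_gaussian_rv N Y \<longleftrightarrow>
     Y \<in> borel_measurable N \<and>
     ((AE x in N. Y x = 0) \<or> (\<exists>\<sigma>>0. distributed N lborel Y (normal_density 0 \<sigma>)))"

definition centred_gaussian_process ::
    "'b measure \<Rightarrow> 't set \<Rightarrow> ('t \<Rightarrow> 'b \<Rightarrow> real) \<Rightarrow> bool" where
  "centred_gaussian_process N T W \<longleftrightarrow>
     (\<forall>A c. finite A \<and> A \<subseteq> T \<longrightarrow> centred_gaussian_rv N (\<lambda>x. \<Sum>t\<in>A. c t * W t x))"

definition L2_unit :: "(real \<Rightarrow> real) set" where
  "L2_unit = {f \<in> extensional {0..1}.
     f \<in> borel_measurable (lebesgue_on {0..1}) \<and> integrable (lebesgue_on {0..1}) (\<lambda>t. (f t)\<^sup>2)}"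

definition isonormal_process ::
    "'b measure \<Rightarrow> ((real \<Rightarrow> real) \<Rightarrow> 'b \<Rightarrow> real) \<Rightarrow> bool" where
  "isonormal_process N W \<longleftrightarrow>
     prob_space N \<and> centred_gaussian_process N L2_unit W \<and>
     (\<forall>f\<in>L2_unit. \<forall>g\<in>L2_unit.
        (\<integral>x. W f x * W g x \<partial>N) = (\<integral>t. f t * g t \<partial>lebesgue_on {0..1}))"

text \<open>
  Expectations of extended real functions, with values in the extended reals; note that
  \<open>e2ennreal\<close> sends negative numbers to 0.
\<close>

definition expectation_exists :: "'a measure \<Rightarrow> ('a \<Rightarrow> ereal) \<Rightarrow> bool" where
  "expectation_exists M U \<longleftrightarrow>
     (\<integral>\<^sup>+x. e2ennreal (U x) \<partial>M) < \<infinity> \<or> (\<integral>\<^sup>+x. e2ennreal (- U x) \<partial>M) < \<infinity>"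

definition ereal_expectation :: "'a measure \<Rightarrow> ('a \<Rightarrow> ereal) \<Rightarrow> ereal" where
  "ereal_expectation M U =
     enn2ereal (\<integral>\<^sup>+x. e2ennreal (U x) \<partial>M) - enn2ereal (\<integral>\<^sup>+x. e2ennreal (- U x) \<partial>M)"

definition outer_expectation :: "'a measure \<Rightarrow> ('a \<Rightarrow> real) \<Rightarrow> ereal" where
  "outer_expectation M T =
     Inf {ereal_expectation M U | U. U \<in> borel_measurable M \<and> expectation_exists M U \<and>
            (\<forall>x\<in>space M. ereal (T x) \<le> U x)}"

definition borel_of_topology :: "'e topology \<Rightarrow> 'e measure" where
  "borel_of_topology X = sigma (topspace X) {U. openin X U}"

definition separably_valued_borel :: "'e metric \<Rightarrow> 'b measure \<Rightarrow> ('b \<Rightarrow> 'e) \<Rightarrow> bool" where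
  "separably_valued_borel E N Z \<longleftrightarrow>
     (\<exists>S \<subseteq> mspace E. separable_space (subtopology (mtopology_of E) S) \<and> Z ` space N \<subseteq> S) \<and>
     Z \<in> N \<rightarrow>\<^sub>M borel_of_topology (subtopology (mtopology_of E) (Z ` space N))"

definition converges_in_outer_distribution ::
    "'e metric \<Rightarrow> (nat \<Rightarrow> 'a measure) \<Rightarrow> (nat \<Rightarrow> 'a \<Rightarrow> 'e) \<Rightarrow> 'b measure \<Rightarrow> ('b \<Rightarrow> 'e) \<Rightarrow> bool" where
  "converges_in_outer_distribution E P Z P0 Z0 \<longleftrightarrow>
     (\<forall>n. prob_space (P n) \<and> Z n ` space (P n) \<subseteq> mspace E) \<and>
     prob_space P0 \<and> separably_valued_borel E P0 Z0 \<and>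
     (\<forall>h. continuous_map (mtopology_of E) euclideanreal h \<and> bounded (h ` mspace E) \<longrightarrow>
        (\<lambda>n. outer_expectation (P n) (\<lambda>x. h (Z n x)))
          \<longlonglongrightarrow> ereal (\<integral>x. h (Z0 x) \<partial>P0))"

text \<open>
  The library metric space of bounded functions with the supremum distance; its points are
  extensional on the index set, which is why processes are restricted to it.
\<close>

definition linfty :: "'t set \<Rightarrow> ('t \<Rightarrow> real) metric" where
  "linfty F = funspace F euclidean_metric"

end

theory Submission
  imports Defs
begin

text \<open>Approximate \<open>f\<close> by the step function \<open>f_k\<close> taking on each dyadic cell of level \<open>k\<close> the value at its
  left endpoint. For fixed \<open>k\<close> the normalised sums of \<open>f_k\<close> are a fixed linear combination of \<open>2^k\<close> block
  sums of the process; these differ from \<open>\<Sum>j. \<psi> j\<close> times the block sums of the innovations by \<open>o(\<surd>n)\<close> in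
  mean, and the classical central limit theorem applies. It remains to bound the error of the approximation
  uniformly over \<open>f\<close> and \<open>n\<close>. The sum over \<open>j\<close> may be taken outside, so independent innovations suffice. If
  these are bounded, chaining over the dyadic levels works since \<open>q < 2\<close> makes the contributions of the
  levels summable by means of second and fourth moments. In general, truncation leaves independent
  variables of small variance; the partial sums \<open>s\<close> of these are approximated by step functions \<open>a_l\<close> with \<open>\<bar>s - a_l\<bar>\<close>
  at most \<open>2 powr (- l)\<close> and, in mean, at most \<open>4^l\<close> times the variance many jumps. Summing by parts, the
  weighted sums of the increments of \<open>a_(l+1) - a_l\<close> are bounded uniformly over functions of bounded
  \<open>q\<close>-variation, and the bounds are again summable in \<open>l\<close>. The same chaining extends white noise on dyadic step
  functions to a limit process which is the uniform limit of finite-dimensional ones, hence separably valued.\<close>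

text \<open>Functions in the class may jump anywhere, so neither uniform approximation nor a
  pointwise modulus is available; only the sum of the \<open>q\<close>-th powers of the increments
  over disjoint intervals is bounded. In dyadic chaining the few large increments must be kept from
  meeting large cell sums, and second moments alone do not give this: the squares of the cell sums
  add up to order one at every level, which leaves room for a single cell that carries everything.
  Fourth moments exclude it, but the innovations have only two. Hence the truncation: the unbounded
  rest need not become smaller along the levels, it only has to be bounded in mean by a constant
  times its standard deviation, and the greedy approximation of a square integrable martingale gives
  exactly that. A supremum over the class need not be measurable. Error bounds are therefore
  pathwise inequalities with a measurable majorant serving all functions at once, and only its mean
  is estimated; this form passes through the series over \<open>j\<close>, where every shift has the
  same bound, and into outer expectations.\<close>

section \<open>Functions of bounded variation\<close>

text \<open>The control function of a map of bounded variation replaces all sums over partitions by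
  telescoping sums.\<close>

definition var_control :: "real \<Rightarrow> real \<Rightarrow> (real \<Rightarrow> real) \<Rightarrow> (real \<Rightarrow> real) \<Rightarrow> bool" where
  "var_control q B f w \<longleftrightarrow> w 0 = 0 \<and> w 1 \<le> B \<and>
     (\<forall>s t. 0 \<le> s \<longrightarrow> s \<le> t \<longrightarrow> t \<le> 1 \<longrightarrow> \<bar>f t - f s\<bar> powr q \<le> w t - w s)"

definition var_class :: "real \<Rightarrow> real \<Rightarrow> (real \<Rightarrow> real) set" where
  "var_class q B = {f. (\<forall>t\<in>{0..1}. \<bar>f t\<bar> \<le> B) \<and> (\<exists>w. var_control q B f w)}"

lemma var_controlD:
  assumes "var_control q B f w" "0 \<le> s" "s \<le> t" "t \<le> 1"
  shows "\<bar>f t - f s\<bar> powr q \<le> w t - w s" "w s \<le> w t" "0 \<le> w t" "w t \<le> B"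
proof -
  have mono: "w s \<le> w t" if "0 \<le> s" "s \<le> t" "t \<le> 1" for s t
  proof -
    have "\<bar>f t - f s\<bar> powr q \<le> w t - w s" using assms(1) that unfolding var_control_def by blast
    then show ?thesis using powr_ge_zero[of "\<bar>f t - f s\<bar>" q] by linarith
  qed
  show "\<bar>f t - f s\<bar> powr q \<le> w t - w s" "w s \<le> w t"
    using assms mono unfolding var_control_def by auto
  show "0 \<le> w t" "w t \<le> B"
    using mono[of 0 t] mono[of t 1] assms unfolding var_control_def by auto
qed

text \<open>The right endpoint \<open>t\<close> is variable because the supremum over this set, as a
  function of \<open>t\<close>, is the control function. Allowing \<open>m = 0\<close> makes the set
  for \<open>t = 0\<close> equal to \<open>{0}\<close>, so that the control starts at 0.\<close>

definition partition_sums :: "real \<Rightarrow> (real \<Rightarrow> real) \<Rightarrow> real \<Rightarrow> real set" where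
  "partition_sums q g t = {(\<Sum>i=1..m. \<bar>g (p i) - g (p (i - 1))\<bar> powr q) | m p.
     p 0 = (0::real) \<and> p m = t \<and> (\<forall>i<m. p i < p (Suc i))}"

lemma partition_sums_extend:
  assumes "x \<in> partition_sums q g s" "s < t"
  shows "x + \<bar>g t - g s\<bar> powr q \<in> partition_sums q g t"
proof -
  obtain m :: nat and p where mp: "x = (\<Sum>i=1..m. \<bar>g (p i) - g (p (i - 1))\<bar> powr q)"
    "p 0 = (0::real)" "p m = s" "\<forall>i<m. p i < p (Suc i)"
    using assms(1) unfolding partition_sums_def by blast
  define p' where "p' i = (if i \<le> m then p i else t)" for i
  have "(\<Sum>i=1..Suc m. \<bar>g (p' i) - g (p' (i - 1))\<bar> powr q) = x + \<bar>g t - g s\<bar> powr q"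
  proof -
    have "(\<Sum>i=1..m. \<bar>g (p' i) - g (p' (i - 1))\<bar> powr q) = x"
      unfolding mp(1) by (intro sum.cong) (auto simp: p'_def)
    then show ?thesis using mp(3) by (simp add: p'_def)
  qed
  moreover have "p' 0 = 0" "p' (Suc m) = t" "\<forall>i<Suc m. p' i < p' (Suc i)"
    using mp assms(2) by (auto simp: p'_def less_Suc_eq)
  ultimately show ?thesis unfolding partition_sums_def by (intro CollectI exI[of _ "Suc m"] exI[of _ p']) auto
qed

lemma partition_sums_le_q_variation:
  assumes "x \<in> partition_sums q g 1"
  shows "ennreal x \<le> q_variation q g"
proof -
  obtain m :: nat and p where mp: "x = (\<Sum>i=1..m. \<bar>g (p i) - g (p (i - 1))\<bar> powr q)"
    "p 0 = (0::real)" "p m = 1" "\<forall>i<m. p i < p (Suc i)"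
    using assms(1) unfolding partition_sums_def by blast
  have "m \<ge> 1" using mp(2,3) by (cases m) auto
  have "ennreal x = (\<Sum>i=1..m. ennreal (\<bar>g (p i) - g (p (i - 1))\<bar> powr q))"
    unfolding mp(1) by (subst sum_ennreal) auto
  also have "\<dots> \<le> q_variation q g"
    unfolding q_variation_def
    by (rule SUP_upper2[of "(m,p)"]) (use mp \<open>m \<ge> 1\<close> in auto)
  finally show ?thesis .
qed

text \<open>The variation over \<open>[0, t]\<close> is superadditive: a partition of
  \<open>[0, s]\<close> followed by the point \<open>t\<close> is a partition of
  \<open>[0, t]\<close>.\<close>

lemma var_control_exists:
  assumes V: "q_variation q g \<le> ennreal V" "V \<ge> 0"
  shows "\<exists>w. var_control q V g w"
proof -
  define S where "S = partition_sums q g"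
  have S0: "S 0 = {0}"
  proof -
    have "x = 0" if x: "x \<in> S 0" for x
    proof -
      obtain m :: nat and p where mp: "x = (\<Sum>i=1..m. \<bar>g (p i) - g (p (i - 1))\<bar> powr q)"
        "p 0 = (0::real)" "p m = 0" "\<forall>i<m. p i < p (Suc i)"
        using x unfolding S_def partition_sums_def by blast
      have "k \<le> m \<Longrightarrow> 0 < k \<Longrightarrow> 0 < p k" for k
      proof (induction k)
        case (Suc k)
        then show ?case using mp(2,4) by (cases "k = 0") (auto dest!: spec[of _ k])
      qed simp
      from this[of m] mp(3) have "m = 0" by auto
      with mp(1) show ?thesis by simp
    qed
    moreover have "0 \<in> S 0"
      unfolding S_def partition_sums_def by (auto intro!: exI[of _ 0] exI[of _ "\<lambda>_. 0"])
    ultimately show ?thesis by auto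
  qed
  have S1: "x \<le> V" if "x \<in> S 1" for x
    using partition_sums_le_q_variation[of x q g] that V unfolding S_def
    by (meson ennreal_le_iff order_trans)
  have ext: "x + \<bar>g t - g s\<bar> powr q \<in> S t" if "x \<in> S s" "s < t" for x s t
    using partition_sums_extend that unfolding S_def by blast
  have ne: "S t \<noteq> {}" if "0 \<le> t" for t
    using ext[of 0 0 t] that S0 by (cases "t = 0") auto
  \<comment> \<open>A partition of \<open>[0, t]\<close> completed by the point 1 is covered by the
    bound for the whole interval.\<close>
  have bd: "bdd_above (S t)" if "t \<le> 1" for t
  proof (rule bdd_aboveI[of _ V])
    fix x assume x: "x \<in> S t"
    show "x \<le> V"
    proof (cases "t = 1")
      case False
      then have "x + \<bar>g 1 - g t\<bar> powr q \<le> V" using ext[OF x, of 1] S1 that by auto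
      then show ?thesis using powr_ge_zero[of "\<bar>g 1 - g t\<bar>" q] by linarith
    qed (use x S1 in auto)
  qed
  define w where "w t = Sup (S t)" for t
  have "\<bar>g t - g s\<bar> powr q \<le> w t - w s" if st: "0 \<le> s" "s \<le> t" "t \<le> 1" for s t
  proof (cases "s = t")
    case False
    have "w s \<le> w t - \<bar>g t - g s\<bar> powr q"
      unfolding w_def
    proof (rule cSup_least)
      fix x assume "x \<in> S s"
      then have "x + \<bar>g t - g s\<bar> powr q \<in> S t" using ext st False by auto
      from cSup_upper[OF this bd[OF st(3)]] show "x \<le> Sup (S t) - \<bar>g t - g s\<bar> powr q" by linarith
    qed (use ne st in auto)
    then show ?thesis by linarith
  qed auto
  moreover have "w 1 \<le> V" unfolding w_def using ne[of 1] S1 by (intro cSup_least) auto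
  moreover have "w 0 = 0" unfolding w_def S0 by simp
  ultimately show ?thesis unfolding var_control_def by auto
qed

lemma var_control_mono: "var_control q B f w \<Longrightarrow> B \<le> B' \<Longrightarrow> var_control q B' f w"
  unfolding var_control_def by auto

lemma Wq_bounded_var_class:
  assumes "Wq_bounded q F" "1 \<le> q"
  shows "\<exists>B\<ge>1. F \<subseteq> var_class q B"
proof -
  obtain C where C: "\<forall>f\<in>F. Wq_norm q f \<le> C" and FW: "F \<subseteq> Wq q"
    using assms unfolding Wq_bounded_def by auto
  \<comment> \<open>The norm bounds the \<open>q\<close>-th root of the variation by
    \<open>C\<close>, hence the variation itself by \<open>C powr q\<close>.\<close>
  define B where "B = max 1 (max C (C powr q))"
  have "f \<in> var_class q B" if f: "f \<in> F" for f
  proof -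
    define v where "v = enn2real (q_variation q f)"
    have v: "q_variation q f = ennreal v" "v \<ge> 0"
      using f FW unfolding v_def Wq_def by auto
    obtain w where w: "var_control q v f w" using var_control_exists[of q f v] v by auto
    \<comment> \<open>A real supremum says nothing about an unbounded set, so boundedness of
      \<open>f\<close> has to come first; comparison with the value at 0 gives it.\<close>
    have bd: "bdd_above ((\<lambda>t. \<bar>f t\<bar>) ` {0..1})"
    proof (rule bdd_aboveI2)
      fix t :: real assume t: "t \<in> {0..1}"
      have "\<bar>f t - f 0\<bar> powr q \<le> v" using var_controlD[OF w, of 0 t] t w unfolding var_control_def
        by (smt (verit) atLeastAtMost_iff var_controlD(4) w)
      then have "\<bar>f t - f 0\<bar> \<le> v powr (1/q)"
      proof -
        assume "\<bar>f t - f 0\<bar> powr q \<le> v"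
        then have "(\<bar>f t - f 0\<bar> powr q) powr (1/q) \<le> v powr (1/q)"
          using assms(2) by (intro powr_mono2) auto
        then show ?thesis using assms(2) by (simp add: powr_powr)
      qed
      then show "\<bar>f t\<bar> \<le> \<bar>f 0\<bar> + v powr (1/q)" by linarith
    qed
    have norm: "(SUP t\<in>{0..1}. \<bar>f t\<bar>) + v powr (1 / q) \<le> C"
      using C f unfolding Wq_norm_def v_def by auto
    have sup: "\<bar>f t\<bar> \<le> (SUP t\<in>{0..1}. \<bar>f t\<bar>)" if "t \<in> {0..1}" for t
      using cSUP_upper[OF that bd] .
    have "\<bar>f t\<bar> \<le> B" if "t \<in> {0..1}" for t
      using sup[OF that] norm powr_ge_zero[of v "1/q"] unfolding B_def by linarith
    moreover have "v \<le> B"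
    proof -
      have "v powr (1/q) \<le> C" using norm sup[of 0] by auto
      then have "(v powr (1/q)) powr q \<le> C powr q" using assms(2) by (intro powr_mono2) auto
      then show ?thesis using assms(2) v(2) unfolding B_def by (simp add: powr_powr)
    qed
    ultimately show ?thesis
      using var_control_mono[OF w] unfolding var_class_def by auto
  qed
  then show ?thesis by (intro exI[of _ B]) (auto simp: B_def)
qed

text \<open>Above the threshold the exponent \<open>1 - q\<close>, which is not positive, makes
  \<open>\<bar>x\<bar> powr (1 - q)\<close> at most \<open>d powr (1 - q)\<close>. Summed over
  increments, the first term counts them and the second is paid by the
  \<open>q\<close>-variation.\<close>

lemma abs_le_threshold:
  fixes x d q :: real
  assumes "1 \<le> q" "0 < d"
  shows "\<bar>x\<bar> \<le> d + d powr (1 - q) * \<bar>x\<bar> powr q"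
proof (cases "\<bar>x\<bar> \<le> d")
  case False
  have "\<bar>x\<bar> = \<bar>x\<bar> powr (1 - q) * \<bar>x\<bar> powr q"
    using False assms powr_add[of "\<bar>x\<bar>" "1 - q" q] by simp
  also have "\<dots> \<le> d powr (1 - q) * \<bar>x\<bar> powr q"
    using False assms by (intro mult_right_mono powr_mono2') auto
  finally show ?thesis using assms(2) by linarith
qed (use assms in \<open>simp add: add_increasing2\<close>)

text \<open>Summation by parts in which \<open>f\<close> is compared only at successive jumps of
  \<open>g\<close>, so that the number of increments of \<open>f\<close> is the number of jumps and
  not \<open>n\<close>. Each increment is split by \<open>abs_le_threshold\<close>.\<close>

lemma piecewise_constant_sum_bound:
  fixes g p :: "nat \<Rightarrow> real"
  assumes f: "f \<in> var_class q B" and q: "1 \<le> q" and d: "0 < d"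
    and g0: "g 0 = 0" and g: "\<And>i. i \<le> n \<Longrightarrow> \<bar>g i\<bar> \<le> b"
    and p: "0 \<le> p 0" "\<And>i. i < n \<Longrightarrow> p i \<le> p (Suc i)" "p n \<le> 1"
  shows "\<bar>\<Sum>i<n. (g (Suc i) - g i) * f (p (Suc i))\<bar>
           \<le> b * (B + d * real (card {i. i < n \<and> g (Suc i) \<noteq> g i}) + d powr (1 - q) * B)"
proof -
  obtain w where w: "var_control q B f w" and fB: "\<And>t. t \<in> {0..1} \<Longrightarrow> \<bar>f t\<bar> \<le> B"
    using f unfolding var_class_def by auto
  define M where "M k = card {i. i < k \<and> g (Suc i) \<noteq> g i}" for k
  have b0: "0 \<le> b" using g[of 0] by auto
  have pk: "p k \<le> p l" if "k \<le> l" "l \<le> n" for k l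
    using that
  proof (induction l rule: dec_induct)
    case (step l)
    then show ?case using p(2)[of l] by simp
  qed simp
  have MS: "M (Suc k) = M k + (if g (Suc k) \<noteq> g k then 1 else 0)" for k
  proof -
    have "{i. i < Suc k \<and> g (Suc i) \<noteq> g i} =
      (if g (Suc k) \<noteq> g k then insert k {i. i < k \<and> g (Suc i) \<noteq> g i} else {i. i < k \<and> g (Suc i) \<noteq> g i})"
      by (auto simp: less_Suc_eq)
    then show ?thesis unfolding M_def by simp
  qed
  \<comment> \<open>Here \<open>t\<close> is the sampling point of the last jump so far, or 0 if
    there was none; the part of the bound that depends on \<open>t\<close> telescopes along the
    control function.\<close>
  have "k \<le> n \<Longrightarrow> \<exists>t\<ge>0. t \<le> p k \<and>
     \<bar>(\<Sum>i<k. (g (Suc i) - g i) * f (p (Suc i))) - g k * f t\<bar>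
       \<le> b * (d * real (M k) + d powr (1 - q) * w t)" for k
  proof (induction k)
    case 0
    have "w 0 = 0" using w unfolding var_control_def by auto
    then show ?case using p(1) by (intro exI[of _ 0]) (simp add: g0 M_def)
  next
    case (Suc k)
    then obtain t where t: "0 \<le> t" "t \<le> p k"
     "\<bar>(\<Sum>i<k. (g (Suc i) - g i) * f (p (Suc i))) - g k * f t\<bar>
       \<le> b * (d * real (M k) + d powr (1 - q) * w t)" by auto
    have pp: "p k \<le> p (Suc k)" "p (Suc k) \<le> 1" using p Suc pk[of "Suc k" n] by auto
    show ?case
    proof (cases "g (Suc k) = g k")
      case True
      then show ?thesis using t pp by (intro exI[of _ t]) (auto simp: MS)
    next
      case False
      let ?u = "p (Suc k)"
      have "\<bar>f t - f ?u\<bar> \<le> d + d powr (1 - q) * \<bar>f t - f ?u\<bar> powr q"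
        using abs_le_threshold[OF q d] .
      also have "\<bar>f t - f ?u\<bar> powr q \<le> w ?u - w t"
        using var_controlD(1)[OF w t(1), of ?u] t pp by (simp add: abs_minus_commute)
      finally have st: "\<bar>f t - f ?u\<bar> \<le> d + d powr (1 - q) * (w ?u - w t)"
        by (simp add: mult_left_mono)
      have "\<bar>g k * (f t - f ?u)\<bar> \<le> b * (d + d powr (1 - q) * (w ?u - w t))"
        unfolding abs_mult using st g[of k] Suc.prems b0 by (intro mult_mono) auto
      moreover have "(\<Sum>i<Suc k. (g (Suc i) - g i) * f (p (Suc i))) - g (Suc k) * f ?u
         = ((\<Sum>i<k. (g (Suc i) - g i) * f (p (Suc i))) - g k * f t) + g k * (f t - f ?u)"
        by (simp add: algebra_simps)
      ultimately have "\<bar>(\<Sum>i<Suc k. (g (Suc i) - g i) * f (p (Suc i))) - g (Suc k) * f ?u\<bar>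
         \<le> b * (d * real (M k) + d powr (1 - q) * w t) + b * (d + d powr (1 - q) * (w ?u - w t))"
        using t(3) by linarith
      also have "\<dots> = b * (d * real (M (Suc k)) + d powr (1 - q) * w ?u)"
        using False by (simp add: MS algebra_simps)
      finally show ?thesis using t pp by (intro exI[of _ ?u]) auto
    qed
  qed
  from this[of n] obtain t where t: "0 \<le> t" "t \<le> p n"
     "\<bar>(\<Sum>i<n. (g (Suc i) - g i) * f (p (Suc i))) - g n * f t\<bar>
       \<le> b * (d * real (M n) + d powr (1 - q) * w t)" by auto
  have "\<bar>g n * f t\<bar> \<le> b * B"
    unfolding abs_mult using g[of n] fB[of t] t p(3) b0 by (intro mult_mono) auto
  moreover have "w t \<le> B" using var_controlD(4)[OF w t(1) order.refl] t p(3) by auto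
  then have "b * (d * real (M n) + d powr (1 - q) * w t) \<le> b * (d * real (M n) + d powr (1 - q) * B)"
    using b0 by (intro mult_left_mono add_left_mono) auto
  ultimately show ?thesis using t(3) unfolding M_def by (simp add: algebra_simps)
qed

section \<open>Greedy approximation of partial sums\<close>

text \<open>Greedy approximation of \<open>s\<close>: the anchor stays put until \<open>s\<close> is at distance at least \<open>e\<close>. It is a
  step function with at most \<open>anchor_energy / e\<^sup>2\<close> jumps.\<close>

fun anchor :: "real \<Rightarrow> (nat \<Rightarrow> real) \<Rightarrow> nat \<Rightarrow> real" where
  "anchor e s 0 = s 0"
| "anchor e s (Suc i) = (if \<bar>s (Suc i) - anchor e s i\<bar> \<ge> e then s (Suc i) else anchor e s i)"

definition anchor_energy :: "real \<Rightarrow> (nat \<Rightarrow> real) \<Rightarrow> nat \<Rightarrow> real" where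
  "anchor_energy e s n = (\<Sum>i<n. (anchor e s (Suc i) - anchor e s i)\<^sup>2)"

lemma anchor_dist: "0 < e \<Longrightarrow> \<bar>s i - anchor e s i\<bar> < e"
  by (induction i) auto

lemma anchor_energy_nonneg: "0 \<le> anchor_energy e s n"
  unfolding anchor_energy_def by (intro sum_nonneg) auto

lemma anchor_jump: "anchor e s (Suc i) \<noteq> anchor e s i \<Longrightarrow> e \<le> \<bar>anchor e s (Suc i) - anchor e s i\<bar>"
  by (auto split: if_splits)

lemma anchor_card:
  assumes "0 < e"
  shows "real (card {i. i < n \<and> anchor e s (Suc i) \<noteq> anchor e s i}) \<le> anchor_energy e s n / e\<^sup>2"
proof -
  let ?J = "{i. i < n \<and> anchor e s (Suc i) \<noteq> anchor e s i}"
  have "real (card ?J) * e\<^sup>2 = (\<Sum>i\<in>?J. e\<^sup>2)" by simp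
  also have "\<dots> \<le> (\<Sum>i\<in>?J. (anchor e s (Suc i) - anchor e s i)\<^sup>2)"
  proof (rule sum_mono)
    fix i assume "i \<in> ?J"
    then have "e \<le> \<bar>anchor e s (Suc i) - anchor e s i\<bar>" using anchor_jump by blast
    then show "e\<^sup>2 \<le> (anchor e s (Suc i) - anchor e s i)\<^sup>2"
      using assms by (metis abs_le_square_iff abs_of_pos)
  qed
  also have "\<dots> \<le> anchor_energy e s n"
    unfolding anchor_energy_def by (intro sum_mono2) auto
  finally show ?thesis using assms by (simp add: field_simps)
qed

text \<open>The three terms belong to the coarsest approximation, the differences of consecutive
  ones and the final error. The cut \<open>2 powr (- (2/q) * real l)\<close> for the increments of
  \<open>f\<close> balances the cost of the jumps, whose number is of order \<open>4^l\<close>,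
  against that of the variation: multiplied by \<open>(1/2)^l\<close>, both are of order
  \<open>2 powr ((1 - 2/q) * l)\<close>, summable as \<open>q < 2\<close>. The energies are an
  argument because the expression is affine in them, so an expectation can be moved inside.\<close>

definition anchor_bound :: "real \<Rightarrow> real \<Rightarrow> (nat \<Rightarrow> real) \<Rightarrow> nat \<Rightarrow> nat \<Rightarrow> real" where
  "anchor_bound q B E n L = B * E 0 + (\<Sum>l<L. 2 * (1/2)^l * (B + 2 powr (- (2/q) * real l) * (4^l * E l + 4^Suc l * E (Suc l))
       + (2 powr (- (2/q) * real l)) powr (1 - q) * B)) + 2 * real n * B * (1/2)^L"

text \<open>The weighted sum is linear in the path. Writing \<open>s\<close> as \<open>a 0\<close>,
  plus consecutive differences up to \<open>a L\<close>, plus a remainder splits it into terms that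
  \<open>piecewise_constant_sum_bound\<close> handles or that are bounded directly.\<close>

lemma anchor_chaining:
  fixes s p :: "nat \<Rightarrow> real"
  assumes f: "f \<in> var_class q B" and q: "1 \<le> q" and B: "0 \<le> B"
    and s0: "s 0 = 0"
    and p: "0 \<le> p 0" "\<And>i. i < n \<Longrightarrow> p i \<le> p (Suc i)" "p n \<le> 1"
  shows "\<bar>\<Sum>i<n. (s (Suc i) - s i) * f (p (Suc i))\<bar>
           \<le> anchor_bound q B (\<lambda>l. anchor_energy ((1/2)^l) s n) n L"
proof -
  define a where "a l = anchor ((1/2)^l) s" for l :: nat
  define T where "T g = (\<Sum>i<n. (g (Suc i) - g i) * f (p (Suc i)))" for g :: "nat \<Rightarrow> real"
  let ?E = "\<lambda>l. anchor_energy ((1/2)^l) s n"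
  have pk: "p k \<le> p l" if "k \<le> l" "l \<le> n" for k l
    using that
  proof (induction l rule: dec_induct)
    case (step l)
    then show ?case using p(2)[of l] by simp
  qed simp
  have fB: "\<bar>f (p i)\<bar> \<le> B" if "i \<le> n" for i
    using f p(1,3) pk[of 0 i] pk[of i n] that unfolding var_class_def by auto
  have tele: "T (a L) = T (a 0) + (\<Sum>l<L. T (\<lambda>i. a (Suc l) i - a l i))" for L
  proof (induction L)
    case (Suc L)
    have "T (a (Suc L)) = T (a L) + T (\<lambda>i. a (Suc L) i - a L i)"
      unfolding T_def by (simp add: algebra_simps flip: sum.distrib sum_subtractf)
    then show ?case using Suc by simp
  qed simp
  have da: "\<bar>s i - a l i\<bar> \<le> (1/2)^l" for i l
    using anchor_dist[of "(1/2)^l" s i] unfolding a_def by simp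
  \<comment> \<open>At threshold 1 every nonzero jump has modulus at least 1 and is bounded by its
    square.\<close>
  have T0: "\<bar>T (a 0)\<bar> \<le> B * ?E 0"
  proof -
    have "\<bar>T (a 0)\<bar> \<le> (\<Sum>i<n. \<bar>a 0 (Suc i) - a 0 i\<bar> * \<bar>f (p (Suc i))\<bar>)"
      unfolding T_def by (intro order_trans[OF sum_abs] sum_mono) (simp add: abs_mult)
    also have "\<dots> \<le> (\<Sum>i<n. (a 0 (Suc i) - a 0 i)\<^sup>2 * B)"
    proof (intro sum_mono mult_mono)
      fix i assume "i \<in> {..<n}"
      then show "\<bar>f (p (Suc i))\<bar> \<le> B" using fB[of "Suc i"] by auto
      have "a 0 (Suc i) = a 0 i \<or> 1 \<le> \<bar>a 0 (Suc i) - a 0 i\<bar>"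
        using anchor_jump[of 1 s i] unfolding a_def by auto
      then show "\<bar>a 0 (Suc i) - a 0 i\<bar> \<le> (a 0 (Suc i) - a 0 i)\<^sup>2"
      proof
        assume "1 \<le> \<bar>a 0 (Suc i) - a 0 i\<bar>"
        then show ?thesis using self_le_power[of "\<bar>a 0 (Suc i) - a 0 i\<bar>" 2] by simp
      qed simp
    qed auto
    also have "\<dots> = B * ?E 0" unfolding anchor_energy_def a_def by (simp add: sum_distrib_left mult.commute)
    finally show ?thesis .
  qed
  have Tl: "\<bar>T (\<lambda>i. a (Suc l) i - a l i)\<bar> \<le> 2 * (1/2)^l * (B + 2 powr (- (2/q) * real l) * (4^l * ?E l + 4^Suc l * ?E (Suc l))
       + (2 powr (- (2/q) * real l)) powr (1 - q) * B)" for l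
  proof -
    let ?g = "\<lambda>i. a (Suc l) i - a l i"
    define d where "d = 2 powr (- (2/q) * real l)"
    have d: "0 < d" unfolding d_def by simp
    let ?J = "\<lambda>l. {i. i < n \<and> a l (Suc i) \<noteq> a l i}"
    \<comment> \<open>A difference of two consecutive approximations jumps only where one of them
      does.\<close>
    have "card {i. i < n \<and> ?g (Suc i) \<noteq> ?g i} \<le> card (?J l \<union> ?J (Suc l))"
      by (intro card_mono) auto
    also have "\<dots> \<le> card (?J l) + card (?J (Suc l))" by (rule card_Un_le)
    finally have "real (card {i. i < n \<and> ?g (Suc i) \<noteq> ?g i}) \<le> real (card (?J l)) + real (card (?J (Suc l)))"
      by linarith
    moreover have cle: "real (card (?J l)) \<le> 4^l * ?E l" for l
    proof -
      have "((1/2)^l)\<^sup>2 = (1/4::real)^l" by (simp add: power_mult [symmetric] mult.commute[of l 2]) (simp add: power_mult power_divide)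
      moreover have "?E l / (1/4)^l = 4^l * ?E l" by (simp add: power_divide)
      ultimately show ?thesis using anchor_card[of "(1/2)^l" n s] unfolding a_def by (simp del: anchor.simps)
    qed

    ultimately have "real (card {i. i < n \<and> ?g (Suc i) \<noteq> ?g i}) \<le> real (card (?J l)) + real (card (?J (Suc l)))"
      by blast
    with cle[of l] cle[of "Suc l"]
    have M: "real (card {i. i < n \<and> ?g (Suc i) \<noteq> ?g i}) \<le> 4^l * ?E l + 4^Suc l * ?E (Suc l)" by linarith
    have "\<bar>T ?g\<bar> \<le> 2 * (1/2)^l * (B + d * real (card {i. i < n \<and> ?g (Suc i) \<noteq> ?g i}) + d powr (1 - q) * B)"
      unfolding T_def
    proof (rule piecewise_constant_sum_bound[OF f q d])
      show "\<bar>?g i\<bar> \<le> 2 * (1/2)^l" for i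
      proof -
        have "(1/2::real)^Suc l \<le> (1/2)^l" by simp
        then show ?thesis using da[of i l] da[of i "Suc l"] by linarith
      qed
    qed (use p s0 in \<open>auto simp: a_def\<close>)
    also have "\<dots> \<le> 2 * (1/2)^l * (B + d * (4^l * ?E l + 4^Suc l * ?E (Suc l)) + d powr (1 - q) * B)"
      using M d by (intro mult_left_mono add_mono) auto
    finally show ?thesis unfolding d_def .
  qed
  \<comment> \<open>Crude in \<open>n\<close>, but \<open>L\<close> is still free and will be chosen
    after \<open>n\<close>.\<close>
  have TL: "\<bar>T s - T (a L)\<bar> \<le> 2 * real n * B * (1/2)^L"
  proof -
    have "T s - T (a L) = (\<Sum>i<n. ((s (Suc i) - a L (Suc i)) - (s i - a L i)) * f (p (Suc i)))"
      unfolding T_def by (simp add: algebra_simps flip: sum.distrib sum_subtractf)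
    also have "\<bar>\<dots>\<bar> \<le> (\<Sum>i<n. 2 * (1/2)^L * B)"
    proof (intro order_trans[OF sum_abs] sum_mono, unfold abs_mult, rule mult_mono)
      fix i assume "i \<in> {..<n}"
      then show "\<bar>f (p (Suc i))\<bar> \<le> B" using fB[of "Suc i"] by auto
      show "\<bar>s (Suc i) - a L (Suc i) - (s i - a L i)\<bar> \<le> 2 * (1/2)^L"
        using da[of i L] da[of "Suc i" L] by linarith
    qed auto
    finally show ?thesis by (simp add: mult_ac)
  qed
  have "\<bar>T s\<bar> \<le> \<bar>T (a 0)\<bar> + (\<Sum>l<L. \<bar>T (\<lambda>i. a (Suc l) i - a l i)\<bar>) + \<bar>T s - T (a L)\<bar>"
    using tele[of L] sum_abs[of "\<lambda>l. T (\<lambda>i. a (Suc l) i - a l i)" "{..<L}"] by linarith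
  also have "\<dots> \<le> anchor_bound q B ?E n L"
    unfolding anchor_bound_def by (intro add_mono T0 TL sum_mono Tl)
  finally show ?thesis unfolding T_def .
qed

section \<open>Dyadic chaining\<close>

text \<open>With \<open>S2\<close> and \<open>S4\<close> of orders \<open>1\<close> and \<open>2 powr (- k)\<close>, as for the increments over \<open>2^k\<close> dyadic cells,
  this decays geometrically in \<open>k\<close>. The exponent comes from cutting the increments of \<open>f\<close> at \<open>2 powr (- k/24)\<close>:
  the small ones are paired with second moments, the large ones with fourth moments.\<close>

definition level_bound :: "real \<Rightarrow> real \<Rightarrow> nat \<Rightarrow> real \<Rightarrow> real \<Rightarrow> real" where
  "level_bound q B k S2 S4 =
     2 powr (- ((2 - q)/48) * real k) * (B + 2 * B\<^sup>2 + S2) + 2 * B * 2 powr (real k / 2) * S4"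

text \<open>If \<open>a \<le> d\<close>, a weighted inequality bounds \<open>a * b\<close> by
  multiples of \<open>a\<^sup>2\<close> and \<open>b\<^sup>2\<close>, and
  \<open>a\<^sup>2 \<le> d powr (2 - q) * a powr q\<close>. Otherwise
  \<open>1 \<le> d powr (- q) * a powr q\<close>, and \<open>b\<close> is at most \<open>r\<close>
  or at most \<open>b^4 / r^3\<close>. The parameters stay free for
  \<open>level_sum\<close>.\<close>

lemma product_threshold:
  fixes a b B :: real
  assumes q: "1 \<le> q" "q < 2" and a: "0 \<le> a" "a \<le> 2 * B" and b: "0 \<le> b"
    and pos: "0 < d" "0 < l" "0 < r"
  shows "a * b \<le> l * d powr (2 - q) * a powr q + b\<^sup>2 / l + 2 * B * (r * d powr (- q) * a powr q + b^4 / r^3)"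
proof (cases "a \<le> d")
  case True
  have "0 \<le> (l * a - b)\<^sup>2 + l * a * b" using a b pos by simp
  then have "a * b * l \<le> l\<^sup>2 * a\<^sup>2 + b\<^sup>2" by (simp add: power2_eq_square algebra_simps)
  then have "a * b \<le> (l\<^sup>2 * a\<^sup>2 + b\<^sup>2) / l" using pos by (simp add: pos_le_divide_eq)
  also have "\<dots> = l * a\<^sup>2 + b\<^sup>2 / l" using pos by (simp add: add_divide_distrib power2_eq_square)
  also have "a\<^sup>2 \<le> d powr (2 - q) * a powr q"
  proof (cases "a = 0")
    case False
    then have "a\<^sup>2 = a powr (2 - q) * a powr q" using a powr_add[of a "2 - q" q] by (simp add: powr_numeral)
    also have "\<dots> \<le> d powr (2 - q) * a powr q" using True a q by (intro mult_right_mono powr_mono2) auto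
    finally show ?thesis .
  qed simp
  finally have "a * b \<le> l * (d powr (2 - q) * a powr q) + b\<^sup>2 / l" using pos by simp
  moreover have "0 \<le> 2 * B * (r * d powr (- q) * a powr q + b^4 / r^3)"
    using a pos b by (intro mult_nonneg_nonneg add_nonneg_nonneg) auto
  ultimately show ?thesis by (simp add: mult.assoc)
next
  case False
  have 1: "1 \<le> d powr (- q) * a powr q"
    using False pos q a powr_mono2[of q d a] by (simp add: powr_minus field_simps)
  have "b \<le> r + b^4 / r^3"
  proof (cases "b \<le> r")
    case True then show ?thesis using pos b by (simp add: add_increasing2)
  next
    case False
    have "b * r^3 \<le> b * b^3" using False pos b by (intro mult_left_mono power_mono) auto
    then have "b \<le> b^4 / r^3" using pos by (simp add: pos_le_divide_eq power_numeral_reduce)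
    then show ?thesis using pos by simp
  qed
  moreover have "r \<le> r * (d powr (- q) * a powr q)" using 1 pos by simp
  ultimately have "b \<le> r * d powr (- q) * a powr q + b^4 / r^3" by (simp add: mult.assoc)
  then have "a * b \<le> 2 * B * (r * d powr (- q) * a powr q + b^4 / r^3)"
    using a b by (intro mult_mono) auto
  moreover have "0 \<le> l * d powr (2 - q) * a powr q + b\<^sup>2 / l" using pos by simp
  ultimately show ?thesis by linarith
qed

text \<open>The intervals from \<open>u j\<close> to \<open>v j\<close> do not overlap, so the
  \<open>q\<close>-th powers of the increments sum to at most \<open>B\<close>. The bound involves
  \<open>f\<close> only through \<open>B\<close> and so holds for the whole class at once.\<close>

lemma level_sum:
  fixes u v Y :: "nat \<Rightarrow> real"
  assumes f: "f \<in> var_class q B" and q: "1 \<le> q" "q < 2" and B: "0 \<le> B"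
    and uv: "\<And>j. j < m \<Longrightarrow> 0 \<le> u j \<and> u j \<le> v j \<and> v j \<le> 1"
    and vu: "\<And>j. Suc j < m \<Longrightarrow> v j \<le> u (Suc j)"
  shows "(\<Sum>j<m. \<bar>(f (v j) - f (u j)) * Y j\<bar>) \<le> level_bound q B k (\<Sum>j<m. (Y j)\<^sup>2) (\<Sum>j<m. Y j ^ 4)"
proof -
  obtain w where w: "var_control q B f w" and fB: "\<And>t. t \<in> {0..1} \<Longrightarrow> \<bar>f t\<bar> \<le> B"
    using f unfolding var_class_def by auto
  let ?a = "\<lambda>j. \<bar>f (v j) - f (u j)\<bar>"
  have tele: "j < m \<Longrightarrow> (\<Sum>i<Suc j. w (v i) - w (u i)) \<le> w (v j)" for j
  proof (induction j)
    case 0 then show ?case using var_controlD(3)[OF w, of "u 0" "u 0"] uv[of 0] by auto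
  next
    case (Suc j)
    then show ?case using var_controlD(2)[OF w, of "v j" "u (Suc j)"] vu[of j] uv[of j] uv[of "Suc j"] by auto
  qed
  have var: "(\<Sum>j<m. ?a j powr q) \<le> B"
  proof (cases m)
    case (Suc m')
    have "(\<Sum>j<m. ?a j powr q) \<le> (\<Sum>j<m. w (v j) - w (u j))"
      using uv by (intro sum_mono var_controlD(1)[OF w]) auto
    also have "\<dots> \<le> w (v m')" using tele[of m'] Suc by simp
    also have "\<dots> \<le> B" using var_controlD(4)[OF w, of "v m'" "v m'"] uv[of m'] Suc by auto
    finally show ?thesis .
  qed (use B in auto)
  \<comment> \<open>These exponents make \<open>l * d powr (2 - q)\<close> equal to
    \<open>1 / l\<close>, both decaying with exponent \<open>(2 - q)/48\<close>. The factor
    \<open>r * d powr (- q)\<close> decays faster, and \<open>1 / r^3 = 2 powr (k/2)\<close> costs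
    only half of the decay that fourth moments provide.\<close>
  define d where "d = 2 powr (- (1/24) * real k)"
  define l where "l = 2 powr ((2 - q)/48 * real k)"
  define r where "r = 2 powr (- (1/6) * real k)"
  have pos: "0 < d" "0 < l" "0 < r" unfolding d_def l_def r_def by auto
  have "(\<Sum>j<m. \<bar>(f (v j) - f (u j)) * Y j\<bar>) \<le> (\<Sum>j<m. l * d powr (2 - q) * ?a j powr q + \<bar>Y j\<bar>\<^sup>2 / l
      + 2 * B * (r * d powr (- q) * ?a j powr q + \<bar>Y j\<bar>^4 / r^3))"
  proof (intro sum_mono, unfold abs_mult, rule product_threshold[OF q _ _ _ pos])
    fix j assume "j \<in> {..<m}"
    then show "?a j \<le> 2 * B" using fB[of "u j"] fB[of "v j"] uv[of j] by auto
  qed auto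
  also have "\<dots> = (l * d powr (2 - q) + 2 * B * (r * d powr (- q))) * (\<Sum>j<m. ?a j powr q)
     + (\<Sum>j<m. (Y j)\<^sup>2) / l + 2 * B * ((\<Sum>j<m. Y j ^ 4) / r^3)"
    by (simp add: sum.distrib sum_distrib_left sum_distrib_right sum_divide_distrib algebra_simps)
  also have "\<dots> \<le> (l * d powr (2 - q) + 2 * B * (r * d powr (- q))) * B
     + (\<Sum>j<m. (Y j)\<^sup>2) / l + 2 * B * ((\<Sum>j<m. Y j ^ 4) / r^3)"
    using var pos B by (intro add_mono mult_left_mono) auto
  also have "\<dots> \<le> level_bound q B k (\<Sum>j<m. (Y j)\<^sup>2) (\<Sum>j<m. Y j ^ 4)"
  proof -
    have e1: "l * d powr (2 - q) = 2 powr (- ((2 - q)/48) * real k)"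
      unfolding l_def d_def by (simp add: powr_powr flip: powr_add) (simp add: field_simps)
    have "r * d powr (- q) = 2 powr (- (1/6 - q/24) * real k)"
      unfolding r_def d_def by (simp add: powr_powr flip: powr_add) (simp add: field_simps)
    also have "\<dots> \<le> 2 powr (- ((2 - q)/48) * real k)"
    proof -
      have "- (1/6 - q/24) \<le> - ((2 - q)/48)" using q by (simp add: field_simps)
      then show ?thesis by (intro powr_mono mult_right_mono) auto
    qed
    finally have e2: "r * d powr (- q) \<le> 2 powr (- ((2 - q)/48) * real k)" .
    have e3: "x / l = 2 powr (- ((2 - q)/48) * real k) * x" for x
      unfolding l_def by (simp add: powr_minus field_simps)
    have "r ^ 3 = 2 powr (- (real k / 2))"
      unfolding r_def by (simp add: powr_powr flip: powr_realpow)
    then have e4: "x / r^3 = 2 powr (real k / 2) * x" for x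
      by (simp only: powr_minus divide_inverse inverse_inverse_eq mult.commute)
    have "2 * B * (r * d powr (- q)) * B \<le> 2 * B * (2 powr (- ((2 - q)/48) * real k)) * B"
      using e2 B by (intro mult_right_mono mult_left_mono) auto
    then show ?thesis unfolding level_bound_def e1 e3 e4
      by (simp add: algebra_simps power2_eq_square)
  qed
  finally show ?thesis .
qed

lemma sum_even_odd:
  fixes g :: "nat \<Rightarrow> 'b::comm_monoid_add"
  shows "(\<Sum>j<2 * m. g j) = (\<Sum>j<m. g (2 * j) + g (2 * j + 1))"
  by (induction m) (auto simp: add.assoc)

definition dyadic_sum :: "(nat \<Rightarrow> real) \<Rightarrow> (real \<Rightarrow> real) \<Rightarrow> nat \<Rightarrow> real" where
  "dyadic_sum y f k = (\<Sum>j<2^k. f (real j / 2^k) * y j)"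

text \<open>A left child has the same left endpoint as its parent, so only the right children
  contribute, each with the increment of \<open>f\<close> from the parent's endpoint to its
  midpoint. Additivity of the cell values holds for block sums and for white noise alike, so both
  chainings rest on this step.\<close>

lemma dyadic_sum_step:
  assumes f: "f \<in> var_class q B" and q: "1 \<le> q" "q < 2" and B: "0 \<le> B"
    and add: "\<And>j. j < 2^k \<Longrightarrow> y j = z (2 * j) + z (2 * j + 1)"
  shows "\<bar>dyadic_sum z f (Suc k) - dyadic_sum y f k\<bar>
    \<le> level_bound q B k (\<Sum>j<2^k. (z (2 * j + 1))\<^sup>2) (\<Sum>j<2^k. z (2 * j + 1) ^ 4)"
proof -
  let ?u = "\<lambda>j. real j / 2^k" and ?v = "\<lambda>j. (2 * real j + 1) / 2^Suc k"
  have "dyadic_sum z f (Suc k) = (\<Sum>j<2^k. f (?u j) * z (2 * j) + f (?v j) * z (2 * j + 1))"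
    unfolding dyadic_sum_def power_Suc sum_even_odd by (simp add: add.commute)
  moreover have "dyadic_sum y f k = (\<Sum>j<2^k. f (?u j) * z (2 * j) + f (?u j) * z (2 * j + 1))"
    unfolding dyadic_sum_def by (intro sum.cong) (auto simp: add distrib_left)
  ultimately have "dyadic_sum z f (Suc k) - dyadic_sum y f k = (\<Sum>j<2^k. (f (?v j) - f (?u j)) * z (2 * j + 1))"
    by (simp add: algebra_simps flip: sum_subtractf)
  also have "\<bar>\<dots>\<bar> \<le> (\<Sum>j<2^k. \<bar>(f (?v j) - f (?u j)) * z (2 * j + 1)\<bar>)" by (rule sum_abs)
  also have "\<dots> \<le> level_bound q B k (\<Sum>j<2^k. (z (2 * j + 1))\<^sup>2) (\<Sum>j<2^k. z (2 * j + 1) ^ 4)"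
  proof (rule level_sum[OF f q B])
    fix j :: nat assume j: "j < 2^k"
    have "real (Suc j) \<le> 2^k" using j by (metis Suc_leI of_nat_le_iff of_nat_numeral of_nat_power)
    then show "0 \<le> ?u j \<and> ?u j \<le> ?v j \<and> ?v j \<le> 1" by (auto simp: field_simps)
  qed (auto simp: field_simps)
  finally show ?thesis .
qed

section \<open>Uniform bounds for weighted sums\<close>

definition psum :: "(nat \<Rightarrow> real) \<Rightarrow> nat \<Rightarrow> real" where
  "psum y n = (\<Sum>i<n. y i)"

lemma psum_simps [simp]: "psum y 0 = 0" "psum y (Suc n) = psum y n + y n"
  unfolding psum_def by auto

lemma measurable_psum_PiM: "m \<le> n \<Longrightarrow> (\<lambda>y. psum y m) \<in> borel_measurable (Pi\<^sub>M {..<n} (\<lambda>_. borel))"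
  unfolding psum_def by (intro borel_measurable_sum measurable_component_singleton) auto

text \<open>The anchor is adapted to the summands; with \<open>indep_var_past\<close> this makes it
  independent of the next one.\<close>

lemma measurable_anchor_PiM:
  "m \<le> n \<Longrightarrow> (\<lambda>y. anchor e (psum y) m) \<in> borel_measurable (Pi\<^sub>M {..<n} (\<lambda>_. borel))"
proof (induction m)
  case (Suc m)
  note [measurable] = measurable_psum_PiM[of "Suc m" n, OF Suc.prems] Suc.IH[OF Suc_leD[OF Suc.prems]]
  show ?case by (simp only: anchor.simps) measurable
qed simp

lemma anchor_psum_cong:
  "(\<And>i. i < n \<Longrightarrow> y i = z i) \<Longrightarrow> m \<le> n \<Longrightarrow> anchor e (psum y) m = anchor e (psum z) m"
proof (induction m)
  case (Suc m)
  have "psum y (Suc m) = psum z (Suc m)" unfolding psum_def using Suc.prems by (intro sum.cong) auto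
  then show ?case using Suc by simp
qed simp

lemma (in prob_space) indep_var_past:
  fixes x :: "nat \<Rightarrow> 'a \<Rightarrow> real"
  assumes "indep_vars (\<lambda>_. borel) x UNIV" "h \<in> borel_measurable (Pi\<^sub>M {..<n} (\<lambda>_. borel))"
  shows "indep_var borel (\<lambda>\<omega>. h (\<lambda>i\<in>{..<n}. x i \<omega>)) borel (x n)"
proof -
  have "indep_var borel (h \<circ> (\<lambda>\<omega>. restrict (\<lambda>i. x i \<omega>) {..<n})) borel ((\<lambda>y. y n) \<circ> (\<lambda>\<omega>. restrict (\<lambda>i. x i \<omega>) {n}))"
    by (intro indep_var_compose[OF indep_var_restrict[OF assms(1)]] assms(2) measurable_component_singleton) auto
  then show ?thesis by (simp add: comp_def)
qed

text \<open>Anchored at a fixed point, the squared displacement of a martingale grows by the variance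
  of each increment; re-anchoring releases at least the squared jump.\<close>

lemma (in prob_space) anchor_energy_expectation:
  fixes x :: "nat \<Rightarrow> 'a \<Rightarrow> real"
  assumes ind: "indep_vars (\<lambda>_. borel) x UNIV"
    and sq: "\<And>i. integrable M (\<lambda>\<omega>. (x i \<omega>)\<^sup>2)" and mean: "\<And>i. expectation (x i) = 0"
    and e: "0 < e"
  shows "integrable M (\<lambda>\<omega>. anchor_energy e (psum (\<lambda>i. x i \<omega>)) n)"
    and "expectation (\<lambda>\<omega>. anchor_energy e (psum (\<lambda>i. x i \<omega>)) n) \<le> (\<Sum>i<n. expectation (\<lambda>\<omega>. (x i \<omega>)\<^sup>2))"
proof -
  have xm[measurable]: "x i \<in> borel_measurable M" for i
    using ind unfolding indep_vars_def2 by auto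
  have xi: "integrable M (x i)" for i
    using square_integrable_imp_integrable[OF xm sq] .
  define s where "s \<omega> = psum (\<lambda>i. x i \<omega>)" for \<omega>
  have sm[measurable]: "(\<lambda>\<omega>. s \<omega> m) \<in> borel_measurable M" for m
    unfolding s_def psum_def by measurable
  have am[measurable]: "(\<lambda>\<omega>. anchor e (s \<omega>) m) \<in> borel_measurable M" for m
  proof (induction m)
    case (Suc m)
    note [measurable] = Suc
    show ?case by (simp only: anchor.simps) measurable
  qed simp
  \<comment> \<open>A potential: the current squared distance from the anchor plus the energy
    already released. Moving the anchor turns the first into the second and leaves the sum
    unchanged, so both branches of the recursion give the same value.\<close>
  define P where "P m \<omega> = (s \<omega> m - anchor e (s \<omega>) m)\<^sup>2 + anchor_energy e (s \<omega>) m" for m \<omega>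
  have Em[measurable]: "(\<lambda>\<omega>. anchor_energy e (s \<omega>) m) \<in> borel_measurable M" for m
    unfolding anchor_energy_def by measurable
  have Pm[measurable]: "P m \<in> borel_measurable M" for m unfolding P_def by measurable
  have P0: "0 \<le> P m \<omega>" for m \<omega> unfolding P_def using anchor_energy_nonneg by simp
  define D where "D m \<omega> = s \<omega> m - anchor e (s \<omega>) m" for m \<omega>
  have Dm[measurable]: "D m \<in> borel_measurable M" for m unfolding D_def by measurable
  \<comment> \<open>The distance stays below \<open>e\<close>, so its product with the next summand
    is integrable and, by independence, of mean zero.\<close>
  have Di: "integrable M (D m)" for m
    using anchor_dist[OF e] by (intro integrable_const_bound[where B=e] AE_I2) (auto simp: D_def less_imp_le)
  have step: "P (Suc m) \<omega> \<le> P m \<omega> + 2 * (D m \<omega> * x m \<omega>) + (x m \<omega>)\<^sup>2" for m \<omega>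
  proof -
    let ?a = "anchor e (s \<omega>) m" and ?t = "s \<omega> m + x m \<omega>"
    have t: "s \<omega> (Suc m) = ?t" unfolding s_def by simp
    have "anchor e (s \<omega>) (Suc m) = ?t \<or> anchor e (s \<omega>) (Suc m) = ?a" using t by (simp only: anchor.simps) presburger
    then have "P (Suc m) \<omega> = (?t - ?a)\<^sup>2 + anchor_energy e (s \<omega>) m"
      unfolding P_def anchor_energy_def t sum.lessThan_Suc by (elim disjE) (simp_all only:, simp_all)
    also have "\<dots> = P m \<omega> + 2 * (D m \<omega> * x m \<omega>) + (x m \<omega>)\<^sup>2"
      unfolding P_def D_def by (simp add: power2_eq_square algebra_simps)
    finally show ?thesis by simp
  qed
  have indD: "indep_var borel (D m) borel (x m)" for m
  proof -
    have "indep_var borel (\<lambda>\<omega>. psum (\<lambda>i\<in>{..<m}. x i \<omega>) m - anchor e (psum (\<lambda>i\<in>{..<m}. x i \<omega>)) m) borel (x m)"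
      by (rule indep_var_past[OF ind]) (intro borel_measurable_diff measurable_psum_PiM measurable_anchor_PiM order.refl)
    moreover have "psum (\<lambda>i\<in>{..<m}. x i \<omega>) m - anchor e (psum (\<lambda>i\<in>{..<m}. x i \<omega>)) m = D m \<omega>" for \<omega>
      unfolding D_def s_def
      by (intro arg_cong2[of _ _ _ _ "(-)"] anchor_psum_cong[of m]) (auto simp: psum_def)
    ultimately show ?thesis by simp
  qed
  have Dx: "integrable M (\<lambda>\<omega>. D m \<omega> * x m \<omega>)" "expectation (\<lambda>\<omega>. D m \<omega> * x m \<omega>) = 0" for m
    using indep_var_integrable[OF indD Di xi] indep_var_lebesgue_integral[OF indD Di xi] mean by auto
  have "integrable M (P m) \<and> expectation (P m) \<le> (\<Sum>i<m. expectation (\<lambda>\<omega>. (x i \<omega>)\<^sup>2))" for m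
  proof (induction m)
    case 0
    show ?case unfolding P_def s_def anchor_energy_def by simp
  next
    case (Suc m)
    let ?U = "\<lambda>\<omega>. P m \<omega> + 2 * (D m \<omega> * x m \<omega>) + (x m \<omega>)\<^sup>2"
    have U: "integrable M ?U" using Suc Dx sq by (intro Bochner_Integration.integrable_add integrable_mult_right) auto
    have PS: "integrable M (P (Suc m))"
      by (rule Bochner_Integration.integrable_bound[OF U]) (use step P0 order_trans[OF P0 step] in auto)
    have "expectation (P (Suc m)) \<le> expectation ?U" by (intro integral_mono PS U step)
    also have "\<dots> = expectation (P m) + expectation (\<lambda>\<omega>. (x m \<omega>)\<^sup>2)"
      using Suc Dx sq by simp
    finally show ?case using Suc PS by auto
  qed
  then have Pn: "integrable M (P n)" "expectation (P n) \<le> (\<Sum>i<n. expectation (\<lambda>\<omega>. (x i \<omega>)\<^sup>2))" by auto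
  have le: "anchor_energy e (s \<omega>) n \<le> P n \<omega>" for \<omega> unfolding P_def by simp
  have 1: "integrable M (\<lambda>\<omega>. anchor_energy e (s \<omega>) n)"
  proof (rule Bochner_Integration.integrable_bound[OF Pn(1) Em], rule AE_I2)
    show "norm (anchor_energy e (s \<omega>) n) \<le> norm (P n \<omega>)" for \<omega>
      using le[of \<omega>] P0[of n \<omega>] anchor_energy_nonneg[of e "s \<omega>" n] by simp
  qed
  then show "integrable M (\<lambda>\<omega>. anchor_energy e (psum (\<lambda>i. x i \<omega>)) n)" unfolding s_def .
  have "expectation (\<lambda>\<omega>. anchor_energy e (s \<omega>) n) \<le> expectation (P n)"
    by (rule integral_mono[OF 1 Pn(1) le])
  with Pn(2) show "expectation (\<lambda>\<omega>. anchor_energy e (psum (\<lambda>i. x i \<omega>)) n) \<le> (\<Sum>i<n. expectation (\<lambda>\<omega>. (x i \<omega>)\<^sup>2))"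
    unfolding s_def by linarith
qed

text \<open>Sum of the geometric series in \<open>anchor_bound\<close> when all energies are 1:
  \<open>5 * B\<close> collects the coarsest level and the series of ratio 1/2, the factor 10 is
  \<open>2 * (1 + 4)\<close> from the jumps of two consecutive levels, and the last 1 is room for
  the remainder.\<close>

definition greedy_const :: "real \<Rightarrow> real \<Rightarrow> real" where
  "greedy_const q B = 5 * B + (10 + 2 * B) / (1 - 2 powr (1 - 2/q)) + 1"

lemma anchor_bound_one:
  assumes q: "1 \<le> q" "q < 2" and B: "0 \<le> B"
  shows "anchor_bound q B (\<lambda>_. 1) n L \<le> greedy_const q B - 1 + 2 * real n * B * (1/2)^L"
proof -
  define r where "r = 2 powr (1 - 2/q)"
  have r: "0 < r" "r < 1" using q unfolding r_def by (auto simp: powr_less_one field_simps)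
  have rl: "r ^ l = 2 powr (- (2/q) * real l) * 2^l" for l
  proof -
    have "r ^ l = 2 powr ((1 - 2/q) * real l)" unfolding r_def by (simp add: powr_powr flip: powr_realpow)
    also have "(1 - 2/q) * real l = - (2/q) * real l + real l" by (simp add: algebra_simps)
    also have "2 powr \<dots> = 2 powr (- (2/q) * real l) * 2 powr real l" by (rule powr_add)
    also have "2 powr real l = 2 ^ l" by (rule powr_realpow) simp
    finally show ?thesis .
  qed
  \<comment> \<open>The cut in \<open>anchor_bound\<close> was chosen so that this term has the same
    ratio \<open>r\<close> as the previous one.\<close>
  have rl': "r ^ l = (1/2)^l * (2 powr (- (2/q) * real l)) powr (1 - q)" for l
  proof -
    have "r ^ l = 2 powr ((1 - 2/q) * real l)" unfolding r_def by (simp add: powr_powr flip: powr_realpow)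
    also have "(1 - 2/q) * real l = - real l + (- (2/q) * real l) * (1 - q)" using q by (simp add: field_simps)
    also have "2 powr \<dots> = 2 powr (- real l) * 2 powr ((- (2/q) * real l) * (1 - q))" by (rule powr_add)
    also have "2 powr (- real l) = (1/2)^l" by (simp add: powr_minus powr_realpow power_one_over inverse_eq_divide)
    also have "2 powr ((- (2/q) * real l) * (1 - q)) = (2 powr (- (2/q) * real l)) powr (1 - q)" by (simp only: powr_powr)
    finally show ?thesis .
  qed
  have "anchor_bound q B (\<lambda>_. 1) n L = B + (\<Sum>l<L. 2 * B * (1/2)^l + (10 + 2 * B) * r^l) + 2 * real n * B * (1/2)^L"
  proof -
    have "2 * (1/2)^l * (B + 2 powr (- (2/q) * real l) * (4^l * 1 + 4^Suc l * 1)
       + (2 powr (- (2/q) * real l)) powr (1 - q) * B) = 2 * B * (1/2)^l + (10 + 2 * B) * r^l" for l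
    proof -
      have 4: "(4::real)^l = 2^l * 2^l" by (simp flip: power_mult_distrib)
      define w z h where "w = 2 powr (- (2/q) * real l)" "z = w powr (1 - q)" "h = (1/2::real)^l"
      have "w * 2^l = r^l" "h * z = r^l" using rl[of l] rl'[of l] unfolding w_z_h_def by auto
      moreover have "h * 4^l = 2^l" unfolding w_z_h_def 4 by (simp add: power_one_over)
      moreover have "2 * h * (B + w * (4^l * 1 + 4^Suc l * 1) + z * B) = 2 * B * h + 10 * (w * (h * 4^l)) + 2 * B * (h * z)"
        by (simp add: algebra_simps)
      ultimately have "2 * h * (B + w * (4^l * 1 + 4^Suc l * 1) + z * B) = 2 * B * h + (10 + 2 * B) * r^l"
        by (simp add: algebra_simps)
      then show ?thesis unfolding w_z_h_def .
    qed
    then show ?thesis unfolding anchor_bound_def by simp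
  qed
  moreover have "(\<Sum>l<L. 2 * B * (1/2)^l + (10 + 2 * B) * r^l) \<le> 4 * B + (10 + 2 * B) / (1 - r)"
  proof -
    have "(\<Sum>l<L. (1/2::real)^l) \<le> 2"
      using sum_le_suminf[OF summable_geometric, of "1/2::real" "{..<L}"] suminf_geometric[of "1/2::real"] by simp
    moreover have "(\<Sum>l<L. r^l) \<le> 1 / (1 - r)"
      using sum_le_suminf[OF summable_geometric, of r "{..<L}"] suminf_geometric[of r] r by simp
    ultimately have "2 * B * (\<Sum>l<L. (1/2)^l) + (10 + 2 * B) * (\<Sum>l<L. r^l) \<le> 2 * B * 2 + (10 + 2 * B) * (1 / (1 - r))"
      using B by (intro add_mono mult_left_mono) auto
    then show ?thesis by (simp add: sum.distrib sum_distrib_left)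
  qed
  ultimately show ?thesis unfolding greedy_const_def r_def by linarith
qed

lemma (in prob_space) expectation_anchor_bound:
  assumes "\<And>l. integrable M (E l)"
  shows "integrable M (\<lambda>\<omega>. anchor_bound q B (\<lambda>l. E l \<omega>) n L)"
    and "expectation (\<lambda>\<omega>. anchor_bound q B (\<lambda>l. E l \<omega>) n L) = anchor_bound q B (\<lambda>l. expectation (E l)) n L"
  unfolding anchor_bound_def using assms prob_space
  by (simp_all add: Bochner_Integration.integral_sum Bochner_Integration.integrable_sum)

lemma anchor_bound_mono:
  assumes "0 \<le> B" "\<And>l. E l \<le> E' l"
  shows "anchor_bound q B E n L \<le> anchor_bound q B E' n L"
  unfolding anchor_bound_def using assms
  by (intro add_mono sum_mono mult_left_mono) auto

text \<open>Used for the sampling points \<open>i / n\<close> and for the left endpoints of their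
  dyadic cells; the same majorant then bounds both weighted sums and hence their difference.\<close>

definition monotone_sample :: "nat \<Rightarrow> (nat \<Rightarrow> real) \<Rightarrow> bool" where
  "monotone_sample n p \<longleftrightarrow> 0 \<le> p 0 \<and> (\<forall>i<n. p i \<le> p (Suc i)) \<and> p n \<le> 1"

text \<open>The pathwise bound of \<open>anchor_chaining\<close> depends on the path through the
  energies alone, and these have means at most the total variance. \<open>R\<close> is measurable
  although a supremum over the class need not be.\<close>

lemma (in prob_space) weighted_sums_bound_one:
  fixes x :: "nat \<Rightarrow> 'a \<Rightarrow> real"
  assumes q: "1 \<le> q" "q < 2" and B: "0 \<le> B"
    and ind: "indep_vars (\<lambda>_. borel) x UNIV"
    and sq: "\<And>i. integrable M (\<lambda>\<omega>. (x i \<omega>)\<^sup>2)" and mean: "\<And>i. expectation (x i) = 0"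
    and v: "(\<Sum>i<n. expectation (\<lambda>\<omega>. (x i \<omega>)\<^sup>2)) \<le> 1"
  shows "\<exists>R\<in>borel_measurable M. integrable M R \<and> expectation R \<le> greedy_const q B \<and>
    (\<forall>f\<in>var_class q B. \<forall>p \<omega>. monotone_sample n p \<longrightarrow> \<bar>\<Sum>i<n. x i \<omega> * f (p (Suc i))\<bar> \<le> R \<omega>)"
proof -
  have pos: "0 < 2 * real n * B + 1" using B by (simp add: add_nonneg_pos)
  \<comment> \<open>This \<open>L\<close> makes the remainder term at most 1, the room left in
    \<open>greedy_const\<close>.\<close>
  then obtain L where "(1/2::real)^L < 1 / (2 * real n * B + 1)"
    using real_arch_pow_inv[of "1 / (2 * real n * B + 1)" "1/2"] by auto
  with pos have "(1/2::real)^L * (2 * real n * B + 1) < 1" by (simp add: pos_less_divide_eq)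
  moreover define h where "h = (1/2::real)^L"
  ultimately have "h * (2 * real n * B + 1) < 1" by simp
  moreover have "0 < h" unfolding h_def by simp
  ultimately have L: "2 * real n * B * (1/2)^L \<le> 1" unfolding h_def[symmetric] by (simp add: algebra_simps)
  let ?E = "\<lambda>l \<omega>. anchor_energy ((1/2)^l) (psum (\<lambda>i. x i \<omega>)) n"
  define R where "R \<omega> = anchor_bound q B (\<lambda>l. ?E l \<omega>) n L" for \<omega>
  have E: "integrable M (?E l)" "expectation (?E l) \<le> 1" for l
    using anchor_energy_expectation[OF ind sq mean, of "(1/2)^l" n] v by auto
  have Ri: "integrable M R" and "expectation R = anchor_bound q B (\<lambda>l. expectation (?E l)) n L"
    unfolding R_def using expectation_anchor_bound[of ?E q B n L] E(1) by auto
  note this(2)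
  also have "\<dots> \<le> anchor_bound q B (\<lambda>_. 1) n L"
    by (rule anchor_bound_mono[OF B E(2)])
  also have "\<dots> \<le> greedy_const q B" using anchor_bound_one[OF q B, of n L] L by linarith
  finally have "expectation R \<le> greedy_const q B" .
  moreover have "\<bar>\<Sum>i<n. x i \<omega> * f (p (Suc i))\<bar> \<le> R \<omega>"
    if "f \<in> var_class q B" "monotone_sample n p" for f p \<omega>
    using anchor_chaining[OF that(1) q(1) B, of "psum (\<lambda>i. x i \<omega>)" p n L] that(2)
    unfolding R_def monotone_sample_def by simp
  ultimately show ?thesis using Ri by (intro bexI[of _ R]) auto
qed

lemma greedy_const_pos:
  assumes q: "1 \<le> q" "q < 2" and B: "0 \<le> B"
  shows "0 < greedy_const q B"
proof -
  have "2 powr (1 - 2/q) < 1" using q by (auto simp: powr_less_one field_simps)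
  then show ?thesis unfolding greedy_const_def using B by (intro add_nonneg_pos) auto
qed

text \<open>Homogeneity: dividing by \<open>v\<close> reduces to total variance 1. The result is
  proportional to the standard deviation, which is why a truncation remainder of small variance is
  harmless.\<close>

lemma (in prob_space) weighted_sums_bound:
  fixes x :: "nat \<Rightarrow> 'a \<Rightarrow> real"
  assumes q: "1 \<le> q" "q < 2" and B: "0 \<le> B"
    and ind: "indep_vars (\<lambda>_. borel) x UNIV"
    and sq: "\<And>i. integrable M (\<lambda>\<omega>. (x i \<omega>)\<^sup>2)" and mean: "\<And>i. expectation (x i) = 0"
    and v: "(\<Sum>i<n. expectation (\<lambda>\<omega>. (x i \<omega>)\<^sup>2)) \<le> v\<^sup>2" and vpos: "0 < v"
  shows "\<exists>R\<in>borel_measurable M. integrable M R \<and> expectation R \<le> greedy_const q B * v \<and>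
    (\<forall>f\<in>var_class q B. \<forall>p \<omega>. monotone_sample n p \<longrightarrow> \<bar>\<Sum>i<n. x i \<omega> * f (p (Suc i))\<bar> \<le> R \<omega>)"
proof -
  define y where "y i \<omega> = x i \<omega> / v" for i \<omega>
  have ind': "indep_vars (\<lambda>_. borel) y UNIV"
    unfolding y_def using indep_vars_compose2[OF ind, of "\<lambda>_ t. t / v" "\<lambda>_. borel"] by simp
  have sqy: "(\<lambda>\<omega>. (y i \<omega>)\<^sup>2) = (\<lambda>\<omega>. (x i \<omega>)\<^sup>2 / v\<^sup>2)" for i by (auto simp: y_def power_divide)
  have vy: "(\<Sum>i<n. expectation (\<lambda>\<omega>. (y i \<omega>)\<^sup>2)) \<le> 1"
    unfolding sqy using v vpos by (simp flip: sum_divide_distrib)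
  obtain R where R: "R \<in> borel_measurable M" "integrable M R" "expectation R \<le> greedy_const q B"
    "\<And>f p \<omega>. f \<in> var_class q B \<Longrightarrow> monotone_sample n p \<Longrightarrow> \<bar>\<Sum>i<n. y i \<omega> * f (p (Suc i))\<bar> \<le> R \<omega>"
    using weighted_sums_bound_one[OF q B ind' _ _ vy] sq mean unfolding sqy by (auto simp: y_def)
  show ?thesis
  proof (intro bexI[of _ "\<lambda>\<omega>. R \<omega> * v"] conjI ballI allI impI)
    fix f p \<omega> assume fp: "f \<in> var_class q B" "monotone_sample n p"
    have "(\<Sum>i<n. x i \<omega> * f (p (Suc i))) = (\<Sum>i<n. y i \<omega> * f (p (Suc i))) * v"
      using vpos unfolding sum_distrib_right by (intro sum.cong) (auto simp: y_def)
    then show "\<bar>\<Sum>i<n. x i \<omega> * f (p (Suc i))\<bar> \<le> R \<omega> * v"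
      using R(4)[OF fp, of \<omega>] vpos by (simp add: abs_mult mult_right_mono)
  qed (use R vpos in \<open>auto intro: mult_right_mono\<close>)
qed

section \<open>Moments of sums of bounded variables, and dyadic blocks\<close>

lemma (in prob_space) integrable_bounded:
  fixes g :: "'a \<Rightarrow> real"
  assumes "g \<in> borel_measurable M" "\<And>\<omega>. \<bar>g \<omega>\<bar> \<le> C"
  shows "integrable M g"
  using assms by (intro integrable_const_bound[where B=C] AE_I2) auto

text \<open>Induction on \<open>m\<close>: the new variable and the old sum are independent and
  centred, so in the expansion of the fourth power only \<open>S^4\<close>,
  \<open>6 * x\<^sup>2 * S\<^sup>2\<close> and \<open>x^4\<close> keep a mean. The closing
  inequality is \<open>3 * m\<^sup>2 + 6 * m + 1 \<le> 3 * (m + 1)\<^sup>2\<close>.\<close>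

lemma (in prob_space) bounded_sum_moments:
  fixes x :: "nat \<Rightarrow> 'a \<Rightarrow> real"
  assumes ind: "indep_vars (\<lambda>_. borel) x UNIV" and bd: "\<And>i \<omega>. \<bar>x i \<omega>\<bar> \<le> c"
    and mean: "\<And>i. expectation (x i) = 0"
  shows "expectation (\<lambda>\<omega>. (\<Sum>i=a..<a+m. x i \<omega>)\<^sup>2) \<le> real m * c\<^sup>2"
    and "expectation (\<lambda>\<omega>. (\<Sum>i=a..<a+m. x i \<omega>)^4) \<le> 3 * (real m)\<^sup>2 * c^4"
proof -
  have xm[measurable]: "x i \<in> borel_measurable M" for i
    using ind unfolding indep_vars_def2 by auto
  define S where "S m \<omega> = (\<Sum>i=a..<a+m. x i \<omega>)" for m \<omega>
  have Sm[measurable]: "S m \<in> borel_measurable M" for m unfolding S_def by measurable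
  have Sb: "\<bar>S m \<omega>\<bar> \<le> real m * c" for m \<omega>
  proof -
    have "\<bar>S m \<omega>\<bar> \<le> (\<Sum>i=a..<a+m. c)" unfolding S_def by (intro order_trans[OF sum_abs] sum_mono bd)
    then show ?thesis by simp
  qed
  have int: "integrable M (\<lambda>\<omega>. S m \<omega> ^ k)" "integrable M (\<lambda>\<omega>. x i \<omega> ^ k)" for m k i
  proof -
    have "\<bar>S m \<omega> ^ k\<bar> \<le> (real m * c)^k" "\<bar>x i \<omega> ^ k\<bar> \<le> c^k" for \<omega>
      unfolding power_abs by (intro power_mono Sb bd abs_ge_zero)+
    then show "integrable M (\<lambda>\<omega>. S m \<omega> ^ k)" "integrable M (\<lambda>\<omega>. x i \<omega> ^ k)"
      by (auto intro: integrable_bounded[where C="(real m * c)^k"] integrable_bounded[where C="c^k"])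
  qed
  have S_Suc: "S (Suc m) \<omega> = S m \<omega> + x (a + m) \<omega>" for m \<omega> unfolding S_def by simp
  have ES: "expectation (S m) = 0" for m
    unfolding S_def using mean int(2)[of _ 1] by (simp add: Bochner_Integration.integral_sum)
  have "indep_var borel (x (a + m)) borel (S m)" for m
    unfolding S_def by (rule indep_vars_sum) (auto intro: indep_vars_subset[OF ind])
  then have indp: "indep_var borel (\<lambda>\<omega>. x (a + m) \<omega> ^ k) borel (\<lambda>\<omega>. S m \<omega> ^ l)" for m k l
    using indep_var_compose[of borel "x (a + m)" borel "S m" "\<lambda>t. t^k" borel "\<lambda>t. t^l" borel]
    by (simp add: comp_def)
  have prod: "integrable M (\<lambda>\<omega>. x (a + m) \<omega> ^ k * S m \<omega> ^ l)"
    "expectation (\<lambda>\<omega>. x (a + m) \<omega> ^ k * S m \<omega> ^ l) = expectation (\<lambda>\<omega>. x (a + m) \<omega> ^ k) * expectation (\<lambda>\<omega>. S m \<omega> ^ l)" for m k l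
    using indep_var_integrable[OF indp int(2) int(1)] indep_var_lebesgue_integral[OF indp int(2) int(1)] by auto
  have x2: "expectation (\<lambda>\<omega>. x i \<omega> ^ k) \<le> c ^ k" for i k
  proof -
    have "expectation (\<lambda>\<omega>. x i \<omega> ^ k) \<le> expectation (\<lambda>\<omega>. c ^ k)"
    proof (intro integral_mono int)
      show "x i \<omega> ^ k \<le> c ^ k" for \<omega>
        using power_mono[OF bd[of i \<omega>], of k] abs_ge_self[of "x i \<omega> ^ k"] by (simp add: power_abs)
    qed simp
    then show ?thesis by (simp add: prob_space)
  qed
  have c0: "0 \<le> c" using bd[of 0 undefined] by linarith
  have two: "expectation (\<lambda>\<omega>. S m \<omega> ^ 2) \<le> real m * c\<^sup>2" for m
  proof (induction m)
    case 0 then show ?case by (simp add: S_def)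
  next
    case (Suc m)
    have "(\<lambda>\<omega>. S (Suc m) \<omega> ^ 2) = (\<lambda>\<omega>. S m \<omega> ^ 2 + 2 * (x (a+m) \<omega> ^ 1 * S m \<omega> ^ 1) + x (a+m) \<omega> ^ 2)"
      unfolding S_Suc by (auto simp: power2_eq_square algebra_simps)
    then have "expectation (\<lambda>\<omega>. S (Suc m) \<omega> ^ 2) = expectation (\<lambda>\<omega>. S m \<omega> ^ 2) + expectation (\<lambda>\<omega>. x (a+m) \<omega> ^ 2)"
      using int prod[of m 1 1] mean by simp
    then show ?case using Suc x2[of "a+m" 2] by (simp add: algebra_simps)
  qed
  then show "expectation (\<lambda>\<omega>. (\<Sum>i=a..<a+m. x i \<omega>)\<^sup>2) \<le> real m * c\<^sup>2" unfolding S_def .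
  have "expectation (\<lambda>\<omega>. S m \<omega> ^ 4) \<le> 3 * (real m)\<^sup>2 * c^4" for m
  proof (induction m)
    case 0 then show ?case by (simp add: S_def)
  next
    case (Suc m)
    have "(\<lambda>\<omega>. S (Suc m) \<omega> ^ 4) = (\<lambda>\<omega>. S m \<omega> ^ 4 + 4 * (x (a+m) \<omega> ^ 1 * S m \<omega> ^ 3)
       + 6 * (x (a+m) \<omega> ^ 2 * S m \<omega> ^ 2) + 4 * (x (a+m) \<omega> ^ 3 * S m \<omega> ^ 1) + x (a+m) \<omega> ^ 4)"
      unfolding S_Suc by (rule ext) (simp add: power_numeral_reduce algebra_simps)
    then have "expectation (\<lambda>\<omega>. S (Suc m) \<omega> ^ 4) = expectation (\<lambda>\<omega>. S m \<omega> ^ 4)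
       + 6 * (expectation (\<lambda>\<omega>. x (a+m) \<omega> ^ 2) * expectation (\<lambda>\<omega>. S m \<omega> ^ 2)) + expectation (\<lambda>\<omega>. x (a+m) \<omega> ^ 4)"
      using int prod[of m 1 3] prod[of m 2 2] prod[of m 3 1] mean ES by simp
    also have "\<dots> \<le> 3 * (real m)\<^sup>2 * c^4 + 6 * (c^2 * (real m * c\<^sup>2)) + c^4"
      using Suc x2 two c0 by (intro add_mono mult_left_mono mult_mono) auto
    also have "\<dots> = (3 * (real m)\<^sup>2 + 6 * real m + 1) * c^4" by (simp add: algebra_simps power_numeral_reduce)
    also have "\<dots> \<le> 3 * (real (Suc m))\<^sup>2 * c^4" using c0 by (intro mult_right_mono) (auto simp: power2_eq_square algebra_simps)
    finally show ?case .
  qed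
  then show "expectation (\<lambda>\<omega>. (\<Sum>i=a..<a+m. x i \<omega>)^4) \<le> 3 * (real m)\<^sup>2 * c^4" unfolding S_def .
qed

text \<open>The summation index \<open>i < n\<close> belongs to the sampling point \<open>(i + 1) / n\<close>; the \<open>j\<close>-th block of
  level \<open>k\<close> collects the sampling points in the half-open cell \<open>(j / 2^k, (j + 1) / 2^k]\<close>, whose left
  endpoint is \<open>cell_point\<close>.\<close>

definition block_start :: "nat \<Rightarrow> nat \<Rightarrow> nat \<Rightarrow> nat" where
  "block_start n k j = (j * n) div 2^k"

definition block_sum :: "nat \<Rightarrow> (nat \<Rightarrow> real) \<Rightarrow> nat \<Rightarrow> nat \<Rightarrow> real" where
  "block_sum n y k j = (\<Sum>i=block_start n k j..<block_start n k (Suc j). y i)"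

definition cell_point :: "nat \<Rightarrow> nat \<Rightarrow> nat \<Rightarrow> real" where
  "cell_point n k i = real ((i * 2^k - 1) div n) / 2^k"

lemma block_start_mono: "i \<le> j \<Longrightarrow> block_start n k i \<le> block_start n k j"
  unfolding block_start_def by (intro div_le_mono mult_right_mono) auto

lemma block_start_double: "block_start n (Suc k) (2 * j) = block_start n k j"
  unfolding block_start_def by (simp add: mult.assoc)

lemma block_start_ends [simp]: "block_start n k 0 = 0" "block_start n k (2^k) = n"
  unfolding block_start_def by auto

lemma block_sum_add:
  "block_sum n y k j = block_sum n y (Suc k) (2 * j) + block_sum n y (Suc k) (2 * j + 1)"
  unfolding block_sum_def block_start_double[symmetric, of n k]
  using block_start_mono[of "2*j" "Suc (2*j)" n "Suc k"] block_start_mono[of "Suc (2*j)" "2 * Suc j" n "Suc k"]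
  by (simp add: sum.atLeastLessThan_concat)

lemma block_length:
  "real (block_start n k (Suc j) - block_start n k j) \<le> real n / 2^k + 1"
proof -
  have "block_start n k (Suc j) \<le> block_start n k j + n div 2^k + 1"
  proof -
    let ?m = "2^k :: nat"
    have "n mod ?m + (j * n) mod ?m < 2 * ?m"
      using mod_less_divisor[of ?m n] mod_less_divisor[of ?m "j * n"] unfolding mult_2
      by (intro add_strict_mono) auto
    then have "(n mod ?m + (j * n) mod ?m) div ?m < 2" by (rule less_mult_imp_div_less)
    then show ?thesis unfolding block_start_def mult_Suc div_add1_eq[of n "j * n" ?m] by linarith
  qed
  then have "real (block_start n k (Suc j) - block_start n k j) \<le> real (n div 2^k) + 1" by linarith
  also have "real (n div 2^k) \<le> real n / 2^k" using of_nat_div_le_of_nat[of n "2^k"] by simp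
  finally show ?thesis by simp
qed

lemma sum_blocks:
  fixes g :: "nat \<Rightarrow> real"
  assumes "\<And>j. j < N \<Longrightarrow> u j \<le> u (Suc j)"
  shows "(\<Sum>j<N. \<Sum>i=u j..<u (Suc j). g i) = (\<Sum>i=u 0..<u N. g i)"
  using assms
proof (induction N)
  case (Suc N)
  have "u 0 \<le> u N" using Suc.prems
  proof (induction N)
    case (Suc N) then show ?case by (meson le_SucI le_trans lessI less_SucI)
  qed simp
  then show ?case using Suc by (simp add: sum.atLeastLessThan_concat)
qed simp

text \<open>The subtraction of 1 in \<open>cell_point\<close> makes the cells closed on the right:
  \<open>i\<close> lies in block \<open>j\<close> exactly when
  \<open>j * n < Suc i * 2^k \<le> Suc j * n\<close>.\<close>

lemma cell_point_block:
  assumes n: "0 < n" and i: "block_start n k j \<le> i" "i < block_start n k (Suc j)"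
  shows "cell_point n k (Suc i) = real j / 2^k"
proof -
  have "j * n < Suc i * 2^k" using i(1) unfolding block_start_def
    by (metis less_Suc_eq_le div_less_iff_less_mult zero_less_numeral zero_less_power)
  moreover have "Suc i * 2^k \<le> Suc j * n" using i(2) unfolding block_start_def
    by (metis Suc_leI less_eq_div_iff_mult_less_eq zero_less_numeral zero_less_power)
  ultimately have "(Suc i * 2^k - 1) div n = j"
    by (intro div_nat_eqI) (auto simp: algebra_simps)
  then show ?thesis unfolding cell_point_def by simp
qed

lemma dyadic_sum_block_sum:
  assumes n: "0 < n"
  shows "dyadic_sum (block_sum n y k) f k = (\<Sum>i<n. y i * f (cell_point n k (Suc i)))"
proof -
  have "dyadic_sum (block_sum n y k) f k
      = (\<Sum>j<2^k. \<Sum>i=block_start n k j..<block_start n k (Suc j). y i * f (cell_point n k (Suc i)))"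
    unfolding dyadic_sum_def block_sum_def sum_distrib_left
    using cell_point_block[OF n] by (intro sum.cong refl) auto
  also have "\<dots> = (\<Sum>i=block_start n k 0..<block_start n k (2^k). y i * f (cell_point n k (Suc i)))"
    by (intro sum_blocks block_start_mono) auto
  finally show ?thesis by (simp add: atLeast0LessThan)
qed

text \<open>Once \<open>n \<le> 2^k\<close>, the cell points interlace with the sampling points, so
  the intervals between them do not overlap and \<open>level_sum\<close> applies. For
  \<open>i = 0\<close> truncated subtraction gives the cell point 0.\<close>

lemma cell_point_bounds:
  assumes n: "0 < n"
  shows "0 \<le> cell_point n k i" "cell_point n k i \<le> real i / real n"
    "cell_point n k i \<le> cell_point n k (Suc i)"
    "n \<le> 2^k \<Longrightarrow> real i / real n \<le> cell_point n k (Suc i)"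
proof -
  show "0 \<le> cell_point n k i" unfolding cell_point_def by simp
  show "cell_point n k i \<le> cell_point n k (Suc i)"
    unfolding cell_point_def by (intro divide_right_mono) (auto intro!: div_le_mono)
  have "real ((i * 2^k - 1) div n) \<le> real (i * 2^k - 1) / real n" by (rule of_nat_div_le_of_nat)
  also have "\<dots> \<le> real (i * 2^k) / real n" by (intro divide_right_mono of_nat_mono) auto
  finally show "cell_point n k i \<le> real i / real n"
    unfolding cell_point_def by (simp add: field_simps)
  assume nk: "n \<le> 2^k"
  have "i * 2^k \<le> ((Suc i * 2^k - 1) div n) * n"
  proof -
    \<comment> \<open>Adding \<open>n - 1\<close> before dividing rounds up, and
      \<open>n \<le> 2^k\<close> makes \<open>Suc i * 2^k - 1\<close> at least that large.\<close>
    have "((i * 2^k + n - 1) div n) * n = (i * 2^k + n - 1) - (i * 2^k + n - 1) mod n"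
      by (simp add: minus_mod_eq_div_mult)
    moreover have "(i * 2^k + n - 1) mod n \<le> n - 1" using n by (metis Suc_pred' less_Suc_eq_le mod_less_divisor)
    ultimately have "i * 2^k \<le> ((i * 2^k + n - 1) div n) * n" using n by linarith
    also have "\<dots> \<le> ((Suc i * 2^k - 1) div n) * n"
      using nk by (intro mult_right_mono div_le_mono) auto
    finally show ?thesis .
  qed
  then have "real i * 2^k \<le> real ((Suc i * 2^k - 1) div n) * real n"
    by (metis of_nat_mono of_nat_mult of_nat_numeral of_nat_power)
  then show "real i / real n \<le> cell_point n k (Suc i)"
    unfolding cell_point_def using n by (simp add: divide_simps)
qed

definition block_level :: "real \<Rightarrow> real \<Rightarrow> nat \<Rightarrow> (nat \<Rightarrow> real) \<Rightarrow> nat \<Rightarrow> real" where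
  "block_level q B n y l = level_bound q B l (\<Sum>j<2^l. (block_sum n y (Suc l) (2 * j + 1))\<^sup>2)
      (\<Sum>j<2^l. block_sum n y (Suc l) (2 * j + 1) ^ 4)"

text \<open>Chaining from level \<open>k\<close> up to a level \<open>K\<close> at which no cell
  holds two sampling points, followed by one more step from the cell points to the sampling points
  themselves.\<close>

lemma block_chaining:
  assumes f: "f \<in> var_class q B" and q: "1 \<le> q" "q < 2" and B: "0 \<le> B"
    and n: "0 < n" "n \<le> 2^K" and k: "k \<le> K"
  shows "\<bar>\<Sum>i<n. y i * (f (real (Suc i) / real n) - f (cell_point n k (Suc i)))\<bar>
     \<le> (\<Sum>l=k..<K. block_level q B n y l) + level_bound q B K (\<Sum>i<n. (y i)\<^sup>2) (\<Sum>i<n. y i ^ 4)"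
proof -
  let ?d = "\<lambda>l. dyadic_sum (block_sum n y l) f l"
  have "?d K - ?d k = (\<Sum>l=k..<K. ?d (Suc l) - ?d l)" using sum_Suc_diff'[OF k, of ?d] by simp
  also have "\<bar>\<dots>\<bar> \<le> (\<Sum>l=k..<K. block_level q B n y l)"
    unfolding block_level_def
    by (intro order_trans[OF sum_abs] sum_mono dyadic_sum_step[OF f q B] block_sum_add)
  finally have 1: "\<bar>?d K - ?d k\<bar> \<le> (\<Sum>l=k..<K. block_level q B n y l)" .
  have "\<bar>\<Sum>i<n. (f (real (Suc i) / real n) - f (cell_point n K (Suc i))) * y i\<bar>
     \<le> (\<Sum>i<n. \<bar>(f (real (Suc i) / real n) - f (cell_point n K (Suc i))) * y i\<bar>)" by (rule sum_abs)
  also have "\<dots> \<le> level_bound q B K (\<Sum>i<n. (y i)\<^sup>2) (\<Sum>i<n. y i ^ 4)"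
    by (rule level_sum[OF f q B]) (use n cell_point_bounds[OF n(1)] in \<open>auto simp del: of_nat_Suc\<close>)
  finally have 2: "\<bar>\<Sum>i<n. (f (real (Suc i) / real n) - f (cell_point n K (Suc i))) * y i\<bar>
    \<le> level_bound q B K (\<Sum>i<n. (y i)\<^sup>2) (\<Sum>i<n. y i ^ 4)" .
  have "(\<Sum>i<n. y i * (f (real (Suc i) / real n) - f (cell_point n k (Suc i))))
    = (?d K - ?d k) + (\<Sum>i<n. (f (real (Suc i) / real n) - f (cell_point n K (Suc i))) * y i)"
    unfolding dyadic_sum_block_sum[OF n(1)] by (simp add: algebra_simps flip: sum.distrib sum_subtractf)
  then show ?thesis using 1 2 by linarith
qed

definition level_rate :: "real \<Rightarrow> real" where
  "level_rate q = 2 powr (- ((2 - q)/48))"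

lemma level_rate: "q < 2 \<Longrightarrow> 0 < level_rate q \<and> level_rate q < 1"
  unfolding level_rate_def by (auto simp: powr_less_one)

text \<open>Second moments may stay bounded, fourth moments must decay like \<open>1 / 2^l\<close>.
  Of that decay the factor \<open>2 powr (l/2)\<close> leaves \<open>2 powr (- (l/2))\<close>, which
  is still at most \<open>level_rate q ^ l\<close>.\<close>

lemma level_bound_le:
  assumes q: "1 \<le> q" "q < 2" and B: "0 \<le> B" and D: "0 \<le> D" "S2 \<le> A" "S4 \<le> D / 2^l"
  shows "level_bound q B l S2 S4 \<le> (B + 2 * B\<^sup>2 + A + 2 * B * D) * level_rate q ^ l"
proof -
  have rl: "level_rate q ^ l = 2 powr (- ((2 - q)/48) * real l)"
    unfolding level_rate_def by (simp add: powr_powr flip: powr_realpow)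
  have "2 powr (real l / 2) * S4 \<le> 2 powr (real l / 2) * (D / 2^l)" using D by (intro mult_left_mono) auto
  also have "\<dots> = D * 2 powr (- (real l / 2))"
  proof -
    have "2 powr (real l / 2) * 2 powr (real l / 2) = 2 ^ l" by (simp flip: powr_add powr_realpow)
    then show ?thesis by (simp add: powr_minus field_simps)
  qed
  also have "2 powr (- (real l / 2)) \<le> level_rate q ^ l"
    unfolding rl using q by (intro powr_mono) (auto simp: field_simps mult_left_le)
  finally have "2 * B * (2 powr (real l / 2) * S4) \<le> 2 * B * (D * level_rate q ^ l)"
    using D B by (intro mult_left_mono) (auto intro: mult_left_mono)
  moreover have "level_rate q ^ l * (B + 2 * B\<^sup>2 + S2) \<le> level_rate q ^ l * (B + 2 * B\<^sup>2 + A)"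
    using D level_rate[OF q(2)] by (intro mult_left_mono) auto
  ultimately show ?thesis unfolding level_bound_def rl[symmetric] by (simp add: algebra_simps)
qed

lemma (in prob_space) expectation_level_bound:
  assumes "integrable M S2" "integrable M S4"
  shows "integrable M (\<lambda>\<omega>. level_bound q B l (S2 \<omega>) (S4 \<omega>))"
    "expectation (\<lambda>\<omega>. level_bound q B l (S2 \<omega>) (S4 \<omega>)) = level_bound q B l (expectation S2) (expectation S4)"
  unfolding level_bound_def using assms prob_space by simp_all

text \<open>The normalised block sums of level \<open>l\<close> have second moments adding up to at
  most \<open>c\<^sup>2\<close> and fourth moments adding up to order \<open>1 / 2^l\<close>, so the
  terms of \<open>block_chaining\<close> have geometrically decaying means, uniformly in
  \<open>n\<close>.\<close>

lemma (in prob_space) bounded_weighted_sums: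
  fixes x :: "nat \<Rightarrow> 'a \<Rightarrow> real"
  assumes q: "1 \<le> q" "q < 2" and B: "0 \<le> B"
    and ind: "indep_vars (\<lambda>_. borel) x UNIV" and bd: "\<And>i \<omega>. \<bar>x i \<omega>\<bar> \<le> c"
    and mean: "\<And>i. expectation (x i) = 0" and n: "2^k \<le> n"
  shows "\<exists>R\<in>borel_measurable M. integrable M R \<and>
    expectation R \<le> (B + 2 * B\<^sup>2 + c\<^sup>2 + 2 * B * (6 * c^4)) * level_rate q ^ k / (1 - level_rate q) \<and>
    (\<forall>f\<in>var_class q B. \<forall>\<omega>. \<bar>(\<Sum>i<n. x i \<omega> * (f (real (Suc i) / real n) - f (cell_point n k (Suc i))))\<bar>
        \<le> sqrt (real n) * R \<omega>)"
proof -
  have npos: "0 < n" using n by (metis gr0I not_one_le_zero one_le_numeral one_le_power order_trans)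
  have c0: "0 \<le> c" using bd[of 0 undefined] by linarith
  have xm[measurable]: "x i \<in> borel_measurable M" for i
    using ind unfolding indep_vars_def2 by auto
  define y where "y \<omega> i = x i \<omega> / sqrt (real n)" for i \<omega>
  have ym[measurable]: "(\<lambda>\<omega>. y \<omega> i) \<in> borel_measurable M" for i unfolding y_def by measurable
  \<comment> \<open>The least possible \<open>K\<close>: \<open>n \<le> 2^K\<close> is needed for
    the interlacing, \<open>2^l < n\<close> below \<open>K\<close> keeps block lengths from being
    dominated by rounding, and \<open>2^K \<le> 2 * n\<close> controls the last step.\<close>
  define K where "K = (LEAST K. n \<le> 2^K)"
  have K: "n \<le> 2^K" unfolding K_def by (rule LeastI[of _ n]) simp
  have Kmin: "2^l < n" if "l < K" for l
    using not_less_Least[of l "\<lambda>K. n \<le> 2^K"] that unfolding K_def by auto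
  have "(2::nat)^k \<le> 2^K" using n K by (rule order_trans)
  then have kK: "k \<le> K" by simp
  define H where "H = B + 2 * B\<^sup>2 + c\<^sup>2 + 2 * B * (6 * c^4)"
  let ?b = "\<lambda>l j \<omega>. block_sum n (y \<omega>) l j"
  have bexp: "?b l j \<omega> = (\<Sum>i=block_start n l j..<block_start n l j + (block_start n l (Suc j) - block_start n l j). x i \<omega>) / sqrt (real n)" for l j \<omega>
    using block_start_mono[of j "Suc j" n l] unfolding block_sum_def y_def by (simp add: sum_divide_distrib)
  define m where "m l j = block_start n l (Suc j) - block_start n l j" for l j
  have bm: "expectation (\<lambda>\<omega>. (?b l j \<omega>)\<^sup>2) \<le> real (m l j) * c\<^sup>2 / real n"
    "expectation (\<lambda>\<omega>. (?b l j \<omega>)^4) \<le> 3 * (real (m l j))\<^sup>2 * c^4 / (real n)\<^sup>2" for l j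
  proof -
    have s4: "sqrt (real n)^4 = (real n)\<^sup>2" by (simp add: power4_eq_xxxx power2_eq_square)
    show "expectation (\<lambda>\<omega>. (?b l j \<omega>)\<^sup>2) \<le> real (m l j) * c\<^sup>2 / real n"
      "expectation (\<lambda>\<omega>. (?b l j \<omega>)^4) \<le> 3 * (real (m l j))\<^sup>2 * c^4 / (real n)\<^sup>2"
      using bounded_sum_moments[OF ind bd mean, of "block_start n l j" "m l j"] npos
      unfolding bexp power_divide s4 m_def by (auto intro!: divide_right_mono)
  qed
  have bb: "\<bar>?b l j \<omega>\<bar> \<le> real (m l j) * c / sqrt (real n)" for l j \<omega>
  proof -
    have "\<bar>?b l j \<omega>\<bar> \<le> (\<Sum>i=block_start n l j..<block_start n l (Suc j). c / sqrt (real n))"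
      unfolding block_sum_def y_def using bd by (intro order_trans[OF sum_abs] sum_mono) (auto intro: divide_right_mono)
    then show ?thesis unfolding m_def by simp
  qed
  have bmeas[measurable]: "?b l j \<in> borel_measurable M" for l j
    unfolding block_sum_def by measurable
  have bint: "integrable M (\<lambda>\<omega>. ?b l j \<omega> ^ p)" for l j p
  proof (rule integrable_bounded[where C="(real (m l j) * c / sqrt (real n))^p"])
    show "\<bar>?b l j \<omega> ^ p\<bar> \<le> (real (m l j) * c / sqrt (real n))^p" for \<omega>
      unfolding power_abs by (intro power_mono bb) auto
  qed measurable
  \<comment> \<open>Only blocks of odd index occur in \<open>block_level\<close>; their lengths are
    part of those of all blocks, which exhaust the sample.\<close>
  have summ: "(\<Sum>j<2^l. real (m (Suc l) (2 * j + 1))) \<le> real n" for l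
  proof -
    have "(\<Sum>j<2^l. real (m (Suc l) (2 * j + 1))) \<le> (\<Sum>j<2 * 2^l. real (m (Suc l) j))"
      unfolding sum_even_odd by (intro sum_mono) auto
    also have "\<dots> = (\<Sum>j<2^Suc l. \<Sum>i=block_start n (Suc l) j..<block_start n (Suc l) (Suc j). 1)"
      unfolding m_def by simp
    also have "\<dots> = (\<Sum>i=block_start n (Suc l) 0..<block_start n (Suc l) (2^Suc l). 1)"
      by (intro sum_blocks block_start_mono) auto
    also have "\<dots> = real n" by (simp del: power_Suc)
    finally show ?thesis .
  qed
  have lev: "integrable M (\<lambda>\<omega>. block_level q B n (y \<omega>) l)" "expectation (\<lambda>\<omega>. block_level q B n (y \<omega>) l) \<le> H * level_rate q ^ l"
    if l: "l < K" for l
  proof -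
    let ?S2 = "\<lambda>\<omega>. \<Sum>j<2^l. (?b (Suc l) (2 * j + 1) \<omega>)\<^sup>2"
    let ?S4 = "\<lambda>\<omega>. \<Sum>j<2^l. ?b (Suc l) (2 * j + 1) \<omega> ^ 4"
    have i2: "integrable M ?S2" and i4: "integrable M ?S4" using bint by auto
    have "expectation ?S2 \<le> (\<Sum>j<2^l. real (m (Suc l) (2 * j + 1)) * c\<^sup>2 / real n)"
      using bint bm by (subst Bochner_Integration.integral_sum) (auto intro!: sum_mono)
    also have "\<dots> = (\<Sum>j<2^l. real (m (Suc l) (2 * j + 1))) * (c\<^sup>2 / real n)"
      unfolding sum_distrib_right by simp
    also have "\<dots> \<le> real n * (c\<^sup>2 / real n)" using summ by (intro mult_right_mono) auto
    finally have e2: "expectation ?S2 \<le> c\<^sup>2" using npos by simp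
    have ml: "real (m (Suc l) j) \<le> 2 * real n / 2^l" for j
    proof -
      define t where "t = real n / 2^l"
      have 1: "1 \<le> t" unfolding t_def using Kmin[OF l]
        by (metis less_imp_le of_nat_le_iff of_nat_numeral of_nat_power pos_le_divide_eq mult_1 zero_less_numeral zero_less_power)
      have 2: "real n / 2^Suc l = t / 2" "2 * real n / 2^l = 2 * t" unfolding t_def by auto
      have "real (m (Suc l) j) \<le> t / 2 + 1" using block_length[of n "Suc l" j] unfolding m_def 2(1) .
      with 1 show ?thesis unfolding 2(2) by linarith
    qed
    have "expectation ?S4 \<le> (\<Sum>j<2^l. 3 * (real (m (Suc l) (2 * j + 1)))\<^sup>2 * c^4 / (real n)\<^sup>2)"
      using bint bm by (subst Bochner_Integration.integral_sum) (auto intro!: sum_mono)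
    \<comment> \<open>One of the two factors \<open>m\<close> is bounded by \<open>ml\<close>, which
      gives the decay in \<open>l\<close>; the other is summed over the blocks.\<close>
    also have "\<dots> \<le> (\<Sum>j<2^l. 3 * (real (m (Suc l) (2 * j + 1)) * (2 * real n / 2^l)) * c^4 / (real n)\<^sup>2)"
      unfolding power2_eq_square[of "real (m _ _)"] using ml c0
      by (intro sum_mono divide_right_mono mult_right_mono mult_left_mono) auto
    also have "\<dots> = (\<Sum>j<2^l. real (m (Suc l) (2 * j + 1))) * (6 * c^4 / 2^l / real n)"
      unfolding sum_distrib_right using npos by (simp add: power2_eq_square field_simps)
    also have "\<dots> \<le> real n * (6 * c^4 / 2^l / real n)" using summ by (intro mult_right_mono) auto
    finally have e4: "expectation ?S4 \<le> 6 * c^4 / 2^l" using npos by simp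
    show "integrable M (\<lambda>\<omega>. block_level q B n (y \<omega>) l)"
      unfolding block_level_def by (rule expectation_level_bound[OF i2 i4])
    show "expectation (\<lambda>\<omega>. block_level q B n (y \<omega>) l) \<le> H * level_rate q ^ l"
      unfolding block_level_def expectation_level_bound(2)[OF i2 i4] H_def
      by (rule level_bound_le[OF q B _ e2 e4]) simp
  qed
  have yint: "integrable M (\<lambda>\<omega>. y \<omega> i ^ p)" and yexp: "expectation (\<lambda>\<omega>. y \<omega> i ^ p) \<le> (c / sqrt (real n)) ^ p" for i p
  proof -
    have "\<bar>y \<omega> i\<bar> \<le> c / sqrt (real n)" for \<omega> unfolding y_def using bd by (auto intro: divide_right_mono)
    then have p: "\<bar>y \<omega> i ^ p\<bar> \<le> (c / sqrt (real n)) ^ p" for \<omega> using power_mono[of "\<bar>y \<omega> i\<bar>" "c / sqrt (real n)" p] by (simp add: power_abs)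
    then show i: "integrable M (\<lambda>\<omega>. y \<omega> i ^ p)" by (intro integrable_bounded[where C="(c / sqrt (real n))^p"]) auto
    have "expectation (\<lambda>\<omega>. y \<omega> i ^ p) \<le> expectation (\<lambda>\<omega>. (c / sqrt (real n)) ^ p)"
      using p by (intro integral_mono i) (auto simp: abs_le_iff)
    then show "expectation (\<lambda>\<omega>. y \<omega> i ^ p) \<le> (c / sqrt (real n)) ^ p" by (simp add: prob_space)
  qed
  let ?T2 = "\<lambda>\<omega>. \<Sum>i<n. (y \<omega> i)\<^sup>2" and ?T4 = "\<lambda>\<omega>. \<Sum>i<n. y \<omega> i ^ 4"
  have j2: "integrable M ?T2" and j4: "integrable M ?T4" using yint by auto
  have "expectation ?T2 = (\<Sum>i<n. expectation (\<lambda>\<omega>. (y \<omega> i)\<^sup>2))"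
    by (rule Bochner_Integration.integral_sum) (rule yint)
  also have "\<dots> \<le> (\<Sum>i<n. (c / sqrt (real n))\<^sup>2)" by (rule sum_mono) (rule yexp)
  also have "\<dots> = c\<^sup>2" using npos by (simp add: power_divide)
  finally have e2: "expectation ?T2 \<le> c\<^sup>2" .
  have "expectation ?T4 = (\<Sum>i<n. expectation (\<lambda>\<omega>. y \<omega> i ^ 4))"
    by (rule Bochner_Integration.integral_sum) (rule yint)
  also have "\<dots> \<le> (\<Sum>i<n. (c / sqrt (real n))^4)" by (rule sum_mono) (rule yexp)
  also have "\<dots> = c^4 / real n" using npos by (simp add: power_divide power4_eq_xxxx)
  also have "\<dots> \<le> 6 * c^4 / 2^K"
  proof (cases K)
    case 0
    then have "n = 1" using npos K by simp
    then show ?thesis using 0 c0 by simp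
  next
    case (Suc K')
    have "2^K' < n" using Kmin[of K'] Suc by simp
    then have "2 ^ K \<le> 2 * n" using Suc by simp
    then have "real (2 ^ K) \<le> real (6 * n)" by (intro of_nat_mono) simp
    then have "2 ^ K \<le> 6 * real n" by simp
    then have "c^4 * 2^K \<le> c^4 * (6 * real n)" by (intro mult_left_mono) auto
    then show ?thesis using npos by (simp add: field_simps)
  qed
  finally have e4: "expectation ?T4 \<le> 6 * c^4 / 2^K" .
  have top: "integrable M (\<lambda>\<omega>. level_bound q B K (?T2 \<omega>) (?T4 \<omega>))"
    "expectation (\<lambda>\<omega>. level_bound q B K (?T2 \<omega>) (?T4 \<omega>)) \<le> H * level_rate q ^ K"
    unfolding expectation_level_bound(2)[OF j2 j4] H_def
    by (rule expectation_level_bound[OF j2 j4], rule level_bound_le[OF q B _ e2 e4]) simp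
  define R where "R \<omega> = (\<Sum>l=k..<K. block_level q B n (y \<omega>) l) + level_bound q B K (?T2 \<omega>) (?T4 \<omega>)" for \<omega>
  have Ri: "integrable M R" unfolding R_def using lev(1) top(1) by (intro Bochner_Integration.integrable_add Bochner_Integration.integrable_sum) auto
  have "expectation R = (\<Sum>l=k..<K. expectation (\<lambda>\<omega>. block_level q B n (y \<omega>) l)) + expectation (\<lambda>\<omega>. level_bound q B K (?T2 \<omega>) (?T4 \<omega>))"
  proof -
    have "integrable M (\<lambda>\<omega>. \<Sum>l=k..<K. block_level q B n (y \<omega>) l)"
      by (rule Bochner_Integration.integrable_sum) (simp add: lev(1))
    moreover have "expectation (\<lambda>\<omega>. \<Sum>l=k..<K. block_level q B n (y \<omega>) l) = (\<Sum>l=k..<K. expectation (\<lambda>\<omega>. block_level q B n (y \<omega>) l))"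
      by (rule Bochner_Integration.integral_sum) (simp add: lev(1))
    note s = calculation this
    show ?thesis unfolding R_def by (simp only: Bochner_Integration.integral_add[OF s(1) top(1)] s(2))
  qed
  also have "\<dots> \<le> (\<Sum>l=k..<K. H * level_rate q ^ l) + H * level_rate q ^ K"
    using lev(2) top(2) by (intro add_mono sum_mono) auto
  also have "\<dots> = H * level_rate q ^ k * (\<Sum>l<Suc (K - k). level_rate q ^ l)"
  proof -
    have "(\<Sum>l=k..<K. level_rate q ^ l) + level_rate q ^ K = (\<Sum>l=k..<Suc K. level_rate q ^ l)" using kK by simp
    also have "\<dots> = (\<Sum>l=0+k..<Suc (K - k)+k. level_rate q ^ l)" using kK by simp
    also have "\<dots> = level_rate q ^ k * (\<Sum>l<Suc (K - k). level_rate q ^ l)"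
      unfolding sum.shift_bounds_nat_ivl by (simp add: power_add sum_distrib_left atLeast0LessThan mult.commute del: sum.lessThan_Suc)
    finally have geo: "(\<Sum>l=k..<K. level_rate q ^ l) + level_rate q ^ K = level_rate q ^ k * (\<Sum>l<Suc (K - k). level_rate q ^ l)" .
    have "(\<Sum>l=k..<K. H * level_rate q ^ l) + H * level_rate q ^ K = H * ((\<Sum>l=k..<K. level_rate q ^ l) + level_rate q ^ K)"
      by (simp add: sum_distrib_left distrib_left)
    then show ?thesis unfolding geo by (simp only: mult.assoc)
  qed
  also have "\<dots> \<le> H * level_rate q ^ k * (1 / (1 - level_rate q))"
  proof (intro mult_left_mono)
    show "(\<Sum>l<Suc (K - k). level_rate q ^ l) \<le> 1 / (1 - level_rate q)"
      using sum_le_suminf[OF summable_geometric, of "level_rate q" "{..<Suc (K - k)}"] suminf_geometric[of "level_rate q"] level_rate[OF q(2)]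
      by simp
    show "0 \<le> H * level_rate q ^ k" unfolding H_def using B c0 level_rate[OF q(2)] by simp
  qed
  finally have ER: "expectation R \<le> H * level_rate q ^ k / (1 - level_rate q)" by simp
  have "\<bar>(\<Sum>i<n. x i \<omega> * (f (real (Suc i) / real n) - f (cell_point n k (Suc i))))\<bar> \<le> sqrt (real n) * R \<omega>"
    if f: "f \<in> var_class q B" for f \<omega>
  proof -
    have "(\<Sum>i<n. x i \<omega> * (f (real (Suc i) / real n) - f (cell_point n k (Suc i))))
      = sqrt (real n) * (\<Sum>i<n. y \<omega> i * (f (real (Suc i) / real n) - f (cell_point n k (Suc i))))"
      unfolding sum_distrib_left using npos by (intro sum.cong) (auto simp: y_def)
    then show ?thesis using block_chaining[OF f q B npos K kK, of "y \<omega>"] unfolding R_def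
      by (simp add: abs_mult mult_left_mono)
  qed
  then show ?thesis using Ri ER unfolding H_def by (intro bexI[of _ R]) auto
qed

section \<open>Linear processes\<close>

lemma (in prob_space) indep_vars_inj:
  assumes "indep_vars (\<lambda>_. N) X UNIV" "inj s"
  shows "indep_vars (\<lambda>_. N) (\<lambda>i. X (s i)) UNIV"
proof -
  have "indep_vars (\<lambda>j. PiM {s j} (\<lambda>_. N)) (\<lambda>j \<omega>. restrict (\<lambda>i. X i \<omega>) {s j}) UNIV"
    using assms by (intro indep_vars_restrict) (auto simp: disjoint_family_on_def inj_def)
  then have "indep_vars (\<lambda>_. N) (\<lambda>j \<omega>. (\<lambda>y. y (s j)) (restrict (\<lambda>i. X i \<omega>) {s j})) UNIV"
    by (rule indep_vars_compose2) (auto intro: measurable_component_singleton)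
  then show ?thesis by simp
qed

lemma distr_eq_transfer:
  fixes u :: "'c \<Rightarrow> 'd::{banach, second_countable_topology}"
  assumes "distr M S X = distr N S Y" "X \<in> measurable M S" "Y \<in> measurable N S" "u \<in> borel_measurable S"
  shows "integrable M (\<lambda>\<omega>. u (X \<omega>)) \<longleftrightarrow> integrable N (\<lambda>\<omega>. u (Y \<omega>))"
    "(\<integral>\<omega>. u (X \<omega>) \<partial>M) = (\<integral>\<omega>. u (Y \<omega>) \<partial>N)"
  using integrable_distr_eq[OF assms(2,4)] integrable_distr_eq[OF assms(3,4)]
    integral_distr[OF assms(2,4)] integral_distr[OF assms(3,4)] unfolding assms(1) by simp_all

lemma (in prob_space) iid_innovationsD:
  assumes "iid_innovations M \<eta>"
  shows "indep_vars (\<lambda>_. borel) \<eta> UNIV" "\<eta> j \<in> borel_measurable M"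
    "distr M borel (\<eta> j) = distr M borel (\<eta> 1)" "integrable M (\<lambda>\<omega>. (\<eta> j \<omega>)\<^sup>2)" "integrable M (\<eta> j)"
    "expectation (\<eta> j) = 0" "expectation (\<lambda>\<omega>. (\<eta> j \<omega>)\<^sup>2) = expectation (\<lambda>\<omega>. (\<eta> 1 \<omega>)\<^sup>2)"
    "0 < expectation (\<lambda>\<omega>. (\<eta> 1 \<omega>)\<^sup>2)"
proof -
  show ind: "indep_vars (\<lambda>_. borel) \<eta> UNIV" and d: "distr M borel (\<eta> j) = distr M borel (\<eta> 1)" for j
    using assms unfolding iid_innovations_def by auto
  show m[measurable]: "\<eta> j \<in> borel_measurable M" for j using ind unfolding indep_vars_def2 by auto
  have tr: "integrable M (\<lambda>\<omega>. h (\<eta> j \<omega>)) = integrable M (\<lambda>\<omega>. h (\<eta> 1 \<omega>))"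
    "expectation (\<lambda>\<omega>. h (\<eta> j \<omega>)) = expectation (\<lambda>\<omega>. h (\<eta> 1 \<omega>))"
    if [measurable]: "h \<in> borel_measurable borel" for j and h :: "real \<Rightarrow> real"
    using distr_eq_transfer[OF d[of j] m m that] by auto
  show sq: "integrable M (\<lambda>\<omega>. (\<eta> j \<omega>)\<^sup>2)" for j
    using tr(1)[of "\<lambda>x. x\<^sup>2" j] assms unfolding iid_innovations_def by auto
  show "integrable M (\<eta> j)" by (rule square_integrable_imp_integrable[OF m sq])
  show "expectation (\<eta> j) = 0" using tr(2)[of "\<lambda>x. x" j] assms unfolding iid_innovations_def by auto
  show "expectation (\<lambda>\<omega>. (\<eta> j \<omega>)\<^sup>2) = expectation (\<lambda>\<omega>. (\<eta> 1 \<omega>)\<^sup>2)" using tr(2)[of "\<lambda>x. x\<^sup>2" j] by auto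
  have "0 \<le> expectation (\<lambda>\<omega>. (\<eta> 1 \<omega>)\<^sup>2)" by (intro integral_nonneg_AE) auto
  then show "0 < expectation (\<lambda>\<omega>. (\<eta> 1 \<omega>)\<^sup>2)" using assms unfolding iid_innovations_def by (metis order_le_less)
qed

text \<open>The innovations are split into a bounded part, treated by dyadic chaining with fourth moments,
  and a part of small variance, treated by the greedy approximation of its partial sums.\<close>

lemma (in prob_space) innovation_sums_approx:
  assumes iid: "iid_innovations M \<eta>" and q: "1 \<le> q" "q < 2" and B: "0 \<le> B" and e: "0 < e"
  shows "\<exists>k0. \<forall>k\<ge>k0. \<forall>n\<ge>2^k. \<forall>a::int. \<exists>R\<in>borel_measurable M. integrable M R \<and> expectation R \<le> e \<and>
    (\<forall>f\<in>var_class q B. \<forall>\<omega>. \<bar>(\<Sum>i<n. \<eta> (int (Suc i) - a) \<omega> * (f (real (Suc i) / real n) - f (cell_point n k (Suc i))))\<bar>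
        \<le> sqrt (real n) * R \<omega>)"
proof -
  note D = iid_innovationsD[OF iid]
  note [measurable] = D(2)
  \<comment> \<open>Values beyond \<open>m\<close> are replaced by 0 and not clipped, so
    \<open>y - T m y\<close> is 0 or \<open>y\<close> and its square is dominated by that of
    \<open>y\<close>.\<close>
  define T :: "nat \<Rightarrow> real \<Rightarrow> real" where "T m y = (if \<bar>y\<bar> \<le> real m then y else 0)" for m y
  have Tm[measurable]: "T m \<in> borel_measurable borel" for m unfolding T_def by measurable
  have "(\<lambda>m. expectation (\<lambda>\<omega>. (\<eta> 1 \<omega> - T m (\<eta> 1 \<omega>))\<^sup>2)) \<longlonglongrightarrow> expectation (\<lambda>\<omega>. 0)"
  proof (rule integral_dominated_convergence[where w="\<lambda>\<omega>. (\<eta> 1 \<omega>)\<^sup>2"])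
    show "AE \<omega> in M. (\<lambda>m. (\<eta> 1 \<omega> - T m (\<eta> 1 \<omega>))\<^sup>2) \<longlonglongrightarrow> 0"
    proof (rule AE_I2)
      fix \<omega>
      obtain m0 where "\<bar>\<eta> 1 \<omega>\<bar> \<le> real m0" using real_arch_simple by blast
      then have "eventually (\<lambda>m. (\<eta> 1 \<omega> - T m (\<eta> 1 \<omega>))\<^sup>2 = 0) sequentially"
        by (intro eventually_sequentiallyI[of m0]) (auto simp: T_def)
      then show "(\<lambda>m. (\<eta> 1 \<omega> - T m (\<eta> 1 \<omega>))\<^sup>2) \<longlonglongrightarrow> 0" by (rule tendsto_eventually)
    qed
    show "AE \<omega> in M. norm ((\<eta> 1 \<omega> - T m (\<eta> 1 \<omega>))\<^sup>2) \<le> (\<eta> 1 \<omega>)\<^sup>2" for m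
      by (rule AE_I2) (auto simp: T_def)
  qed (use D in auto)
  then have lim: "(\<lambda>m. expectation (\<lambda>\<omega>. (\<eta> 1 \<omega> - T m (\<eta> 1 \<omega>))\<^sup>2)) \<longlonglongrightarrow> 0" by simp
  define Kg where "Kg = greedy_const q B"
  have Kg: "0 < Kg" unfolding Kg_def by (rule greedy_const_pos[OF q B])
  \<comment> \<open>The unbounded part is evaluated at two samplings, each at cost
    \<open>Kg * v\<close>; together they make \<open>e / 2\<close>.\<close>
  define v where "v = e / (4 * Kg)"
  have v: "0 < v" unfolding v_def using e Kg by simp
  have "0 < v\<^sup>2" using v by simp
  then obtain m where m: "expectation (\<lambda>\<omega>. (\<eta> 1 \<omega> - T m (\<eta> 1 \<omega>))\<^sup>2) \<le> v\<^sup>2"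
  proof -
    have "eventually (\<lambda>m. expectation (\<lambda>\<omega>. (\<eta> 1 \<omega> - T m (\<eta> 1 \<omega>))\<^sup>2) < v\<^sup>2) sequentially"
      by (rule order_tendstoD(2)[OF lim \<open>0 < v\<^sup>2\<close>])
    then show ?thesis using that by (meson eventually_happens less_imp_le sequentially_bot)
  qed
  define mu where "mu = expectation (\<lambda>\<omega>. T m (\<eta> 1 \<omega>))"
  \<comment> \<open>Recentring by \<open>mu\<close> gives both parts mean zero and keeps their sum
    equal to the identity.\<close>
  define g where "g y = y - T m y + mu" for y
  define h where "h y = T m y - mu" for y
  have [measurable]: "g \<in> borel_measurable borel" "h \<in> borel_measurable borel" unfolding g_def h_def by auto
  have tr: "integrable M (\<lambda>\<omega>. u (\<eta> j \<omega>)) = integrable M (\<lambda>\<omega>. u (\<eta> 1 \<omega>))"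
    "expectation (\<lambda>\<omega>. u (\<eta> j \<omega>)) = expectation (\<lambda>\<omega>. u (\<eta> 1 \<omega>))"
    if [measurable]: "u \<in> borel_measurable borel" for j and u :: "real \<Rightarrow> real"
    using distr_eq_transfer[OF D(3)[of j] D(2) D(2) that] by auto
  have Tb: "\<bar>T m y\<bar> \<le> real m" for y unfolding T_def by auto
  have Ti: "integrable M (\<lambda>\<omega>. T m (\<eta> j \<omega>))" for j
    by (rule integrable_bounded[where C="real m"]) (use Tb in auto)
  have "\<bar>mu\<bar> \<le> real m"
  proof -
    have "\<bar>mu\<bar> \<le> expectation (\<lambda>\<omega>. \<bar>T m (\<eta> 1 \<omega>)\<bar>)" unfolding mu_def by (rule integral_abs_bound)
    also have "\<dots> \<le> expectation (\<lambda>\<omega>. real m)" using Ti Tb by (intro integral_mono) auto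
    finally show ?thesis by (simp add: prob_space)
  qed
  then have hb: "\<bar>h y\<bar> \<le> 2 * real m" for y unfolding h_def using Tb[of y] by linarith
  have hmean: "expectation (\<lambda>\<omega>. h (\<eta> j \<omega>)) = 0" for j
    using tr(2)[of h j] Ti[of 1] unfolding h_def mu_def by (simp add: prob_space)
  have gmean: "expectation (\<lambda>\<omega>. g (\<eta> j \<omega>)) = 0" for j
    using tr(2)[of g j] Ti[of 1] D(5)[of 1] D(6)[of 1] unfolding g_def mu_def by (simp add: prob_space)
  have di: "integrable M (\<lambda>\<omega>. (\<eta> 1 \<omega> - T m (\<eta> 1 \<omega>))\<^sup>2)"
    by (rule Bochner_Integration.integrable_bound[OF D(4)[of 1]]) (auto simp: T_def)
  have g2: "(\<lambda>\<omega>. (g (\<eta> 1 \<omega>))\<^sup>2) = (\<lambda>\<omega>. (\<eta> 1 \<omega> - T m (\<eta> 1 \<omega>))\<^sup>2 + 2 * mu * (\<eta> 1 \<omega> - T m (\<eta> 1 \<omega>)) + mu\<^sup>2)"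
    unfolding g_def by (rule ext) (simp add: power2_eq_square algebra_simps)
  have gsq: "integrable M (\<lambda>\<omega>. (g (\<eta> j \<omega>))\<^sup>2)" for j
    unfolding tr(1)[of "\<lambda>y. (g y)\<^sup>2" j, simplified] g2 using di Ti[of 1] D(5)[of 1] by simp
  \<comment> \<open>The mean of \<open>\<eta> 1 - T m (\<eta> 1)\<close> is \<open>- mu\<close>, so
    recentring lowers the second moment by \<open>mu\<^sup>2\<close>.\<close>
  have "expectation (\<lambda>\<omega>. (g (\<eta> 1 \<omega>))\<^sup>2) = expectation (\<lambda>\<omega>. (\<eta> 1 \<omega> - T m (\<eta> 1 \<omega>))\<^sup>2) + 2 * mu * (0 - mu) + mu\<^sup>2"
    unfolding g2 using di Ti[of 1] D(5)[of 1] D(6)[of 1] by (simp add: prob_space flip: mu_def)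
  also have "2 * mu * (0 - mu) = - 2 * mu\<^sup>2" by (simp add: power2_eq_square)
  also have "expectation (\<lambda>\<omega>. (\<eta> 1 \<omega> - T m (\<eta> 1 \<omega>))\<^sup>2) + - 2 * mu\<^sup>2 + mu\<^sup>2 \<le> v\<^sup>2"
    using m zero_le_power2[of mu] by linarith
  finally have gv: "expectation (\<lambda>\<omega>. (g (\<eta> j \<omega>))\<^sup>2) \<le> v\<^sup>2" for j
    using tr(2)[of "\<lambda>y. (g y)\<^sup>2" j] by simp
  \<comment> \<open>The constant of \<open>bounded_weighted_sums\<close> for variables bounded by
    \<open>2 * m\<close>. It depends on neither \<open>n\<close> nor the shift \<open>a\<close>, so
    \<open>k0\<close> is uniform in both.\<close>
  define H where "H = B + 2 * B\<^sup>2 + (2 * real m)\<^sup>2 + 2 * B * (6 * (2 * real m)^4)"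
  have "(\<lambda>k. H * level_rate q ^ k / (1 - level_rate q)) \<longlonglongrightarrow> H * 0 / (1 - level_rate q)"
    using level_rate[OF q(2)] by (intro tendsto_intros LIMSEQ_realpow_zero) auto
  then have "eventually (\<lambda>k. H * level_rate q ^ k / (1 - level_rate q) < e / 2) sequentially"
    using e by (intro order_tendstoD(2)) auto
  then obtain k0 where k0: "\<And>k. k \<ge> k0 \<Longrightarrow> H * level_rate q ^ k / (1 - level_rate q) < e / 2"
    by (auto simp: eventually_sequentially)
  show ?thesis
  proof (intro exI[of _ k0] allI impI)
    fix k n :: nat and a :: int assume k: "k0 \<le> k" and n: "2^k \<le> n"
    have npos: "0 < n" using n by (metis gr0I not_one_le_zero one_le_numeral one_le_power order_trans)
    have inj: "inj (\<lambda>i. int (Suc i) - a)" by (auto simp: inj_def)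
    have ind: "indep_vars (\<lambda>_. borel) (\<lambda>i \<omega>. u (\<eta> (int (Suc i) - a) \<omega>)) UNIV"
      if [measurable]: "u \<in> borel_measurable borel" for u :: "real \<Rightarrow> real"
      by (rule indep_vars_compose2[OF indep_vars_inj[OF D(1) inj]]) auto
    obtain R1 where R1: "R1 \<in> borel_measurable M" "integrable M R1"
      "expectation R1 \<le> H * level_rate q ^ k / (1 - level_rate q)"
      "\<And>f \<omega>. f \<in> var_class q B \<Longrightarrow> \<bar>(\<Sum>i<n. h (\<eta> (int (Suc i) - a) \<omega>) * (f (real (Suc i) / real n) - f (cell_point n k (Suc i))))\<bar>
        \<le> sqrt (real n) * R1 \<omega>"
      using bounded_weighted_sums[OF q B ind[of h] hb hmean n] unfolding H_def by auto
    have indg: "indep_vars (\<lambda>_. borel) (\<lambda>i \<omega>. g (\<eta> (int (Suc i) - a) \<omega>) / sqrt (real n)) UNIV"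
      using ind[of "\<lambda>y. g y / sqrt (real n)"] by simp
    have sqg: "(\<lambda>\<omega>. (g (\<eta> j \<omega>) / sqrt (real n))\<^sup>2) = (\<lambda>\<omega>. (g (\<eta> j \<omega>))\<^sup>2 / real n)" for j
      using npos by (auto simp: power_divide)
    have var: "(\<Sum>i<n. expectation (\<lambda>\<omega>. (g (\<eta> (int (Suc i) - a) \<omega>) / sqrt (real n))\<^sup>2)) \<le> v\<^sup>2"
    proof -
      have "(\<Sum>i<n. expectation (\<lambda>\<omega>. (g (\<eta> (int (Suc i) - a) \<omega>) / sqrt (real n))\<^sup>2)) \<le> (\<Sum>i<n. v\<^sup>2 / real n)"
        unfolding sqg using gv npos by (intro sum_mono) (auto intro: divide_right_mono)
      then show ?thesis using npos by simp
    qed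
    have "integrable M (\<lambda>\<omega>. (g (\<eta> (int (Suc i) - a) \<omega>) / sqrt (real n))\<^sup>2)"
      "expectation (\<lambda>\<omega>. g (\<eta> (int (Suc i) - a) \<omega>) / sqrt (real n)) = 0" for i
      unfolding sqg using gsq gmean by auto
    from weighted_sums_bound[OF q B indg this var v]
    obtain R2 where R2: "R2 \<in> borel_measurable M" "integrable M R2" "expectation R2 \<le> Kg * v"
      "\<And>f p \<omega>. f \<in> var_class q B \<Longrightarrow> monotone_sample n p \<Longrightarrow>
         \<bar>\<Sum>i<n. g (\<eta> (int (Suc i) - a) \<omega>) / sqrt (real n) * f (p (Suc i))\<bar> \<le> R2 \<omega>"
      unfolding Kg_def by auto
    have ms: "monotone_sample n (\<lambda>i. real i / real n)" "monotone_sample n (cell_point n k)"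
      unfolding monotone_sample_def using cell_point_bounds(1,3)[OF npos] cell_point_bounds(2)[OF npos, of k n] npos
      by (auto intro: divide_right_mono)
    show "\<exists>R\<in>borel_measurable M. integrable M R \<and> expectation R \<le> e \<and>
    (\<forall>f\<in>var_class q B. \<forall>\<omega>. \<bar>(\<Sum>i<n. \<eta> (int (Suc i) - a) \<omega> * (f (real (Suc i) / real n) - f (cell_point n k (Suc i))))\<bar>
        \<le> sqrt (real n) * R \<omega>)"
    proof (intro bexI[of _ "\<lambda>\<omega>. R1 \<omega> + 2 * R2 \<omega>"] conjI ballI allI)
      show "integrable M (\<lambda>\<omega>. R1 \<omega> + 2 * R2 \<omega>)" using R1 R2 by auto
      have "expectation (\<lambda>\<omega>. R1 \<omega> + 2 * R2 \<omega>) = expectation R1 + 2 * expectation R2" using R1 R2 by simp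
      also have "\<dots> \<le> e / 2 + 2 * (Kg * v)" using R1(3) R2(3) k0[OF k] by linarith
      also have "\<dots> = e" unfolding v_def using Kg by simp
      finally show "expectation (\<lambda>\<omega>. R1 \<omega> + 2 * R2 \<omega>) \<le> e" .
      show "(\<lambda>\<omega>. R1 \<omega> + 2 * R2 \<omega>) \<in> borel_measurable M" using R1 R2 by simp
      fix f \<omega> assume f: "f \<in> var_class q B"
      let ?t = "\<lambda>i. real (Suc i) / real n" and ?c = "\<lambda>i. cell_point n k (Suc i)" and ?x = "\<lambda>i. \<eta> (int (Suc i) - a) \<omega>"
      have eq: "?x i = h (?x i) + g (?x i)" for i unfolding g_def h_def by simp
      have "(\<Sum>i<n. ?x i * (f (?t i) - f (?c i))) = (\<Sum>i<n. h (?x i) * (f (?t i) - f (?c i)))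
         + ((\<Sum>i<n. g (?x i) * f (?t i)) - (\<Sum>i<n. g (?x i) * f (?c i)))"
        by (subst (1) eq) (simp add: algebra_simps sum.distrib sum_subtractf)
      moreover have "\<bar>\<Sum>i<n. g (?x i) * f (p (Suc i))\<bar> \<le> sqrt (real n) * R2 \<omega>" if "monotone_sample n p" for p
      proof -
        have "(\<Sum>i<n. g (?x i) * f (p (Suc i))) = sqrt (real n) * (\<Sum>i<n. g (?x i) / sqrt (real n) * f (p (Suc i)))"
          unfolding sum_distrib_left using npos by (intro sum.cong) auto
        then show ?thesis using R2(4)[OF f that, of \<omega>] by (simp add: abs_mult mult_left_mono)
      qed
      note this[OF ms(1)] this[OF ms(2)]
      ultimately show "\<bar>\<Sum>i<n. ?x i * (f (?t i) - f (?c i))\<bar> \<le> sqrt (real n) * (R1 \<omega> + 2 * R2 \<omega>)"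
        using R1(4)[OF f, of \<omega>] by (simp add: algebra_simps)
    qed
  qed
qed

section \<open>From innovations to the linear process\<close>

lemma ennreal_abs_sums_le:
  fixes a :: "nat \<Rightarrow> real"
  assumes "a sums s" "\<And>j. ennreal \<bar>a j\<bar> \<le> b j"
  shows "ennreal \<bar>s\<bar> \<le> (\<Sum>j. b j)"
proof (rule LIMSEQ_le_const2)
  show "(\<lambda>n. ennreal \<bar>\<Sum>j<n. a j\<bar>) \<longlonglongrightarrow> ennreal \<bar>s\<bar>"
    using assms(1) unfolding sums_def by (intro tendsto_ennrealI tendsto_rabs)
  have "ennreal \<bar>\<Sum>j<n. a j\<bar> \<le> (\<Sum>j. b j)" for n
  proof -
    have "ennreal \<bar>\<Sum>j<n. a j\<bar> \<le> ennreal (\<Sum>j<n. \<bar>a j\<bar>)" by (intro ennreal_leI sum_abs)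
    also have "\<dots> = (\<Sum>j<n. ennreal \<bar>a j\<bar>)" by (subst sum_ennreal) auto
    also have "\<dots> \<le> (\<Sum>j<n. b j)" by (intro sum_mono assms(2))
    also have "\<dots> \<le> (\<Sum>j. b j)" by (intro sum_le_suminf) auto
    finally show ?thesis .
  qed
  then show "\<exists>N. \<forall>n\<ge>N. ennreal \<bar>\<Sum>j<n. a j\<bar> \<le> (\<Sum>j. b j)" by blast
qed

lemma zero_in_var_class: "0 \<le> B \<Longrightarrow> (\<lambda>_. 0) \<in> var_class q B"
  unfolding var_class_def var_control_def by (auto intro!: exI[of _ "\<lambda>_. 0"])

lemma (in prob_space) AE_process_sums:
  assumes "short_memory_linear_process M \<eta> \<psi> X"
  shows "AE \<omega> in M. \<forall>i. (\<lambda>j. \<psi> j * \<eta> (i - int j) \<omega>) sums X i \<omega>"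
  using assms unfolding short_memory_linear_process_def AE_all_countable by auto

text \<open>A weighted sum of the process is the series over \<open>j\<close> of
  \<open>\<psi> j\<close> times the weighted sum of the innovations shifted by \<open>j\<close>. All
  shifts have majorants with the same bound for the mean, so absolute summability of
  \<open>\<psi>\<close> suffices. The series of majorants is formed in the extended nonnegative
  numbers, where it always exists.\<close>

lemma (in prob_space) process_sums_approx:
  assumes X: "short_memory_linear_process M \<eta> \<psi> X"
    and q: "1 \<le> q" "q < 2" and B: "0 \<le> B" and e: "0 < e"
  shows "\<exists>k0. \<forall>k\<ge>k0. \<forall>n\<ge>2^k. \<exists>R\<in>borel_measurable M. (\<integral>\<^sup>+\<omega>. R \<omega> \<partial>M) \<le> ennreal e \<and>
    (AE \<omega> in M. \<forall>f\<in>var_class q B.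
       ennreal \<bar>\<Sum>i<n. X (int (Suc i)) \<omega> * (f (real (Suc i) / real n) - f (cell_point n k (Suc i)))\<bar>
         \<le> ennreal (sqrt (real n)) * R \<omega>)"
proof -
  have iid: "iid_innovations M \<eta>" and sm: "summable (\<lambda>j. \<bar>\<psi> j\<bar>)"
    using X unfolding short_memory_linear_process_def by auto
  define S where "S = (\<Sum>j. \<bar>\<psi> j\<bar>)"
  have S: "0 \<le> S" unfolding S_def by (intro suminf_nonneg sm) auto
  have "0 < e / (S + 1)" using e S by simp
  from innovation_sums_approx[OF iid q B this] obtain k0 where k0:
    "\<And>k n a. k \<ge> k0 \<Longrightarrow> n \<ge> 2^k \<Longrightarrow> \<exists>R\<in>borel_measurable M. integrable M R \<and> expectation R \<le> e / (S + 1) \<and>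
    (\<forall>f\<in>var_class q B. \<forall>\<omega>. \<bar>(\<Sum>i<n. \<eta> (int (Suc i) - a) \<omega> * (f (real (Suc i) / real n) - f (cell_point n k (Suc i))))\<bar>
        \<le> sqrt (real n) * R \<omega>)" by meson
  show ?thesis
  proof (intro exI[of _ k0] allI impI)
    fix k n :: nat assume k: "k0 \<le> k" and n: "2^k \<le> n"
    have npos: "0 < n" using n by (metis gr0I not_one_le_zero one_le_numeral one_le_power order_trans)
    have "\<exists>R. \<forall>j. R j \<in> borel_measurable M \<and> integrable M (R j) \<and> expectation (R j) \<le> e / (S + 1) \<and>
      (\<forall>f\<in>var_class q B. \<forall>\<omega>. \<bar>(\<Sum>i<n. \<eta> (int (Suc i) - int j) \<omega> * (f (real (Suc i) / real n) - f (cell_point n k (Suc i))))\<bar>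
        \<le> sqrt (real n) * R j \<omega>)"
      using k0[OF k n, of "int j" for j] by (intro choice allI) blast
    then obtain R where Rm[measurable]: "\<And>j. R j \<in> borel_measurable M" and Ri: "\<And>j. integrable M (R j)"
      and RE: "\<And>j. expectation (R j) \<le> e / (S + 1)"
      and Rb: "\<And>j f \<omega>. f \<in> var_class q B \<Longrightarrow> \<bar>(\<Sum>i<n. \<eta> (int (Suc i) - int j) \<omega> * (f (real (Suc i) / real n) - f (cell_point n k (Suc i))))\<bar>
        \<le> sqrt (real n) * R j \<omega>" by blast
    \<comment> \<open>The zero function belongs to the class, so the pathwise bound forces
      nonnegativity.\<close>
    have R0: "0 \<le> R j \<omega>" for j \<omega>
    proof -
      have "0 \<le> sqrt (real n) * R j \<omega>" using Rb[OF zero_in_var_class[OF B], of j \<omega>] by simp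
      then show ?thesis using npos by (simp add: zero_le_mult_iff)
    qed
    define Q where "Q \<omega> = (\<Sum>j. ennreal (\<bar>\<psi> j\<bar> * R j \<omega>))" for \<omega>
    have [measurable]: "Q \<in> borel_measurable M" unfolding Q_def by measurable
    have "(\<integral>\<^sup>+\<omega>. Q \<omega> \<partial>M) = (\<Sum>j. \<integral>\<^sup>+\<omega>. ennreal (\<bar>\<psi> j\<bar> * R j \<omega>) \<partial>M)"
      unfolding Q_def by (rule nn_integral_suminf) measurable
    also have "\<dots> \<le> (\<Sum>j. ennreal (\<bar>\<psi> j\<bar> * (e / (S + 1))))"
    proof (intro suminf_le)
      fix j
      have "(\<integral>\<^sup>+\<omega>. ennreal (\<bar>\<psi> j\<bar> * R j \<omega>) \<partial>M) = ennreal (expectation (\<lambda>\<omega>. \<bar>\<psi> j\<bar> * R j \<omega>))"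
        using Ri R0 by (intro nn_integral_eq_integral) auto
      also have "\<dots> \<le> ennreal (\<bar>\<psi> j\<bar> * (e / (S + 1)))" using mult_left_mono[OF RE[of j] abs_ge_zero[of "\<psi> j"]] by (intro ennreal_leI) simp
      finally show "(\<integral>\<^sup>+\<omega>. ennreal (\<bar>\<psi> j\<bar> * R j \<omega>) \<partial>M) \<le> ennreal (\<bar>\<psi> j\<bar> * (e / (S + 1)))" .
    qed auto
    also have "\<dots> = ennreal (S * (e / (S + 1)))"
    proof -
      have "(\<lambda>j. \<bar>\<psi> j\<bar> * (e / (S + 1))) sums (S * (e / (S + 1)))"
        unfolding S_def by (intro sums_mult2 summable_sums sm)
      moreover have "0 \<le> \<bar>\<psi> j\<bar> * (e / (S + 1))" for j using e S by simp
      ultimately show ?thesis by (simp add: suminf_ennreal2 sums_iff)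
    qed
    also have "\<dots> \<le> ennreal e" using e S by (intro ennreal_leI) (simp add: field_simps)
    finally have "(\<integral>\<^sup>+\<omega>. Q \<omega> \<partial>M) \<le> ennreal e" .
    moreover have "AE \<omega> in M. \<forall>f\<in>var_class q B.
       ennreal \<bar>\<Sum>i<n. X (int (Suc i)) \<omega> * (f (real (Suc i) / real n) - f (cell_point n k (Suc i)))\<bar>
         \<le> ennreal (sqrt (real n)) * Q \<omega>"
      using AE_process_sums[OF X]
    proof eventually_elim
      case (elim \<omega>)
      show ?case
      proof
        fix f assume f: "f \<in> var_class q B"
        let ?g = "\<lambda>i. f (real (Suc i) / real n) - f (cell_point n k (Suc i))"
        have "(\<lambda>j. \<Sum>i<n. \<psi> j * \<eta> (int (Suc i) - int j) \<omega> * ?g i) sums (\<Sum>i<n. X (int (Suc i)) \<omega> * ?g i)"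
          using elim by (intro sums_sum sums_mult2) blast
        then have "ennreal \<bar>\<Sum>i<n. X (int (Suc i)) \<omega> * ?g i\<bar> \<le> (\<Sum>j. ennreal (sqrt (real n)) * ennreal (\<bar>\<psi> j\<bar> * R j \<omega>))"
        proof (rule ennreal_abs_sums_le)
          fix j
          have "(\<Sum>i<n. \<psi> j * \<eta> (int (Suc i) - int j) \<omega> * ?g i) = \<psi> j * (\<Sum>i<n. \<eta> (int (Suc i) - int j) \<omega> * ?g i)"
            by (simp add: sum_distrib_left mult.assoc)
          then have "\<bar>\<Sum>i<n. \<psi> j * \<eta> (int (Suc i) - int j) \<omega> * ?g i\<bar> \<le> \<bar>\<psi> j\<bar> * (sqrt (real n) * R j \<omega>)"
            using Rb[OF f, of j \<omega>] by (simp only: abs_mult mult_left_mono abs_ge_zero)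
          then show "ennreal \<bar>\<Sum>i<n. \<psi> j * \<eta> (int (Suc i) - int j) \<omega> * ?g i\<bar> \<le> ennreal (sqrt (real n)) * ennreal (\<bar>\<psi> j\<bar> * R j \<omega>)"
            using R0 by (simp add: ennreal_mult[symmetric] mult_ac ennreal_leI)
        qed
        also have "\<dots> = ennreal (sqrt (real n)) * Q \<omega>" unfolding Q_def by (rule ennreal_suminf_cmult)
        finally show "ennreal \<bar>\<Sum>i<n. X (int (Suc i)) \<omega> * ?g i\<bar> \<le> ennreal (sqrt (real n)) * Q \<omega>" .
      qed
    qed
    ultimately show "\<exists>R\<in>borel_measurable M. (\<integral>\<^sup>+\<omega>. R \<omega> \<partial>M) \<le> ennreal e \<and>
      (AE \<omega> in M. \<forall>f\<in>var_class q B.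
       ennreal \<bar>\<Sum>i<n. X (int (Suc i)) \<omega> * (f (real (Suc i) / real n) - f (cell_point n k (Suc i)))\<bar>
         \<le> ennreal (sqrt (real n)) * R \<omega>)" by (intro bexI[of _ Q]) auto
  qed
qed

text \<open>The variance of a block of at most \<open>n\<close> innovations is at most
  \<open>n * s\<^sup>2\<close>; the first moment follows from
  \<open>2 * \<bar>g\<bar> * t \<le> t\<^sup>2 + g\<^sup>2\<close>, where \<open>t\<close> bounds
  the standard deviation.\<close>

lemma (in prob_space) innovation_sum_L1:
  fixes a b :: nat and c :: int
  assumes iid: "iid_innovations M \<eta>" and ab: "a \<le> b" "b \<le> n"
  defines "s \<equiv> sqrt (expectation (\<lambda>\<omega>. (\<eta> 1 \<omega>)\<^sup>2))"
  shows "expectation (\<lambda>\<omega>. \<bar>\<Sum>i=a..<b. \<eta> (int i + c) \<omega>\<bar>) \<le> s * sqrt (real n)"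
    and "expectation (\<lambda>\<omega>. \<bar>\<eta> c \<omega>\<bar>) \<le> s"
proof -
  note D = iid_innovationsD[OF iid]
  note [measurable] = D(2)
  have s: "0 < s" "s\<^sup>2 = expectation (\<lambda>\<omega>. (\<eta> 1 \<omega>)\<^sup>2)" unfolding s_def using D(8) by auto
  have sec: "integrable M (\<lambda>\<omega>. (\<Sum>i=a..<a+m. \<eta> (int i + c) \<omega>)\<^sup>2) \<and> expectation (\<lambda>\<omega>. (\<Sum>i=a..<a+m. \<eta> (int i + c) \<omega>)\<^sup>2) = real m * s\<^sup>2" for a m :: nat
  proof (induction m)
    case (Suc m)
    let ?S = "\<lambda>\<omega>. \<Sum>i=a..<a+m. \<eta> (int i + c) \<omega>" and ?x = "\<eta> (int (a + m) + c)"
    have "inj (\<lambda>i. int i + c)" by (auto simp: inj_def)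
    from indep_vars_inj[OF D(1) this]
    have "indep_var borel ?x borel ?S"
      by (intro indep_vars_sum[where X="\<lambda>i. \<eta> (int i + c)"]) (auto intro: indep_vars_subset)
    moreover have Si: "integrable M ?S" using D(5) by auto
    ultimately have p: "integrable M (\<lambda>\<omega>. ?x \<omega> * ?S \<omega>)" "expectation (\<lambda>\<omega>. ?x \<omega> * ?S \<omega>) = 0"
      using indep_var_integrable[of ?x ?S] indep_var_lebesgue_integral[of ?x ?S] D(5,6) by auto
    have eq: "(\<lambda>\<omega>. (\<Sum>i=a..<a+Suc m. \<eta> (int i + c) \<omega>)\<^sup>2) = (\<lambda>\<omega>. (?S \<omega>)\<^sup>2 + 2 * (?x \<omega> * ?S \<omega>) + (?x \<omega>)\<^sup>2)"
      by (rule ext) (simp add: power2_eq_square algebra_simps)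
    show ?case unfolding eq using Suc p D(4)[of "int (a + m) + c"] D(7)[of "int (a + m) + c"] s(2)
      by (simp add: algebra_simps)
  qed simp
  have L1: "expectation (\<lambda>\<omega>. \<bar>g \<omega>\<bar>) \<le> t" if [measurable]: "g \<in> borel_measurable M"
      and "integrable M (\<lambda>\<omega>. (g \<omega>)\<^sup>2)" "expectation (\<lambda>\<omega>. (g \<omega>)\<^sup>2) \<le> t\<^sup>2" "0 < t" for g :: "'a \<Rightarrow> real" and t
  proof -
    have "\<bar>g \<omega>\<bar> \<le> (t + (g \<omega>)\<^sup>2 / t) / 2" for \<omega>
    proof -
      have "0 \<le> (\<bar>g \<omega>\<bar> - t)\<^sup>2" by simp
      then have "2 * \<bar>g \<omega>\<bar> * t \<le> t * t + (g \<omega>)\<^sup>2" by (simp add: power2_diff power2_eq_square algebra_simps)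
      then have "2 * \<bar>g \<omega>\<bar> \<le> (t * t + (g \<omega>)\<^sup>2) / t" using that(4) by (simp add: pos_le_divide_eq)
      then show ?thesis using that(4) by (simp add: add_divide_distrib)
    qed
    moreover have gi: "integrable M g" by (rule square_integrable_imp_integrable[OF that(1,2)])
    ultimately have "expectation (\<lambda>\<omega>. \<bar>g \<omega>\<bar>) \<le> expectation (\<lambda>\<omega>. (t + (g \<omega>)\<^sup>2 / t) / 2)"
      using that by (intro integral_mono) auto
    also have "\<dots> = (t + expectation (\<lambda>\<omega>. (g \<omega>)\<^sup>2) / t) / 2" using that(2) by (simp add: prob_space)
    also have "\<dots> \<le> (t + t\<^sup>2 / t) / 2" using that(3,4) by (intro divide_right_mono add_left_mono) auto
    finally show ?thesis using that(4) by (simp add: power2_eq_square)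
  qed
  show "expectation (\<lambda>\<omega>. \<bar>\<eta> c \<omega>\<bar>) \<le> s"
    using L1[of "\<eta> c" s] D(4)[of c] D(7)[of c] s by simp
  show "expectation (\<lambda>\<omega>. \<bar>\<Sum>i=a..<b. \<eta> (int i + c) \<omega>\<bar>) \<le> s * sqrt (real n)"
  proof (cases "n = 0")
    case False
    have "expectation (\<lambda>\<omega>. (\<Sum>i=a..<b. \<eta> (int i + c) \<omega>)\<^sup>2) \<le> (s * sqrt (real n))\<^sup>2"
      using sec[of a "b - a"] ab by (simp add: power_mult_distrib mult.commute mult_right_mono)
    then show ?thesis using sec[of a "b - a"] ab s(1) False
      by (intro L1) auto
  qed (use ab in simp)
qed

text \<open>Shifting the window by one more step exchanges only one term at each end, whatever its
  length.\<close>

lemma (in prob_space) shifted_innovation_sum: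
  fixes a b :: nat
  assumes iid: "iid_innovations M \<eta>" and ab: "a \<le> b"
  defines "s \<equiv> sqrt (expectation (\<lambda>\<omega>. (\<eta> 1 \<omega>)\<^sup>2))"
  shows "expectation (\<lambda>\<omega>. \<bar>(\<Sum>i=a..<b. \<eta> (int (Suc i) - int j) \<omega>) - (\<Sum>i=a..<b. \<eta> (int (Suc i)) \<omega>)\<bar>) \<le> 2 * real j * s"
proof (induction j)
  case (Suc j)
  note D = iid_innovationsD[OF iid]
  let ?T = "\<lambda>j \<omega>. \<Sum>i=a..<b. \<eta> (int (Suc i) - int j) \<omega>"
  have Ti: "integrable M (?T j)" for j using D(5) by auto
  have tele: "?T (Suc j) \<omega> - ?T j \<omega> = \<eta> (int a - int j) \<omega> - \<eta> (int b - int j) \<omega>" for \<omega>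
    using ab
  proof (induction b rule: dec_induct)
    case (step b) then show ?case by simp
  qed simp
  have "expectation (\<lambda>\<omega>. \<bar>?T (Suc j) \<omega> - (\<Sum>i=a..<b. \<eta> (int (Suc i)) \<omega>)\<bar>)
    \<le> expectation (\<lambda>\<omega>. \<bar>?T j \<omega> - (\<Sum>i=a..<b. \<eta> (int (Suc i)) \<omega>)\<bar> + (\<bar>\<eta> (int a - int j) \<omega>\<bar> + \<bar>\<eta> (int b - int j) \<omega>\<bar>))"
  proof (rule integral_mono)
    fix \<omega>
    show "\<bar>?T (Suc j) \<omega> - (\<Sum>i=a..<b. \<eta> (int (Suc i)) \<omega>)\<bar> \<le> \<bar>?T j \<omega> - (\<Sum>i=a..<b. \<eta> (int (Suc i)) \<omega>)\<bar> + (\<bar>\<eta> (int a - int j) \<omega>\<bar> + \<bar>\<eta> (int b - int j) \<omega>\<bar>)"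
      using tele[of \<omega>] by linarith
  qed (use D(5) in \<open>auto intro!: Bochner_Integration.integrable_add integrable_abs Bochner_Integration.integrable_diff\<close>)
  also have "\<dots> = expectation (\<lambda>\<omega>. \<bar>?T j \<omega> - (\<Sum>i=a..<b. \<eta> (int (Suc i)) \<omega>)\<bar>) + (expectation (\<lambda>\<omega>. \<bar>\<eta> (int a - int j) \<omega>\<bar>) + expectation (\<lambda>\<omega>. \<bar>\<eta> (int b - int j) \<omega>\<bar>))"
    using D(5) Ti[of j] by simp
  also have "\<dots> \<le> 2 * real j * s + (s + s)"
    using Suc.IH innovation_sum_L1(2)[OF iid order.refl order.refl] unfolding s_def by (intro add_mono) auto
  finally show ?case by (simp add: algebra_simps)
qed simp

text \<open>The difference is the series over \<open>j\<close> of \<open>\<psi> j\<close> times a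
  shifted block minus the unshifted one. A fixed number \<open>J\<close> of shifts costs a bounded
  amount, negligible against \<open>sqrt n\<close>; the later ones cost order \<open>sqrt n\<close>
  but carry small total weight.\<close>

lemma (in prob_space) process_block_approx:
  assumes X: "short_memory_linear_process M \<eta> \<psi> X" and e: "0 < e"
  shows "\<exists>N. \<forall>n\<ge>N. \<forall>a b. a \<le> b \<longrightarrow> b \<le> n \<longrightarrow>
    (\<integral>\<^sup>+\<omega>. ennreal \<bar>\<Sum>i=a..<b. X (int (Suc i)) \<omega> - (\<Sum>j. \<psi> j) * \<eta> (int (Suc i)) \<omega>\<bar> \<partial>M) \<le> ennreal (e * sqrt (real n))"
proof -
  have iid: "iid_innovations M \<eta>" and sm: "summable (\<lambda>j. \<bar>\<psi> j\<bar>)"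
    using X unfolding short_memory_linear_process_def by auto
  note D = iid_innovationsD[OF iid]
  note [measurable] = D(2)
  define s where "s = sqrt (expectation (\<lambda>\<omega>. (\<eta> 1 \<omega>)\<^sup>2))"
  have s: "0 < s" unfolding s_def using D(8) by auto
  define S where "S = (\<Sum>j. \<bar>\<psi> j\<bar>)"
  have S: "0 \<le> S" unfolding S_def by (intro suminf_nonneg sm) auto
  have "(\<lambda>J. \<Sum>j<J. \<bar>\<psi> j\<bar>) \<longlonglongrightarrow> S" unfolding S_def using sm by (rule summable_LIMSEQ)
  moreover have "S - e / (4 * s) < S" using e s by simp
  ultimately have "eventually (\<lambda>J. S - e / (4 * s) < (\<Sum>j<J. \<bar>\<psi> j\<bar>)) sequentially"
    by (rule order_tendstoD(1))
  then obtain J where "S - e / (4 * s) < (\<Sum>j<J. \<bar>\<psi> j\<bar>)" by (auto simp: eventually_sequentially)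
  \<comment> \<open>A later shift costs \<open>2 * s * sqrt n\<close>, so this tail contributes at
    most half of \<open>e * sqrt n\<close>; the \<open>N\<close> obtained below makes room for the
    term with \<open>J\<close> in the other half.\<close>
  then have J: "S - (\<Sum>j<J. \<bar>\<psi> j\<bar>) \<le> e / (4 * s)" by linarith
  define t where "t = S - (\<Sum>j<J. \<bar>\<psi> j\<bar>)"
  have tail: "(\<lambda>j. if j < J then 0 else \<bar>\<psi> j\<bar>) sums t"
  proof -
    have "(\<lambda>j. \<bar>\<psi> j\<bar> - (if j \<in> {..<J} then \<bar>\<psi> j\<bar> else 0)) sums t"
      unfolding t_def S_def by (intro sums_diff summable_sums sm sums_If_finite_set) auto
    moreover have "(\<lambda>j. \<bar>\<psi> j\<bar> - (if j \<in> {..<J} then \<bar>\<psi> j\<bar> else 0)) = (\<lambda>j. if j < J then 0 else \<bar>\<psi> j\<bar>)" by auto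
    ultimately show ?thesis by simp
  qed
  obtain N where N: "(4 * real J * s * S / e)\<^sup>2 \<le> real N" using real_arch_simple by blast
  show ?thesis
  proof (intro exI[of _ N] allI impI)
    fix n a b :: nat assume n: "N \<le> n" and ab: "a \<le> b" "b \<le> n"
    define A where "A = (\<Sum>j. \<psi> j)"
    let ?T = "\<lambda>j \<omega>. (\<Sum>i=a..<b. \<eta> (int (Suc i) - int j) \<omega>) - (\<Sum>i=a..<b. \<eta> (int (Suc i)) \<omega>)"
    define c where "c j = 2 * real J * s + (if j < J then 0 else 2 * s * sqrt (real n))" for j
    have Ti: "integrable M (?T j)" for j using D(5) by auto
    have TE: "expectation (\<lambda>\<omega>. \<bar>?T j \<omega>\<bar>) \<le> c j" for j
    proof (cases "j < J")
      case True
      have "expectation (\<lambda>\<omega>. \<bar>?T j \<omega>\<bar>) \<le> 2 * real j * s"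
        using shifted_innovation_sum[OF iid ab(1)] unfolding s_def .
      also have "\<dots> \<le> 2 * real J * s" using True s by (intro mult_right_mono) auto
      finally show ?thesis using True unfolding c_def by simp
    next
      case False
      have "expectation (\<lambda>\<omega>. \<bar>?T j \<omega>\<bar>) \<le> expectation (\<lambda>\<omega>. \<bar>\<Sum>i=a..<b. \<eta> (int i + (1 - int j)) \<omega>\<bar> + \<bar>\<Sum>i=a..<b. \<eta> (int i + 1) \<omega>\<bar>)"
      proof (rule integral_mono)
        show "\<bar>?T j \<omega>\<bar> \<le> \<bar>\<Sum>i=a..<b. \<eta> (int i + (1 - int j)) \<omega>\<bar> + \<bar>\<Sum>i=a..<b. \<eta> (int i + 1) \<omega>\<bar>" for \<omega>
          using abs_triangle_ineq4[of "\<Sum>i=a..<b. \<eta> (int (Suc i) - int j) \<omega>" "\<Sum>i=a..<b. \<eta> (int (Suc i)) \<omega>"]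
          by (simp add: algebra_simps)
      qed (use Ti D(5) in auto)
      also have "\<dots> = expectation (\<lambda>\<omega>. \<bar>\<Sum>i=a..<b. \<eta> (int i + (1 - int j)) \<omega>\<bar>) + expectation (\<lambda>\<omega>. \<bar>\<Sum>i=a..<b. \<eta> (int i + 1) \<omega>\<bar>)"
        using D(5) by simp
      also have "\<dots> \<le> s * sqrt (real n) + s * sqrt (real n)"
        using innovation_sum_L1(1)[OF iid ab] unfolding s_def by (intro add_mono) auto
      also have "\<dots> \<le> c j" using False s unfolding c_def by simp
      finally show ?thesis .
    qed
    have "(\<integral>\<^sup>+\<omega>. ennreal \<bar>\<Sum>i=a..<b. X (int (Suc i)) \<omega> - A * \<eta> (int (Suc i)) \<omega>\<bar> \<partial>M)
       \<le> (\<integral>\<^sup>+\<omega>. (\<Sum>j. ennreal (\<bar>\<psi> j\<bar> * \<bar>?T j \<omega>\<bar>)) \<partial>M)"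
    proof (rule nn_integral_mono_AE)
      show "AE \<omega> in M. ennreal \<bar>\<Sum>i=a..<b. X (int (Suc i)) \<omega> - A * \<eta> (int (Suc i)) \<omega>\<bar> \<le> (\<Sum>j. ennreal (\<bar>\<psi> j\<bar> * \<bar>?T j \<omega>\<bar>))"
        using AE_process_sums[OF X]
      proof eventually_elim
        case (elim \<omega>)
        have psi: "\<psi> sums A" unfolding A_def by (rule summable_sums[OF summable_rabs_cancel[OF sm]])
        have "(\<lambda>j. \<Sum>i=a..<b. \<psi> j * \<eta> (int (Suc i) - int j) \<omega> - \<psi> j * \<eta> (int (Suc i)) \<omega>) sums (\<Sum>i=a..<b. X (int (Suc i)) \<omega> - A * \<eta> (int (Suc i)) \<omega>)"
          using elim psi by (intro sums_sum sums_diff sums_mult2) blast+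
        then show ?case
        proof (rule ennreal_abs_sums_le)
          fix j
          have "(\<Sum>i=a..<b. \<psi> j * \<eta> (int (Suc i) - int j) \<omega> - \<psi> j * \<eta> (int (Suc i)) \<omega>) = \<psi> j * ?T j \<omega>"
            by (simp add: sum_distrib_left sum_subtractf right_diff_distrib)
          then show "ennreal \<bar>\<Sum>i=a..<b. \<psi> j * \<eta> (int (Suc i) - int j) \<omega> - \<psi> j * \<eta> (int (Suc i)) \<omega>\<bar> \<le> ennreal (\<bar>\<psi> j\<bar> * \<bar>?T j \<omega>\<bar>)"
            by (simp only: abs_mult)
        qed
      qed
    qed
    also have "\<dots> = (\<Sum>j. \<integral>\<^sup>+\<omega>. ennreal (\<bar>\<psi> j\<bar> * \<bar>?T j \<omega>\<bar>) \<partial>M)"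
      by (rule nn_integral_suminf) measurable
    also have "\<dots> \<le> (\<Sum>j. ennreal (\<bar>\<psi> j\<bar> * c j))"
    proof (intro suminf_le)
      fix j
      have "(\<integral>\<^sup>+\<omega>. ennreal (\<bar>\<psi> j\<bar> * \<bar>?T j \<omega>\<bar>) \<partial>M) = ennreal (expectation (\<lambda>\<omega>. \<bar>\<psi> j\<bar> * \<bar>?T j \<omega>\<bar>))"
        using Ti by (intro nn_integral_eq_integral) (auto intro!: integrable_mult_right integrable_abs)
      also have "\<dots> \<le> ennreal (\<bar>\<psi> j\<bar> * c j)"
      proof (rule ennreal_leI)
        have "expectation (\<lambda>\<omega>. \<bar>\<psi> j\<bar> * \<bar>?T j \<omega>\<bar>) = \<bar>\<psi> j\<bar> * expectation (\<lambda>\<omega>. \<bar>?T j \<omega>\<bar>)"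
          by (rule Bochner_Integration.integral_mult_right) (use Ti in auto)
        then show "expectation (\<lambda>\<omega>. \<bar>\<psi> j\<bar> * \<bar>?T j \<omega>\<bar>) \<le> \<bar>\<psi> j\<bar> * c j"
          using TE[of j] by (simp only: mult_left_mono abs_ge_zero)
      qed
      finally show "(\<integral>\<^sup>+\<omega>. ennreal (\<bar>\<psi> j\<bar> * \<bar>?T j \<omega>\<bar>) \<partial>M) \<le> ennreal (\<bar>\<psi> j\<bar> * c j)" .
    qed auto
    also have "\<dots> = ennreal (S * (2 * real J * s) + t * (2 * s * sqrt (real n)))"
    proof -
      have "(\<lambda>j. \<bar>\<psi> j\<bar> * (2 * real J * s) + (if j < J then 0 else \<bar>\<psi> j\<bar>) * (2 * s * sqrt (real n))) sums
         (S * (2 * real J * s) + t * (2 * s * sqrt (real n)))"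
        unfolding S_def by (intro sums_add sums_mult2 tail summable_sums sm)
      also have "(\<lambda>j. \<bar>\<psi> j\<bar> * (2 * real J * s) + (if j < J then 0 else \<bar>\<psi> j\<bar>) * (2 * s * sqrt (real n))) = (\<lambda>j. \<bar>\<psi> j\<bar> * c j)"
        unfolding c_def by (auto simp: algebra_simps)
      finally have sums: "(\<lambda>j. \<bar>\<psi> j\<bar> * c j) sums (S * (2 * real J * s) + t * (2 * s * sqrt (real n)))" .
      have "(\<Sum>j. ennreal (\<bar>\<psi> j\<bar> * c j)) = ennreal (\<Sum>j. \<bar>\<psi> j\<bar> * c j)"
        using sums s unfolding c_def by (intro suminf_ennreal2) (auto simp: sums_iff)
      then show ?thesis using sums by (simp add: sums_iff)
    qed
    also have "\<dots> \<le> ennreal (e * sqrt (real n))"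
    proof (rule ennreal_leI)
      have "t * (2 * s * sqrt (real n)) \<le> e / (4 * s) * (2 * s * sqrt (real n))"
        using J s unfolding t_def by (intro mult_right_mono) auto
      also have "\<dots> = e / 2 * sqrt (real n)" using s by simp
      finally have 1: "t * (2 * s * sqrt (real n)) \<le> e / 2 * sqrt (real n)" .
      have "4 * real J * s * S / e \<le> sqrt (real n)" using N n by (intro real_le_rsqrt) linarith
      then have "4 * real J * s * S \<le> sqrt (real n) * e" using e by (simp add: pos_divide_le_eq)
      then show "S * (2 * real J * s) + t * (2 * s * sqrt (real n)) \<le> e * sqrt (real n)" using 1
        by (simp add: algebra_simps)
    qed
    finally show "(\<integral>\<^sup>+\<omega>. ennreal \<bar>\<Sum>i=a..<b. X (int (Suc i)) \<omega> - (\<Sum>j. \<psi> j) * \<eta> (int (Suc i)) \<omega>\<bar> \<partial>M) \<le> ennreal (e * sqrt (real n))"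
      unfolding A_def .
  qed
qed

section \<open>Central limit theorem for block sums\<close>

lemma indep_vars_PiM_coordinates:
  assumes "\<And>i. prob_space (N i)" "I \<noteq> {}"
  shows "prob_space.indep_vars (PiM I N) N (\<lambda>i x. x i) I"
proof -
  interpret prob_space "PiM I N" by (intro prob_space_PiM assms)
  have "distr (PiM I N) (PiM I N) (\<lambda>x. \<lambda>i\<in>I. x i) = PiM I N"
    by (subst distr_cong[of _ _ _ _ _ "\<lambda>x. x"]) (auto simp: space_PiM PiE_iff extensional_restrict distr_id)
  moreover have "(\<Pi>\<^sub>M i\<in>I. distr (PiM I N) (N i) (\<lambda>x. x i)) = PiM I N"
    by (intro PiM_cong refl distr_PiM_component assms)
  ultimately show ?thesis
    by (subst indep_vars_iff_distr_eq_PiM') (use assms(2) in auto)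
qed

text \<open>Vectors of every length \<open>2^k\<close> are represented in the one type of sequences,
  whose Borel sets are those of the product; filling with 0 makes a functional depend on the first
  \<open>K\<close> coordinates only.\<close>

definition zero_beyond :: "nat \<Rightarrow> (nat \<Rightarrow> real) \<Rightarrow> nat \<Rightarrow> real" where
  "zero_beyond K y j = (if j < K then y j else 0)"

lemma measurable_nat_fun_borel:
  assumes "\<And>j. (\<lambda>\<omega>. y \<omega> j) \<in> borel_measurable M"
  shows "(\<lambda>\<omega>. y \<omega>) \<in> M \<rightarrow>\<^sub>M (borel :: (nat \<Rightarrow> real) measure)"
proof -
  have "(\<lambda>\<omega> j. y \<omega> j) \<in> M \<rightarrow>\<^sub>M Pi\<^sub>M UNIV (\<lambda>_. borel)" by (intro measurable_abs_UNIV assms)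
  then show ?thesis using measurable_cong_sets[OF refl sets_PiM_equal_borel] by blast
qed

lemma measurable_zero_beyond:
  assumes "\<And>j. j < K \<Longrightarrow> (\<lambda>\<omega>. y \<omega> j) \<in> borel_measurable M"
  shows "(\<lambda>\<omega>. zero_beyond K (y \<omega>)) \<in> M \<rightarrow>\<^sub>M (borel :: (nat \<Rightarrow> real) measure)"
proof (rule measurable_nat_fun_borel)
  show "(\<lambda>\<omega>. zero_beyond K (y \<omega>) j) \<in> borel_measurable M" for j
    unfolding zero_beyond_def using assms[of j] by (cases "j < K") auto
qed

text \<open>Independence makes the joint law the product of the marginals, so each coordinate may be
  replaced by a variable of the same law living on its own copy of \<open>N\<close>. This allows a
  representation to be chosen coordinate by coordinate.\<close>

lemma integral_indep_vector:
  fixes V :: "nat \<Rightarrow> 'a \<Rightarrow> real" and Z :: "nat \<Rightarrow> 'b \<Rightarrow> real" and \<phi> :: "(nat \<Rightarrow> real) \<Rightarrow> real"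
  assumes M: "prob_space M" and N: "prob_space N"
    and ind: "prob_space.indep_vars M (\<lambda>_. borel) V {..<K}"
    and Z: "\<And>j. j < K \<Longrightarrow> Z j \<in> borel_measurable N"
    and law: "\<And>j. j < K \<Longrightarrow> distr M borel (V j) = distr N borel (Z j)"
    and \<phi>: "\<phi> \<in> borel_measurable borel" and K: "0 < K"
  shows "(\<integral>\<omega>. \<phi> (zero_beyond K (\<lambda>j. V j \<omega>)) \<partial>M) = (\<integral>u. \<phi> (zero_beyond K (\<lambda>j. Z j (u j))) \<partial>PiM {..<K} (\<lambda>_. N))"
proof -
  interpret M: prob_space M by fact
  interpret N: prob_space N by fact
  interpret P: prob_space "PiM {..<K} (\<lambda>_. N)" by (intro prob_space_PiM N)
  have ne: "{..<K} \<noteq> {}" using K by auto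
  have V: "V j \<in> borel_measurable M" if "j < K" for j using ind that unfolding M.indep_vars_def2 by auto
  have comp: "(\<lambda>u. u j) \<in> PiM {..<K} (\<lambda>_. N) \<rightarrow>\<^sub>M N" if "j < K" for j using that by simp
  have Zu: "(\<lambda>u. Z j (u j)) \<in> borel_measurable (PiM {..<K} (\<lambda>_. N))" if "j < K" for j
    by (rule measurable_compose[OF comp[OF that] Z[OF that]])
  have "P.indep_vars (\<lambda>_. borel) (\<lambda>j u. Z j (u j)) {..<K}"
    using Z by (intro P.indep_vars_compose2[OF indep_vars_PiM_coordinates[of "\<lambda>_. N", OF N ne]]) auto
  then have "distr (PiM {..<K} (\<lambda>_. N)) (PiM {..<K} (\<lambda>_. borel)) (\<lambda>u. \<lambda>j\<in>{..<K}. Z j (u j)) = PiM {..<K} (\<lambda>j. distr (PiM {..<K} (\<lambda>_. N)) borel (\<lambda>u. Z j (u j)))"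
    using P.indep_vars_iff_distr_eq_PiM'[of "{..<K}" "\<lambda>j u. Z j (u j)" "\<lambda>_. borel"] ne Zu by auto
  also have "\<dots> = PiM {..<K} (\<lambda>j. distr N borel (Z j))"
  proof (intro PiM_cong refl)
    fix j assume "j \<in> {..<K}"
    then have j: "j < K" by simp
    have "distr (PiM {..<K} (\<lambda>_. N)) borel (\<lambda>u. Z j (u j)) = distr (distr (PiM {..<K} (\<lambda>_. N)) N (\<lambda>u. u j)) borel (Z j)"
      using distr_distr[OF Z[OF j] comp[OF j]] by (simp add: comp_def)
    also have "distr (PiM {..<K} (\<lambda>_. N)) N (\<lambda>u. u j) = N"
      using distr_PiM_component[of "{..<K}" "\<lambda>_. N" j] N j by simp
    finally show "distr (PiM {..<K} (\<lambda>_. N)) borel (\<lambda>u. Z j (u j)) = distr N borel (Z j)" .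
  qed
  also have "\<dots> = PiM {..<K} (\<lambda>j. distr M borel (V j))" by (intro PiM_cong refl) (simp add: law)
  also have "\<dots> = distr M (PiM {..<K} (\<lambda>_. borel)) (\<lambda>\<omega>. \<lambda>j\<in>{..<K}. V j \<omega>)"
    using M.indep_vars_iff_distr_eq_PiM'[of "{..<K}" V "\<lambda>_. borel"] ne V ind by auto
  finally have eq: "distr (PiM {..<K} (\<lambda>_. N)) (PiM {..<K} (\<lambda>_. borel)) (\<lambda>u. \<lambda>j\<in>{..<K}. Z j (u j))
     = distr M (PiM {..<K} (\<lambda>_. borel)) (\<lambda>\<omega>. \<lambda>j\<in>{..<K}. V j \<omega>)" .
  have "(\<lambda>y. \<phi> (zero_beyond K y)) \<in> borel_measurable (PiM {..<K} (\<lambda>_. borel))"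
    by (rule measurable_compose[OF measurable_zero_beyond \<phi>]) simp
  from distr_eq_transfer(2)[OF eq _ _ this]
  have "(\<integral>u. \<phi> (zero_beyond K (\<lambda>j\<in>{..<K}. Z j (u j))) \<partial>PiM {..<K} (\<lambda>_. N)) = (\<integral>\<omega>. \<phi> (zero_beyond K (\<lambda>j\<in>{..<K}. V j \<omega>)) \<partial>M)"
    using V Zu by (auto intro!: measurable_restrict)
  moreover have "zero_beyond K (\<lambda>j\<in>{..<K}. y j) = zero_beyond K y" for y
    unfolding zero_beyond_def by auto
  ultimately show ?thesis by simp
qed

lemma (in prob_space) innovation_sum_char:
  assumes iid: "iid_innovations M \<eta>" and I: "finite I" "inj_on s I"
  shows "char (distr M borel (\<lambda>\<omega>. \<Sum>i\<in>I. \<eta> (s i) \<omega>)) u = char (distr M borel (\<eta> 1)) u ^ card I"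
proof -
  note D = iid_innovationsD[OF iid]
  have "(\<lambda>\<omega>. \<Sum>i\<in>I. \<eta> (s i) \<omega>) = (\<lambda>\<omega>. \<Sum>i\<in>s ` I. \<eta> i \<omega>)" using I by (simp add: sum.reindex)
  then have "char (distr M borel (\<lambda>\<omega>. \<Sum>i\<in>I. \<eta> (s i) \<omega>)) u = (\<Prod>i\<in>s ` I. char (distr M borel (\<eta> i)) u)"
    using char_distr_sum[OF indep_vars_subset[OF D(1)], of "s ` I" u] by simp
  also have "\<dots> = (\<Prod>i\<in>s ` I. char (distr M borel (\<eta> 1)) u)" by (intro prod.cong refl) (metis D(3))
  finally show ?thesis using I by (simp add: card_image)
qed

text \<open>The characteristic function of such a sum is a power determined by the number of terms.
  A block sum thus has the law of an initial sum of the same length, to which the classical theorem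
  applies.\<close>

lemma (in prob_space) innovation_sum_law:
  assumes iid: "iid_innovations M \<eta>" and I: "finite I" "inj_on s I" and J: "finite J" "inj_on t J" "card I = card J"
  shows "distr M borel (\<lambda>\<omega>. \<Sum>i\<in>I. \<eta> (s i) \<omega>) = distr M borel (\<lambda>\<omega>. \<Sum>i\<in>J. \<eta> (t i) \<omega>)"
proof (rule Levy_uniqueness)
  note [measurable] = iid_innovationsD(2)[OF iid]
  show "real_distribution (distr M borel (\<lambda>\<omega>. \<Sum>i\<in>I. \<eta> (s i) \<omega>))"
    "real_distribution (distr M borel (\<lambda>\<omega>. \<Sum>i\<in>J. \<eta> (t i) \<omega>))"
    by (intro real_distribution_distr; measurable)+
  show "char (distr M borel (\<lambda>\<omega>. \<Sum>i\<in>I. \<eta> (s i) \<omega>)) = char (distr M borel (\<lambda>\<omega>. \<Sum>i\<in>J. \<eta> (t i) \<omega>))"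
    using innovation_sum_char[OF iid I] innovation_sum_char[OF iid J(1,2)] J(3) by auto
qed

lemma block_length_lower:
  "n div 2^k \<le> block_start n k (Suc j) - block_start n k j"
  unfolding block_start_def mult_Suc div_add1_eq[of n "j * n" "2^k"] by simp

lemma block_length_ratio:
  "(\<lambda>n. real (block_start n k (Suc j) - block_start n k j) / real n) \<longlonglongrightarrow> 1 / 2^k"
proof (rule tendsto_sandwich)
  show "eventually (\<lambda>n. 1 / 2^k - 1 / real n \<le> real (block_start n k (Suc j) - block_start n k j) / real n) sequentially"
    using eventually_gt_at_top[of 0]
  proof eventually_elim
    case (elim n)
    have "n = 2^k * (n div 2^k) + n mod 2^k" by simp
    then have "real n = 2^k * real (n div 2^k) + real (n mod 2^k)"
      using of_nat_add[of "2^k * (n div 2^k)" "n mod 2^k", where ?'a=real] by (simp del: mult_div_mod_eq)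
    also have "real (n mod 2^k) \<le> 2^k"
      using mod_less_divisor[of "2^k" n] by (metis less_imp_le of_nat_le_iff of_nat_numeral of_nat_power zero_less_numeral zero_less_power)
    finally have "real n / 2^k - 1 \<le> real (n div 2^k)" by (simp add: field_simps)
    also have "\<dots> \<le> real (block_start n k (Suc j) - block_start n k j)"
      using block_length_lower by (rule of_nat_mono)
    finally have "(real n / 2^k - 1) / real n \<le> real (block_start n k (Suc j) - block_start n k j) / real n"
      using elim by (intro divide_right_mono) auto
    then show ?case using elim by (simp add: diff_divide_distrib)
  qed
  show "eventually (\<lambda>n. real (block_start n k (Suc j) - block_start n k j) / real n \<le> 1 / 2^k + 1 / real n) sequentially"
    using eventually_gt_at_top[of 0]
  proof eventually_elim
    case (elim n)
    have "real (block_start n k (Suc j) - block_start n k j) / real n \<le> (real n / 2^k + 1) / real n"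
      using block_length elim by (intro divide_right_mono) auto
    then show ?case using elim by (simp add: add_divide_distrib)
  qed
  have "(\<lambda>n. 1 / 2^k - 1 / real n) \<longlonglongrightarrow> 1 / 2^k - 0" by (intro tendsto_intros lim_1_over_n)
  then show "(\<lambda>n. 1 / 2^k - 1 / real n) \<longlonglongrightarrow> 1 / 2^k" by simp
  have "(\<lambda>n. 1 / 2^k + 1 / real n) \<longlonglongrightarrow> 1 / 2^k + 0" by (intro tendsto_intros lim_1_over_n)
  then show "(\<lambda>n. 1 / 2^k + 1 / real n) \<longlonglongrightarrow> 1 / 2^k" by simp
qed

lemma block_length_at_top:
  "filterlim (\<lambda>n. block_start n k (Suc j) - block_start n k j) at_top sequentially"
  unfolding filterlim_at_top
proof
  fix Z
  show "eventually (\<lambda>n. Z \<le> block_start n k (Suc j) - block_start n k j) sequentially"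
  proof (rule eventually_sequentiallyI[of "Z * 2^k"])
    fix n assume "Z * 2^k \<le> n"
    then have "Z \<le> n div 2^k" by (simp add: less_eq_div_iff_mult_less_eq)
    then show "Z \<le> block_start n k (Suc j) - block_start n k j" using block_length_lower[of n k j] by linarith
  qed
qed

lemma tendsto_fun_coordinates:
  fixes f :: "'a \<Rightarrow> 'b \<Rightarrow> 'c::topological_space"
  assumes "\<And>i. ((\<lambda>x. f x i) \<longlongrightarrow> l i) F"
  shows "(f \<longlongrightarrow> l) F"
proof -
  have "limitin (product_topology (\<lambda>_. euclidean) UNIV) f l F"
    unfolding limitin_componentwise using assms by (auto simp: limitin_canonical_iff)
  then show ?thesis by (simp add: euclidean_product_topology limitin_canonical_iff)
qed

text \<open>The blocks are independent, so the one-dimensional Skorohod representation can be used in each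
  coordinate of a product space.\<close>

lemma (in prob_space) block_sums_clt:
  fixes \<phi> :: "(nat \<Rightarrow> real) \<Rightarrow> real"
  assumes iid: "iid_innovations M \<eta>" and \<phi>: "continuous_on UNIV \<phi>" "\<And>y. \<bar>\<phi> y\<bar> \<le> b"
  defines "s \<equiv> sqrt (expectation (\<lambda>\<omega>. (\<eta> 1 \<omega>)\<^sup>2))"
  shows "(\<lambda>n. expectation (\<lambda>\<omega>. \<phi> (zero_beyond (2^k) (\<lambda>j. A / sqrt (real n) * block_sum n (\<lambda>i. \<eta> (int (Suc i)) \<omega>) k j))))
    \<longlonglongrightarrow> (\<integral>x. \<phi> (zero_beyond (2^k) (\<lambda>j. A * s * sqrt (1/2^k) * x j)) \<partial>PiM UNIV (\<lambda>_. std_normal_distribution))"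
proof -
  note D = iid_innovationsD[OF iid]
  note [measurable] = D(2)
  have s: "0 < s" "s\<^sup>2 = expectation (\<lambda>\<omega>. (\<eta> 1 \<omega>)\<^sup>2)" unfolding s_def using D(8) by auto
  define S where "S m \<omega> = (\<Sum>i<m. \<eta> (int (Suc i)) \<omega>)" for m :: nat and \<omega>
  have [measurable]: "S m \<in> borel_measurable M" for m unfolding S_def by measurable
  define \<mu> where "\<mu> m = distr M borel (\<lambda>\<omega>. S m \<omega> / sqrt (real m * s\<^sup>2))" for m
  have inj: "inj (\<lambda>i. int (Suc i))" by (auto simp: inj_def)
  have "weak_conv_m \<mu> std_normal_distribution"
    unfolding \<mu>_def S_def
    by (rule central_limit_theorem_zero_mean[OF indep_vars_inj[OF D(1) inj], where \<mu>="distr M borel (\<eta> 1)"])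
       (use D s in \<open>auto simp: fun_eq_iff\<close>)
  moreover have rd: "real_distribution (\<mu> m)" for m unfolding \<mu>_def by (intro real_distribution_distr) measurable
  moreover have "real_distribution std_normal_distribution" by (rule real_dist_normal_dist)
  ultimately obtain \<Omega> :: "real measure" and Ys Y where Om: "prob_space \<Omega>"
    and Ys: "\<And>m. Ys m \<in> borel_measurable \<Omega>" "\<And>m. distr \<Omega> borel (Ys m) = \<mu> m"
    and Y: "Y \<in> borel_measurable \<Omega>" "distr \<Omega> borel Y = std_normal_distribution"
    and conv: "\<And>u. u \<in> space \<Omega> \<Longrightarrow> (\<lambda>m. Ys m u) \<longlonglongrightarrow> Y u"
  proof -
    assume that': "weak_conv_m \<mu> std_normal_distribution" "\<And>m. real_distribution (\<mu> m)" "real_distribution std_normal_distribution"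
    obtain \<Omega> :: "real measure" and Ys Y where "prob_space \<Omega> \<and>
      (\<forall>n. Ys n \<in> measurable \<Omega> borel) \<and> (\<forall>n. distr \<Omega> borel (Ys n) = \<mu> n) \<and> Y \<in> measurable \<Omega> lborel \<and>
      distr \<Omega> borel Y = std_normal_distribution \<and> (\<forall>x \<in> space \<Omega>. (\<lambda>n. Ys n x) \<longlonglongrightarrow> Y x)"
      using Skorohod[OF that'(2,3,1)] by blast
    then show ?thesis by (intro that[of \<Omega> Ys Y]) (simp_all add: measurable_lborel2)
  qed
  let ?K = "2^k :: nat"
  have \<phi>m: "\<phi> \<in> borel_measurable borel" using \<phi>(1) by (rule borel_measurable_continuous_onI)
  define m where "m n j = block_start n k (Suc j) - block_start n k j" for n j
  \<comment> \<open>In the central limit theorem a block is normalised by its own length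
    \<open>m n j\<close>; \<open>c\<close> restores the normalisation by \<open>n\<close> and tends
    to \<open>A * s * sqrt (1/2^k)\<close>.\<close>
  define c where "c n j = A * s * sqrt (real (m n j) / real n)" for n j
  let ?V = "\<lambda>n j \<omega>. A / sqrt (real n) * block_sum n (\<lambda>i. \<eta> (int (Suc i)) \<omega>) k j"
  have bm[measurable]: "(\<lambda>\<omega>. block_sum n (\<lambda>i. \<eta> (int (Suc i)) \<omega>) k j) \<in> borel_measurable M" for n j
    unfolding block_sum_def by measurable
  interpret Om: prob_space \<Omega> by fact
  interpret P: prob_space "PiM {..<?K} (\<lambda>_. \<Omega>)" by (intro prob_space_PiM Om)
  have law: "distr M borel (?V n j) = distr \<Omega> borel (\<lambda>u. c n j * Ys (m n j) u)" if n: "0 < n" for n j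
  proof -
    have "distr M borel (\<lambda>\<omega>. block_sum n (\<lambda>i. \<eta> (int (Suc i)) \<omega>) k j) = distr M borel (S (m n j))"
      unfolding block_sum_def S_def m_def using inj
      by (intro innovation_sum_law[OF iid]) (auto intro: inj_on_subset)
    then have "distr (distr M borel (\<lambda>\<omega>. block_sum n (\<lambda>i. \<eta> (int (Suc i)) \<omega>) k j)) borel (\<lambda>t. A / sqrt (real n) * t)
       = distr (distr M borel (S (m n j))) borel (\<lambda>t. A / sqrt (real n) * t)" by simp
    then have "distr M borel (?V n j) = distr M borel (\<lambda>\<omega>. A / sqrt (real n) * S (m n j) \<omega>)"
      by (simp add: distr_distr comp_def del: of_nat_Suc)
    also have "(\<lambda>\<omega>. A / sqrt (real n) * S (m n j) \<omega>) = (\<lambda>\<omega>. c n j * (S (m n j) \<omega> / sqrt (real (m n j) * s\<^sup>2)))"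
    proof (cases "m n j = 0")
      \<comment> \<open>An empty block: the sum is 0, and so is its quotient by
        \<open>sqrt 0\<close>.\<close>
      case True then show ?thesis unfolding S_def by simp
    next
      case False
      then show ?thesis unfolding c_def using s(1) n by (auto simp: real_sqrt_mult real_sqrt_divide)
    qed
    also have "distr M borel \<dots> = distr (\<mu> (m n j)) borel (\<lambda>t. c n j * t)"
      unfolding \<mu>_def by (simp add: distr_distr comp_def)
    also have "\<dots> = distr \<Omega> borel (\<lambda>u. c n j * Ys (m n j) u)"
      unfolding Ys(2)[symmetric] using Ys(1) by (simp add: distr_distr comp_def)
    finally show ?thesis .
  qed
  have ind: "indep_vars (\<lambda>_. borel) (?V n) {..<?K}" for n
  proof -
    let ?B = "\<lambda>j. {block_start n k j..<block_start n k (Suc j)}"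
    have "disjoint_family_on ?B {..<?K}"
    proof (unfold disjoint_family_on_def, intro ballI impI)
      fix i j :: nat assume "i \<noteq> j"
      then consider "Suc i \<le> j" | "Suc j \<le> i" by linarith
      then show "?B i \<inter> ?B j = {}"
        using block_start_mono[of "Suc i" j n k] block_start_mono[of "Suc j" i n k] by cases auto
    qed
    then have "indep_vars (\<lambda>j. PiM (?B j) (\<lambda>_. borel)) (\<lambda>j \<omega>. restrict (\<lambda>i. \<eta> (int (Suc i)) \<omega>) (?B j)) {..<?K}"
      by (intro indep_vars_restrict[OF indep_vars_inj[OF D(1) inj]]) auto
    then have "indep_vars (\<lambda>_. borel) (\<lambda>j \<omega>. (\<lambda>y. A / sqrt (real n) * (\<Sum>i\<in>?B j. y i)) (restrict (\<lambda>i. \<eta> (int (Suc i)) \<omega>) (?B j))) {..<?K}"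
      by (rule indep_vars_compose2) auto
    then show ?thesis unfolding block_sum_def by simp
  qed
  have eq: "expectation (\<lambda>\<omega>. \<phi> (zero_beyond ?K (\<lambda>j. ?V n j \<omega>))) =
     (\<integral>u. \<phi> (zero_beyond ?K (\<lambda>j. c n j * Ys (m n j) (u j))) \<partial>PiM {..<?K} (\<lambda>_. \<Omega>))" if "0 < n" for n
    using Ys(1) law[OF that] by (intro integral_indep_vector[OF prob_space_axioms Om ind _ _ \<phi>m]) auto
  have climit: "(\<lambda>n. c n j) \<longlonglongrightarrow> A * s * sqrt (1/2^k)" for j
    unfolding c_def m_def by (intro tendsto_intros block_length_ratio)
  have comp: "(\<lambda>u. u j) \<in> PiM {..<?K} (\<lambda>_. \<Omega>) \<rightarrow>\<^sub>M \<Omega>" if "j < ?K" for j using that by simp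
  have "(\<lambda>n. \<integral>u. \<phi> (zero_beyond ?K (\<lambda>j. c n j * Ys (m n j) (u j))) \<partial>PiM {..<?K} (\<lambda>_. \<Omega>))
     \<longlonglongrightarrow> (\<integral>u. \<phi> (zero_beyond ?K (\<lambda>j. A * s * sqrt (1/2^k) * Y (u j))) \<partial>PiM {..<?K} (\<lambda>_. \<Omega>))"
  proof (rule integral_dominated_convergence[where w="\<lambda>_. b"])
    show "(\<lambda>u. \<phi> (zero_beyond ?K (\<lambda>j. A * s * sqrt (1/2^k) * Y (u j)))) \<in> borel_measurable (PiM {..<?K} (\<lambda>_. \<Omega>))"
      using measurable_compose[OF comp Y(1)]
      by (intro measurable_compose[OF measurable_zero_beyond \<phi>m] borel_measurable_times borel_measurable_const) auto
    show "(\<lambda>u. \<phi> (zero_beyond ?K (\<lambda>j. c n j * Ys (m n j) (u j)))) \<in> borel_measurable (PiM {..<?K} (\<lambda>_. \<Omega>))" for n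
      using measurable_compose[OF comp Ys(1)]
      by (intro measurable_compose[OF measurable_zero_beyond \<phi>m] borel_measurable_times borel_measurable_const) auto
    show "AE u in PiM {..<?K} (\<lambda>_. \<Omega>). (\<lambda>n. \<phi> (zero_beyond ?K (\<lambda>j. c n j * Ys (m n j) (u j)))) \<longlonglongrightarrow> \<phi> (zero_beyond ?K (\<lambda>j. A * s * sqrt (1/2^k) * Y (u j)))"
    proof (rule AE_I2)
      fix u assume u: "u \<in> space (PiM {..<?K} (\<lambda>_. \<Omega>))"
      \<comment> \<open>Block lengths tend to infinity, so the Skorohod sequence converges along
        them. Coordinatewise convergence is convergence in the product topology, for which
        \<open>\<phi>\<close> is continuous.\<close>
      have "(\<lambda>n. zero_beyond ?K (\<lambda>j. c n j * Ys (m n j) (u j)) j) \<longlonglongrightarrow> zero_beyond ?K (\<lambda>j. A * s * sqrt (1/2^k) * Y (u j)) j" for j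
      proof (cases "j < ?K")
        case True
        then have "u j \<in> space \<Omega>" using u by (auto simp: space_PiM)
        then have "(\<lambda>n. Ys (m n j) (u j)) \<longlonglongrightarrow> Y (u j)"
          unfolding m_def by (intro filterlim_compose[OF conv block_length_at_top])
        then show ?thesis unfolding zero_beyond_def using True by (auto intro!: tendsto_mult climit)
      qed (auto simp: zero_beyond_def)
      then have "(\<lambda>n. zero_beyond ?K (\<lambda>j. c n j * Ys (m n j) (u j))) \<longlonglongrightarrow> zero_beyond ?K (\<lambda>j. A * s * sqrt (1/2^k) * Y (u j))"
        by (rule tendsto_fun_coordinates)
      moreover have "isCont \<phi> y" for y using \<phi>(1) by (simp add: continuous_on_eq_continuous_at)
      ultimately show "(\<lambda>n. \<phi> (zero_beyond ?K (\<lambda>j. c n j * Ys (m n j) (u j)))) \<longlonglongrightarrow> \<phi> (zero_beyond ?K (\<lambda>j. A * s * sqrt (1/2^k) * Y (u j)))"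
        by (rule isCont_tendsto_compose[rotated])
    qed
  qed (use \<phi>(2) in auto)
  \<comment> \<open>Back from the copies of the Skorohod space to independent standard normal
    coordinates.\<close>
  moreover have "(\<integral>u. \<phi> (zero_beyond ?K (\<lambda>j. A * s * sqrt (1/2^k) * Y (u j))) \<partial>PiM {..<?K} (\<lambda>_. \<Omega>))
     = (\<integral>x. \<phi> (zero_beyond ?K (\<lambda>j. A * s * sqrt (1/2^k) * x j)) \<partial>PiM UNIV (\<lambda>_. std_normal_distribution))"
  proof -
    have N: "prob_space std_normal_distribution" by (rule prob_space_normal_density) simp
    interpret PN: prob_space "PiM (UNIV::nat set) (\<lambda>_. std_normal_distribution)" by (intro prob_space_PiM N)
    have mc: "(\<lambda>x. x j) \<in> PiM (UNIV::nat set) (\<lambda>_. std_normal_distribution) \<rightarrow>\<^sub>M std_normal_distribution" for j by simp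
    have "PN.indep_vars (\<lambda>_. std_normal_distribution) (\<lambda>i x. x i) UNIV"
      by (rule indep_vars_PiM_coordinates[OF N]) simp
    then have "PN.indep_vars (\<lambda>_. std_normal_distribution) (\<lambda>i x. x i) {..<?K}"
      by (rule PN.indep_vars_subset) simp
    then have "PN.indep_vars (\<lambda>_. borel) (\<lambda>j x. A * s * sqrt (1/2^k) * x j) {..<?K}"
      by (rule PN.indep_vars_compose2) simp
    moreover have "distr (PiM (UNIV::nat set) (\<lambda>_. std_normal_distribution)) borel (\<lambda>x. A * s * sqrt (1/2^k) * x j)
        = distr \<Omega> borel (\<lambda>u. A * s * sqrt (1/2^k) * Y u)" for j
    proof -
      have "distr \<Omega> borel (\<lambda>u. A * s * sqrt (1/2^k) * Y u) = distr std_normal_distribution borel (\<lambda>t. A * s * sqrt (1/2^k) * t)"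
        unfolding Y(2)[symmetric] using Y(1) by (simp add: distr_distr comp_def)
      also have "\<dots> = distr (distr (PiM (UNIV::nat set) (\<lambda>_. std_normal_distribution)) std_normal_distribution (\<lambda>x. x j)) borel (\<lambda>t. A * s * sqrt (1/2^k) * t)"
        using distr_PiM_component[of "UNIV::nat set" "\<lambda>_. std_normal_distribution" j] N by simp
      finally show ?thesis by (subst (asm) distr_distr) (auto simp: comp_def)
    qed
    ultimately show ?thesis
      using Y(1) by (intro integral_indep_vector[OF PN.prob_space_axioms Om _ _ _ \<phi>m, symmetric]) auto
  qed
  ultimately show ?thesis
    using eq by (subst tendsto_cong[OF eventually_mono[OF eventually_gt_at_top[of 0]]]) auto
qed

section \<open>Dyadic white noise\<close>

lemma std_normal_density_rotate:
  "std_normal_density ((u + v) / sqrt 2) * std_normal_density ((u - v) / sqrt 2) = std_normal_density u * std_normal_density v"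
proof -
  have "((u + v) / sqrt 2)\<^sup>2 + ((u - v) / sqrt 2)\<^sup>2 = u\<^sup>2 + v\<^sup>2"
    by (simp add: power_divide power2_eq_square field_simps)
  then have "exp (- ((u + v) / sqrt 2)\<^sup>2 / 2) * exp (- ((u - v) / sqrt 2)\<^sup>2 / 2) = exp (- u\<^sup>2 / 2) * exp (- v\<^sup>2 / 2)"
    by (simp flip: exp_add add: field_simps)
  then show ?thesis unfolding std_normal_density_def by simp
qed

text \<open>Invariance under an orthogonal map of the plane, which preserves the product density.
  Two one-dimensional affine substitutions, in \<open>b\<close> and, after exchanging the integrals,
  in \<open>a\<close>, with factors \<open>sqrt 2\<close> and \<open>1 / sqrt 2\<close>, replace a
  change of variables in two dimensions.\<close>

lemma std_normal_rotate:
  assumes [measurable]: "A \<in> sets borel" "B \<in> sets borel"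
  shows "(\<integral>\<^sup>+a. \<integral>\<^sup>+b. indicator A ((a + b) / sqrt 2) * indicator B ((a - b) / sqrt 2) \<partial>std_normal_distribution \<partial>std_normal_distribution)
    = emeasure std_normal_distribution A * emeasure std_normal_distribution B"
proof -
  let ?d = "\<lambda>x. std_normal_density x"
  have emA: "emeasure std_normal_distribution A = (\<integral>\<^sup>+u. ennreal (?d u) * indicator A u \<partial>lborel)" if [measurable]: "A \<in> sets borel" for A
    by (subst emeasure_density) auto
  have "(\<integral>\<^sup>+a. \<integral>\<^sup>+b. indicator A ((a + b) / sqrt 2) * indicator B ((a - b) / sqrt 2) \<partial>std_normal_distribution \<partial>std_normal_distribution)
    = (\<integral>\<^sup>+a. ennreal (?d a) * (\<integral>\<^sup>+b. ennreal (?d b) * (indicator A ((a + b) / sqrt 2) * indicator B ((a - b) / sqrt 2)) \<partial>lborel) \<partial>lborel)"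
    by (simp add: nn_integral_density)
  also have "\<dots> = (\<integral>\<^sup>+a. \<integral>\<^sup>+b. ennreal (?d a * ?d b) * (indicator A ((a + b) / sqrt 2) * indicator B ((a - b) / sqrt 2)) \<partial>lborel \<partial>lborel)"
    by (subst nn_integral_cmult[symmetric]) (auto simp: ennreal_mult mult.assoc)
  also have "\<dots> = (\<integral>\<^sup>+a. \<integral>\<^sup>+u. ennreal (sqrt 2) * (ennreal (?d a * ?d (sqrt 2 * u - a)) * (indicator A u * indicator B (sqrt 2 * a - u))) \<partial>lborel \<partial>lborel)"
  proof (rule nn_integral_cong)
    fix a :: real
    have e: "(a - (- a + sqrt 2 * u)) / sqrt 2 = sqrt 2 * a - u" for u
      by (simp add: field_simps)
    have e': "(2 * a - sqrt 2 * u) / sqrt 2 = sqrt 2 * a - u" for u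
      by (simp add: field_simps)
    show "(\<integral>\<^sup>+b. ennreal (?d a * ?d b) * (indicator A ((a + b) / sqrt 2) * indicator B ((a - b) / sqrt 2)) \<partial>lborel)
      = (\<integral>\<^sup>+u. ennreal (sqrt 2) * (ennreal (?d a * ?d (sqrt 2 * u - a)) * (indicator A u * indicator B (sqrt 2 * a - u))) \<partial>lborel)"
      by (subst nn_integral_real_affine[where c="sqrt 2" and t="-a"])
         (auto simp: e e' nn_integral_cmult[symmetric] intro!: nn_integral_cong arg_cong2[of _ _ _ _ "(*)"] arg_cong[of _ _ ennreal])
  qed
  also have "\<dots> = (\<integral>\<^sup>+u. \<integral>\<^sup>+a. ennreal (sqrt 2) * (ennreal (?d a * ?d (sqrt 2 * u - a)) * (indicator A u * indicator B (sqrt 2 * a - u))) \<partial>lborel \<partial>lborel)"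
    by (rule lborel_pair.Fubini') measurable
  also have "\<dots> = (\<integral>\<^sup>+u. \<integral>\<^sup>+v. ennreal (?d u * ?d v) * (indicator A u * indicator B v) \<partial>lborel \<partial>lborel)"
  proof (rule nn_integral_cong)
    fix u :: real
    have e1: "sqrt 2 * (u / sqrt 2 + v / sqrt 2) - u = v" for v by (simp add: field_simps)
    have e2: "sqrt 2 * u - (u / sqrt 2 + v / sqrt 2) = (u - v) / sqrt 2" for v
      by (simp add: field_simps)
    have e3: "u / sqrt 2 + v / sqrt 2 = (u + v) / sqrt 2" for v by (simp add: add_divide_distrib)
    have c: "ennreal (1 / sqrt 2) * (ennreal (sqrt 2) * z) = z" for z
      by (simp add: mult.assoc[symmetric] ennreal_mult[symmetric])
    show "(\<integral>\<^sup>+a. ennreal (sqrt 2) * (ennreal (?d a * ?d (sqrt 2 * u - a)) * (indicator A u * indicator B (sqrt 2 * a - u))) \<partial>lborel)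
      = (\<integral>\<^sup>+v. ennreal (?d u * ?d v) * (indicator A u * indicator B v) \<partial>lborel)"
      apply (subst nn_integral_real_affine[where c="1 / sqrt 2" and t="u / sqrt 2"])
        apply (measurable)
       apply simp
      apply (subst nn_integral_cmult[symmetric], measurable)
      apply (simp add: e1 e2)
      apply (simp add: e3 std_normal_density_rotate c)
      done
  qed
  also have "\<dots> = (\<integral>\<^sup>+u. \<integral>\<^sup>+v. (ennreal (?d u) * indicator A u) * (ennreal (?d v) * indicator B v) \<partial>lborel \<partial>lborel)"
    by (intro nn_integral_cong) (simp add: ennreal_mult mult_ac)
  also have "\<dots> = (\<integral>\<^sup>+u. (ennreal (?d u) * indicator A u) * emeasure std_normal_distribution B \<partial>lborel)"
    by (intro nn_integral_cong) (simp add: nn_integral_cmult emA[of B])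
  also have "\<dots> = emeasure std_normal_distribution A * emeasure std_normal_distribution B"
    by (subst nn_integral_multc) (auto simp: emA[of A])
  finally show ?thesis .
qed

definition gauss_space :: "(nat \<Rightarrow> real) measure" where
  "gauss_space = PiM UNIV (\<lambda>_. std_normal_distribution)"

lemma prob_space_std_normal: "prob_space std_normal_distribution"
  by (rule prob_space_normal_density) simp

lemma prob_space_gauss_space: "prob_space gauss_space"
  unfolding gauss_space_def by (intro prob_space_PiM prob_space_std_normal)

lemma measurable_gauss_coord: "(\<lambda>x. x j) \<in> borel_measurable gauss_space"
  unfolding gauss_space_def by (rule measurable_compose[OF measurable_component_singleton[of j]]) auto

lemma space_gauss_space [simp]: "space gauss_space = UNIV"
  unfolding gauss_space_def by (auto simp: space_PiM)

lemma measurable_into_gauss_space: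
  "(\<And>j. (\<lambda>\<omega>. y \<omega> j) \<in> borel_measurable M) \<Longrightarrow> y \<in> M \<rightarrow>\<^sub>M gauss_space"
  unfolding gauss_space_def using measurable_abs_UNIV[of "\<lambda>j \<omega>. y \<omega> j" M "\<lambda>_. std_normal_distribution"]
  by (simp cong: measurable_cong_sets)

definition rotate_pair :: "nat \<Rightarrow> nat \<Rightarrow> (nat \<Rightarrow> real) \<Rightarrow> nat \<Rightarrow> real" where
  "rotate_pair a b y = y(a := (y a + y b) / sqrt 2, b := (y a - y b) / sqrt 2)"

lemma measurable_rotate_pair [measurable]: "rotate_pair a b \<in> gauss_space \<rightarrow>\<^sub>M gauss_space"
proof (rule measurable_into_gauss_space)
  fix j
  show "(\<lambda>y. rotate_pair a b y j) \<in> borel_measurable gauss_space"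
    unfolding rotate_pair_def fun_upd_def
    using measurable_gauss_coord[of a] measurable_gauss_coord[of b] measurable_gauss_coord[of j]
    by (cases "j = b"; cases "j = a") auto
qed

text \<open>Product measures are determined by cylinders. On a cylinder the coordinates
  \<open>a\<close> and \<open>b\<close> are integrated first, where \<open>std_normal_rotate\<close>
  applies, and the remaining ones are untouched.\<close>

lemma distr_rotate_pair:
  assumes ab: "a \<noteq> b"
  shows "distr gauss_space gauss_space (rotate_pair a b) = gauss_space"
proof (rule measure_eqI_PiM_infinite[of _ UNIV "\<lambda>_. std_normal_distribution", symmetric])
  interpret prob_space gauss_space by (rule prob_space_gauss_space)
  interpret product_prob_space "\<lambda>_::nat. std_normal_distribution" UNIV
    by (rule product_prob_spaceI) (rule prob_space_std_normal)
  show "finite_measure gauss_space" using prob_space_gauss_space by (simp add: prob_space_def)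
  fix A :: "nat \<Rightarrow> real set" and J
  assume J: "finite J" and A: "\<And>i. i \<in> J \<Longrightarrow> A i \<in> sets std_normal_distribution"
  \<comment> \<open>Filling up with \<open>UNIV\<close> lets \<open>a\<close> and \<open>b\<close>
    count among the constrained coordinates whether or not they lie in \<open>J\<close>.\<close>
  define A' where "A' j = (if j \<in> J then A j else UNIV)" for j
  have A'[measurable]: "A' j \<in> sets borel" for j using A unfolding A'_def by auto
  define K where "K = J - {a, b}"
  define L where "L = insert a (insert b K)"
  have K: "finite K" "a \<notin> K" "b \<notin> K" "finite L" using J unfolding K_def L_def by auto
  let ?E = "prod_emb UNIV (\<lambda>_. std_normal_distribution) J (Pi\<^sub>E J A)"
  have emb: "prod_emb UNIV (\<lambda>_. std_normal_distribution) I (Pi\<^sub>E I C) = {y. \<forall>j\<in>I. y j \<in> C j}" for I C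
    unfolding prod_emb_def by (auto simp: PiE_iff)
  have E: "?E = {y. \<forall>j\<in>L. y j \<in> A' j}"
    unfolding emb A'_def L_def K_def by auto
  have Em: "?E \<in> sets gauss_space"
    unfolding gauss_space_def using J A by (intro sets_PiM_I) auto
  have "emeasure gauss_space ?E = (\<Prod>j\<in>L. emeasure std_normal_distribution (A' j))"
  proof -
    have "?E = prod_emb UNIV (\<lambda>_. std_normal_distribution) L (Pi\<^sub>E L A')"
      using E emb[of L A'] by simp
    moreover have "emeasure gauss_space (prod_emb UNIV (\<lambda>_. std_normal_distribution) L (Pi\<^sub>E L A')) = (\<Prod>j\<in>L. emeasure std_normal_distribution (A' j))"
      unfolding gauss_space_def using K by (intro emeasure_PiM_emb) auto
    ultimately show ?thesis by simp
  qed
  also have "\<dots> = emeasure std_normal_distribution (A' a) * emeasure std_normal_distribution (A' b) * (\<Prod>j\<in>K. emeasure std_normal_distribution (A' j))"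
    unfolding L_def using K ab by (simp add: mult.assoc)
  finally have lhs: "emeasure gauss_space ?E = emeasure std_normal_distribution (A' a) * emeasure std_normal_distribution (A' b) * (\<Prod>j\<in>K. emeasure std_normal_distribution (A' j))" .
  let ?F = "\<lambda>y. (\<Prod>j\<in>K. indicator (A' j) (y j)) * (indicator (A' a) ((y a + y b) / sqrt 2) * indicator (A' b) ((y a - y b) / sqrt 2)) :: ennreal"
  have comp: "(\<lambda>y. y j) \<in> borel_measurable (PiM L (\<lambda>_. std_normal_distribution))" if "j \<in> L" for j
    by (rule measurable_compose[OF measurable_component_singleton[OF that]]) auto

  have inL: "a \<in> L" "b \<in> L" "K \<subseteq> L" unfolding L_def by auto
  have Fm: "?F \<in> borel_measurable (PiM L (\<lambda>_. std_normal_distribution))"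
  proof (intro borel_measurable_times_ennreal borel_measurable_prod_ennreal)
    show "(\<lambda>y. indicator (A' j) (y j)) \<in> borel_measurable (PiM L (\<lambda>_. std_normal_distribution))" if "j \<in> K" for j
      by (rule measurable_compose[OF comp borel_measurable_indicator[OF A']]) (use inL that in auto)
    show "(\<lambda>y. indicator (A' a) ((y a + y b) / sqrt 2)) \<in> borel_measurable (PiM L (\<lambda>_. std_normal_distribution))"
      by (rule measurable_compose[OF _ borel_measurable_indicator[OF A']])
         (intro borel_measurable_divide borel_measurable_add borel_measurable_const comp inL)
    show "(\<lambda>y. indicator (A' b) ((y a - y b) / sqrt 2)) \<in> borel_measurable (PiM L (\<lambda>_. std_normal_distribution))"
      by (rule measurable_compose[OF _ borel_measurable_indicator[OF A']])
         (intro borel_measurable_divide borel_measurable_diff borel_measurable_const comp inL)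
  qed
  have "emeasure (distr gauss_space gauss_space (rotate_pair a b)) ?E = emeasure gauss_space (rotate_pair a b -` ?E)"
    using Em by (subst emeasure_distr) auto
  also have "\<dots> = (\<integral>\<^sup>+y. indicator (rotate_pair a b -` ?E) y \<partial>gauss_space)"
    using measurable_sets[OF measurable_rotate_pair Em, of a b] by simp
  also have "\<dots> = (\<integral>\<^sup>+y. ?F (restrict y L) \<partial>gauss_space)"
  proof (rule nn_integral_cong)
    fix y
    have "rotate_pair a b y j = y j" if "j \<in> K" for j using K that unfolding rotate_pair_def by auto
    moreover have "rotate_pair a b y a = (y a + y b) / sqrt 2" "rotate_pair a b y b = (y a - y b) / sqrt 2"
      using ab unfolding rotate_pair_def by auto
    ultimately have "y \<in> rotate_pair a b -` ?E \<longleftrightarrow> (\<forall>j\<in>K. y j \<in> A' j) \<and> (y a + y b) / sqrt 2 \<in> A' a \<and> (y a - y b) / sqrt 2 \<in> A' b"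
      unfolding E L_def by auto
    moreover have "(\<Prod>j\<in>K. indicator (A' j) (y j)) = (if \<forall>j\<in>K. y j \<in> A' j then 1 else 0 :: ennreal)"
      using K(1) by (auto simp: indicator_def)
    moreover have "(\<Prod>j\<in>K. indicator (A' j) (restrict y L j)) = (\<Prod>j\<in>K. indicator (A' j) (y j) :: ennreal)"
      using inL by (intro prod.cong) auto
    ultimately show "indicator (rotate_pair a b -` ?E) y = ?F (restrict y L)"
      using inL by (simp add: indicator_def)
  qed
  also have "\<dots> = (\<integral>\<^sup>+y. ?F y \<partial>distr gauss_space (PiM L (\<lambda>_. std_normal_distribution)) (\<lambda>y. restrict y L))"
    unfolding gauss_space_def by (subst nn_integral_distr) (use Fm in \<open>auto intro!: measurable_restrict_subset\<close>)
  also have "distr gauss_space (PiM L (\<lambda>_. std_normal_distribution)) (\<lambda>y. restrict y L) = PiM L (\<lambda>_. std_normal_distribution)"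
    unfolding gauss_space_def using K by (intro distr_PiM_restrict_finite) auto
  also have "(\<integral>\<^sup>+y. ?F y \<partial>PiM L (\<lambda>_. std_normal_distribution))
     = (\<integral>\<^sup>+z. \<integral>\<^sup>+v. ?F (z(a := v)) \<partial>std_normal_distribution \<partial>PiM (insert b K) (\<lambda>_. std_normal_distribution))"
    using K ab Fm unfolding L_def by (intro product_nn_integral_insert) auto
  also have "\<dots> = (\<integral>\<^sup>+z. \<integral>\<^sup>+u. \<integral>\<^sup>+v. ?F (z(b := u, a := v)) \<partial>std_normal_distribution \<partial>std_normal_distribution \<partial>PiM K (\<lambda>_. std_normal_distribution))"
  proof (rule product_nn_integral_insert)
    have 1: "(\<lambda>(z, v). z(a := v)) \<in> PiM (insert b K) (\<lambda>_. std_normal_distribution) \<Otimes>\<^sub>M std_normal_distribution \<rightarrow>\<^sub>M PiM L (\<lambda>_. std_normal_distribution)"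
      unfolding L_def by (rule measurable_add_dim)
    have "(\<lambda>(z, v). ?F (z(a := v))) \<in> borel_measurable (PiM (insert b K) (\<lambda>_. std_normal_distribution) \<Otimes>\<^sub>M std_normal_distribution)"
      using measurable_compose[OF 1 Fm] by (simp add: case_prod_beta')
    then show "(\<lambda>z. \<integral>\<^sup>+v. ?F (z(a := v)) \<partial>std_normal_distribution) \<in> borel_measurable (PiM (insert b K) (\<lambda>_. std_normal_distribution))"
      by (rule sigma_finite_measure.borel_measurable_nn_integral[OF sigma_finite_measures])
  qed (use K in auto)
  also have "\<dots> = (\<integral>\<^sup>+z. (\<Prod>j\<in>K. indicator (A' j) (z j)) * (emeasure std_normal_distribution (A' a) * emeasure std_normal_distribution (A' b)) \<partial>PiM K (\<lambda>_. std_normal_distribution))"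
  proof (rule nn_integral_cong)
    fix z
    let ?P = "\<Prod>j\<in>K. indicator (A' j) (z j) :: ennreal"
    have "?F (z(b := u, a := v)) = ?P * (indicator (A' a) ((u + v) / sqrt 2) * indicator (A' b) ((v - u) / sqrt 2))" for u v
    proof -
      have "(\<Prod>j\<in>K. indicator (A' j) ((z(b := u, a := v)) j)) = ?P" using K by (intro prod.cong) auto
      then show ?thesis using ab by (simp add: add.commute)
    qed
    then have "(\<integral>\<^sup>+u. \<integral>\<^sup>+v. ?F (z(b := u, a := v)) \<partial>std_normal_distribution \<partial>std_normal_distribution)
      = (\<integral>\<^sup>+u. \<integral>\<^sup>+v. ?P * (indicator (A' a) ((u + v) / sqrt 2) * indicator (A' b) ((v - u) / sqrt 2)) \<partial>std_normal_distribution \<partial>std_normal_distribution)"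
      by simp
    also have "\<dots> = (\<integral>\<^sup>+u. ?P * (\<integral>\<^sup>+v. indicator (A' a) ((u + v) / sqrt 2) * indicator (A' b) ((v - u) / sqrt 2) \<partial>std_normal_distribution) \<partial>std_normal_distribution)"
      by (intro nn_integral_cong nn_integral_cmult) measurable
    also have "\<dots> = ?P * (\<integral>\<^sup>+u. \<integral>\<^sup>+v. indicator (A' a) ((u + v) / sqrt 2) * indicator (A' b) ((v - u) / sqrt 2) \<partial>std_normal_distribution \<partial>std_normal_distribution)"
      by (intro nn_integral_cmult) measurable
    also have "(\<integral>\<^sup>+u. \<integral>\<^sup>+v. indicator (A' a) ((u + v) / sqrt 2) * indicator (A' b) ((v - u) / sqrt 2) \<partial>std_normal_distribution \<partial>std_normal_distribution)
      = (\<integral>\<^sup>+v. \<integral>\<^sup>+u. indicator (A' a) ((v + u) / sqrt 2) * indicator (A' b) ((v - u) / sqrt 2) \<partial>std_normal_distribution \<partial>std_normal_distribution)"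
    proof -
      interpret pair_sigma_finite std_normal_distribution std_normal_distribution
        by (intro pair_sigma_finite.intro sigma_finite_measures)
      show ?thesis by (subst Fubini') (measurable, simp add: add.commute)
    qed
    also have "\<dots> = emeasure std_normal_distribution (A' a) * emeasure std_normal_distribution (A' b)"
      by (rule std_normal_rotate[OF A' A'])
    finally show "(\<integral>\<^sup>+u. \<integral>\<^sup>+v. ?F (z(b := u, a := v)) \<partial>std_normal_distribution \<partial>std_normal_distribution)
      = ?P * (emeasure std_normal_distribution (A' a) * emeasure std_normal_distribution (A' b))" .
  qed
  also have "\<dots> = (\<integral>\<^sup>+z. (\<Prod>j\<in>K. indicator (A' j) (z j)) \<partial>PiM K (\<lambda>_. std_normal_distribution)) * (emeasure std_normal_distribution (A' a) * emeasure std_normal_distribution (A' b))"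
    by (rule nn_integral_multc) (intro borel_measurable_prod_ennreal measurable_compose[OF measurable_component_singleton borel_measurable_indicator], auto)
  also have "(\<integral>\<^sup>+z. (\<Prod>j\<in>K. indicator (A' j) (z j)) \<partial>PiM K (\<lambda>_. std_normal_distribution)) = (\<Prod>j\<in>K. emeasure std_normal_distribution (A' j))"
    using K by (subst product_nn_integral_prod) auto
  finally show "emeasure gauss_space ?E = emeasure (distr gauss_space gauss_space (rotate_pair a b)) ?E"
    unfolding lhs by (simp add: mult_ac)
qed (auto simp: gauss_space_def)

lemma distr_compose_preserving:
  assumes "distr M M f = M" "distr M M g = M" "f \<in> M \<rightarrow>\<^sub>M M" "g \<in> M \<rightarrow>\<^sub>M M"
  shows "distr M M (\<lambda>x. g (f x)) = M"
  using distr_distr[OF assms(4,3)] assms(1,2) by (simp add: comp_def)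

text \<open>Acts on the disjoint pairs \<open>(i, n + i)\<close> for \<open>i < m\<close>. With
  \<open>n = m = 2^k\<close> it performs one refinement of the dyadic partition, up to a
  permutation.\<close>

primrec rotate_pairs :: "nat \<Rightarrow> nat \<Rightarrow> (nat \<Rightarrow> real) \<Rightarrow> nat \<Rightarrow> real" where
  "rotate_pairs n 0 y = y"
| "rotate_pairs n (Suc m) y = rotate_pair m (n + m) (rotate_pairs n m y)"

lemma rotate_pairs_eq:
  "m \<le> n \<Longrightarrow> rotate_pairs n m y j = (if j < m then (y j + y (n + j)) / sqrt 2
     else if n \<le> j \<and> j < n + m then (y (j - n) - y j) / sqrt 2 else y j)"
proof (induction m arbitrary: j)
  case (Suc m)
  have "rotate_pairs n m y m = y m" "rotate_pairs n m y (n + m) = y (n + m)" using Suc by auto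
  then show ?case using Suc.IH[of j] Suc.prems by (auto simp: rotate_pair_def)
qed simp

lemma distr_rotate_pairs:
  "0 < n \<Longrightarrow> distr gauss_space gauss_space (rotate_pairs n m) = gauss_space \<and> rotate_pairs n m \<in> gauss_space \<rightarrow>\<^sub>M gauss_space"
proof (induction m)
  case 0
  have "rotate_pairs n 0 = (\<lambda>y. y)" by auto
  then show ?case by (simp add: distr_id)
next
  case (Suc m)
  have eq: "rotate_pairs n (Suc m) = (\<lambda>y. rotate_pair m (n + m) (rotate_pairs n m y))" by auto
  have rp: "distr gauss_space gauss_space (rotate_pairs n m) = gauss_space" "rotate_pairs n m \<in> gauss_space \<rightarrow>\<^sub>M gauss_space"
    using Suc by auto
  have "m \<noteq> n + m" using Suc.prems by simp
  then show ?case unfolding eq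
    by (intro conjI distr_compose_preserving[OF rp(1) distr_rotate_pair rp(2) measurable_rotate_pair]
      measurable_compose[OF rp(2) measurable_rotate_pair])
qed

text \<open>The midpoint construction: \<open>noise k j\<close> is the white noise of the dyadic interval
  \<open>(j / 2^k, (j + 1) / 2^k]\<close>.\<close>

primrec noise :: "nat \<Rightarrow> nat \<Rightarrow> (nat \<Rightarrow> real) \<Rightarrow> real" where
  "noise 0 j x = x 0"
| "noise (Suc k) j x = (noise k (j div 2) x + (if even j then 1 else - 1) * sqrt (1 / 2^k) * x (2^k + j div 2)) / 2"

lemma noise_add: "noise k j x = noise (Suc k) (2 * j) x + noise (Suc k) (2 * j + 1) x"
  by (simp add: field_simps)

lemma measurable_noise [measurable]: "noise k j \<in> borel_measurable gauss_space"
proof (induction k arbitrary: j)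
  case (Suc k)
  note [measurable] = Suc[of "j div 2"] measurable_gauss_coord[of "2^k + j div 2"]
  show ?case unfolding noise.simps by measurable
next
  case 0
  have "noise 0 j = (\<lambda>x. x 0)" by auto
  then show ?case using measurable_gauss_coord[of 0] by simp
qed

text \<open>The noise of level \<open>k\<close>, scaled to unit variance, fills the first
  \<open>2^k\<close> coordinates, and the variables not yet used are kept. As a map of the whole
  sequence space that preserves the measure it can be treated by induction on
  \<open>k\<close>.\<close>

definition standard_noise :: "nat \<Rightarrow> (nat \<Rightarrow> real) \<Rightarrow> nat \<Rightarrow> real" where
  "standard_noise k x j = (if j < 2^k then sqrt (2^k) * noise k j x else x j)"

lemma measurable_standard_noise [measurable]: "standard_noise k \<in> gauss_space \<rightarrow>\<^sub>M gauss_space"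
proof (rule measurable_into_gauss_space)
  show "(\<lambda>x. standard_noise k x j) \<in> borel_measurable gauss_space" for j
    unfolding standard_noise_def using measurable_gauss_coord[of j] by (cases "j < 2^k") auto
qed

text \<open>One step of the midpoint construction combines the parent \<open>i\<close> with the
  fresh variable \<open>2^k + i\<close> by an orthogonal map of this pair and then sorts the results
  into the positions of the children.\<close>

lemma distr_standard_noise: "distr gauss_space gauss_space (standard_noise k) = gauss_space"
proof (induction k)
  case 0
  have "standard_noise 0 = (\<lambda>x. x)" by (auto simp: standard_noise_def fun_eq_iff)
  then show ?case by (simp add: distr_id)
next
  case (Suc k)
  \<comment> \<open>Position \<open>j\<close> of level \<open>k + 1\<close> is read off at the
    parent's place for a left child and at that of the fresh variable for a right child.\<close>
  define p where "p j = (if j < 2 * 2^k then (if even j then j div 2 else 2^k + j div 2) else j)" for j :: nat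
  have "inj p"
  proof (rule injI)
    fix i j assume eq: "p i = p j"
    obtain m :: nat where m: "2^k = m" by blast
    have "\<exists>a. i = 2 * a \<or> i = 2 * a + 1" for i :: nat by presburger
    then obtain a b where "i = 2 * a \<or> i = 2 * a + 1" "j = 2 * b \<or> j = 2 * b + 1" by blast
    then show "i = j"
      using eq unfolding p_def m by (elim disjE) (simp_all split: if_splits)
  qed
  have perm: "distr gauss_space gauss_space (\<lambda>y j. y (p j)) = gauss_space"
    using distr_PiM_reindex[of UNIV "\<lambda>_. std_normal_distribution" p UNIV] \<open>inj p\<close> prob_space_std_normal
    unfolding gauss_space_def by (simp add: restrict_UNIV)
  have pm: "(\<lambda>y j. y (p j)) \<in> gauss_space \<rightarrow>\<^sub>M gauss_space" by (rule measurable_into_gauss_space) (rule measurable_gauss_coord)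
  note rp = distr_rotate_pairs[of "2^k" "2^k"]
  have "standard_noise (Suc k) x j = rotate_pairs (2^k) (2^k) (standard_noise k x) (p j)" for x j
  proof (cases "j < 2 * 2^k")
    case True
    define i where "i = j div 2"
    have i: "i < 2^k" using True unfolding i_def by auto
    have r: "sqrt (2 ^ k) * sqrt (1/2^k) = (1::real)" by (simp flip: real_sqrt_mult)
    have s: "standard_noise k x i = sqrt (2^k) * noise k i x" "standard_noise k x (2^k + i) = x (2^k + i)"
      using i unfolding standard_noise_def by auto
    have two: "sqrt 2 * sqrt (2 ^ k) * t / 2 = sqrt (2^k) * t / sqrt 2" for t :: real
      by (simp add: field_simps)
    show ?thesis
    proof (cases "even j")
      case e: True
      have "standard_noise (Suc k) x j = sqrt 2 * sqrt (2 ^ k) * (noise k i x + sqrt (1/2^k) * x (2^k + i)) / 2"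
        using True e unfolding standard_noise_def i_def by (simp add: real_sqrt_mult)
      also have "\<dots> = (sqrt (2^k) * noise k i x + sqrt (2 ^ k) * sqrt (1/2^k) * x (2^k + i)) / sqrt 2"
        unfolding two by (simp add: algebra_simps)
      also have "\<dots> = (standard_noise k x i + standard_noise k x (2^k + i)) / sqrt 2"
        unfolding s r by simp
      finally show ?thesis using True e i unfolding p_def i_def[symmetric] by (simp add: rotate_pairs_eq i_def[symmetric])
    next
      case o: False
      have "standard_noise (Suc k) x j = sqrt 2 * sqrt (2 ^ k) * (noise k i x - sqrt (1/2^k) * x (2^k + i)) / 2"
        using True o unfolding standard_noise_def i_def by (simp add: real_sqrt_mult)
      also have "\<dots> = (sqrt (2^k) * noise k i x - sqrt (2 ^ k) * sqrt (1/2^k) * x (2^k + i)) / sqrt 2"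
        unfolding two by (simp add: algebra_simps)
      also have "\<dots> = (standard_noise k x i - standard_noise k x (2^k + i)) / sqrt 2"
        unfolding s r by simp
      finally show ?thesis using True o i unfolding p_def i_def[symmetric] by (simp add: rotate_pairs_eq i_def[symmetric])
    qed
  next
    case False
    then show ?thesis unfolding p_def standard_noise_def by (simp add: rotate_pairs_eq standard_noise_def)
  qed
  then have eq: "standard_noise (Suc k) = (\<lambda>x. (\<lambda>y j. y (p j)) (rotate_pairs (2^k) (2^k) (standard_noise k x)))"
    by (intro ext) simp
  have rp: "distr gauss_space gauss_space (rotate_pairs (2^k) (2^k)) = gauss_space"
    "rotate_pairs (2^k) (2^k) \<in> gauss_space \<rightarrow>\<^sub>M gauss_space" using rp by auto
  show ?case unfolding eq
    by (rule distr_compose_preserving[OF distr_compose_preserving[OF Suc rp(1) measurable_standard_noise rp(2)] perm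
          measurable_compose[OF measurable_standard_noise rp(2)] pm])
qed

section \<open>The white noise integral\<close>

definition sq_int :: "'a measure \<Rightarrow> ('a \<Rightarrow> real) \<Rightarrow> bool" where
  "sq_int M f \<longleftrightarrow> f \<in> borel_measurable M \<and> integrable M (\<lambda>x. (f x)\<^sup>2)"

text \<open>Squared norms of functions, not of classes, avoid roots and quotients: the bound
  \<open>sqn_lin_le\<close> with its factors 2 takes the place of the triangle inequality.\<close>

definition sqn :: "'a measure \<Rightarrow> ('a \<Rightarrow> real) \<Rightarrow> real" where
  "sqn M f = (\<integral>x. (f x)\<^sup>2 \<partial>M)"

lemma sq_intD [dest]: "sq_int M f \<Longrightarrow> f \<in> borel_measurable M" "sq_int M f \<Longrightarrow> integrable M (\<lambda>x. (f x)\<^sup>2)"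
  unfolding sq_int_def by auto

lemma sqn_nonneg: "0 \<le> sqn M f"
  unfolding sqn_def by simp

lemma sq_int_mult:
  assumes "sq_int M f" "sq_int M g"
  shows "integrable M (\<lambda>x. f x * g x)"
proof -
  have "integrable M (\<lambda>x. (f x)\<^sup>2 + (g x)\<^sup>2)" using assms by auto
  then show ?thesis
  proof (rule Bochner_Integration.integrable_bound)
    show "AE x in M. norm (f x * g x) \<le> norm ((f x)\<^sup>2 + (g x)\<^sup>2)"
    proof (rule AE_I2)
      fix x
      have "2 * \<bar>f x * g x\<bar> \<le> (f x)\<^sup>2 + (g x)\<^sup>2"
        using sum_squares_bound[of "\<bar>f x\<bar>" "\<bar>g x\<bar>"] by (simp add: abs_mult)
      then show "norm (f x * g x) \<le> norm ((f x)\<^sup>2 + (g x)\<^sup>2)" by simp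
    qed
  qed (use assms[THEN sq_intD(1)] in auto)
qed

lemma sq_int_lin:
  assumes "sq_int M f" "sq_int M g"
  shows "sq_int M (\<lambda>x. c * f x + g x)"
    and "sqn M (\<lambda>x. c * f x + g x) = c\<^sup>2 * sqn M f + 2 * c * (\<integral>x. f x * g x \<partial>M) + sqn M g"
proof -
  have e: "(\<lambda>x. (c * f x + g x)\<^sup>2) = (\<lambda>x. c\<^sup>2 * (f x)\<^sup>2 + 2 * c * (f x * g x) + (g x)\<^sup>2)"
    by (rule ext) (simp add: power2_eq_square algebra_simps)
  have i: "integrable M (\<lambda>x. c\<^sup>2 * (f x)\<^sup>2)" "integrable M (\<lambda>x. 2 * c * (f x * g x))" "integrable M (\<lambda>x. (g x)\<^sup>2)"
    using assms sq_int_mult[OF assms] by auto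
  show "sq_int M (\<lambda>x. c * f x + g x)"
    unfolding sq_int_def e using assms[THEN sq_intD(1)] i by auto
  show "sqn M (\<lambda>x. c * f x + g x) = c\<^sup>2 * sqn M f + 2 * c * (\<integral>x. f x * g x \<partial>M) + sqn M g"
    unfolding sqn_def e using i by simp
qed

lemma sq_int_diff: "sq_int M f \<Longrightarrow> sq_int M g \<Longrightarrow> sq_int M (\<lambda>x. f x - g x)"
  using sq_int_lin(1)[of M g f "-1"] by (simp add: algebra_simps)

lemma sqn_lin_le:
  assumes "sq_int M f" "sq_int M g"
  shows "sqn M (\<lambda>x. c * f x + g x) \<le> 2 * c\<^sup>2 * sqn M f + 2 * sqn M g"
proof -
  have "sqn M (\<lambda>x. c * f x + g x) \<le> (\<integral>x. 2 * c\<^sup>2 * (f x)\<^sup>2 + 2 * (g x)\<^sup>2 \<partial>M)"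
    unfolding sqn_def
  proof (rule integral_mono)
    show "integrable M (\<lambda>x. (c * f x + g x)\<^sup>2)" using sq_int_lin(1)[OF assms] by auto
    show "integrable M (\<lambda>x. 2 * c\<^sup>2 * (f x)\<^sup>2 + 2 * (g x)\<^sup>2)" using assms[THEN sq_intD(2)] by auto
    show "(c * f x + g x)\<^sup>2 \<le> 2 * c\<^sup>2 * (f x)\<^sup>2 + 2 * (g x)\<^sup>2" for x
      using sum_squares_bound[of "c * f x" "g x"] by (simp add: power2_sum power_mult_distrib)
  qed
  also have "\<dots> = 2 * c\<^sup>2 * sqn M f + 2 * sqn M g" unfolding sqn_def using assms[THEN sq_intD(2)] by auto
  finally show ?thesis .
qed

lemma sqn_diff_le:
  assumes "sq_int M f" "sq_int M g" "sq_int M h"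
  shows "sqn M (\<lambda>x. f x - h x) \<le> 2 * sqn M (\<lambda>x. f x - g x) + 2 * sqn M (\<lambda>x. g x - h x)"
  using sqn_lin_le[OF sq_int_diff[OF assms(1,2)] sq_int_diff[OF assms(2,3)], of 1] by simp

lemma sqn_diff_commute: "sqn M (\<lambda>x. f x - g x) = sqn M (\<lambda>x. g x - f x)"
  unfolding sqn_def by (simp add: power2_commute)

text \<open>From \<open>\<bar>g\<^sup>2 - f\<^sup>2\<bar> \<le> (1 + 1/r) * (g - f)\<^sup>2 + r *
  f\<^sup>2\<close> for every \<open>r > 0\<close>; the choice of \<open>r\<close> makes the last
  term integrate to at most \<open>e / 2\<close>.\<close>

lemma sqn_tendsto:
  assumes g: "\<And>n. sq_int M (g n)" and f: "sq_int M f"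
    and lim: "(\<lambda>n. sqn M (\<lambda>x. g n x - f x)) \<longlonglongrightarrow> 0"
  shows "(\<lambda>n. sqn M (g n)) \<longlonglongrightarrow> sqn M f"
proof (rule LIMSEQ_I)
  fix e :: real assume e: "0 < e"
  define r where "r = e / (2 * (sqn M f + 1))"
  have r: "0 < r" unfolding r_def using e sqn_nonneg[of M f] by (simp add: add_nonneg_pos)
  have close: "\<bar>sqn M (g n) - sqn M f\<bar> \<le> (1 + 1 / r) * sqn M (\<lambda>x. g n x - f x) + r * sqn M f" for n
  proof -
    have d: "sq_int M (\<lambda>x. g n x - f x)" by (rule sq_int_diff[OF g f])
    have "sqn M (g n) - sqn M f = (\<integral>x. (g n x)\<^sup>2 - (f x)\<^sup>2 \<partial>M)" unfolding sqn_def using sq_intD(2)[OF g[of n]] sq_intD(2)[OF f] by auto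
    also have "\<bar>\<dots>\<bar> \<le> (\<integral>x. \<bar>(g n x)\<^sup>2 - (f x)\<^sup>2\<bar> \<partial>M)" by (rule integral_abs_bound)
    also have "\<dots> \<le> (\<integral>x. (1 + 1 / r) * (g n x - f x)\<^sup>2 + r * (f x)\<^sup>2 \<partial>M)"
    proof (rule integral_mono)
      fix x
      let ?d = "g n x - f x"
      have "0 \<le> (\<bar>?d\<bar> - r * \<bar>f x\<bar>)\<^sup>2" by simp
      then have "2 * \<bar>?d\<bar> * \<bar>f x\<bar> * r \<le> ?d\<^sup>2 + r\<^sup>2 * (f x)\<^sup>2"
        by (simp add: power2_diff power_mult_distrib algebra_simps)
      then have "2 * \<bar>?d\<bar> * \<bar>f x\<bar> \<le> (?d\<^sup>2 + r\<^sup>2 * (f x)\<^sup>2) / r" using r by (simp add: pos_le_divide_eq)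
      also have "\<dots> = ?d\<^sup>2 / r + r * (f x)\<^sup>2" using r by (simp add: add_divide_distrib power2_eq_square)
      finally have 1: "2 * \<bar>?d\<bar> * \<bar>f x\<bar> \<le> ?d\<^sup>2 / r + r * (f x)\<^sup>2" .
      have "(g n x)\<^sup>2 - (f x)\<^sup>2 = ?d\<^sup>2 + 2 * ?d * f x" by (simp add: power2_eq_square algebra_simps)
      then have "\<bar>(g n x)\<^sup>2 - (f x)\<^sup>2\<bar> \<le> ?d\<^sup>2 + 2 * \<bar>?d\<bar> * \<bar>f x\<bar>"
        using abs_triangle_ineq[of "?d\<^sup>2" "2 * ?d * f x"] by (simp only: abs_mult abs_numeral abs_power2)
      with 1 have "\<bar>(g n x)\<^sup>2 - (f x)\<^sup>2\<bar> \<le> ?d\<^sup>2 + (?d\<^sup>2 / r + r * (f x)\<^sup>2)" by linarith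
      then show "\<bar>(g n x)\<^sup>2 - (f x)\<^sup>2\<bar> \<le> (1 + 1 / r) * ?d\<^sup>2 + r * (f x)\<^sup>2"
        by (simp add: distrib_right)
    qed (use sq_intD(2)[OF g[of n]] sq_intD(2)[OF f] sq_intD(2)[OF d] in auto)
    also have "\<dots> = (1 + 1 / r) * sqn M (\<lambda>x. g n x - f x) + r * sqn M f" unfolding sqn_def using sq_intD(2)[OF f] sq_intD(2)[OF d] by auto
    finally show ?thesis .
  qed
  have rf: "r * sqn M f \<le> e / 2"
  proof -
    have "r * sqn M f \<le> r * (sqn M f + 1)" using r by (intro mult_left_mono) auto
    also have "\<dots> = e / 2" unfolding r_def using sqn_nonneg[of M f] by (simp add: field_simps)
    finally show ?thesis .
  qed
  have "(\<lambda>n. (1 + 1 / r) * sqn M (\<lambda>x. g n x - f x)) \<longlonglongrightarrow> (1 + 1 / r) * 0" by (intro tendsto_intros lim)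
  then have "eventually (\<lambda>n. (1 + 1 / r) * sqn M (\<lambda>x. g n x - f x) < e / 2) sequentially"
    using e by (intro order_tendstoD(2)) auto
  then obtain N where "\<And>n. n \<ge> N \<Longrightarrow> (1 + 1 / r) * sqn M (\<lambda>x. g n x - f x) < e / 2" by (auto simp: eventually_sequentially)
  then have "\<And>n. n \<ge> N \<Longrightarrow> norm (sqn M (g n) - sqn M f) < e" using close rf by (simp add: real_norm_def) (smt (verit) field_sum_of_halves)
  then show "\<exists>N. \<forall>n\<ge>N. norm (sqn M (g n) - sqn M f) < e" by blast
qed

section \<open>Dyadic step functions and their white noise integrals\<close>

abbreviation unit_leb :: "real measure" where
  "unit_leb \<equiv> lebesgue_on {0..1}"

lemma prob_space_unit_leb: "prob_space unit_leb"
  by (intro prob_spaceI) (simp add: emeasure_restrict_space)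

text \<open>At \<open>t = 1\<close> this reads \<open>a (2^k)\<close>, a coefficient that does not
  occur in \<open>noise_sum\<close>; a single point has no weight in the integrals.\<close>

definition stepf :: "nat \<Rightarrow> (nat \<Rightarrow> real) \<Rightarrow> real \<Rightarrow> real" where
  "stepf k a t = a (nat \<lfloor>2^k * t\<rfloor>)"

definition noise_sum :: "nat \<Rightarrow> (nat \<Rightarrow> real) \<Rightarrow> (nat \<Rightarrow> real) \<Rightarrow> real" where
  "noise_sum k a x = (\<Sum>j<2^k. a j * noise k j x)"

lemma measurable_noise_sum [measurable]: "noise_sum k a \<in> borel_measurable gauss_space"
  unfolding noise_sum_def by measurable

text \<open>Both children inherit the coefficient of the parent, and the noise is additive over
  them. Step functions of different levels can thus be compared at the finer one.\<close>

lemma step_refine: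
  assumes "k \<le> l"
  shows "\<exists>b. noise_sum k a = noise_sum l b \<and> (\<forall>t\<ge>0. stepf k a t = stepf l b t)"
  using assms
proof (induction l rule: dec_induct)
  case (step l)
  then obtain b where b: "noise_sum k a = noise_sum l b" "\<forall>t\<ge>0. stepf k a t = stepf l b t" by blast
  let ?b = "\<lambda>j. b (j div 2)"
  have "noise_sum l b x = noise_sum (Suc l) ?b x" for x
    unfolding noise_sum_def power_Suc sum_even_odd noise_add[of l] by (simp add: distrib_left)
  moreover have "stepf l b t = stepf (Suc l) ?b t" if "0 \<le> t" for t
  proof -
    have "\<lfloor>2 ^ l * t\<rfloor> = \<lfloor>(2 ^ Suc l * t) / real_of_int 2\<rfloor>" by simp
    also have "\<dots> = \<lfloor>2 ^ Suc l * t\<rfloor> div 2" by (rule floor_divide_real_eq_div) simp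
    finally have "nat \<lfloor>2 ^ l * t\<rfloor> = nat \<lfloor>2 ^ Suc l * t\<rfloor> div 2" by (simp add: nat_div_distrib)
    then show ?thesis unfolding stepf_def by simp
  qed
  ultimately show ?case using b by (intro exI[of _ ?b]) (auto simp: fun_eq_iff)
qed auto

lemma step_lin:
  "\<exists>l d. (\<forall>x. c * noise_sum k a x + noise_sum m b x = noise_sum l d x) \<and>
         (\<forall>t\<ge>0. c * stepf k a t + stepf m b t = stepf l d t)"
proof -
  obtain a' where a': "noise_sum k a = noise_sum (max k m) a'" "\<forall>t\<ge>0. stepf k a t = stepf (max k m) a' t"
    using step_refine[of k "max k m" a] by auto
  obtain b' where b': "noise_sum m b = noise_sum (max k m) b'" "\<forall>t\<ge>0. stepf m b t = stepf (max k m) b' t"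
    using step_refine[of m "max k m" b] by auto
  show ?thesis
    unfolding a'(1) b'(1)
    by (intro exI[of _ "max k m"] exI[of _ "\<lambda>j. c * a' j + b' j"])
       (use a' b' in \<open>auto simp: noise_sum_def stepf_def sum_distrib_left sum.distrib algebra_simps\<close>)
qed

lemma borel_measurable_unit_leb: "f \<in> borel_measurable borel \<Longrightarrow> f \<in> borel_measurable unit_leb"
  by (intro measurable_restrict_space1 measurable_completion) simp

lemma measurable_stepf: "stepf k a \<in> borel_measurable borel"
  unfolding stepf_def by measurable

lemma stepf_integral:
  "integrable unit_leb (stepf k a)" "(\<integral>t. stepf k a t \<partial>unit_leb) = (\<Sum>j<2^k. a j) / 2^k"
proof -
  define g where "g t = (\<Sum>j<2^k. a j * indicator {real j / 2^k..<real (Suc j) / 2^k} t)" for t :: real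
  have cells: "{real j / 2^k..<real (Suc j) / 2^k} \<subseteq> {0..1}" if "j < 2^k" for j
  proof -
    have "real (Suc j) \<le> 2^k" using that by (metis Suc_leI of_nat_le_iff of_nat_numeral of_nat_power)
    then have "real (Suc j) / 2^k \<le> 1" by (simp add: divide_le_eq_1)
    moreover have "0 \<le> real j / 2^k" by simp
    ultimately show ?thesis unfolding subset_iff by (meson atLeastAtMost_iff atLeastLessThan_iff less_imp_le order_trans)
  qed
  have eq: "stepf k a t = g t" if t: "0 \<le> t" "t < 1" for t
  proof -
    let ?i = "nat \<lfloor>2^k * t\<rfloor>"
    have i: "real ?i \<le> 2^k * t" "2^k * t < real ?i + 1" using t by auto
    have "real ?i < 2^k" using i(1) t by (smt (verit) mult_less_cancel_left2 zero_less_power)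
    then have "?i < 2^k" by (metis of_nat_less_iff of_nat_numeral of_nat_power)
    have "indicator {real j / 2^k..<real (Suc j) / 2^k} t = (if j = ?i then 1 else 0 :: real)" for j
    proof -
      have "t \<in> {real j / 2^k..<real (Suc j) / 2^k} \<longleftrightarrow> real j \<le> 2^k * t \<and> 2^k * t < real j + 1"
        by (auto simp: field_simps)
      also have "\<dots> \<longleftrightarrow> j = ?i" using i by linarith
      finally have iff: "t \<in> {real j / 2^k..<real (Suc j) / 2^k} \<longleftrightarrow> j = ?i" .
      show ?thesis unfolding indicator_def iff by simp
    qed
    then have "g t = (\<Sum>j<2^k. a j * (if j = ?i then 1 else 0))" unfolding g_def by simp
    also have "\<dots> = a ?i" using \<open>?i < 2^k\<close> by (simp add: if_distrib cong: if_cong)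
    finally show ?thesis unfolding stepf_def by simp
  qed
  have sets: "{real j / 2^k..<real (Suc j) / 2^k} \<in> sets unit_leb" if "j < 2^k" for j
    using cells[OF that] by (auto simp: sets_restrict_space_iff)
  have meas: "measure unit_leb {real j / 2^k..<real (Suc j) / 2^k} = 1 / 2^k" if "j < 2^k" for j
    using cells[OF that] by (subst measure_restrict_space) (auto simp: diff_divide_distrib[symmetric] divide_right_mono)
  interpret U: prob_space unit_leb by (rule prob_space_unit_leb)
  have ii: "integrable unit_leb (\<lambda>t. a j * indicator {real j / 2^k..<real (Suc j) / 2^k} t)" if "j < 2^k" for j
    using sets[OF that] by (intro integrable_mult_right integrable_real_indicator) (auto simp: U.emeasure_finite less_top[symmetric])
  have gi: "integrable unit_leb g" unfolding g_def using ii by (intro Bochner_Integration.integrable_sum) auto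
  have "(\<integral>t. g t \<partial>unit_leb) = (\<Sum>j<2^k. \<integral>t. a j * indicator {real j / 2^k..<real (Suc j) / 2^k} t \<partial>unit_leb)"
    unfolding g_def using ii by (intro Bochner_Integration.integral_sum) auto
  also have "\<dots> = (\<Sum>j<2^k. a j / 2^k)"
  proof (rule sum.cong[OF refl])
    fix j :: nat assume "j \<in> {..<2^k}"
    then have j: "j < 2^k" by simp
    have "(\<integral>t. indicator {real j / 2^k..<real (Suc j) / 2^k} t \<partial>unit_leb) = measure unit_leb {real j / 2^k..<real (Suc j) / 2^k}"
      using sets[OF j] cells[OF j] by (simp add: Int_absorb2)
    then show "(\<integral>t. a j * indicator {real j / 2^k..<real (Suc j) / 2^k} t \<partial>unit_leb) = a j / 2^k"
      using meas[OF j] by simp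
  qed
  finally have gI: "(\<integral>t. g t \<partial>unit_leb) = (\<Sum>j<2^k. a j) / 2^k" by (simp add: sum_divide_distrib)
  \<comment> \<open>The sum of indicators agrees with the step function on \<open>[0, 1)\<close>
    only.\<close>
  have "emeasure unit_leb {1} = 0" by (simp add: emeasure_restrict_space)
  then have "AE t in unit_leb. t \<noteq> 1" by (intro AE_I'[of "{1}"]) (auto intro!: null_setsI simp: sets_restrict_space_iff)
  moreover have "AE t in unit_leb. t \<in> {0..1}" by (rule AE_I2) simp
  ultimately have ae: "AE t in unit_leb. g t = stepf k a t"
    by eventually_elim (simp add: eq)
  have sm: "stepf k a \<in> borel_measurable unit_leb" by (intro borel_measurable_unit_leb measurable_stepf)
  show "integrable unit_leb (stepf k a)"
    using integrable_cong_AE[OF _ sm ae] gi by auto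
  show "(\<integral>t. stepf k a t \<partial>unit_leb) = (\<Sum>j<2^k. a j) / 2^k"
    using integral_cong_AE[OF _ sm ae] gi gI by auto
qed

lemma stepf_sq: "sq_int unit_leb (stepf k a)" "sqn unit_leb (stepf k a) = (\<Sum>j<2^k. (a j)\<^sup>2) / 2^k"
proof -
  have e: "(\<lambda>t. (stepf k a t)\<^sup>2) = stepf k (\<lambda>j. (a j)\<^sup>2)" by (auto simp: stepf_def)
  show "sq_int unit_leb (stepf k a)" "sqn unit_leb (stepf k a) = (\<Sum>j<2^k. (a j)\<^sup>2) / 2^k"
    unfolding sq_int_def sqn_def e using stepf_integral[of k "\<lambda>j. (a j)\<^sup>2"] borel_measurable_unit_leb[OF measurable_stepf]
    by auto
qed

interpretation G: prob_space gauss_space by (rule prob_space_gauss_space)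

lemma distr_gauss_coord: "distr gauss_space borel (\<lambda>x. x j) = std_normal_distribution"
proof -
  have "distr gauss_space borel (\<lambda>x. x j) = distr gauss_space std_normal_distribution (\<lambda>x. x j)"
    by (intro distr_cong) auto
  then show ?thesis unfolding gauss_space_def
    using distr_PiM_component[of UNIV "\<lambda>_. std_normal_distribution" j] prob_space_std_normal by simp
qed

lemma gauss_coord_moment:
  "integrable gauss_space (\<lambda>x. x j ^ p)"
  "(\<integral>x. x j ^ p \<partial>gauss_space) = (\<integral>y. std_normal_density y * y ^ p \<partial>lborel)"
proof -
  have "integrable std_normal_distribution (\<lambda>y. y ^ p)"
    by (subst integrable_density) (auto simp: integrable_std_normal_moment)
  then show "integrable gauss_space (\<lambda>x. x j ^ p)"
    unfolding distr_gauss_coord[of j, symmetric] by (subst (asm) integrable_distr_eq) (auto simp: measurable_gauss_coord)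
  have "(\<integral>x. x j ^ p \<partial>gauss_space) = (\<integral>y. y ^ p \<partial>distr gauss_space borel (\<lambda>x. x j))"
    by (subst integral_distr) (auto simp: measurable_gauss_coord)
  then show "(\<integral>x. x j ^ p \<partial>gauss_space) = (\<integral>y. std_normal_density y * y ^ p \<partial>lborel)"
    unfolding distr_gauss_coord by (subst (asm) integral_density) auto
qed

lemma gauss_coord_moments:
  "(\<integral>x. x j \<partial>gauss_space) = 0" "(\<integral>x. (x j)\<^sup>2 \<partial>gauss_space) = 1" "(\<integral>x. x j ^ 4 \<partial>gauss_space) = 3"
  using gauss_coord_moment(2)[of j 1] gauss_coord_moment(2)[of j 2] gauss_coord_moment(2)[of j 4]
    integral_std_normal_moment_odd[of 0] integral_std_normal_moment_even[of 1] integral_std_normal_moment_even[of 2]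
  by (simp_all add: fact_numeral)

lemma gauss_indep: "G.indep_vars (\<lambda>_. borel) (\<lambda>j x. x j) UNIV"
proof -
  have "G.indep_vars (\<lambda>_. std_normal_distribution) (\<lambda>j x. x j) UNIV"
    unfolding gauss_space_def by (rule indep_vars_PiM_coordinates[OF prob_space_std_normal]) simp
  from G.indep_vars_compose2[OF this, of "\<lambda>_ y. y" "\<lambda>_. borel"] show ?thesis by simp
qed

lemma gauss_product:
  "integrable gauss_space (\<lambda>x. x i * x j)" "(\<integral>x. x i * x j \<partial>gauss_space) = (if i = j then 1 else 0)"
proof -
  have i1: "integrable gauss_space (\<lambda>x. x j)" for j using gauss_coord_moment(1)[of j 1] by simp
  have "integrable gauss_space (\<lambda>x. x i * x j) \<and> (\<integral>x. x i * x j \<partial>gauss_space) = 0" if "i \<noteq> j"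
  proof -
    have "G.indep_var borel (\<lambda>x. x i) borel (\<lambda>x. \<Sum>j\<in>{j}. x j)"
      by (rule G.indep_vars_sum[where X="\<lambda>j x. x j"]) (use that G.indep_vars_subset[OF gauss_indep] in auto)
    then have "G.indep_var borel (\<lambda>x. x i) borel (\<lambda>x. x j)" by simp
    from G.indep_var_integrable[OF this i1 i1] G.indep_var_lebesgue_integral[OF this i1 i1]
    show ?thesis by (simp add: gauss_coord_moments)
  qed
  moreover have "integrable gauss_space (\<lambda>x. x j * x j) \<and> (\<integral>x. x j * x j \<partial>gauss_space) = 1"
    using gauss_coord_moment(1)[of j 2] gauss_coord_moments(2)[of j] by (simp add: power2_eq_square)
  ultimately show "integrable gauss_space (\<lambda>x. x i * x j)" "(\<integral>x. x i * x j \<partial>gauss_space) = (if i = j then 1 else 0)"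
    by (cases "i = j"; simp)+
qed

lemma gauss_linear_sq:
  "integrable gauss_space (\<lambda>x. (\<Sum>j\<in>J. b j * x j)\<^sup>2)"
  "finite J \<Longrightarrow> (\<integral>x. (\<Sum>j\<in>J. b j * x j)\<^sup>2 \<partial>gauss_space) = (\<Sum>j\<in>J. (b j)\<^sup>2)"
proof -
  have e: "(\<lambda>x. (\<Sum>j\<in>J. b j * x j)\<^sup>2) = (\<lambda>x. \<Sum>i\<in>J. \<Sum>j\<in>J. b i * b j * (x i * x j))"
    unfolding power2_eq_square sum_product by (simp add: mult_ac)
  show "integrable gauss_space (\<lambda>x. (\<Sum>j\<in>J. b j * x j)\<^sup>2)"
    unfolding e by (intro Bochner_Integration.integrable_sum integrable_mult_right gauss_product)
  assume J: "finite J"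
  have "(\<integral>x. (\<Sum>j\<in>J. b j * x j)\<^sup>2 \<partial>gauss_space) = (\<Sum>i\<in>J. \<Sum>j\<in>J. b i * b j * (if i = j then 1 else 0))"
    unfolding e by (simp add: Bochner_Integration.integral_sum gauss_product Bochner_Integration.integrable_sum)
  also have "\<dots> = (\<Sum>j\<in>J. (b j)\<^sup>2)" using J by (intro sum.cong refl) (simp add: power2_eq_square if_distrib cong: if_cong)
  finally show "(\<integral>x. (\<Sum>j\<in>J. b j * x j)\<^sup>2 \<partial>gauss_space) = (\<Sum>j\<in>J. (b j)\<^sup>2)" .
qed

text \<open>Since \<open>standard_noise k\<close> preserves the measure, statements on the noise of
  level \<open>k\<close> become statements on independent coordinates.\<close>

lemma integral_standard_noise:
  fixes h :: "(nat \<Rightarrow> real) \<Rightarrow> 'd::{banach, second_countable_topology}"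
  assumes h: "h \<in> borel_measurable gauss_space"
  shows "integrable gauss_space (\<lambda>x. h (standard_noise k x)) \<longleftrightarrow> integrable gauss_space h"
    "(\<integral>x. h (standard_noise k x) \<partial>gauss_space) = (\<integral>x. h x \<partial>gauss_space)"
  using integrable_distr_eq[OF measurable_standard_noise h, of k] integral_distr[OF measurable_standard_noise h, of k]
  unfolding distr_standard_noise by auto

lemma noise_standard: "j < 2^k \<Longrightarrow> noise k j x = sqrt (1 / 2^k) * standard_noise k x j"
  unfolding standard_noise_def by (simp add: real_sqrt_divide)

lemma noise_sum_standard: "noise_sum k a x = (\<Sum>j<2^k. (a j * sqrt (1 / 2^k)) * standard_noise k x j)"
  unfolding noise_sum_def by (intro sum.cong refl) (simp add: noise_standard)

lemma noise_moment:
  assumes j: "j < 2^k"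
  shows "integrable gauss_space (\<lambda>x. noise k j x ^ p)"
    "(\<integral>x. (noise k j x)\<^sup>2 \<partial>gauss_space) = 1 / 2^k" "(\<integral>x. noise k j x ^ 4 \<partial>gauss_space) = 3 / 4^k"
proof -
  have m: "(\<lambda>x. (sqrt (1/2^k) * x j) ^ p) \<in> borel_measurable gauss_space" for p
    using measurable_gauss_coord[of j] by simp
  have s4: "sqrt (1/2^k) ^ 4 = (1 / 4^k :: real)"
    by (simp add: power4_eq_xxxx) (simp add: power_divide flip: power_mult_distrib)
  have e: "(\<lambda>x. noise k j x ^ p) = (\<lambda>x. (sqrt (1/2^k) * standard_noise k x j) ^ p)" for p
    using noise_standard[OF j] by simp
  show "integrable gauss_space (\<lambda>x. noise k j x ^ p)"
    unfolding e integral_standard_noise(1)[OF m] using gauss_coord_moment(1)[of j p] by (simp add: power_mult_distrib)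
  show "(\<integral>x. (noise k j x)\<^sup>2 \<partial>gauss_space) = 1 / 2^k" "(\<integral>x. noise k j x ^ 4 \<partial>gauss_space) = 3 / 4^k"
    unfolding e integral_standard_noise(2)[OF m]
    using gauss_coord_moments(2)[of j] gauss_coord_moments(3)[of j] by (simp_all add: power_mult_distrib s4)
qed

text \<open>The isometry on step functions: the noise of a cell of level \<open>k\<close> has
  variance \<open>1 / 2^k\<close>, the length of the cell, and the noises of distinct cells are
  uncorrelated.\<close>

lemma noise_sum_sq: "sq_int gauss_space (noise_sum k a)" "sqn gauss_space (noise_sum k a) = sqn unit_leb (stepf k a)"
proof -
  let ?b = "\<lambda>j. a j * sqrt (1 / 2^k)"
  have m: "(\<lambda>x. (\<Sum>j<2^k. ?b j * x j)\<^sup>2) \<in> borel_measurable gauss_space"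
    using measurable_gauss_coord by (intro borel_measurable_power borel_measurable_sum borel_measurable_times) auto
  show "sq_int gauss_space (noise_sum k a)"
    unfolding sq_int_def using integral_standard_noise(1)[OF m, of k] gauss_linear_sq(1)[where J="{..<2^k}" and b="?b"]
    by (simp add: noise_sum_standard[symmetric])
  have "sqn gauss_space (noise_sum k a) = (\<Sum>j<2^k. (?b j)\<^sup>2)"
    unfolding sqn_def noise_sum_standard integral_standard_noise(2)[OF m] by (rule gauss_linear_sq(2)) simp
  also have "\<dots> = sqn unit_leb (stepf k a)"
    unfolding stepf_sq by (simp add: power_mult_distrib sum_divide_distrib)
  finally show "sqn gauss_space (noise_sum k a) = sqn unit_leb (stepf k a)" .
qed

lemma noise_sum_char:
  "char (distr gauss_space borel (noise_sum k a)) t = complex_of_real (exp (- (t\<^sup>2 * sqn unit_leb (stepf k a)) / 2))"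
proof -
  let ?b = "\<lambda>j. a j * sqrt (1 / 2^k)"
  have mj: "(\<lambda>x. ?b j * x j) \<in> borel_measurable gauss_space" for j using measurable_gauss_coord[of j] by simp
  have ms: "(\<lambda>x. \<Sum>j<2^k. ?b j * x j) \<in> borel_measurable gauss_space" by (intro borel_measurable_sum mj)
  have mi: "(\<lambda>x. iexp (t * (\<Sum>j<2^k. ?b j * x j))) \<in> borel_measurable gauss_space" using ms by measurable
  have "char (distr gauss_space borel (noise_sum k a)) t = (\<integral>x. iexp (t * noise_sum k a x) \<partial>gauss_space)"
    unfolding char_def by (subst integral_distr) auto
  also have "\<dots> = (\<integral>x. iexp (t * (\<Sum>j<2^k. ?b j * x j)) \<partial>gauss_space)"
    unfolding noise_sum_standard by (rule integral_standard_noise(2)[OF mi])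
  also have "\<dots> = char (distr gauss_space borel (\<lambda>x. \<Sum>j<2^k. ?b j * x j)) t"
    unfolding char_def using ms by (subst integral_distr) auto
  also have "\<dots> = (\<Prod>j<2^k. char (distr gauss_space borel (\<lambda>x. ?b j * x j)) t)"
  proof (rule G.char_distr_sum)
    show "G.indep_vars (\<lambda>i. borel) (\<lambda>j x. ?b j * x j) {..<2^k}"
      using G.indep_vars_compose2[OF G.indep_vars_subset[OF gauss_indep, of "{..<2^k}"], of "\<lambda>j y. ?b j * y" "\<lambda>_. borel"] by simp
  qed
  also have "\<dots> = (\<Prod>j<2^k. complex_of_real (exp (- ((t * ?b j)\<^sup>2) / 2)))"
  proof (rule prod.cong[OF refl])
    fix j
    have "char (distr gauss_space borel (\<lambda>x. ?b j * x j)) t = (\<integral>x. iexp (t * (?b j * x j)) \<partial>gauss_space)"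
      unfolding char_def using mj[of j] by (subst integral_distr) auto
    also have "\<dots> = (\<integral>y. iexp (t * (?b j * y)) \<partial>distr gauss_space borel (\<lambda>x. x j))"
      using measurable_gauss_coord[of j] by (subst integral_distr) auto
    also have "\<dots> = char std_normal_distribution (t * ?b j)"
      unfolding distr_gauss_coord char_def by (simp add: mult.assoc)
    finally show "char (distr gauss_space borel (\<lambda>x. ?b j * x j)) t = complex_of_real (exp (- ((t * ?b j)\<^sup>2) / 2))"
      unfolding char_std_normal_distribution .
  qed
  also have "\<dots> = complex_of_real (exp (\<Sum>j<2^k. - ((t * ?b j)\<^sup>2) / 2))" by (simp add: exp_sum)
  also have "(\<Sum>j<2^k. - ((t * ?b j)\<^sup>2) / 2) = - (t\<^sup>2 * sqn unit_leb (stepf k a)) / 2"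
    unfolding stepf_sq by (simp add: power_mult_distrib sum_divide_distrib sum_distrib_left sum_negf)
  finally show ?thesis .
qed

lemma noise_sum_diff_sq:
  "sqn gauss_space (\<lambda>x. noise_sum k a x - noise_sum l b x) = sqn unit_leb (\<lambda>t. stepf k a t - stepf l b t)"
proof -
  obtain m d where d: "\<And>x. -1 * noise_sum l b x + noise_sum k a x = noise_sum m d x"
    "\<And>t. t \<ge> 0 \<Longrightarrow> -1 * stepf l b t + stepf k a t = stepf m d t" using step_lin[of "-1" l b k a] by blast
  have "(\<lambda>x. noise_sum k a x - noise_sum l b x) = noise_sum m d" using d(1) by (auto simp: fun_eq_iff)
  moreover have "sqn unit_leb (\<lambda>t. stepf k a t - stepf l b t) = sqn unit_leb (stepf m d)"
    unfolding sqn_def using d(2) by (intro Bochner_Integration.integral_cong) auto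
  ultimately show ?thesis using noise_sum_sq(2) by simp
qed

section \<open>Density of dyadic step functions in the square integrable functions\<close>

definition step_approx :: "(real \<Rightarrow> real) \<Rightarrow> bool" where
  "step_approx f \<longleftrightarrow> sq_int unit_leb f \<and> (\<forall>e>0. \<exists>k a. sqn unit_leb (\<lambda>t. f t - stepf k a t) < e)"

text \<open>Regularity of Lebesgue measure gives a compact \<open>T\<close> inside and an open
  \<open>V\<close> around \<open>S\<close> that differ by measure less than \<open>e\<close>. The
  cells that meet \<open>T\<close> stay, within \<open>[0, 1]\<close>, inside \<open>V\<close> once
  the mesh is below the distance from \<open>T\<close> to the complement of
  \<open>V\<close>.\<close>

lemma step_approx_indicator:
  assumes S: "S \<in> sets unit_leb"
  shows "step_approx (indicator S)"
  unfolding step_approx_def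
proof (intro conjI allI impI)
  interpret U: prob_space unit_leb by (rule prob_space_unit_leb)
  have S': "S \<in> sets lebesgue" "S \<subseteq> {0..1}" using S by (auto simp: sets_restrict_space_iff)
  have e: "(\<lambda>t. (indicator S t :: real)\<^sup>2) = indicator S" by (auto simp: indicator_def)
  show sqS: "sq_int unit_leb (indicator S)"
    unfolding sq_int_def e using S by (auto intro!: integrable_real_indicator simp: U.emeasure_finite less_top[symmetric])
  fix e :: real assume e: "0 < e"
  then have e2: "0 < e / 2" by simp
  obtain T where T: "closed T" "T \<subseteq> S" "S - T \<in> lmeasurable" "emeasure lebesgue (S - T) < ennreal (e / 2)"
    using sets_lebesgue_inner_closed[OF S'(1) e2] by blast
  obtain V where V: "open V" "S \<subseteq> V" "V - S \<in> lmeasurable" "emeasure lebesgue (V - S) < ennreal (e / 2)"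
    using sets_lebesgue_outer_open[OF S'(1) e2] by blast
  have "compact T" using T S'(2) by (meson bounded_closed_interval bounded_subset compact_eq_bounded_closed order_trans)
  moreover have "closed (- V)" "T \<inter> - V = {}" using V T by auto
  ultimately obtain d where d: "0 < d" "\<And>x y. x \<in> T \<Longrightarrow> y \<in> - V \<Longrightarrow> d \<le> dist x y"
    using separate_compact_closed[of T "- V"] by blast
  obtain k where k: "(1/2::real)^k < d" using real_arch_pow_inv[OF d(1), of "1/2"] by auto
  define a where "a j = (if \<exists>x\<in>T. nat \<lfloor>2^k * x\<rfloor> = j then 1 else 0 :: real)" for j
  define A where "A = {0..1} \<inter> (V - T)"
  have Am: "A \<in> sets lebesgue" unfolding A_def using V T by auto
  have AU: "A \<in> sets unit_leb" using Am unfolding A_def by (auto simp: sets_restrict_space_iff)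
  have pt: "(indicator S t - stepf k a t)\<^sup>2 \<le> indicator A t" if t: "t \<in> {0..1}" for t
  proof -
    have 1: "stepf k a t = 1" if "t \<in> T" using that unfolding stepf_def a_def by auto
    have 2: "stepf k a t = 0" if "t \<notin> V"
    proof (rule ccontr)
      assume "stepf k a t \<noteq> 0"
      then obtain x where x: "x \<in> T" "nat \<lfloor>2^k * x\<rfloor> = nat \<lfloor>2^k * t\<rfloor>" unfolding stepf_def a_def by (auto split: if_splits)
      have "0 \<le> x" using x(1) T(2) S'(2) by auto
      then have "\<lfloor>2^k * x\<rfloor> = \<lfloor>2^k * t\<rfloor>" using x(2) t by (simp add: eq_nat_nat_iff)
      then have "\<bar>2^k * x - 2^k * t\<bar> < 1" by linarith
      then have "2^k * \<bar>x - t\<bar> < 1" by (simp add: abs_mult flip: right_diff_distrib)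
      then have "\<bar>x - t\<bar> < (1/2)^k" by (simp add: power_divide field_simps)
      then show False using d(2)[OF x(1), of t] that k by (simp add: dist_real_def)
    qed
    have "stepf k a t \<in> {0, 1}" unfolding stepf_def a_def by auto
    then show ?thesis using 1 2 T(2) V(2) t unfolding A_def by (auto simp: indicator_def)
  qed
  have "sqn unit_leb (\<lambda>t. indicator S t - stepf k a t) \<le> (\<integral>t. indicator A t \<partial>unit_leb)"
    unfolding sqn_def
  proof (rule integral_mono)
    show "integrable unit_leb (\<lambda>t. (indicator S t - stepf k a t)\<^sup>2)" using sq_int_diff[OF sqS stepf_sq(1)] by blast
    show "integrable unit_leb (indicator A :: real \<Rightarrow> real)" using AU by (auto intro!: integrable_real_indicator simp: U.emeasure_finite less_top[symmetric])
  qed (use pt in auto)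
  also have "\<dots> = measure lebesgue A" using Am unfolding A_def by (simp add: measure_restrict_space Int_absorb1 Int_absorb2)
  also have "\<dots> < e"
  proof -
    have "A \<subseteq> (V - S) \<union> (S - T)" unfolding A_def by auto
    then have "emeasure lebesgue A \<le> emeasure lebesgue ((V - S) \<union> (S - T))" using V T by (intro emeasure_mono) auto
    also have "\<dots> \<le> emeasure lebesgue (V - S) + emeasure lebesgue (S - T)" using V T by (intro emeasure_subadditive) auto
    also have "\<dots> < ennreal (e / 2) + ennreal (e / 2)" by (rule add_strict_mono) fact+
    also have "\<dots> = ennreal e" using e by (subst ennreal_plus[symmetric]) auto
    finally have "emeasure lebesgue A < ennreal e" .
    then show ?thesis using e unfolding measure_def
      by (metis enn2real_ennreal ennreal_enn2real ennreal_less_iff ennreal_less_top less_trans enn2real_nonneg not_less_iff_gr_or_eq top.not_eq_extremum less_eq_real_def)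
  qed
  finally show "\<exists>k a. sqn unit_leb (\<lambda>t. indicator S t - stepf k a t) < e" by blast
qed

lemma step_approx_lin:
  assumes f: "step_approx f" and g: "step_approx g"
  shows "step_approx (\<lambda>t. c * f t + g t)"
  unfolding step_approx_def
proof (intro conjI allI impI)
  have sf: "sq_int unit_leb f" "sq_int unit_leb g" using f g unfolding step_approx_def by auto
  then show "sq_int unit_leb (\<lambda>t. c * f t + g t)" by (rule sq_int_lin)
  fix e :: real assume e: "0 < e"
  \<comment> \<open>The two errors enter with weights \<open>2 * c\<^sup>2\<close> and 2, so the
    total is half of \<open>e\<close>.\<close>
  define e1 where "e1 = e / (4 * c\<^sup>2 + 4)"
  have p: "0 < 4 * c\<^sup>2 + 4" by (simp add: add_nonneg_pos)
  then have eq: "(4 * c\<^sup>2 + 4) * e1 = e" unfolding e1_def by simp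
  have "(2 * c\<^sup>2 + 2) * e1 = ((4 * c\<^sup>2 + 4) * e1) / 2" by (simp add: algebra_simps)
  then have e1: "0 < e1" "(2 * c\<^sup>2 + 2) * e1 < e"
    using e p unfolding eq by (simp_all add: e1_def)
  obtain k a where a: "sqn unit_leb (\<lambda>t. f t - stepf k a t) < e1" using f e1 unfolding step_approx_def by blast
  obtain m b where b: "sqn unit_leb (\<lambda>t. g t - stepf m b t) < e1" using g e1 unfolding step_approx_def by blast
  obtain l d where d: "\<forall>t\<ge>0. c * stepf k a t + stepf m b t = stepf l d t" using step_lin[of c k a m b] by blast
  have "sqn unit_leb (\<lambda>t. c * f t + g t - stepf l d t) = sqn unit_leb (\<lambda>t. c * (f t - stepf k a t) + (g t - stepf m b t))"
    unfolding sqn_def using d by (intro Bochner_Integration.integral_cong) (auto simp: algebra_simps power2_eq_square simp flip: d[rule_format])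
  also have "\<dots> \<le> 2 * c\<^sup>2 * sqn unit_leb (\<lambda>t. f t - stepf k a t) + 2 * sqn unit_leb (\<lambda>t. g t - stepf m b t)"
    by (intro sqn_lin_le sq_int_diff sf stepf_sq)
  also have "\<dots> \<le> 2 * c\<^sup>2 * e1 + 2 * e1" using a b by (intro add_mono mult_left_mono) auto
  also have "\<dots> < e" using e1(2) by (simp add: distrib_right)
  finally show "\<exists>k a. sqn unit_leb (\<lambda>t. c * f t + g t - stepf k a t) < e" by blast
qed

lemma sqn_unit_leb_cong: "(\<And>t. t \<in> {0..1} \<Longrightarrow> f t = g t) \<Longrightarrow> sqn unit_leb f = sqn unit_leb g"
  unfolding sqn_def by (intro Bochner_Integration.integral_cong) auto

lemma sq_int_unit_leb_cong: "(\<And>t. t \<in> {0..1} \<Longrightarrow> f t = g t) \<Longrightarrow> sq_int unit_leb f = sq_int unit_leb g"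
  unfolding sq_int_def by (intro conj_cong measurable_cong Bochner_Integration.integrable_cong) auto

text \<open>Simple functions with \<open>\<bar>s i\<bar> \<le> 2 * \<bar>f\<bar>\<close> converge
  pointwise to \<open>f\<close>, and \<open>(s i - f)\<^sup>2\<close> is dominated by
  \<open>9 * f\<^sup>2\<close>. Each of them is a finite combination of indicators.\<close>

lemma step_approx_dense:
  assumes f: "sq_int unit_leb f"
  shows "step_approx f"
  unfolding step_approx_def
proof (intro conjI allI impI f)
  fix e :: real assume e: "0 < e"
  obtain s where s: "\<And>i::nat. simple_function unit_leb (s i)" "\<And>t. t \<in> {0..1} \<Longrightarrow> (\<lambda>i. s i t) \<longlonglongrightarrow> f t"
    "\<And>i t. t \<in> {0..1} \<Longrightarrow> dist (s i t) 0 \<le> 2 * dist (f t) 0"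
  proof -
    obtain s where "(\<forall>i. simple_function unit_leb (s i)) \<and> (\<forall>t\<in>space unit_leb. (\<lambda>i. s i t) \<longlonglongrightarrow> f t) \<and>
      (\<forall>i. \<forall>t\<in>space unit_leb. dist (s i t) 0 \<le> 2 * dist (f t) 0)"
      using borel_measurable_implies_sequence_metric[OF sq_intD(1)[OF f], of 0] by blast
    then show ?thesis by (intro that[of s]) (simp_all only: space_lebesgue_on)
  qed
  have zero: "step_approx (\<lambda>_. 0)"
  proof -
    have "(indicator {} :: real \<Rightarrow> real) = (\<lambda>_. 0)" by auto
    then show ?thesis using step_approx_indicator[of "{}"] by simp
  qed
  have lin: "step_approx (\<lambda>t. \<Sum>y\<in>Y. y * indicator (A y) t)" if "finite Y" "\<And>y. A y \<in> sets unit_leb" for Y and A :: "real \<Rightarrow> real set"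
    using that(1)
  proof (induction Y)
    case (insert y Y)
    then show ?case using step_approx_lin[OF step_approx_indicator[OF that(2)] insert.IH, of y y]
      unfolding sum.insert[OF insert.hyps(1,2)] by blast
  qed (use zero in simp)
  have ss: "sq_int unit_leb (s i) \<and> step_approx (s i)" for i
  proof -
    let ?g = "\<lambda>t. \<Sum>y\<in>s i ` {0..1}. y * indicator (s i -` {y} \<inter> {0..1}) t"
    have fin: "finite (s i ` {0..1})" using simple_functionD(1)[OF s(1)[of i]] by simp
    have "step_approx ?g" using simple_functionD(2)[OF s(1)[of i]] by (intro lin fin) auto
    moreover have eq: "?g t = s i t" if t: "t \<in> {0..1}" for t
    proof -
      have "?g t = (\<Sum>y\<in>s i ` {0..1}. if y = s i t then y else 0)" using t by (intro sum.cong) (auto simp: indicator_def)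
      then show ?thesis using fin t by simp
    qed
    have c: "sqn unit_leb (\<lambda>t. ?g t - stepf k a t) = sqn unit_leb (\<lambda>t. s i t - stepf k a t)" for k a
      by (rule sqn_unit_leb_cong) (simp only: eq)
    have "sq_int unit_leb ?g = sq_int unit_leb (s i)" by (rule sq_int_unit_leb_cong) (rule eq)
    ultimately show ?thesis unfolding step_approx_def c by simp
  qed
  have "(\<lambda>i. sqn unit_leb (\<lambda>t. s i t - f t)) \<longlonglongrightarrow> (\<integral>t. 0 \<partial>unit_leb)"
    unfolding sqn_def
  proof (rule integral_dominated_convergence[where w="\<lambda>t. 9 * (f t)\<^sup>2"])
    show "AE t in unit_leb. (\<lambda>i. (s i t - f t)\<^sup>2) \<longlonglongrightarrow> 0"
    proof (rule AE_I2)
      fix t assume "t \<in> space unit_leb"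
      then have "(\<lambda>i. (s i t - f t)\<^sup>2) \<longlonglongrightarrow> (f t - f t)\<^sup>2" using s(2)[of t] by (intro tendsto_intros) auto
      then show "(\<lambda>i. (s i t - f t)\<^sup>2) \<longlonglongrightarrow> 0" by simp
    qed
    show "AE t in unit_leb. norm ((s i t - f t)\<^sup>2) \<le> 9 * (f t)\<^sup>2" for i
    proof (rule AE_I2)
      fix t assume "t \<in> space unit_leb"
      then have "\<bar>s i t - f t\<bar> \<le> 3 * \<bar>f t\<bar>" using s(3)[of t i] by (simp add: dist_real_def)
      from power_mono[OF this, of 2] show "norm ((s i t - f t)\<^sup>2) \<le> 9 * (f t)\<^sup>2" by (simp add: power_mult_distrib)
    qed
  qed (use sq_intD[OF f] sq_intD[OF conjunct1[OF ss]] in auto)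
  then have "(\<lambda>i. sqn unit_leb (\<lambda>t. s i t - f t)) \<longlonglongrightarrow> 0" by simp
  then have "eventually (\<lambda>i. sqn unit_leb (\<lambda>t. s i t - f t) < e / 4) sequentially"
    using e by (intro order_tendstoD(2)) auto
  then obtain i where i: "sqn unit_leb (\<lambda>t. s i t - f t) < e / 4" by (auto simp: eventually_sequentially)
  have "0 < e / 4" using e by simp
  then obtain k a where ka: "sqn unit_leb (\<lambda>t. s i t - stepf k a t) < e / 4" using ss[of i] unfolding step_approx_def by blast
  have "sqn unit_leb (\<lambda>t. f t - stepf k a t) \<le> 2 * sqn unit_leb (\<lambda>t. f t - s i t) + 2 * sqn unit_leb (\<lambda>t. s i t - stepf k a t)"
    using f ss by (intro sqn_diff_le stepf_sq) auto
  also have "\<dots> < e" using i ka by (simp add: sqn_diff_commute[of unit_leb f])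
  finally show "\<exists>k a. sqn unit_leb (\<lambda>t. f t - stepf k a t) < e" by blast
qed

text \<open>\<open>wiener_rep f Y\<close> says that \<open>Y\<close> is the white noise integral of \<open>f\<close>, that is the mean square limit
  of the white noise integrals of step functions approximating \<open>f\<close>.\<close>

definition wiener_rep :: "(real \<Rightarrow> real) \<Rightarrow> ((nat \<Rightarrow> real) \<Rightarrow> real) \<Rightarrow> bool" where
  "wiener_rep f Y \<longleftrightarrow> sq_int unit_leb f \<and> sq_int gauss_space Y \<and>
     (\<exists>k a. (\<lambda>n. sqn unit_leb (\<lambda>t. f t - stepf (k n) (a n) t)) \<longlonglongrightarrow> 0 \<and>
            (\<lambda>n. sqn gauss_space (\<lambda>x. Y x - noise_sum (k n) (a n) x)) \<longlonglongrightarrow> (0::real))"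

lemma wiener_rep_lin:
  assumes f: "wiener_rep f Y" and g: "wiener_rep g Z"
  shows "wiener_rep (\<lambda>t. c * f t + g t) (\<lambda>x. c * Y x + Z x)"
proof -
  have sq: "sq_int unit_leb f" "sq_int unit_leb g" "sq_int gauss_space Y" "sq_int gauss_space Z"
    using f g unfolding wiener_rep_def by auto
  obtain k a where ka: "(\<lambda>n. sqn unit_leb (\<lambda>t. f t - stepf (k n) (a n) t)) \<longlonglongrightarrow> 0"
    "(\<lambda>n. sqn gauss_space (\<lambda>x. Y x - noise_sum (k n) (a n) x)) \<longlonglongrightarrow> 0" using f unfolding wiener_rep_def by auto
  obtain m b where mb: "(\<lambda>n. sqn unit_leb (\<lambda>t. g t - stepf (m n) (b n) t)) \<longlonglongrightarrow> 0"
    "(\<lambda>n. sqn gauss_space (\<lambda>x. Z x - noise_sum (m n) (b n) x)) \<longlonglongrightarrow> 0" using g unfolding wiener_rep_def by auto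
  have "\<forall>n. \<exists>l d. (\<forall>x. c * noise_sum (k n) (a n) x + noise_sum (m n) (b n) x = noise_sum l d x) \<and>
         (\<forall>t\<ge>0. c * stepf (k n) (a n) t + stepf (m n) (b n) t = stepf l d t)"
    using step_lin by blast
  then obtain l d where ld: "\<And>n x. c * noise_sum (k n) (a n) x + noise_sum (m n) (b n) x = noise_sum (l n) (d n) x"
    "\<And>n t. t \<ge> 0 \<Longrightarrow> c * stepf (k n) (a n) t + stepf (m n) (b n) t = stepf (l n) (d n) t" by metis
  have lim: "(\<lambda>n. 2 * c\<^sup>2 * u n + 2 * v n) \<longlonglongrightarrow> 0" if "u \<longlonglongrightarrow> 0" "v \<longlonglongrightarrow> 0" for u v :: "nat \<Rightarrow> real"
  proof -
    have "(\<lambda>n. 2 * c\<^sup>2 * u n + 2 * v n) \<longlonglongrightarrow> 2 * c\<^sup>2 * 0 + 2 * 0" by (intro tendsto_intros that)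
    then show ?thesis by simp
  qed
  have 1: "(\<lambda>n. sqn unit_leb (\<lambda>t. c * f t + g t - stepf (l n) (d n) t)) \<longlonglongrightarrow> 0"
  proof (rule tendsto_sandwich[OF _ _ tendsto_const lim[OF ka(1) mb(1)]])
    have "sqn unit_leb (\<lambda>t. c * f t + g t - stepf (l n) (d n) t)
      \<le> 2 * c\<^sup>2 * sqn unit_leb (\<lambda>t. f t - stepf (k n) (a n) t) + 2 * sqn unit_leb (\<lambda>t. g t - stepf (m n) (b n) t)" for n
    proof -
      have "sqn unit_leb (\<lambda>t. c * f t + g t - stepf (l n) (d n) t) = sqn unit_leb (\<lambda>t. c * (f t - stepf (k n) (a n) t) + (g t - stepf (m n) (b n) t))"
        by (rule sqn_unit_leb_cong) (simp add: ld(2)[symmetric] algebra_simps)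
      then show ?thesis using sqn_lin_le[OF sq_int_diff[OF sq(1) stepf_sq(1)] sq_int_diff[OF sq(2) stepf_sq(1)], of c] by simp
    qed
    then show "eventually (\<lambda>n. sqn unit_leb (\<lambda>t. c * f t + g t - stepf (l n) (d n) t)
      \<le> 2 * c\<^sup>2 * sqn unit_leb (\<lambda>t. f t - stepf (k n) (a n) t) + 2 * sqn unit_leb (\<lambda>t. g t - stepf (m n) (b n) t)) sequentially" by simp
  qed (simp add: sqn_nonneg)
  have 2: "(\<lambda>n. sqn gauss_space (\<lambda>x. c * Y x + Z x - noise_sum (l n) (d n) x)) \<longlonglongrightarrow> 0"
  proof (rule tendsto_sandwich[OF _ _ tendsto_const lim[OF ka(2) mb(2)]])
    have "sqn gauss_space (\<lambda>x. c * Y x + Z x - noise_sum (l n) (d n) x)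
      \<le> 2 * c\<^sup>2 * sqn gauss_space (\<lambda>x. Y x - noise_sum (k n) (a n) x) + 2 * sqn gauss_space (\<lambda>x. Z x - noise_sum (m n) (b n) x)" for n
    proof -
      have "(\<lambda>x. c * Y x + Z x - noise_sum (l n) (d n) x) = (\<lambda>x. c * (Y x - noise_sum (k n) (a n) x) + (Z x - noise_sum (m n) (b n) x))"
        by (simp add: ld(1)[symmetric] algebra_simps)
      then show ?thesis using sqn_lin_le[OF sq_int_diff[OF sq(3) noise_sum_sq(1)] sq_int_diff[OF sq(4) noise_sum_sq(1)], of c] by simp
    qed
    then show "eventually (\<lambda>n. sqn gauss_space (\<lambda>x. c * Y x + Z x - noise_sum (l n) (d n) x)
      \<le> 2 * c\<^sup>2 * sqn gauss_space (\<lambda>x. Y x - noise_sum (k n) (a n) x) + 2 * sqn gauss_space (\<lambda>x. Z x - noise_sum (m n) (b n) x)) sequentially" by simp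
  qed (simp add: sqn_nonneg)
  show ?thesis unfolding wiener_rep_def using 1 2 sq_int_lin(1)[OF sq(1,2)] sq_int_lin(1)[OF sq(3,4)] by blast
qed

lemma wiener_rep_sqn:
  assumes "wiener_rep f Y"
  shows "sqn gauss_space Y = sqn unit_leb f"
proof -
  have sq: "sq_int unit_leb f" "sq_int gauss_space Y" using assms unfolding wiener_rep_def by auto
  obtain k a where ka: "(\<lambda>n. sqn unit_leb (\<lambda>t. f t - stepf (k n) (a n) t)) \<longlonglongrightarrow> 0"
    "(\<lambda>n. sqn gauss_space (\<lambda>x. Y x - noise_sum (k n) (a n) x)) \<longlonglongrightarrow> 0" using assms unfolding wiener_rep_def by auto
  have "(\<lambda>n. sqn unit_leb (stepf (k n) (a n))) \<longlonglongrightarrow> sqn unit_leb f"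
    using ka(1) by (intro sqn_tendsto stepf_sq sq) (simp add: sqn_diff_commute[of unit_leb f])
  moreover have "(\<lambda>n. sqn gauss_space (noise_sum (k n) (a n))) \<longlonglongrightarrow> sqn gauss_space Y"
    using ka(2) by (intro sqn_tendsto noise_sum_sq sq) (simp add: sqn_diff_commute[of gauss_space Y])
  ultimately show ?thesis unfolding noise_sum_sq(2) by (rule LIMSEQ_unique[symmetric])
qed

text \<open>Polarisation of the isometry, applied to the sum of the two functions.\<close>

lemma wiener_rep_covariance:
  assumes f: "wiener_rep f Y" and g: "wiener_rep g Z"
  shows "(\<integral>x. Y x * Z x \<partial>gauss_space) = (\<integral>t. f t * g t \<partial>unit_leb)"
proof -
  have sq: "sq_int unit_leb f" "sq_int unit_leb g" "sq_int gauss_space Y" "sq_int gauss_space Z"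
    using f g unfolding wiener_rep_def by auto
  show ?thesis
    using wiener_rep_sqn[OF wiener_rep_lin[OF f g, of 1]] wiener_rep_sqn[OF f] wiener_rep_sqn[OF g]
      sq_int_lin(2)[OF sq(1,2), of 1] sq_int_lin(2)[OF sq(3,4), of 1] by simp
qed

lemma sqn_zero_AE:
  assumes "sq_int M Y" "sqn M Y = 0"
  shows "AE x in M. Y x = 0"
proof -
  have "AE x in M. (Y x)\<^sup>2 = 0"
    using assms unfolding sqn_def by (subst integral_nonneg_eq_0_iff_AE[symmetric]) auto
  then show ?thesis by simp
qed

text \<open>By linearity the difference represents the zero function and so has norm 0. This is what
  later identifies \<open>limit_process\<close> with the isonormal process for each
  \<open>f\<close>.\<close>

lemma wiener_rep_unique:
  assumes "wiener_rep f Y" "wiener_rep f Z"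
  shows "AE x in gauss_space. Y x = Z x"
proof -
  let ?D = "\<lambda>x. -1 * Z x + Y x"
  have r: "wiener_rep (\<lambda>t. -1 * f t + f t) ?D" by (rule wiener_rep_lin[OF assms(2,1)])
  have "sqn unit_leb (\<lambda>t. -1 * f t + f t) = 0" unfolding sqn_def by simp
  then have "sqn gauss_space ?D = 0" using wiener_rep_sqn[OF r] by simp
  moreover have "sq_int gauss_space ?D" using r unfolding wiener_rep_def by blast
  ultimately have "AE x in gauss_space. ?D x = 0" by (intro sqn_zero_AE)
  then show ?thesis by simp
qed

section \<open>Gaussian laws, existence of the integral and the isonormal process\<close>

lemma G_L1_le:
  assumes "sq_int gauss_space g" "0 < r"
  shows "integrable gauss_space (\<lambda>x. \<bar>g x\<bar>)" "(\<integral>x. \<bar>g x\<bar> \<partial>gauss_space) \<le> r + sqn gauss_space g / r"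
proof -
  show i: "integrable gauss_space (\<lambda>x. \<bar>g x\<bar>)"
    using G.square_integrable_imp_integrable[OF sq_intD[OF assms(1)]] by simp
  have "(\<integral>x. \<bar>g x\<bar> \<partial>gauss_space) \<le> (\<integral>x. r + (g x)\<^sup>2 / r \<partial>gauss_space)"
  proof (rule integral_mono[OF i])
    fix x
    show "\<bar>g x\<bar> \<le> r + (g x)\<^sup>2 / r"
    proof (cases "\<bar>g x\<bar> \<le> r")
      case False
      then have "\<bar>g x\<bar> * r \<le> \<bar>g x\<bar> * \<bar>g x\<bar>" by (intro mult_left_mono) auto
      then have "\<bar>g x\<bar> \<le> (g x)\<^sup>2 / r" using assms(2) by (simp add: pos_le_divide_eq power2_eq_square)
      then show ?thesis using assms(2) by simp
    qed (use assms(2) in \<open>simp add: add_increasing2\<close>)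
  qed (use assms(1) in auto)
  also have "\<dots> = r + sqn gauss_space g / r" unfolding sqn_def using sq_intD(2)[OF assms(1)] G.prob_space by simp
  finally show "(\<integral>x. \<bar>g x\<bar> \<partial>gauss_space) \<le> r + sqn gauss_space g / r" .
qed

lemma L1_from_L2_tendsto:
  assumes g: "\<And>n. sq_int gauss_space (g n)" and lim: "(\<lambda>n. sqn gauss_space (g n)) \<longlonglongrightarrow> 0"
  shows "(\<lambda>n. \<integral>x. \<bar>g n x\<bar> \<partial>gauss_space) \<longlonglongrightarrow> 0"
proof (rule LIMSEQ_I)
  fix e :: real assume e: "0 < e"
  then have "eventually (\<lambda>n. sqn gauss_space (g n) < e * e / 4) sequentially"
    by (intro order_tendstoD(2)[OF lim]) auto
  then obtain N where N: "\<And>n. n \<ge> N \<Longrightarrow> sqn gauss_space (g n) < e * e / 4" by (auto simp: eventually_sequentially)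
  have "norm ((\<integral>x. \<bar>g n x\<bar> \<partial>gauss_space) - 0) < e" if "n \<ge> N" for n
  proof -
    have "(\<integral>x. \<bar>g n x\<bar> \<partial>gauss_space) \<le> e / 2 + sqn gauss_space (g n) / (e / 2)"
      using e by (intro G_L1_le(2) g) auto
    also have "\<dots> < e / 2 + (e * e / 4) / (e / 2)" using N[OF that] e by (intro add_strict_left_mono divide_strict_right_mono) auto
    also have "\<dots> = e" using e by simp
    finally show ?thesis by simp
  qed
  then show "\<exists>N. \<forall>n\<ge>N. norm ((\<integral>x. \<bar>g n x\<bar> \<partial>gauss_space) - 0) < e" by blast
qed

lemma iexp_diff_le: "cmod (iexp u - iexp v) \<le> \<bar>u - v\<bar>"
proof -
  have "iexp u - iexp v = iexp v * (iexp (u - v) - 1)" by (simp add: algebra_simps flip: exp_add)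
  then have "cmod (iexp u - iexp v) = cmod (iexp (u - v) - 1)" by (simp add: norm_mult)
  also have "\<dots> \<le> \<bar>u - v\<bar>" using iexp_approx1[of "u - v" 0] by simp
  finally show ?thesis .
qed

text \<open>Characteristic functions are Lipschitz with respect to the mean absolute difference, so
  mean square convergence carries the explicit formula for step functions to the limit.\<close>

lemma wiener_rep_char:
  assumes "wiener_rep f Y"
  shows "char (distr gauss_space borel Y) t = complex_of_real (exp (- (t\<^sup>2 * sqn unit_leb f) / 2))"
proof -
  have sq: "sq_int unit_leb f" "sq_int gauss_space Y" using assms unfolding wiener_rep_def by auto
  note [measurable] = sq_intD(1)[OF sq(2)]
  obtain k a where ka: "(\<lambda>n. sqn unit_leb (\<lambda>t. f t - stepf (k n) (a n) t)) \<longlonglongrightarrow> 0"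
    "(\<lambda>n. sqn gauss_space (\<lambda>x. Y x - noise_sum (k n) (a n) x)) \<longlonglongrightarrow> 0" using assms unfolding wiener_rep_def by auto
  have "(\<lambda>n. sqn unit_leb (stepf (k n) (a n))) \<longlonglongrightarrow> sqn unit_leb f"
    using ka(1) by (intro sqn_tendsto stepf_sq sq) (simp add: sqn_diff_commute[of unit_leb f])
  then have "(\<lambda>n. char (distr gauss_space borel (noise_sum (k n) (a n))) t) \<longlonglongrightarrow> complex_of_real (exp (- (t\<^sup>2 * sqn unit_leb f) / 2))"
    unfolding noise_sum_char by (intro tendsto_intros) auto
  moreover have "(\<lambda>n. char (distr gauss_space borel (noise_sum (k n) (a n))) t) \<longlonglongrightarrow> char (distr gauss_space borel Y) t"
  proof (rule LIM_zero_cancel, rule Lim_null_comparison)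
    have "cmod (char (distr gauss_space borel (noise_sum (k n) (a n))) t - char (distr gauss_space borel Y) t)
       \<le> \<bar>t\<bar> * (\<integral>x. \<bar>Y x - noise_sum (k n) (a n) x\<bar> \<partial>gauss_space)" for n
    proof -
      have ib: "integrable gauss_space (\<lambda>x. iexp (t * Z x))" if [measurable]: "Z \<in> borel_measurable gauss_space" for Z
        by (intro G.integrable_const_bound[where B=1]) auto
      have "char (distr gauss_space borel (noise_sum (k n) (a n))) t - char (distr gauss_space borel Y) t
        = (\<integral>x. iexp (t * noise_sum (k n) (a n) x) \<partial>gauss_space) - (\<integral>x. iexp (t * Y x) \<partial>gauss_space)"
        unfolding char_def by (simp add: integral_distr)
      also have "\<dots> = (\<integral>x. iexp (t * noise_sum (k n) (a n) x) - iexp (t * Y x) \<partial>gauss_space)"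
        by (rule Bochner_Integration.integral_diff[symmetric]; rule ib; measurable)
      also have "cmod \<dots> \<le> (\<integral>x. cmod (iexp (t * noise_sum (k n) (a n) x) - iexp (t * Y x)) \<partial>gauss_space)"
        by (rule integral_norm_bound)
      also have "\<dots> \<le> (\<integral>x. \<bar>t\<bar> * \<bar>Y x - noise_sum (k n) (a n) x\<bar> \<partial>gauss_space)"
      proof (rule integral_mono)
        show "integrable gauss_space (\<lambda>x. cmod (iexp (t * noise_sum (k n) (a n) x) - iexp (t * Y x)))"
          by (intro integrable_norm Bochner_Integration.integrable_diff ib) auto
        show "integrable gauss_space (\<lambda>x. \<bar>t\<bar> * \<bar>Y x - noise_sum (k n) (a n) x\<bar>)"
          by (intro integrable_mult_right G_L1_le(1)[of _ 1] sq_int_diff sq noise_sum_sq) simp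
        show "cmod (iexp (t * noise_sum (k n) (a n) x) - iexp (t * Y x)) \<le> \<bar>t\<bar> * \<bar>Y x - noise_sum (k n) (a n) x\<bar>" for x
          using iexp_diff_le[of "t * noise_sum (k n) (a n) x" "t * Y x"] by (simp add: abs_mult abs_minus_commute flip: right_diff_distrib)
      qed
      also have "\<dots> = \<bar>t\<bar> * (\<integral>x. \<bar>Y x - noise_sum (k n) (a n) x\<bar> \<partial>gauss_space)" by simp
      finally show ?thesis .
    qed
    then show "eventually (\<lambda>n. cmod (char (distr gauss_space borel (noise_sum (k n) (a n))) t - char (distr gauss_space borel Y) t)
       \<le> \<bar>t\<bar> * (\<integral>x. \<bar>Y x - noise_sum (k n) (a n) x\<bar> \<partial>gauss_space)) sequentially" by simp
    have "(\<lambda>n. \<bar>t\<bar> * (\<integral>x. \<bar>Y x - noise_sum (k n) (a n) x\<bar> \<partial>gauss_space)) \<longlonglongrightarrow> \<bar>t\<bar> * 0"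
      by (intro tendsto_mult tendsto_const L1_from_L2_tendsto sq_int_diff sq noise_sum_sq ka)
    then show "(\<lambda>n. \<bar>t\<bar> * (\<integral>x. \<bar>Y x - noise_sum (k n) (a n) x\<bar> \<partial>gauss_space)) \<longlonglongrightarrow> 0" by simp
  qed
  ultimately show ?thesis by (rule LIMSEQ_unique[symmetric])
qed

text \<open>The two alternatives in \<open>centred_gaussian_rv\<close> correspond to a vanishing and
  a positive norm of \<open>f\<close>; in the second case \<open>Y / s\<close> is recognised as
  standard normal by its characteristic function.\<close>

lemma wiener_rep_gaussian:
  assumes r: "wiener_rep f Y"
  shows "centred_gaussian_rv gauss_space Y"
proof -
  have sq: "sq_int unit_leb f" "sq_int gauss_space Y" using r unfolding wiener_rep_def by auto
  note Ym[measurable] = sq_intD(1)[OF sq(2)]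
  show ?thesis
  proof (cases "sqn unit_leb f = 0")
    case True
    then show ?thesis unfolding centred_gaussian_rv_def using sqn_zero_AE[OF sq(2)] wiener_rep_sqn[OF r] by simp
  next
    case False
    define s where "s = sqrt (sqn unit_leb f)"
    have s: "0 < s" "s\<^sup>2 = sqn unit_leb f" unfolding s_def using False sqn_nonneg[of unit_leb f] by auto
    have "distr gauss_space borel (\<lambda>x. Y x / s) = std_normal_distribution"
    proof (rule Levy_uniqueness)
      show "real_distribution (distr gauss_space borel (\<lambda>x. Y x / s))" by (intro G.real_distribution_distr) measurable
      show "real_distribution std_normal_distribution" by (rule real_dist_normal_dist)
      show "char (distr gauss_space borel (\<lambda>x. Y x / s)) = char std_normal_distribution"
      proof
        fix t
        have "char (distr gauss_space borel (\<lambda>x. Y x / s)) t = char (distr gauss_space borel Y) (t / s)"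
          unfolding char_def by (simp add: integral_distr)
        also have "\<dots> = complex_of_real (exp (- t\<^sup>2 / 2))" unfolding wiener_rep_char[OF r] s(2)[symmetric]
          using s(1) by (simp add: power_divide)
        finally show "char (distr gauss_space borel (\<lambda>x. Y x / s)) t = char std_normal_distribution t"
          unfolding char_std_normal_distribution by simp
      qed
    qed
    moreover have "distr gauss_space lborel (\<lambda>x. Y x / s) = distr gauss_space borel (\<lambda>x. Y x / s)" by (rule distr_cong) auto
    ultimately have "distributed gauss_space lborel (\<lambda>x. (Y x - 0) / s) std_normal_density"
      unfolding distributed_def by auto
    then have "distributed gauss_space lborel Y (normal_density 0 s)"
      using G.normal_standard_normal_convert[OF s(1), of Y 0] by blast
    then show ?thesis unfolding centred_gaussian_rv_def using s(1) by auto
  qed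
qed

text \<open>Completeness is used in the form of Fatou's lemma along an almost surely convergent sequence.\<close>

lemma wiener_rep_limit:
  assumes f: "sq_int unit_leb f" and Y[measurable]: "Y \<in> borel_measurable gauss_space"
    and lim: "(\<lambda>n. sqn unit_leb (\<lambda>t. f t - stepf (k n) (a n) t)) \<longlonglongrightarrow> 0"
    and ae: "AE x in gauss_space. (\<lambda>n. noise_sum (k n) (a n) x) \<longlonglongrightarrow> Y x"
  shows "wiener_rep f Y"
proof -
  let ?I = "\<lambda>n. noise_sum (k n) (a n)"
  have close: "\<exists>N. \<forall>n\<ge>N. sq_int gauss_space (\<lambda>x. Y x - ?I n x) \<and> sqn gauss_space (\<lambda>x. Y x - ?I n x) \<le> e" if e: "0 < e" for e
  proof -
    have "eventually (\<lambda>n. sqn unit_leb (\<lambda>t. f t - stepf (k n) (a n) t) < e / 4) sequentially"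
      using e by (intro order_tendstoD(2)[OF lim]) auto
    then obtain N where N: "\<And>n. n \<ge> N \<Longrightarrow> sqn unit_leb (\<lambda>t. f t - stepf (k n) (a n) t) < e / 4" by (auto simp: eventually_sequentially)
    show ?thesis
    proof (intro exI[of _ N] allI impI)
      fix n assume n: "N \<le> n"
      have d: "sq_int gauss_space (\<lambda>x. ?I m x - ?I n x)" for m by (intro sq_int_diff noise_sum_sq)
      have "(\<integral>\<^sup>+x. ennreal ((Y x - ?I n x)\<^sup>2) \<partial>gauss_space) \<le> (\<integral>\<^sup>+x. liminf (\<lambda>m. ennreal ((?I m x - ?I n x)\<^sup>2)) \<partial>gauss_space)"
      proof (rule nn_integral_mono_AE)
        show "AE x in gauss_space. ennreal ((Y x - ?I n x)\<^sup>2) \<le> liminf (\<lambda>m. ennreal ((?I m x - ?I n x)\<^sup>2))"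
          using ae
        proof eventually_elim
          case (elim x)
          then have "(\<lambda>m. ennreal ((?I m x - ?I n x)\<^sup>2)) \<longlonglongrightarrow> ennreal ((Y x - ?I n x)\<^sup>2)"
            by (intro tendsto_ennrealI tendsto_intros)
          from lim_imp_Liminf[OF sequentially_bot this] show ?case by simp
        qed
      qed
      also have "\<dots> \<le> liminf (\<lambda>m. \<integral>\<^sup>+x. ennreal ((?I m x - ?I n x)\<^sup>2) \<partial>gauss_space)"
        by (rule nn_integral_liminf) measurable
      also have "\<dots> \<le> ennreal e"
      proof (rule Liminf_le)
        show "eventually (\<lambda>m. (\<integral>\<^sup>+x. ennreal ((?I m x - ?I n x)\<^sup>2) \<partial>gauss_space) \<le> ennreal e) sequentially"
        proof (rule eventually_sequentiallyI[of N])
          fix m assume m: "N \<le> m"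
          have "(\<integral>\<^sup>+x. ennreal ((?I m x - ?I n x)\<^sup>2) \<partial>gauss_space) = ennreal (sqn gauss_space (\<lambda>x. ?I m x - ?I n x))"
            unfolding sqn_def using sq_intD(2)[OF d] by (intro nn_integral_eq_integral) auto
          \<comment> \<open>By the isometry the noise sums inherit the Cauchy property of the step
            functions; \<open>e / 4\<close> allows for the factors 2.\<close>
          also have "sqn gauss_space (\<lambda>x. ?I m x - ?I n x) = sqn unit_leb (\<lambda>t. stepf (k m) (a m) t - stepf (k n) (a n) t)"
            by (rule noise_sum_diff_sq)
          also have "\<dots> \<le> 2 * sqn unit_leb (\<lambda>t. stepf (k m) (a m) t - f t) + 2 * sqn unit_leb (\<lambda>t. f t - stepf (k n) (a n) t)"
            by (intro sqn_diff_le stepf_sq f)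
          also have "\<dots> \<le> e" using N[OF m] N[OF n] unfolding sqn_diff_commute[of unit_leb "stepf (k m) (a m)"] by linarith
          finally show "(\<integral>\<^sup>+x. ennreal ((?I m x - ?I n x)\<^sup>2) \<partial>gauss_space) \<le> ennreal e" by (simp add: ennreal_leI)
        qed
      qed simp
      finally have le: "(\<integral>\<^sup>+x. ennreal ((Y x - ?I n x)\<^sup>2) \<partial>gauss_space) \<le> ennreal e" .
      have int: "integrable gauss_space (\<lambda>x. (Y x - ?I n x)\<^sup>2)"
        by (rule integrableI_nonneg) (use le in \<open>auto simp: le_less_trans\<close>)
      have "ennreal (sqn gauss_space (\<lambda>x. Y x - ?I n x)) \<le> ennreal e"
        unfolding sqn_def using le int by (subst (asm) nn_integral_eq_integral) auto
      then show "sq_int gauss_space (\<lambda>x. Y x - ?I n x) \<and> sqn gauss_space (\<lambda>x. Y x - ?I n x) \<le> e"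
        unfolding sq_int_def using int e by (auto simp: ennreal_le_iff)
    qed
  qed
  obtain N where "sq_int gauss_space (\<lambda>x. Y x - ?I N x)" using close[of 1] by auto
  from sq_int_lin(1)[OF this noise_sum_sq(1)[of "k N" "a N"], of 1]
  have "sq_int gauss_space Y" by simp
  moreover have "(\<lambda>n. sqn gauss_space (\<lambda>x. Y x - ?I n x)) \<longlonglongrightarrow> 0"
  proof (rule LIMSEQ_I)
    fix e :: real assume "0 < e"
    then obtain N where "\<forall>n\<ge>N. sqn gauss_space (\<lambda>x. Y x - ?I n x) \<le> e / 2" using close[of "e / 2"] by auto
    then have "\<forall>n\<ge>N. norm (sqn gauss_space (\<lambda>x. Y x - ?I n x) - 0) < e"
      using \<open>0 < e\<close> by (auto simp: sqn_nonneg intro: le_less_trans)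
    then show "\<exists>N. \<forall>n\<ge>N. norm (sqn gauss_space (\<lambda>x. Y x - ?I n x) - 0) < e" by blast
  qed
  ultimately show ?thesis unfolding wiener_rep_def using f lim by blast
qed

text \<open>The series of absolute increments has finite mean, hence is finite almost surely, and
  the partial sums of the increments telescope.\<close>

lemma AE_convergent_of_summable:
  fixes I :: "nat \<Rightarrow> (nat \<Rightarrow> real) \<Rightarrow> real"
  assumes [measurable]: "\<And>n. I n \<in> borel_measurable gauss_space"
    and d: "\<And>n. (\<integral>\<^sup>+x. ennreal \<bar>I (Suc n) x - I n x\<bar> \<partial>gauss_space) \<le> ennreal (c n)"
    and c: "summable c" "\<And>n. 0 \<le> c n"
  shows "AE x in gauss_space. (\<lambda>n. I n x) \<longlonglongrightarrow> lim (\<lambda>n. I n x)"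
proof -
  have "(\<integral>\<^sup>+x. (\<Sum>n. ennreal \<bar>I (Suc n) x - I n x\<bar>) \<partial>gauss_space) = (\<Sum>n. \<integral>\<^sup>+x. ennreal \<bar>I (Suc n) x - I n x\<bar> \<partial>gauss_space)"
    by (rule nn_integral_suminf) measurable
  also have "\<dots> \<le> (\<Sum>n. ennreal (c n))" by (intro suminf_le d) auto
  also have "\<dots> = ennreal (\<Sum>n. c n)" using c by (intro suminf_ennreal2) auto
  also have "\<dots> < \<infinity>" by simp
  finally have "AE x in gauss_space. (\<Sum>n. ennreal \<bar>I (Suc n) x - I n x\<bar>) \<noteq> \<infinity>"
    by (intro nn_integral_PInf_AE) auto
  then show ?thesis
  proof eventually_elim
    case (elim x)
    then have "summable (\<lambda>n. \<bar>I (Suc n) x - I n x\<bar>)" by (intro summable_suminf_not_top) auto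
    then have "summable (\<lambda>n. I (Suc n) x - I n x)" by (rule summable_rabs_cancel)
    then have "convergent (\<lambda>n. \<Sum>i<n. I (Suc i) x - I i x)" by (simp add: summable_iff_convergent)
    then have "convergent (\<lambda>n. I n x - I 0 x)" unfolding sum_lessThan_telescope[of "\<lambda>n. I n x"] .
    then have "convergent (\<lambda>n. I n x - I 0 x + I 0 x)" by (intro convergent_add convergent_const)
    then show ?case by (simp add: convergent_LIMSEQ_iff)
  qed
qed

lemma wiener_rep_exists:
  assumes f: "sq_int unit_leb f"
  shows "\<exists>Y. wiener_rep f Y"
proof -
  \<comment> \<open>Squared errors below \<open>(1/4)^n\<close> make the mean absolute increments of
    order \<open>(1/2)^n\<close>, which is summable.\<close>
  have "\<forall>n. \<exists>k a. sqn unit_leb (\<lambda>t. f t - stepf k a t) < (1/4)^n"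
    using step_approx_dense[OF f] unfolding step_approx_def by simp
  then obtain k a where ka: "\<And>n. sqn unit_leb (\<lambda>t. f t - stepf (k n) (a n) t) < (1/4)^n" by metis
  let ?I = "\<lambda>n. noise_sum (k n) (a n)"
  define Y where "Y x = lim (\<lambda>n. ?I n x)" for x
  have Ym: "Y \<in> borel_measurable gauss_space" unfolding Y_def by measurable
  have "(\<integral>\<^sup>+x. ennreal \<bar>?I (Suc n) x - ?I n x\<bar> \<partial>gauss_space) \<le> ennreal (5 * (1/2)^n)" for n
  proof -
    have d: "sq_int gauss_space (\<lambda>x. ?I (Suc n) x - ?I n x)" by (intro sq_int_diff noise_sum_sq)
    have "sqn gauss_space (\<lambda>x. ?I (Suc n) x - ?I n x) = sqn unit_leb (\<lambda>t. stepf (k (Suc n)) (a (Suc n)) t - stepf (k n) (a n) t)"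
      by (rule noise_sum_diff_sq)
    also have "\<dots> \<le> 2 * sqn unit_leb (\<lambda>t. stepf (k (Suc n)) (a (Suc n)) t - f t) + 2 * sqn unit_leb (\<lambda>t. f t - stepf (k n) (a n) t)"
      by (intro sqn_diff_le stepf_sq f)
    also have "\<dots> \<le> 4 * (1/4)^n"
    proof -
      have "0 \<le> (1/4::real)^n" by simp
      moreover have "4 * sqn unit_leb (\<lambda>t. f t - stepf (k (Suc n)) (a (Suc n)) t) < (1/4)^n" using ka[of "Suc n"] by simp
      ultimately show ?thesis using ka[of n] unfolding sqn_diff_commute[of unit_leb "stepf (k (Suc n)) (a (Suc n))"] by linarith
    qed
    also have "(1/4)^n = (1/2::real)^n * (1/2)^n" by (simp flip: power_mult_distrib)
    finally have s: "sqn gauss_space (\<lambda>x. ?I (Suc n) x - ?I n x) \<le> 4 * ((1/2)^n * (1/2)^n)" .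
    have "(\<integral>x. \<bar>?I (Suc n) x - ?I n x\<bar> \<partial>gauss_space) \<le> (1/2)^n + sqn gauss_space (\<lambda>x. ?I (Suc n) x - ?I n x) / (1/2)^n"
      by (rule G_L1_le(2)[OF d]) simp
    also have "\<dots> \<le> (1/2)^n + 4 * ((1/2)^n * (1/2)^n) / (1/2)^n" using s by (intro add_left_mono divide_right_mono) auto
    also have "\<dots> = 5 * (1/2)^n" by simp
    finally have "(\<integral>x. \<bar>?I (Suc n) x - ?I n x\<bar> \<partial>gauss_space) \<le> 5 * (1/2)^n" .
    moreover have "(\<integral>\<^sup>+x. ennreal \<bar>?I (Suc n) x - ?I n x\<bar> \<partial>gauss_space) = ennreal (\<integral>x. \<bar>?I (Suc n) x - ?I n x\<bar> \<partial>gauss_space)"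
      using G_L1_le(1)[OF d, of 1] by (intro nn_integral_eq_integral) auto
    ultimately show ?thesis by (simp add: ennreal_leI)
  qed
  then have "AE x in gauss_space. (\<lambda>n. ?I n x) \<longlonglongrightarrow> Y x"
    unfolding Y_def by (rule AE_convergent_of_summable[rotated]) (auto intro: summable_mult summable_geometric)
  moreover have "(\<lambda>n. sqn unit_leb (\<lambda>t. f t - stepf (k n) (a n) t)) \<longlonglongrightarrow> 0"
  proof (rule tendsto_sandwich[OF _ _ tendsto_const])
    show "(\<lambda>n. (1/4::real)^n) \<longlonglongrightarrow> 0" by (rule LIMSEQ_realpow_zero) auto
    show "eventually (\<lambda>n. sqn unit_leb (\<lambda>t. f t - stepf (k n) (a n) t) \<le> (1/4)^n) sequentially" using ka by (simp add: less_imp_le)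
  qed (simp add: sqn_nonneg)
  ultimately show ?thesis using wiener_rep_limit[OF f Ym] by blast
qed

text \<open>The representative is chosen for each \<open>f\<close> separately, so nothing is known
  of its dependence on \<open>f\<close> along a path. The regular version on the variation class is
  \<open>limit_process\<close>.\<close>

definition white_noise :: "(real \<Rightarrow> real) \<Rightarrow> (nat \<Rightarrow> real) \<Rightarrow> real" where
  "white_noise f = (SOME Y. wiener_rep f Y)"

lemma wiener_rep_white_noise: "sq_int unit_leb f \<Longrightarrow> wiener_rep f (white_noise f)"
  unfolding white_noise_def using someI_ex[OF wiener_rep_exists] .

text \<open>Finite combinations are again white noise integrals by linearity, hence Gaussian; the
  covariance is the polarised isometry.\<close>

lemma isonormal_white_noise: "isonormal_process gauss_space white_noise"
  unfolding isonormal_process_def centred_gaussian_process_def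
proof (intro conjI allI impI ballI)
  show "prob_space gauss_space" by (rule prob_space_gauss_space)
  have sq: "sq_int unit_leb f" if "f \<in> L2_unit" for f using that unfolding L2_unit_def sq_int_def by auto
  fix A :: "(real \<Rightarrow> real) set" and c assume A: "finite A \<and> A \<subseteq> L2_unit"
  then have "finite A" "A \<subseteq> L2_unit" by auto
  then have "wiener_rep (\<lambda>t. \<Sum>f\<in>A. c f * f t) (\<lambda>x. \<Sum>f\<in>A. c f * white_noise f x)"
  proof (induction A)
    case empty
    \<comment> \<open>The empty combination is the constant 0, obtained as the difference of a
      representative with itself.\<close>
    have "sq_int unit_leb (\<lambda>_. 0)" unfolding sq_int_def by simp
    then obtain Y where Y: "wiener_rep (\<lambda>_. 0) Y" using wiener_rep_exists by blast
    from wiener_rep_lin[OF this this, of "-1"] show ?case by simp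
  next
    case (insert f A)
    then show ?case using wiener_rep_lin[OF wiener_rep_white_noise[OF sq] insert.IH, of f "c f"] by simp
  qed
  then show "centred_gaussian_rv gauss_space (\<lambda>x. \<Sum>f\<in>A. c f * white_noise f x)" by (rule wiener_rep_gaussian)
next
  fix f g assume "f \<in> L2_unit" "g \<in> L2_unit"
  then have "sq_int unit_leb f" "sq_int unit_leb g" unfolding L2_unit_def sq_int_def by auto
  then show "(\<integral>x. white_noise f x * white_noise g x \<partial>gauss_space) = (\<integral>t. f t * g t \<partial>unit_leb)"
    by (intro wiener_rep_covariance wiener_rep_white_noise)
qed

section \<open>Continuous extension of white noise to the variation class\<close>

text \<open>Measurability is the point: \<open>f\<close> is continuous wherever its control function
  is, and a monotone function has only countably many discontinuities. Clamping the argument to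
  \<open>[0, 1]\<close> makes the control monotone on the whole line.\<close>

lemma var_class_sq_int:
  assumes f: "f \<in> var_class q B" and q: "1 \<le> q"
  shows "sq_int unit_leb f"
proof -
  obtain w where w: "var_control q B f w" and fB: "\<And>t. t \<in> {0..1} \<Longrightarrow> \<bar>f t\<bar> \<le> B"
    using f unfolding var_class_def by auto
  define c where "c t = max 0 (min 1 t)" for t :: real
  have c01: "0 \<le> c t" "c t \<le> 1" "s \<le> t \<Longrightarrow> c s \<le> c t" for s t unfolding c_def by auto
  define g where "g t = w (c t)" for t
  define h where "h t = f (c t)" for t
  have "mono g" unfolding g_def by (intro monoI var_controlD(2)[OF w] c01)
  then have cnt: "countable {t. \<not> isCont g t}" by (rule mono_ctble_discont)
  have le: "\<bar>h s - h t\<bar> powr q \<le> \<bar>g s - g t\<bar>" for s t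
  proof (cases "s \<le> t")
    case True
    then show ?thesis using var_controlD(1)[OF w c01(1) c01(3)[of s t] c01(2)] unfolding h_def g_def
      by (simp add: abs_minus_commute)
  next
    case False
    then show ?thesis using var_controlD(1)[OF w c01(1) c01(3)[of t s] c01(2)] unfolding h_def g_def by simp
  qed
  have cont: "isCont h t" if g: "isCont g t" for t
    unfolding isCont_def
  proof (rule tendstoI)
    fix e :: real assume e: "0 < e"
    then have "0 < e powr q" by simp
    from tendstoD[OF g[unfolded isCont_def] this]
    show "eventually (\<lambda>s. dist (h s) (h t) < e) (at t)"
    proof eventually_elim
      case (elim s)
      then have "\<bar>h s - h t\<bar> powr q < e powr q" using le[of s t] by (simp add: dist_real_def)
      then show ?case using e q powr_mono2[of q e "\<bar>h s - h t\<bar>"] by (auto simp: dist_real_def not_le[symmetric])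
    qed
  qed
  have "h \<in> borel_measurable borel"
  proof (rule borel_measurable_continuous_countable_exceptions[OF cnt])
    show "continuous_on (- {t. \<not> isCont g t}) h" using cont by (intro continuous_at_imp_continuous_on) auto
  qed
  then have "h \<in> borel_measurable unit_leb" by (rule borel_measurable_unit_leb)
  moreover have "h t = f t" if "t \<in> {0..1}" for t using that unfolding h_def c_def by auto
  ultimately have fm: "f \<in> borel_measurable unit_leb" by (subst measurable_cong[of _ f h]) auto
  interpret U: prob_space unit_leb by (rule prob_space_unit_leb)
  have "integrable unit_leb (\<lambda>t. (f t)\<^sup>2)"
  proof (rule U.integrable_const_bound[where B="B\<^sup>2"])
    show "AE t in unit_leb. norm ((f t)\<^sup>2) \<le> B\<^sup>2"
    proof (rule AE_I2)
      fix t assume "t \<in> space unit_leb"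
      then have "\<bar>f t\<bar> \<le> B" using fB by simp
      from power_mono[OF this, of 2] show "norm ((f t)\<^sup>2) \<le> B\<^sup>2" by simp
    qed
  qed (use fm in simp)
  then show ?thesis using fm unfolding sq_int_def by simp
qed

text \<open>On a cell the squared error is at most \<open>(2 * B) powr (2 - q)\<close> times the
  increment of the control function over the cell; these increments telescope in the integral, which
  leaves the mesh \<open>1 / 2^k\<close>.\<close>

lemma var_class_step_error:
  assumes f: "f \<in> var_class q B" and q: "1 \<le> q" "q < 2" and B: "0 \<le> B"
  shows "sqn unit_leb (\<lambda>t. f t - stepf k (\<lambda>j. f (real j / 2^k)) t) \<le> (2 * B) powr (2 - q) * B / 2^k"
proof -
  obtain w where w: "var_control q B f w" and fB: "\<And>t. t \<in> {0..1} \<Longrightarrow> \<bar>f t\<bar> \<le> B"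
    using f unfolding var_class_def by auto
  define C where "C = (2 * B) powr (2 - q)"
  have C: "0 \<le> C" unfolding C_def by simp
  \<comment> \<open>The minimum covers \<open>t = 1\<close>, whose cell would extend beyond the
    interval.\<close>
  define u where "u j = w (min 1 (real j / 2^k))" for j :: nat
  have le: "(f t - stepf k (\<lambda>j. f (real j / 2^k)) t)\<^sup>2 \<le> stepf k (\<lambda>j. C * (u (Suc j) - u j)) t" if t: "t \<in> {0..1}" for t
  proof -
    define j where "j = nat \<lfloor>2^k * t\<rfloor>"
    have j: "real j \<le> 2^k * t" "2^k * t < real j + 1" using t unfolding j_def by auto
    have s: "0 \<le> real j / 2^k" "real j / 2^k \<le> t" "t \<le> min 1 (real (Suc j) / 2^k)"
      using j t by (auto simp: field_simps)
    let ?d = "\<bar>f t - f (real j / 2^k)\<bar>"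
    have "real j / 2^k \<in> {0..1}" using s t by (auto simp only: atLeastAtMost_iff)
    then have d: "?d \<le> 2 * B" using fB[OF t] fB[of "real j / 2^k"] by linarith
    have "?d\<^sup>2 \<le> C * ?d powr q"
    proof (cases "?d = 0")
      case False
      then have "?d\<^sup>2 = ?d powr (2 - q) * ?d powr q" using powr_add[of ?d "2 - q" q] by (simp add: powr_numeral)
      also have "\<dots> \<le> C * ?d powr q" unfolding C_def using d q by (intro mult_right_mono powr_mono2) auto
      finally show ?thesis .
    qed simp
    also have "\<dots> \<le> C * (w t - w (real j / 2^k))"
      using var_controlD(1)[OF w s(1,2)] t C by (intro mult_left_mono) auto
    also have "\<dots> \<le> C * (u (Suc j) - u j)"
    proof -
      have "w t \<le> u (Suc j)" unfolding u_def using s(3) t by (intro var_controlD(2)[OF w]) auto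
      moreover have "real j / 2^k \<le> 1" using s(2) t by (auto simp only: atLeastAtMost_iff)
      then have "u j = w (real j / 2^k)" unfolding u_def by (simp only: min_absorb2)
      ultimately show ?thesis using C by (intro mult_left_mono) auto
    qed
    finally show ?thesis unfolding stepf_def j_def[symmetric] by simp
  qed
  have "sqn unit_leb (\<lambda>t. f t - stepf k (\<lambda>j. f (real j / 2^k)) t) \<le> (\<integral>t. stepf k (\<lambda>j. C * (u (Suc j) - u j)) t \<partial>unit_leb)"
    unfolding sqn_def
  proof (rule integral_mono)
    show "integrable unit_leb (\<lambda>t. (f t - stepf k (\<lambda>j. f (real j / 2^k)) t)\<^sup>2)"
      by (rule sq_intD(2)[OF sq_int_diff[OF var_class_sq_int[OF f q(1)] stepf_sq(1)]])
  qed (use le stepf_integral in auto)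
  also have "\<dots> = C * (u (2^k) - u 0) / 2^k"
    unfolding stepf_integral(2) sum_distrib_left[symmetric] sum_lessThan_telescope ..
  also have "\<dots> \<le> C * B / 2^k"
    using w C unfolding u_def var_control_def by (intro divide_right_mono mult_left_mono) auto
  finally show ?thesis unfolding C_def .
qed

definition noise_bound :: "real \<Rightarrow> real \<Rightarrow> nat \<Rightarrow> (nat \<Rightarrow> real) \<Rightarrow> real" where
  "noise_bound q B k x = level_bound q B k (\<Sum>j<2^k. (noise (Suc k) (2 * j + 1) x)\<^sup>2) (\<Sum>j<2^k. noise (Suc k) (2 * j + 1) x ^ 4)"

text \<open>A bound for all later chaining steps that does not involve \<open>f\<close>. Extended
  values give it a meaning at every sample point; it is finite almost surely.\<close>

definition noise_tail :: "real \<Rightarrow> real \<Rightarrow> nat \<Rightarrow> (nat \<Rightarrow> real) \<Rightarrow> ennreal" where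
  "noise_tail q B k x = (\<Sum>l. ennreal (noise_bound q B (l + k) x))"

lemma level_bound_nonneg: "0 \<le> B \<Longrightarrow> 0 \<le> S2 \<Longrightarrow> 0 \<le> S4 \<Longrightarrow> 0 \<le> level_bound q B k S2 S4"
  unfolding level_bound_def by (intro add_nonneg_nonneg mult_nonneg_nonneg) auto

lemma noise_bound_nonneg: "0 \<le> B \<Longrightarrow> 0 \<le> noise_bound q B k x"
  unfolding noise_bound_def by (intro level_bound_nonneg sum_nonneg) auto

lemma measurable_noise_bound [measurable]: "noise_bound q B k \<in> borel_measurable gauss_space"
  unfolding noise_bound_def level_bound_def by (simp del: noise.simps)

lemma measurable_noise_tail [measurable]: "noise_tail q B k \<in> borel_measurable gauss_space"
  unfolding noise_tail_def by measurable

text \<open>There are \<open>2^k\<close> right children with variance \<open>1 / 2^(k+1)\<close> and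
  fourth moment three times its square, so second moments sum to 1/2 and fourth moments to less than
  \<open>1 / 2^k\<close>, the decay that \<open>level_bound_le\<close> asks for.\<close>

lemma noise_bound_integral:
  assumes q: "1 \<le> q" "q < 2" and B: "0 \<le> B"
  shows "(\<integral>\<^sup>+x. ennreal (noise_bound q B k x) \<partial>gauss_space) \<le> ennreal ((B + 2 * B\<^sup>2 + 1 + 2 * B * 1) * level_rate q ^ k)"
proof -
  let ?S = "\<lambda>p x. \<Sum>j<2^k. noise (Suc k) (2 * j + 1) x ^ p"
  have j: "2 * j + 1 < (2::nat) ^ Suc k" if "j < 2^k" for j using that by simp
  have i: "integrable gauss_space (?S p)" for p
    by (intro Bochner_Integration.integrable_sum noise_moment(1) j) simp
  have "G.expectation (?S 2) = (\<Sum>j<(2::nat)^k. G.expectation (\<lambda>x. (noise (Suc k) (2 * j + 1) x)\<^sup>2))"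
    by (rule Bochner_Integration.integral_sum) (intro noise_moment(1) j, simp)
  also have "\<dots> = (\<Sum>j<(2::nat)^k. 1 / 2^Suc k)" by (intro sum.cong refl noise_moment(2) j) simp
  also have "\<dots> \<le> 1" by simp
  finally have e2: "G.expectation (?S 2) \<le> 1" .
  have "G.expectation (?S 4) = (\<Sum>j<(2::nat)^k. G.expectation (\<lambda>x. noise (Suc k) (2 * j + 1) x ^ 4))"
    by (rule Bochner_Integration.integral_sum) (intro noise_moment(1) j, simp)
  also have "\<dots> = (\<Sum>j<(2::nat)^k. 3 / 4^Suc k)" by (intro sum.cong refl noise_moment(3) j) simp
  also have "\<dots> \<le> 1 / 2^k"
  proof -
    have "(4::real)^k = 2^k * 2^k" by (simp flip: power_mult_distrib)
    then show ?thesis by (simp add: field_simps)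
  qed
  finally have e4: "G.expectation (?S 4) \<le> 1 / 2^k" .
  have "(\<integral>\<^sup>+x. ennreal (noise_bound q B k x) \<partial>gauss_space) = ennreal (G.expectation (noise_bound q B k))"
    using G.expectation_level_bound(1)[OF i[of 2] i[of 4], of q B k] noise_bound_nonneg[OF B]
    by (intro nn_integral_eq_integral) (auto simp: noise_bound_def[abs_def])
  also have "G.expectation (noise_bound q B k) = level_bound q B k (G.expectation (?S 2)) (G.expectation (?S 4))"
    unfolding noise_bound_def[abs_def] by (rule G.expectation_level_bound(2)[OF i i])
  also have "ennreal \<dots> \<le> ennreal ((B + 2 * B\<^sup>2 + 1 + 2 * B * 1) * level_rate q ^ k)"
    by (intro ennreal_leI level_bound_le[OF q B _ e2 e4]) simp
  finally show ?thesis .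
qed

lemma noise_tail_integral:
  assumes q: "1 \<le> q" "q < 2" and B: "0 \<le> B"
  shows "(\<integral>\<^sup>+x. noise_tail q B k x \<partial>gauss_space) \<le> ennreal ((B + 2 * B\<^sup>2 + 1 + 2 * B * 1) * level_rate q ^ k / (1 - level_rate q))"
proof -
  let ?H = "B + 2 * B\<^sup>2 + 1 + 2 * B * 1"
  have r: "0 < level_rate q" "level_rate q < 1" using level_rate[OF q(2)] by auto
  have "(\<integral>\<^sup>+x. noise_tail q B k x \<partial>gauss_space) = (\<Sum>l. \<integral>\<^sup>+x. ennreal (noise_bound q B (l + k) x) \<partial>gauss_space)"
    unfolding noise_tail_def by (rule nn_integral_suminf) measurable
  also have "\<dots> \<le> (\<Sum>l. ennreal (?H * level_rate q ^ (l + k)))" by (intro suminf_le noise_bound_integral[OF q B]) auto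
  also have "\<dots> = ennreal (?H * level_rate q ^ k / (1 - level_rate q))"
  proof -
    have "(\<lambda>l. (?H * level_rate q ^ k) * level_rate q ^ l) sums ((?H * level_rate q ^ k) * (1 / (1 - level_rate q)))"
      using r by (intro sums_mult geometric_sums) auto
    then have s: "(\<lambda>l. ?H * level_rate q ^ (l + k)) sums (?H * level_rate q ^ k / (1 - level_rate q))"
      by (simp add: power_add mult_ac)
    have "0 \<le> ?H * level_rate q ^ (l + k)" for l using B r by simp
    then show ?thesis using s by (simp add: suminf_ennreal2 sums_iff)
  qed
  finally show ?thesis .
qed

lemma noise_tail_finite:
  assumes q: "1 \<le> q" "q < 2" and B: "0 \<le> B"
  shows "AE x in gauss_space. noise_tail q B k x < \<infinity>"
proof -
  have "(\<integral>\<^sup>+x. noise_tail q B k x \<partial>gauss_space) < \<infinity>"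
    using noise_tail_integral[OF q B, of k] by (rule le_less_trans) simp
  then have "AE x in gauss_space. noise_tail q B k x \<noteq> \<infinity>" by (intro nn_integral_PInf_AE) auto
  then show ?thesis by (auto simp: less_top)
qed

abbreviation noise_dyadic :: "(real \<Rightarrow> real) \<Rightarrow> nat \<Rightarrow> (nat \<Rightarrow> real) \<Rightarrow> real" where
  "noise_dyadic f k x \<equiv> dyadic_sum (\<lambda>j. noise k j x) f k"

lemma noise_dyadic_step:
  assumes f: "f \<in> var_class q B" and q: "1 \<le> q" "q < 2" and B: "0 \<le> B"
  shows "\<bar>noise_dyadic f (Suc k) x - noise_dyadic f k x\<bar> \<le> noise_bound q B k x"
  unfolding noise_bound_def by (rule dyadic_sum_step[OF f q B noise_add])

text \<open>The exceptional set is the same for all \<open>f\<close>, and the value 0 on it keeps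
  every path bounded on the class and measurable in the sample point.\<close>

definition limit_process :: "real \<Rightarrow> real \<Rightarrow> (real \<Rightarrow> real) \<Rightarrow> (nat \<Rightarrow> real) \<Rightarrow> real" where
  "limit_process q B f x = (if noise_tail q B 0 x < \<infinity> then lim (\<lambda>k. noise_dyadic f k x) else 0)"

lemma measurable_limit_process [measurable]: "limit_process q B f \<in> borel_measurable gauss_space"
  unfolding limit_process_def dyadic_sum_def by measurable

lemma noise_bound_summable:
  assumes "0 \<le> B" "noise_tail q B 0 x < \<infinity>"
  shows "summable (\<lambda>l. noise_bound q B l x)"
  using assms noise_bound_nonneg[OF assms(1)] unfolding noise_tail_def
  by (intro summable_suminf_not_top) auto

lemma noise_dyadic_converges:
  assumes f: "f \<in> var_class q B" and q: "1 \<le> q" "q < 2" and B: "0 \<le> B" and good: "noise_tail q B 0 x < \<infinity>"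
  shows "(\<lambda>k. noise_dyadic f k x) \<longlonglongrightarrow> limit_process q B f x"
proof -
  have "summable (\<lambda>k. noise_dyadic f (Suc k) x - noise_dyadic f k x)"
    by (rule summable_comparison_test'[OF noise_bound_summable[OF B good], of 0]) (use noise_dyadic_step[OF f q B] in auto)
  then have "convergent (\<lambda>n. \<Sum>k<n. noise_dyadic f (Suc k) x - noise_dyadic f k x)" by (simp add: summable_iff_convergent)
  then have "convergent (\<lambda>n. noise_dyadic f n x - noise_dyadic f 0 x)"
    unfolding sum_lessThan_telescope[of "\<lambda>k. noise_dyadic f k x"] .
  then have "convergent (\<lambda>n. noise_dyadic f n x - noise_dyadic f 0 x + noise_dyadic f 0 x)" by (intro convergent_add convergent_const)
  then show ?thesis unfolding limit_process_def using good by (simp add: convergent_LIMSEQ_iff)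
qed

lemma limit_process_close:
  assumes f: "f \<in> var_class q B" and q: "1 \<le> q" "q < 2" and B: "0 \<le> B" and good: "noise_tail q B 0 x < \<infinity>"
  shows "ennreal \<bar>limit_process q B f x - noise_dyadic f k x\<bar> \<le> noise_tail q B k x"
proof (rule LIMSEQ_le_const2)
  have "(\<lambda>n. noise_dyadic f (n + k) x) \<longlonglongrightarrow> limit_process q B f x"
    using noise_dyadic_converges[OF assms] by (rule LIMSEQ_ignore_initial_segment)
  then show "(\<lambda>n. ennreal \<bar>noise_dyadic f (n + k) x - noise_dyadic f k x\<bar>) \<longlonglongrightarrow> ennreal \<bar>limit_process q B f x - noise_dyadic f k x\<bar>"
    by (intro tendsto_ennrealI tendsto_intros)
  have "ennreal \<bar>noise_dyadic f (n + k) x - noise_dyadic f k x\<bar> \<le> noise_tail q B k x" for n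
  proof -
    have "noise_dyadic f (n + k) x - noise_dyadic f k x = (\<Sum>l<n. noise_dyadic f (Suc (l + k)) x - noise_dyadic f (l + k) x)"
      using sum_lessThan_telescope[of "\<lambda>l. noise_dyadic f (l + k) x" n] by simp
    also have "\<bar>\<dots>\<bar> \<le> (\<Sum>l<n. noise_bound q B (l + k) x)"
      by (intro order_trans[OF sum_abs] sum_mono noise_dyadic_step[OF f q B])
    finally have "ennreal \<bar>noise_dyadic f (n + k) x - noise_dyadic f k x\<bar> \<le> ennreal (\<Sum>l<n. noise_bound q B (l + k) x)" by (rule ennreal_leI)
    also have "\<dots> = (\<Sum>l<n. ennreal (noise_bound q B (l + k) x))" using noise_bound_nonneg[OF B] by (subst sum_ennreal) auto
    also have "\<dots> \<le> noise_tail q B k x" unfolding noise_tail_def by (intro sum_le_suminf) auto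
    finally show ?thesis .
  qed
  then show "\<exists>N. \<forall>n\<ge>N. ennreal \<bar>noise_dyadic f (n + k) x - noise_dyadic f k x\<bar> \<le> noise_tail q B k x" by blast
qed

lemma noise_tail_real:
  assumes B: "0 \<le> B" and good: "noise_tail q B 0 x < \<infinity>"
  shows "noise_tail q B k x < \<infinity>" "(\<lambda>k. enn2real (noise_tail q B k x)) \<longlonglongrightarrow> 0"
proof -
  note s = noise_bound_summable[OF B good]
  have eq: "noise_tail q B k x = ennreal (\<Sum>l. noise_bound q B (l + k) x)" for k
    unfolding noise_tail_def using noise_bound_nonneg[OF B] summable_ignore_initial_segment[OF s] by (intro suminf_ennreal2) auto
  then show "noise_tail q B k x < \<infinity>" by simp
  have nn: "0 \<le> (\<Sum>l. noise_bound q B (l + k) x)" for k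
    by (intro suminf_nonneg summable_ignore_initial_segment[OF s] noise_bound_nonneg[OF B])
  show "(\<lambda>k. enn2real (noise_tail q B k x)) \<longlonglongrightarrow> 0"
    unfolding eq using nn suminf_exist_split[OF _ s] by (intro LIMSEQ_I) auto
qed

text \<open>The dyadic sums are the white noise integrals of the left-endpoint step functions of
  \<open>f\<close>, which converge to \<open>f\<close> in mean square; their pathwise limit is
  therefore a white noise integral of \<open>f\<close>.\<close>

lemma wiener_rep_limit_process:
  assumes f: "f \<in> var_class q B" and q: "1 \<le> q" "q < 2" and B: "0 \<le> B"
  shows "wiener_rep f (limit_process q B f)"
proof (rule wiener_rep_limit[where k="\<lambda>n. n" and a="\<lambda>n j. f (real j / 2^n)", OF var_class_sq_int[OF f q(1)] measurable_limit_process])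
  show "AE x in gauss_space. (\<lambda>n. noise_sum n (\<lambda>j. f (real j / 2^n)) x) \<longlonglongrightarrow> limit_process q B f x"
    using noise_tail_finite[OF q B, of 0]
  proof eventually_elim
    case (elim x)
    from noise_dyadic_converges[OF f q B elim] show ?case unfolding noise_sum_def dyadic_sum_def .
  qed
  show "(\<lambda>n. sqn unit_leb (\<lambda>t. f t - stepf n (\<lambda>j. f (real j / 2^n)) t)) \<longlonglongrightarrow> 0"
  proof (rule tendsto_sandwich[OF _ _ tendsto_const])
    let ?C = "(2 * B) powr (2 - q) * B"
    have "(\<lambda>n. ?C * (1/2)^n) \<longlonglongrightarrow> ?C * 0" by (intro tendsto_intros LIMSEQ_realpow_zero) auto
    then show "(\<lambda>n. ?C / 2^n) \<longlonglongrightarrow> 0" by (simp add: power_divide)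
    show "eventually (\<lambda>n. sqn unit_leb (\<lambda>t. f t - stepf n (\<lambda>j. f (real j / 2^n)) t) \<le> ?C / 2^n) sequentially"
      using var_class_step_error[OF f q B] by simp
  qed (simp add: sqn_nonneg)
qed

section \<open>Convergence in outer distribution\<close>

lemma mdist_basics:
  assumes "x \<in> mspace E" "y \<in> mspace E"
  shows "0 \<le> mdist E x y" "mdist E x x = 0" "mdist E x y = mdist E y x"
    "z \<in> mspace E \<Longrightarrow> mdist E x z \<le> mdist E x y + mdist E y z"
  using assms by (auto simp: mdist_commute mdist_triangle)

lemma openin_mtopology_of:
  "openin (mtopology_of E) U \<longleftrightarrow> U \<subseteq> mspace E \<and> (\<forall>x\<in>U. \<exists>r>0. \<forall>y\<in>mspace E. mdist E x y < r \<longrightarrow> y \<in> U)"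
proof -
  interpret Metric_space "mspace E" "mdist E" by (rule Metric_space_mspace_mdist)
  have ball: "mball x r \<subseteq> U \<longleftrightarrow> (\<forall>y\<in>mspace E. mdist E x y < r \<longrightarrow> y \<in> U)" if "x \<in> mspace E" for x r
    using that by auto
  show ?thesis unfolding mtopology_of_def openin_mtopology
  proof (intro conj_cong refl)
    assume "U \<subseteq> mspace E"
    then show "(\<forall>x. x \<in> U \<longrightarrow> (\<exists>r>0. mball x r \<subseteq> U)) \<longleftrightarrow> (\<forall>x\<in>U. \<exists>r>0. \<forall>y\<in>mspace E. mdist E x y < r \<longrightarrow> y \<in> U)"
      using ball by (metis subsetD)
  qed
qed

lemma continuous_map_mtopology_of_real:
  fixes h :: "'e \<Rightarrow> real"
  shows "continuous_map (mtopology_of E) euclideanreal h \<longleftrightarrow>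
    (\<forall>x\<in>mspace E. \<forall>e>0. \<exists>r>0. \<forall>y\<in>mspace E. mdist E x y < r \<longrightarrow> \<bar>h y - h x\<bar> < e)"
proof
  assume c: "continuous_map (mtopology_of E) euclideanreal h"
  show "\<forall>x\<in>mspace E. \<forall>e>0. \<exists>r>0. \<forall>y\<in>mspace E. mdist E x y < r \<longrightarrow> \<bar>h y - h x\<bar> < e"
  proof (intro ballI allI impI)
    fix x and e :: real assume x: "x \<in> mspace E" and e: "0 < e"
    have "openin (mtopology_of E) {y \<in> topspace (mtopology_of E). h y \<in> ball (h x) e}"
      by (rule openin_continuous_map_preimage[OF c]) simp
    then show "\<exists>r>0. \<forall>y\<in>mspace E. mdist E x y < r \<longrightarrow> \<bar>h y - h x\<bar> < e"
      unfolding openin_mtopology_of using x e by (auto simp: dist_real_def abs_minus_commute)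
  qed
next
  assume c: "\<forall>x\<in>mspace E. \<forall>e>0. \<exists>r>0. \<forall>y\<in>mspace E. mdist E x y < r \<longrightarrow> \<bar>h y - h x\<bar> < e"
  show "continuous_map (mtopology_of E) euclideanreal h"
    unfolding continuous_map_def
  proof (intro conjI allI impI)
    fix U assume "openin euclideanreal U"
    then have U: "open U" by simp
    show "openin (mtopology_of E) {x \<in> topspace (mtopology_of E). h x \<in> U}"
      unfolding openin_mtopology_of
    proof (intro conjI ballI)
      fix x assume x: "x \<in> {x \<in> topspace (mtopology_of E). h x \<in> U}"
      then obtain e where e: "0 < e" "\<And>z. dist z (h x) < e \<Longrightarrow> z \<in> U" using U unfolding open_dist by auto
      have "x \<in> mspace E" using x by auto
      then obtain r where "0 < r" "\<forall>y\<in>mspace E. mdist E x y < r \<longrightarrow> \<bar>h y - h x\<bar> < e" using c e(1) by meson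
      then show "\<exists>r>0. \<forall>y\<in>mspace E. mdist E x y < r \<longrightarrow> y \<in> {x \<in> topspace (mtopology_of E). h x \<in> U}"
        using e(2) by (auto simp: dist_real_def)
    qed auto
  qed simp
qed

text \<open>The Pasch-Hausdorff envelope: for bounded \<open>h\<close> and \<open>m \<ge> 0\<close>
  the largest \<open>m\<close>-Lipschitz minorant of \<open>h\<close>.\<close>

definition inf_conv :: "'e metric \<Rightarrow> ('e \<Rightarrow> real) \<Rightarrow> real \<Rightarrow> 'e \<Rightarrow> real" where
  "inf_conv E h m x = (INF y\<in>mspace E. h y + m * mdist E x y)"

context
  fixes E :: "'e metric" and h :: "'e \<Rightarrow> real" and b :: real
  assumes hb: "\<And>y. y \<in> mspace E \<Longrightarrow> \<bar>h y\<bar> \<le> b"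
begin

lemma inf_conv_lower:
  assumes "x \<in> mspace E" "y \<in> mspace E" "0 \<le> m"
  shows "inf_conv E h m x \<le> h y + m * mdist E x y"
  unfolding inf_conv_def
proof (rule cINF_lower[OF _ assms(2)])
  show "bdd_below ((\<lambda>y. h y + m * mdist E x y) ` mspace E)"
  proof (rule bdd_belowI2[of _ "-b"])
    fix y assume "y \<in> mspace E"
    then have "-b \<le> h y" "0 \<le> m * mdist E x y" using hb[of y] assms by auto
    then show "-b \<le> h y + m * mdist E x y" by linarith
  qed
qed

lemma inf_conv_le: "x \<in> mspace E \<Longrightarrow> 0 \<le> m \<Longrightarrow> inf_conv E h m x \<le> h x"
  using inf_conv_lower[of x x m] mdist_basics(2)[of x E x] by simp

lemma inf_conv_ge:
  assumes "x \<in> mspace E" "\<And>y. y \<in> mspace E \<Longrightarrow> c \<le> h y + m * mdist E x y"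
  shows "c \<le> inf_conv E h m x"
  unfolding inf_conv_def using assms by (intro cINF_greatest) auto

lemma inf_conv_bounded:
  assumes "x \<in> mspace E" "0 \<le> m"
  shows "\<bar>inf_conv E h m x\<bar> \<le> b"
proof -
  have "-b \<le> inf_conv E h m x"
  proof (rule inf_conv_ge[OF assms(1)])
    fix y assume "y \<in> mspace E"
    then have "-b \<le> h y" "0 \<le> m * mdist E x y" using hb[of y] assms by auto
    then show "-b \<le> h y + m * mdist E x y" by linarith
  qed
  moreover have "inf_conv E h m x \<le> b" using inf_conv_le[OF assms] hb[OF assms(1)] by linarith
  ultimately show ?thesis by linarith
qed

lemma inf_conv_lipschitz:
  assumes x: "x \<in> mspace E" "x' \<in> mspace E" "0 \<le> m"
  shows "\<bar>inf_conv E h m x - inf_conv E h m x'\<bar> \<le> m * mdist E x x'"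
proof -
  have "inf_conv E h m x \<le> inf_conv E h m x' + m * mdist E x x'" if x: "x \<in> mspace E" "x' \<in> mspace E" for x x'
  proof -
    have "inf_conv E h m x - m * mdist E x x' \<le> inf_conv E h m x'"
    proof (rule inf_conv_ge[OF x(2)])
      fix y assume y: "y \<in> mspace E"
      have "m * mdist E x y \<le> m * (mdist E x x' + mdist E x' y)"
        using mdist_basics(4)[OF x y] assms(3) by (intro mult_left_mono) auto
      then show "inf_conv E h m x - m * mdist E x x' \<le> h y + m * mdist E x' y"
        using inf_conv_lower[OF x(1) y assms(3)] by (simp add: distrib_left)
    qed
    then show ?thesis by linarith
  qed
  from this[OF x(1,2)] this[OF x(2,1)] show ?thesis using mdist_basics(3)[OF x(1,2)] by (simp add: abs_le_iff)
qed

text \<open>Near \<open>x\<close> continuity keeps \<open>h y\<close> above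
  \<open>h x - e / 2\<close>; at distance at least \<open>r\<close> the penalty outweighs the total
  oscillation \<open>2 * b\<close> once its factor is large.\<close>

lemma inf_conv_tendsto:
  assumes x: "x \<in> mspace E" and c: "continuous_map (mtopology_of E) euclideanreal h"
  shows "(\<lambda>n. inf_conv E h (real n) x) \<longlonglongrightarrow> h x"
proof (rule LIMSEQ_I)
  fix e :: real assume e: "0 < e"
  then have "0 < e / 2" by simp
  then obtain r where r: "0 < r" "\<And>y. y \<in> mspace E \<Longrightarrow> mdist E x y < r \<Longrightarrow> \<bar>h y - h x\<bar> < e / 2"
    using c x unfolding continuous_map_mtopology_of_real by meson
  obtain N where N: "2 * b / r \<le> real N" using real_arch_simple by blast
  have "norm (inf_conv E h (real n) x - h x) < e" if n: "n \<ge> N" for n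
  proof -
    have "h x - e / 2 \<le> inf_conv E h (real n) x"
    proof (rule inf_conv_ge[OF x])
      fix y assume y: "y \<in> mspace E"
      have d: "0 \<le> real n * mdist E x y" using x y by simp
      show "h x - e / 2 \<le> h y + real n * mdist E x y"
      proof (cases "mdist E x y < r")
        case True then show ?thesis using r(2)[OF y True] d e by linarith
      next
        case False
        have "2 * b \<le> real n * r" using N n r(1) by (simp add: pos_divide_le_eq) (meson mult_right_mono of_nat_mono order_trans less_imp_le)
        also have "\<dots> \<le> real n * mdist E x y" using False by (intro mult_left_mono) auto
        finally show ?thesis using hb[OF x] hb[OF y] e by linarith
      qed
    qed
    then show ?thesis using inf_conv_le[OF x, of "real n"] e by auto
  qed
  then show "\<exists>N. \<forall>n\<ge>N. norm (inf_conv E h (real n) x - h x) < e" by blast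
qed

end

text \<open>At a point with a ball of radius \<open>r\<close> inside \<open>V\<close>, the envelope
  of the indicator is at least \<open>min 1 r\<close>. Open sets thus become positivity sets of
  continuous functions, and Borel measurability reduces to that of compositions.\<close>

lemma open_inf_conv:
  assumes V: "openin (mtopology_of E) V" and x: "x \<in> mspace E"
  shows "0 < inf_conv E (indicator V) 1 x \<longleftrightarrow> x \<in> V"
proof -
  have hb: "\<bar>indicator V y\<bar> \<le> (1::real)" for y by (auto simp: indicator_def)
  show ?thesis
  proof
    assume "0 < inf_conv E (indicator V) 1 x"
    then have "0 < (indicator V x :: real)" using inf_conv_le[of E "indicator V" 1 x 1, OF hb x] by simp
    then show "x \<in> V" by (simp add: indicator_def split: if_splits)
  next
    assume "x \<in> V"
    then obtain r where r: "0 < r" "\<And>y. y \<in> mspace E \<Longrightarrow> mdist E x y < r \<Longrightarrow> y \<in> V"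
      using V unfolding openin_mtopology_of by blast
    have "min 1 r \<le> inf_conv E (indicator V) 1 x"
    proof (rule inf_conv_ge[of E "indicator V" 1, OF hb x])
      fix y assume y: "y \<in> mspace E"
      show "min 1 r \<le> indicator V y + 1 * mdist E x y"
      proof (cases "mdist E x y < r")
        case True
        then have "indicator V y = (1::real)" using r(2)[OF y] by simp
        then show ?thesis using mdist_basics(1)[OF x y] min.cobounded1[of 1 r] by linarith
      next
        case False
        have "0 \<le> (indicator V y :: real)" by simp
        then show ?thesis using False min.cobounded2[of 1 r] by linarith
      qed
    qed
    then show "0 < inf_conv E (indicator V) 1 x" using r(1) by linarith
  qed
qed

lemma lipschitz_continuous_map:
  assumes "\<And>x y. x \<in> mspace E \<Longrightarrow> y \<in> mspace E \<Longrightarrow> \<bar>h x - h y\<bar> \<le> l * mdist E x y" "0 \<le> l"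
  shows "continuous_map (mtopology_of E) euclideanreal h"
  unfolding continuous_map_mtopology_of_real
proof (intro ballI allI impI)
  fix x and e :: real assume x: "x \<in> mspace E" and e: "0 < e"
  have "\<bar>h y - h x\<bar> < e" if y: "y \<in> mspace E" "mdist E x y < e / (l + 1)" for y
  proof -
    have "\<bar>h y - h x\<bar> \<le> l * mdist E x y" using assms(1)[OF y(1) x] x y mdist_basics(3)[of x E y] by simp
    also have "\<dots> \<le> (l + 1) * mdist E x y" using x y by (intro mult_right_mono) auto
    also have "\<dots> < e" using y(2) assms(2) by (simp add: pos_less_divide_eq mult.commute)
    finally show ?thesis .
  qed
  moreover have "0 < e / (l + 1)" using e assms(2) by simp
  ultimately show "\<exists>r>0. \<forall>y\<in>mspace E. mdist E x y < r \<longrightarrow> \<bar>h y - h x\<bar> < e" by blast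
qed

text \<open>The separable set is the closure of \<open>D\<close>. Open sets of the trace topology on
  the range are traces of open sets \<open>V\<close>, whose preimages are found by
  \<open>open_inf_conv\<close>.\<close>

lemma separably_valued_borelI:
  assumes Z: "\<And>x. x \<in> space N \<Longrightarrow> Z x \<in> mspace E"
    and D: "countable D" "D \<subseteq> mspace E" "\<And>x e. x \<in> space N \<Longrightarrow> 0 < e \<Longrightarrow> \<exists>d\<in>D. mdist E (Z x) d < e"
    and meas: "\<And>h. continuous_map (mtopology_of E) euclideanreal h \<Longrightarrow> (\<lambda>x. h (Z x)) \<in> borel_measurable N"
  shows "separably_valued_borel E N Z"
proof -
  interpret Metric_space "mspace E" "mdist E" by (rule Metric_space_mspace_mdist)
  let ?S = "mtopology_of E closure_of D"
  have S: "?S \<subseteq> mspace E" using closure_of_subset_topspace[of "mtopology_of E" D] by simp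
  have DS: "D \<subseteq> ?S" using D(2) by (intro closure_of_subset) simp
  have "separable_space (subtopology (mtopology_of E) ?S)"
    unfolding separable_space_def
    using D(1) S DS by (intro exI[of _ D]) (auto simp: closure_of_subtopology Int_absorb1 dest: subsetD)
  moreover have "Z ` space N \<subseteq> ?S"
  proof (clarify)
    fix x assume x: "x \<in> space N"
    show "Z x \<in> mtopology_of E closure_of D"
      unfolding mtopology_of_def metric_closure_of using Z[OF x] D(2) D(3)[OF x] by (auto simp: subset_iff)
  qed
  moreover have "Z \<in> N \<rightarrow>\<^sub>M borel_of_topology (subtopology (mtopology_of E) (Z ` space N))"
    unfolding borel_of_topology_def
  proof (rule measurable_sigma_sets[OF sets_measure_of])
    let ?T = "subtopology (mtopology_of E) (Z ` space N)"
    show "{U. openin ?T U} \<subseteq> Pow (topspace ?T)" "{U. openin ?T U} \<subseteq> Pow (topspace ?T)"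
      by (rule subsetI, rule PowI, rule openin_subset, simp)+
    show "Z \<in> space N \<rightarrow> topspace ?T" using Z by auto
    fix U assume "U \<in> {U. openin ?T U}"
    then obtain V where V: "openin (mtopology_of E) V" "U = V \<inter> Z ` space N" by (auto simp: openin_subtopology)
    have hb: "\<bar>indicator V y\<bar> \<le> (1::real)" for y by (auto simp: indicator_def)
    have "continuous_map (mtopology_of E) euclideanreal (inf_conv E (indicator V) 1)"
      using inf_conv_lipschitz[where E=E and h="indicator V" and b=1 and m=1, OF hb] by (intro lipschitz_continuous_map[where l=1]) auto
    from meas[OF this] have [measurable]: "(\<lambda>x. inf_conv E (indicator V) 1 (Z x)) \<in> borel_measurable N" .
    have "Z -` U \<inter> space N = {x \<in> space N. 0 < inf_conv E (indicator V) 1 (Z x)}"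
      using open_inf_conv[OF V(1) Z] V(2) by auto
    also have "\<dots> \<in> sets N" by measurable
    finally show "Z -` U \<inter> space N \<in> sets N" .
  qed
  ultimately show ?thesis unfolding separably_valued_borel_def using S by blast
qed

lemma separably_valued_borel_compose:
  assumes Z: "separably_valued_borel E N Z" and h: "continuous_map (mtopology_of E) euclideanreal h"
  shows "(\<lambda>x. h (Z x)) \<in> borel_measurable N"
proof -
  let ?T = "subtopology (mtopology_of E) (Z ` space N)"
  have Zm: "Z \<in> N \<rightarrow>\<^sub>M borel_of_topology ?T" using Z unfolding separably_valued_borel_def by auto
  have c: "continuous_map ?T euclideanreal h" by (rule continuous_map_from_subtopology[OF h])
  have sub: "{U. openin ?T U} \<subseteq> Pow (topspace ?T)" by (rule subsetI, rule PowI, rule openin_subset, simp)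
  have "h \<in> borel_of_topology ?T \<rightarrow>\<^sub>M borel"
  proof (rule borel_measurableI)
    fix U :: "real set" assume "open U"
    then have "openin ?T {x \<in> topspace ?T. h x \<in> U}" using openin_continuous_map_preimage[OF c] by simp
    moreover have "h -` U \<inter> space (borel_of_topology ?T) = {x \<in> topspace ?T. h x \<in> U}"
      unfolding borel_of_topology_def using sub by (auto simp: space_measure_of)
    ultimately show "h -` U \<inter> space (borel_of_topology ?T) \<in> sets (borel_of_topology ?T)"
      unfolding borel_of_topology_def using sub by (auto simp: sets_measure_of)
  qed
  from measurable_compose[OF Zm this] show ?thesis .
qed

section \<open>Outer expectations and convergence in outer distribution\<close>

lemma outer_expectation_mono:
  assumes "\<And>x. x \<in> space M \<Longrightarrow> S x \<le> T x"
  shows "outer_expectation M S \<le> outer_expectation M T"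
  unfolding outer_expectation_def
proof (rule Inf_superset_mono, clarify)
  fix U assume "U \<in> borel_measurable M" "expectation_exists M U" "\<forall>x\<in>space M. ereal (T x) \<le> U x"
  moreover have "\<forall>x\<in>space M. ereal (S x) \<le> U x"
    using calculation(3) assms by (meson ereal_less_eq(3) order_trans)
  ultimately show "\<exists>U'. ereal_expectation M U = ereal_expectation M U' \<and> U' \<in> borel_measurable M \<and>
    expectation_exists M U' \<and> (\<forall>x\<in>space M. ereal (S x) \<le> U' x)" by blast
qed

lemma ereal_expectation_real:
  assumes "integrable M u"
  shows "expectation_exists M (\<lambda>x. ereal (u x))" "ereal_expectation M (\<lambda>x. ereal (u x)) = ereal (\<integral>x. u x \<partial>M)"
proof -
  have e: "e2ennreal (ereal r) = ennreal r" for r :: real by simp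
  have f: "(\<integral>\<^sup>+x. ennreal (u x) \<partial>M) < \<infinity>" "(\<integral>\<^sup>+x. ennreal (- u x) \<partial>M) < \<infinity>"
    using assms unfolding real_integrable_def by (auto simp: less_top)
  show "expectation_exists M (\<lambda>x. ereal (u x))" unfolding expectation_exists_def using f by (simp add: e)
  show "ereal_expectation M (\<lambda>x. ereal (u x)) = ereal (\<integral>x. u x \<partial>M)"
    unfolding ereal_expectation_def real_lebesgue_integral_def[OF assms] using f
    by (simp add: e) (metis enn2ereal_ennreal enn2real_nonneg ennreal_enn2real ereal_minus(1))
qed

text \<open>The infimum runs over majorants valid everywhere; an almost sure one is repaired by
  putting the bound \<open>b\<close> on a null set.\<close>

lemma outer_expectation_le:
  assumes u: "integrable M u" and T: "\<And>x. x \<in> space M \<Longrightarrow> \<bar>T x\<bar> \<le> b" and ae: "AE x in M. T x \<le> u x"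
  shows "outer_expectation M T \<le> ereal (\<integral>x. u x \<partial>M)"
proof -
  obtain N where N: "N \<in> null_sets M" "{x \<in> space M. \<not> T x \<le> u x} \<subseteq> N" using ae by (auto simp: eventually_ae_filter)
  define v where "v x = (if x \<in> N then b else u x)" for x
  have um: "u \<in> borel_measurable M" using u by auto
  have vm: "v \<in> borel_measurable M" unfolding v_def using um N(1) by (intro measurable_If_set) auto
  have "AE x in M. u x = v x" using AE_not_in[OF N(1)] by eventually_elim (simp add: v_def)
  then have v: "integrable M v" "(\<integral>x. v x \<partial>M) = (\<integral>x. u x \<partial>M)"
    using integrable_cong_AE[OF um vm] integral_cong_AE[OF um vm] u by auto
  have "ereal (T x) \<le> ereal (v x)" if "x \<in> space M" for x using T[OF that] N(2) that unfolding v_def by auto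
  then have "outer_expectation M T \<le> ereal_expectation M (\<lambda>x. ereal (v x))"
    unfolding outer_expectation_def using ereal_expectation_real(1)[OF v(1)] vm
    by (intro Inf_lower CollectI exI[of _ "\<lambda>x. ereal (v x)"]) auto
  then show ?thesis unfolding ereal_expectation_real(2)[OF v(1)] v(2) .
qed

text \<open>Every competitor \<open>U\<close> in the infimum dominates \<open>u\<close> almost
  surely; positive and negative parts are compared separately because \<open>U\<close> is extended
  real valued.\<close>

lemma outer_expectation_ge:
  assumes u: "integrable M u" and ae: "AE x in M. u x \<le> T x"
  shows "ereal (\<integral>x. u x \<partial>M) \<le> outer_expectation M T"
  unfolding outer_expectation_def
proof (rule Inf_greatest, clarify)
  fix U :: "'a \<Rightarrow> ereal" assume U: "U \<in> borel_measurable M" "expectation_exists M U" "\<forall>x\<in>space M. ereal (T x) \<le> U x"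
  have ae': "AE x in M. ereal (u x) \<le> U x"
    using ae AE_space by eventually_elim (use U(3) in \<open>force intro: order_trans[of _ "ereal _"]\<close>)
  have e: "e2ennreal (ereal r) = ennreal r" for r :: real by simp
  have p: "(\<integral>\<^sup>+x. ennreal (u x) \<partial>M) \<le> (\<integral>\<^sup>+x. e2ennreal (U x) \<partial>M)"
  proof (rule nn_integral_mono_AE)
    show "AE x in M. ennreal (u x) \<le> e2ennreal (U x)" using ae'
      by eventually_elim (metis e e2ennreal_mono)
  qed
  have n: "(\<integral>\<^sup>+x. e2ennreal (- U x) \<partial>M) \<le> (\<integral>\<^sup>+x. ennreal (- u x) \<partial>M)"
  proof (rule nn_integral_mono_AE)
    show "AE x in M. e2ennreal (- U x) \<le> ennreal (- u x)" using ae'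
      by eventually_elim (metis e e2ennreal_mono ereal_minus_le_minus uminus_ereal.simps(1))
  qed
  have "ereal (\<integral>x. u x \<partial>M) = ereal_expectation M (\<lambda>x. ereal (u x))" using ereal_expectation_real(2)[OF u] by simp
  also have "\<dots> \<le> ereal_expectation M U"
    unfolding ereal_expectation_def using p n by (intro ereal_minus_mono) (auto simp: e less_eq_ennreal.rep_eq)
  finally show "ereal (\<integral>x. u x \<partial>M) \<le> ereal_expectation M U" .
qed

text \<open>Lipschitz test functions suffice: a bounded continuous function is the pointwise limit of its
  inf-convolutions with multiples of the metric from below, and similarly from above.\<close>

lemma converges_in_outer_distributionI:
  fixes Z :: "nat \<Rightarrow> 'a \<Rightarrow> 'e"
  assumes P: "prob_space M" "\<And>n \<omega>. \<omega> \<in> space M \<Longrightarrow> Z n \<omega> \<in> mspace E"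
    and N: "prob_space N" and Z0: "separably_valued_borel E N Z0"
    and lip: "\<And>h l b. \<lbrakk>\<And>x. x \<in> mspace E \<Longrightarrow> \<bar>h x\<bar> \<le> b; 0 \<le> l;
        \<And>x y. x \<in> mspace E \<Longrightarrow> y \<in> mspace E \<Longrightarrow> \<bar>h x - h y\<bar> \<le> l * mdist E x y\<rbrakk> \<Longrightarrow>
        (\<lambda>n. outer_expectation M (\<lambda>x. h (Z n x))) \<longlonglongrightarrow> ereal (\<integral>x. h (Z0 x) \<partial>N)"
  shows "converges_in_outer_distribution E (\<lambda>_. M) Z N Z0"
  unfolding converges_in_outer_distribution_def
proof (intro conjI allI impI)
  interpret N: prob_space N by fact
  have Z0m: "Z0 x \<in> mspace E" if "x \<in> space N" for x
    using Z0 that unfolding separably_valued_borel_def by auto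
  fix h :: "'e \<Rightarrow> real" assume h: "continuous_map (mtopology_of E) euclideanreal h \<and> bounded (h ` mspace E)"
  then have c: "continuous_map (mtopology_of E) euclideanreal h" by simp
  have c': "continuous_map (mtopology_of E) euclideanreal (\<lambda>x. - h x)" using continuous_map_minus[OF c] .
  obtain b where b: "\<And>x. x \<in> mspace E \<Longrightarrow> \<bar>h x\<bar> \<le> b" using h unfolding bounded_iff by auto
  then have b': "\<And>x. x \<in> mspace E \<Longrightarrow> \<bar>- h x\<bar> \<le> b" by simp
  note hm = inf_conv_bounded[where E=E and h=h and b=b, OF b] inf_conv_lipschitz[where E=E and h=h and b=b, OF b]
  note hm' = inf_conv_bounded[where E=E and h="\<lambda>x. - h x" and b=b, OF b'] inf_conv_lipschitz[where E=E and h="\<lambda>x. - h x" and b=b, OF b']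
  have int: "(\<lambda>m. \<integral>x. inf_conv E g (real m) (Z0 x) \<partial>N) \<longlonglongrightarrow> (\<integral>x. g (Z0 x) \<partial>N)"
    if g: "continuous_map (mtopology_of E) euclideanreal g" and gb: "\<And>x. x \<in> mspace E \<Longrightarrow> \<bar>g x\<bar> \<le> b" for g
  proof (rule integral_dominated_convergence[where w="\<lambda>_. b"])
    show "(\<lambda>x. g (Z0 x)) \<in> borel_measurable N" by (rule separably_valued_borel_compose[OF Z0 g])
    show "(\<lambda>x. inf_conv E g (real m) (Z0 x)) \<in> borel_measurable N" for m
      by (rule separably_valued_borel_compose[OF Z0 lipschitz_continuous_map[OF inf_conv_lipschitz[OF gb]]]) auto
    show "AE x in N. (\<lambda>m. inf_conv E g (real m) (Z0 x)) \<longlonglongrightarrow> g (Z0 x)"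
      using inf_conv_tendsto[OF gb Z0m g] by (intro AE_I2)
    show "AE x in N. norm (inf_conv E g (real m) (Z0 x)) \<le> b" for m
      using inf_conv_bounded[OF gb Z0m] by (intro AE_I2) auto
  qed simp
  let ?O = "\<lambda>n. outer_expectation M (\<lambda>x. h (Z n x))" and ?I = "\<integral>x. h (Z0 x) \<partial>N"
  show "?O \<longlonglongrightarrow> ereal ?I"
  proof (rule order_tendstoI)
    fix a assume a: "a < ereal ?I"
    obtain r where r: "a < ereal r" "r < ?I" using a by (metis ereal_dense2 less_ereal.simps(1))
    have "eventually (\<lambda>m. r < (\<integral>x. inf_conv E h (real m) (Z0 x) \<partial>N)) sequentially"
      by (rule order_tendstoD(1)[OF int[OF c b] r(2)])
    then obtain m where m: "r < (\<integral>x. inf_conv E h (real m) (Z0 x) \<partial>N)" by (auto simp: eventually_sequentially)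
    \<comment> \<open>The envelope from below is bounded and Lipschitz, so convergence is known for
      it; monotonicity transfers the lower bound to \<open>h\<close>.\<close>
    have "(\<lambda>n. outer_expectation M (\<lambda>x. inf_conv E h (real m) (Z n x))) \<longlonglongrightarrow> ereal (\<integral>x. inf_conv E h (real m) (Z0 x) \<partial>N)"
      using hm by (intro lip[where b=b and l="real m"]) auto
    moreover have "a < ereal (\<integral>x. inf_conv E h (real m) (Z0 x) \<partial>N)" using m r(1) by (meson less_ereal.simps(1) less_trans)
    ultimately have "eventually (\<lambda>n. a < outer_expectation M (\<lambda>x. inf_conv E h (real m) (Z n x))) sequentially"
      by (rule order_tendstoD(1))
    then show "eventually (\<lambda>n. a < ?O n) sequentially"
    proof eventually_elim
      case (elim n)
      have "outer_expectation M (\<lambda>x. inf_conv E h (real m) (Z n x)) \<le> ?O n"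
        using inf_conv_le[where E=E and h=h and b=b, OF b P(2)] by (intro outer_expectation_mono) auto
      with elim show ?case by simp
    qed
  next
    fix a assume a: "ereal ?I < a"
    obtain r where r: "ereal r < a" "?I < r" using a by (metis ereal_dense2 less_ereal.simps(1))
    have "(\<lambda>m. - (\<integral>x. inf_conv E (\<lambda>x. - h x) (real m) (Z0 x) \<partial>N)) \<longlonglongrightarrow> - (\<integral>x. - h (Z0 x) \<partial>N)"
      by (intro tendsto_minus int[OF c' b'])
    moreover have "- (\<integral>x. - h (Z0 x) \<partial>N) < r" using r(2) by simp
    ultimately have "eventually (\<lambda>m. - (\<integral>x. inf_conv E (\<lambda>x. - h x) (real m) (Z0 x) \<partial>N) < r) sequentially"
      by (rule order_tendstoD(2))
    then obtain m where m: "- (\<integral>x. inf_conv E (\<lambda>x. - h x) (real m) (Z0 x) \<partial>N) < r" by (auto simp: eventually_sequentially)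
    \<comment> \<open>The envelope from above, by reflection. Outer expectation is not odd, so the
      upper bound cannot be read off from the lower one.\<close>
    let ?g = "\<lambda>x. - inf_conv E (\<lambda>x. - h x) (real m) x"
    have "(\<lambda>n. outer_expectation M (\<lambda>x. ?g (Z n x))) \<longlonglongrightarrow> ereal (\<integral>x. ?g (Z0 x) \<partial>N)"
    proof (rule lip[where b=b and l="real m"])
      show "\<bar>?g x - ?g y\<bar> \<le> real m * mdist E x y" if "x \<in> mspace E" "y \<in> mspace E" for x y
        using hm'(2)[OF _ that, of "real m"] by (simp add: abs_minus_commute)
    qed (use hm' in auto)
    moreover have "ereal (\<integral>x. ?g (Z0 x) \<partial>N) < a" using m r(1) by (simp add: less_trans[of _ "ereal r"])
    ultimately have "eventually (\<lambda>n. outer_expectation M (\<lambda>x. ?g (Z n x)) < a) sequentially" by (rule order_tendstoD(2))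
    then show "eventually (\<lambda>n. ?O n < a) sequentially"
    proof eventually_elim
      case (elim n)
      have "?O n \<le> outer_expectation M (\<lambda>x. ?g (Z n x))"
        using inf_conv_le[where E=E and h="\<lambda>x. - h x" and b=b, OF b' P(2), of _ "real m" n] by (intro outer_expectation_mono) force
      with elim show ?case by simp
    qed
  qed
qed (use P N Z0 in auto)

section \<open>The uniform central limit theorem\<close>

lemma mspace_linfty: "g \<in> mspace (linfty F) \<longleftrightarrow> g \<in> extensional F \<and> (\<exists>C. \<forall>f\<in>F. \<bar>g f\<bar> \<le> C)"
proof -
  have "Met_TC.mbounded (g ` F) \<longleftrightarrow> (\<exists>C. \<forall>f\<in>F. \<bar>g f\<bar> \<le> C)"
    using bounded_iff[of "g ` F"] by simp
  then show ?thesis unfolding linfty_def mspace_funspace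
    by (subst Metric_space.fspace_def[OF Metric_space_mspace_mdist]) auto
qed

lemma mdist_linfty_le:
  assumes g: "g \<in> mspace (linfty F)" "h \<in> mspace (linfty F)" and c: "0 \<le> c" "\<And>f. f \<in> F \<Longrightarrow> \<bar>g f - h f\<bar> \<le> c"
  shows "mdist (linfty F) g h \<le> c"
proof (cases "F = {}")
  case True
  then have "g = h" using g unfolding mspace_linfty by auto
  then show ?thesis using mdist_basics(2)[OF g(1) g(1)] c(1) by simp
next
  case False
  then show ?thesis using funspace_mdist_le[of g F euclidean_metric h c] g c(2) unfolding linfty_def
    by (simp add: dist_real_def)
qed

definition step_functional :: "(real \<Rightarrow> real) set \<Rightarrow> nat \<Rightarrow> (nat \<Rightarrow> real) \<Rightarrow> (real \<Rightarrow> real) \<Rightarrow> real" where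
  "step_functional F k y = (\<lambda>f\<in>F. dyadic_sum y f k)"

lemma dyadic_sum_cong: "(\<And>j. j < 2^k \<Longrightarrow> y j = z j) \<Longrightarrow> dyadic_sum y f k = dyadic_sum z f k"
  unfolding dyadic_sum_def by (intro sum.cong) auto

lemma step_functional_zero_beyond: "step_functional F k (zero_beyond (2^k) y) = step_functional F k y"
  unfolding step_functional_def by (intro restrict_ext dyadic_sum_cong) (simp add: zero_beyond_def)

locale bounded_var_family =
  fixes F :: "(real \<Rightarrow> real) set" and q B :: real
  assumes F: "F \<subseteq> var_class q B" and q: "1 \<le> q" "q < 2" and B: "0 \<le> B"
begin

lemma F_bound: "f \<in> F \<Longrightarrow> 0 \<le> t \<Longrightarrow> t \<le> 1 \<Longrightarrow> \<bar>f t\<bar> \<le> B"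
  using F unfolding var_class_def by auto

lemma dyadic_sum_diff_le:
  assumes f: "f \<in> F"
  shows "\<bar>dyadic_sum y f k - dyadic_sum z f k\<bar> \<le> B * (\<Sum>j<2^k. \<bar>y j - z j\<bar>)"
proof -
  have "dyadic_sum y f k - dyadic_sum z f k = (\<Sum>j<2^k. f (real j / 2^k) * (y j - z j))"
    unfolding dyadic_sum_def by (simp add: right_diff_distrib sum_subtractf)
  also have "\<bar>\<dots>\<bar> \<le> (\<Sum>j<2^k. B * \<bar>y j - z j\<bar>)"
  proof (intro order_trans[OF sum_abs] sum_mono)
    fix j assume "j \<in> {..<(2::nat)^k}"
    then have "real j \<le> 2^k" by (metis lessThan_iff less_imp_le of_nat_le_iff of_nat_numeral of_nat_power)
    then have "\<bar>f (real j / 2^k)\<bar> \<le> B" using F_bound[OF f, of "real j / 2^k"] by (simp add: divide_le_eq_1)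
    then show "\<bar>f (real j / 2^k) * (y j - z j)\<bar> \<le> B * \<bar>y j - z j\<bar>" unfolding abs_mult by (intro mult_right_mono) auto
  qed
  finally show ?thesis by (simp add: sum_distrib_left)
qed

lemma step_functional_mspace: "step_functional F k y \<in> mspace (linfty F)"
proof -
  have "\<bar>dyadic_sum y f k\<bar> \<le> B * (\<Sum>j<2^k. \<bar>y j\<bar>)" if "f \<in> F" for f
    using dyadic_sum_diff_le[OF that, of y k "\<lambda>_. 0"] by (simp add: dyadic_sum_def)
  then show ?thesis unfolding mspace_linfty step_functional_def by (auto intro!: exI[of _ "B * (\<Sum>j<2^k. \<bar>y j\<bar>)"])
qed

lemma step_functional_dist:
  "mdist (linfty F) (step_functional F k y) (step_functional F k z) \<le> B * (\<Sum>j<2^k. \<bar>y j - z j\<bar>)"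
  using dyadic_sum_diff_le B
  by (intro mdist_linfty_le step_functional_mspace) (auto simp: step_functional_def intro!: mult_nonneg_nonneg sum_nonneg)

text \<open>Even for infinite \<open>F\<close>, a step functional depends on \<open>2^k\<close>
  coordinates with coefficients bounded by \<open>B\<close>, so it is Lipschitz in these into the
  supremum metric and continuous for the product topology.\<close>

lemma continuous_on_step_functional:
  fixes h :: "((real \<Rightarrow> real) \<Rightarrow> real) \<Rightarrow> real"
  assumes h: "continuous_map (mtopology_of (linfty F)) euclideanreal h"
  shows "continuous_on UNIV (\<lambda>y. h (step_functional F k y))"
proof (intro continuous_at_imp_continuous_on ballI)
  fix z :: "nat \<Rightarrow> real"
  have coord: "((\<lambda>y. y j) \<longlongrightarrow> z j) (at z)" for j :: nat
  proof -
    have "isCont (\<lambda>y :: nat \<Rightarrow> real. y j) z"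
      using continuous_on_product_coordinates[of j] continuous_on_eq_continuous_at[OF open_UNIV] by blast
    then show ?thesis unfolding isCont_def .
  qed
  have "((\<lambda>y. B * (\<Sum>j<2^k. \<bar>z j - y j\<bar>)) \<longlongrightarrow> B * (\<Sum>j<(2::nat)^k. \<bar>z j - z j\<bar>)) (at z)"
    by (intro tendsto_intros coord)
  then have lim: "((\<lambda>y. B * (\<Sum>j<2^k. \<bar>z j - y j\<bar>)) \<longlongrightarrow> 0) (at z)" by simp
  show "isCont (\<lambda>y. h (step_functional F k y)) z"
    unfolding isCont_def
  proof (rule tendstoI)
    fix e :: real assume "0 < e"
    then obtain r where r: "0 < r" "\<And>g. g \<in> mspace (linfty F) \<Longrightarrow> mdist (linfty F) (step_functional F k z) g < r \<Longrightarrow> \<bar>h g - h (step_functional F k z)\<bar> < e"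
      using h step_functional_mspace[of k z] unfolding continuous_map_mtopology_of_real by meson
    from order_tendstoD(2)[OF lim r(1)]
    show "eventually (\<lambda>y. dist (h (step_functional F k y)) (h (step_functional F k z)) < e) (at z)"
    proof eventually_elim
      case (elim y)
      then have "mdist (linfty F) (step_functional F k z) (step_functional F k y) < r"
        using step_functional_dist[of k z y] by linarith
      then show ?case using r(2)[OF step_functional_mspace] by (simp add: dist_real_def)
    qed
  qed
qed

text \<open>The factor \<open>c\<close> lets one construction serve both the version of the
  isonormal process, \<open>c = 1\<close>, and its multiple in the limit.\<close>

definition limit_element :: "real \<Rightarrow> (nat \<Rightarrow> real) \<Rightarrow> (real \<Rightarrow> real) \<Rightarrow> real" where
  "limit_element c x = (\<lambda>f\<in>F. c * limit_process q B f x)"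

text \<open>Vanishing on the same exceptional set as \<open>limit_process\<close> makes the
  approximation in \<open>limit_element_close\<close> hold at every sample point.\<close>

definition limit_coords :: "real \<Rightarrow> nat \<Rightarrow> (nat \<Rightarrow> real) \<Rightarrow> nat \<Rightarrow> real" where
  "limit_coords c k x j = (if noise_tail q B 0 x < \<infinity> then c * noise k j x else 0)"

lemma measurable_limit_coords: "limit_coords c k \<in> gauss_space \<rightarrow>\<^sub>M borel"
proof (rule measurable_nat_fun_borel)
  show "(\<lambda>x. limit_coords c k x j) \<in> borel_measurable gauss_space" for j
    unfolding limit_coords_def by measurable
qed

lemma dyadic_sum_cmult: "dyadic_sum (\<lambda>j. c * y j) f k = c * dyadic_sum y f k"
  unfolding dyadic_sum_def by (simp add: sum_distrib_left mult_ac)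

lemma limit_element_close:
  assumes f: "f \<in> F"
  shows "\<bar>c * limit_process q B f x - dyadic_sum (limit_coords c k x) f k\<bar>
     \<le> (if noise_tail q B 0 x < \<infinity> then \<bar>c\<bar> * enn2real (noise_tail q B k x) else 0)"
proof (cases "noise_tail q B 0 x < \<infinity>")
  case True
  have f': "f \<in> var_class q B" using f F by auto
  have "\<bar>limit_process q B f x - noise_dyadic f k x\<bar> \<le> enn2real (noise_tail q B k x)"
    using limit_process_close[OF f' q B True, of k] noise_tail_real(1)[OF B True, of k]
    by (metis enn2real_ennreal enn2real_mono abs_ge_zero infinity_ennreal_def)
  then have "\<bar>c * (limit_process q B f x - noise_dyadic f k x)\<bar> \<le> \<bar>c\<bar> * enn2real (noise_tail q B k x)"
    unfolding abs_mult by (intro mult_left_mono) auto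
  then show ?thesis using True by (simp add: limit_coords_def[abs_def] dyadic_sum_cmult right_diff_distrib)
next
  case False
  then show ?thesis unfolding limit_process_def limit_coords_def dyadic_sum_def by simp
qed

lemma limit_element_mspace: "limit_element c x \<in> mspace (linfty F)"
proof -
  obtain C where C: "\<And>f. f \<in> F \<Longrightarrow> \<bar>step_functional F 0 (limit_coords c 0 x) f\<bar> \<le> C"
    using step_functional_mspace[of 0 "limit_coords c 0 x"] unfolding mspace_linfty by blast
  have "\<bar>c * limit_process q B f x\<bar> \<le> C + \<bar>c\<bar> * enn2real (noise_tail q B 0 x)" if f: "f \<in> F" for f
  proof -
    have "0 \<le> \<bar>c\<bar> * enn2real (noise_tail q B 0 x)" by simp
    then have "\<bar>c * limit_process q B f x - dyadic_sum (limit_coords c 0 x) f 0\<bar> \<le> \<bar>c\<bar> * enn2real (noise_tail q B 0 x)"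
      using limit_element_close[OF f, of c x 0] by (auto split: if_splits)
    then show ?thesis using C[OF f] f unfolding step_functional_def by simp
  qed
  then show ?thesis unfolding mspace_linfty limit_element_def by auto
qed

lemma limit_element_dist:
  "mdist (linfty F) (limit_element c x) (step_functional F k (limit_coords c k x))
     \<le> (if noise_tail q B 0 x < \<infinity> then \<bar>c\<bar> * enn2real (noise_tail q B k x) else 0)"
  using limit_element_close
  by (intro mdist_linfty_le limit_element_mspace step_functional_mspace) (auto simp: limit_element_def step_functional_def)

lemma limit_element_tendsto:
  "(\<lambda>k. mdist (linfty F) (limit_element c x) (step_functional F k (limit_coords c k x))) \<longlonglongrightarrow> 0"
proof (rule tendsto_sandwich[OF _ _ tendsto_const])
  let ?u = "\<lambda>k. if noise_tail q B 0 x < \<infinity> then \<bar>c\<bar> * enn2real (noise_tail q B k x) else 0"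
  show "?u \<longlonglongrightarrow> 0"
  proof (cases "noise_tail q B 0 x < \<infinity>")
    case True
    have "(\<lambda>k. \<bar>c\<bar> * enn2real (noise_tail q B k x)) \<longlonglongrightarrow> \<bar>c\<bar> * 0"
      by (intro tendsto_intros noise_tail_real(2)[OF B True])
    then show ?thesis using True by simp
  qed simp
  show "eventually (\<lambda>k. mdist (linfty F) (limit_element c x) (step_functional F k (limit_coords c k x)) \<le> ?u k) sequentially"
    using limit_element_dist by simp
qed simp

text \<open>The countable approximating family consists of step functionals with rational
  coordinates. Composed with a continuous function, the element is a pointwise limit of continuous
  functions of measurable coordinates.\<close>

lemma limit_element_borel: "separably_valued_borel (linfty F) gauss_space (limit_element c)"
proof (rule separably_valued_borelI)
  let ?D = "\<Union>k. step_functional F k ` ({..<2^k} \<rightarrow>\<^sub>E \<rat>)"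
  show "limit_element c x \<in> mspace (linfty F)" for x by (rule limit_element_mspace)
  show "countable ?D" by (intro countable_UN countable_image countable_PiE) (auto simp: countable_rat)
  show "?D \<subseteq> mspace (linfty F)" using step_functional_mspace by auto
  fix x and e :: real assume e: "0 < e"
  have "eventually (\<lambda>k. mdist (linfty F) (limit_element c x) (step_functional F k (limit_coords c k x)) < e / 2) sequentially"
    using e by (intro order_tendstoD(2)[OF limit_element_tendsto]) auto
  then obtain k where k: "mdist (linfty F) (limit_element c x) (step_functional F k (limit_coords c k x)) < e / 2"
    by (auto simp: eventually_sequentially)
  \<comment> \<open>There are \<open>2^k\<close> coordinates, each weighted by at most
    \<open>B\<close>; \<open>B + 1\<close> also covers \<open>B = 0\<close>.\<close>
  define d where "d = e / (2 * (B + 1) * 2^k)"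
  have d: "0 < d" unfolding d_def using e B by simp
  have "\<exists>r\<in>\<rat>. \<bar>limit_coords c k x j - r\<bar> < d" for j
  proof -
    obtain r where "r \<in> \<rat>" "limit_coords c k x j < r" "r < limit_coords c k x j + d"
      using Rats_dense_in_real[of "limit_coords c k x j" "limit_coords c k x j + d"] d by auto
    then show ?thesis by (intro bexI[of _ r]) auto
  qed
  then obtain y where y: "\<And>j. y j \<in> \<rat>" "\<And>j. \<bar>limit_coords c k x j - y j\<bar> < d" by metis
  define y' where "y' = restrict y {..<2^k}"
  have "B * (\<Sum>j<2^k. \<bar>limit_coords c k x j - y' j\<bar>) \<le> B * (\<Sum>j<(2::nat)^k. d)"
    using y(2) B unfolding y'_def by (intro mult_left_mono sum_mono) (auto intro: less_imp_le)
  also have "\<dots> = (e / 2) * (B / (B + 1))" unfolding d_def using B by simp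
  also have "\<dots> < e / 2" using e B by (simp add: field_simps)
  finally have "mdist (linfty F) (step_functional F k (limit_coords c k x)) (step_functional F k y') < e / 2"
    using step_functional_dist[of k "limit_coords c k x" y'] by linarith
  moreover have "mdist (linfty F) (limit_element c x) (step_functional F k y')
    \<le> mdist (linfty F) (limit_element c x) (step_functional F k (limit_coords c k x)) + mdist (linfty F) (step_functional F k (limit_coords c k x)) (step_functional F k y')"
    by (intro mdist_basics(4) limit_element_mspace step_functional_mspace)
  ultimately have "mdist (linfty F) (limit_element c x) (step_functional F k y') < e" using k by linarith
  moreover have "y' \<in> {..<2^k} \<rightarrow>\<^sub>E \<rat>" unfolding y'_def using y(1) by auto
  ultimately show "\<exists>d\<in>?D. mdist (linfty F) (limit_element c x) d < e" by blast
next
  fix h :: "((real \<Rightarrow> real) \<Rightarrow> real) \<Rightarrow> real" assume h: "continuous_map (mtopology_of (linfty F)) euclideanreal h"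
  show "(\<lambda>x. h (limit_element c x)) \<in> borel_measurable gauss_space"
  proof (rule borel_measurable_LIMSEQ_real)
    show "(\<lambda>x. h (step_functional F k (limit_coords c k x))) \<in> borel_measurable gauss_space" for k
      by (rule measurable_compose[OF measurable_limit_coords borel_measurable_continuous_onI[OF continuous_on_step_functional[OF h]]])
    fix x
    show "(\<lambda>k. h (step_functional F k (limit_coords c k x))) \<longlonglongrightarrow> h (limit_element c x)"
    proof (rule tendstoI)
      fix e :: real assume "0 < e"
      then obtain r where r: "0 < r" "\<And>g. g \<in> mspace (linfty F) \<Longrightarrow> mdist (linfty F) (limit_element c x) g < r \<Longrightarrow> \<bar>h g - h (limit_element c x)\<bar> < e"
        using h limit_element_mspace[of c x] unfolding continuous_map_mtopology_of_real by meson
      from order_tendstoD(2)[OF limit_element_tendsto[of c x] r(1)]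
      show "eventually (\<lambda>k. dist (h (step_functional F k (limit_coords c k x))) (h (limit_element c x)) < e) sequentially"
        by eventually_elim (use r(2)[OF step_functional_mspace] in \<open>simp add: dist_real_def\<close>)
    qed
  qed
qed

definition process_element :: "(int \<Rightarrow> 'a \<Rightarrow> real) \<Rightarrow> nat \<Rightarrow> 'a \<Rightarrow> (real \<Rightarrow> real) \<Rightarrow> real" where
  "process_element X n \<omega> = (\<lambda>f\<in>F. real n powr (-1/2) * weighted_sum X n f \<omega>)"

lemma process_element_mspace: "process_element X n \<omega> \<in> mspace (linfty F)"
proof -
  have "\<bar>real n powr (-1/2) * weighted_sum X n f \<omega>\<bar> \<le> real n powr (-1/2) * (\<Sum>i=1..n. \<bar>X (int i) \<omega>\<bar> * B)" if f: "f \<in> F" for f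
    unfolding abs_mult weighted_sum_def abs_of_nonneg[OF powr_ge_zero]
  proof (intro mult_left_mono order_trans[OF sum_abs] sum_mono)
    fix i assume "i \<in> {1..n}"
    then have "\<bar>f (real i / real n)\<bar> \<le> B" by (intro F_bound[OF f]) (auto simp: divide_le_eq_1)
    then show "\<bar>X (int i) \<omega> * f (real i / real n)\<bar> \<le> \<bar>X (int i) \<omega>\<bar> * B" unfolding abs_mult by (intro mult_left_mono) auto
  qed (auto simp: powr_ge_zero)
  then show ?thesis unfolding mspace_linfty process_element_def by auto
qed

text \<open>Two errors: moving the evaluation points of \<open>f\<close> to the left endpoints of
  the cells, and replacing the process on each block by \<open>A\<close> times the innovations. The
  bound of the second involves \<open>f\<close> only through \<open>B\<close>.\<close>

lemma process_element_diff:
  assumes f: "f \<in> F" and n: "0 < n"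
  shows "\<bar>real n powr (-1/2) * weighted_sum X n f \<omega> - dyadic_sum (\<lambda>j. A / sqrt (real n) * block_sum n (\<lambda>i. \<eta> (int (Suc i)) \<omega>) k j) f k\<bar>
    \<le> \<bar>\<Sum>i<n. X (int (Suc i)) \<omega> * (f (real (Suc i) / real n) - f (cell_point n k (Suc i)))\<bar> / sqrt (real n)
      + (\<Sum>j<2^k. B / sqrt (real n) * \<bar>\<Sum>i=block_start n k j..<block_start n k (Suc j). X (int (Suc i)) \<omega> - A * \<eta> (int (Suc i)) \<omega>\<bar>)"
proof -
  let ?x = "\<lambda>i. X (int (Suc i)) \<omega>" and ?e = "\<lambda>i. \<eta> (int (Suc i)) \<omega>"
  have w: "weighted_sum X n f \<omega> = (\<Sum>i<n. ?x i * f (real (Suc i) / real n))"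
    unfolding weighted_sum_def using sum.atLeast1_atMost_eq[of "\<lambda>i. X (int i) \<omega> * f (real i / real n)" n] by simp
  have pw: "real n powr (-1/2) = 1 / sqrt (real n)"
  proof -
    have "real n powr (-1/2) = real n powr - (1/2)" by simp
    also have "\<dots> = 1 / sqrt (real n)" by (simp only: powr_minus_divide powr_half_sqrt[OF of_nat_0_le_iff])
    finally show ?thesis .
  qed
  have "real n powr (-1/2) * weighted_sum X n f \<omega> - dyadic_sum (\<lambda>j. A / sqrt (real n) * block_sum n ?e k j) f k
     = (\<Sum>i<n. ?x i * (f (real (Suc i) / real n) - f (cell_point n k (Suc i)))) / sqrt (real n)
       + (dyadic_sum (\<lambda>j. 1 / sqrt (real n) * block_sum n ?x k j) f k - dyadic_sum (\<lambda>j. A / sqrt (real n) * block_sum n ?e k j) f k)"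
  proof -
    have "dyadic_sum (\<lambda>j. 1 / sqrt (real n) * block_sum n ?x k j) f k = (\<Sum>i<n. ?x i * f (cell_point n k (Suc i))) / sqrt (real n)"
      unfolding dyadic_sum_cmult dyadic_sum_block_sum[OF n] by simp
    then show ?thesis unfolding w pw by (simp add: right_diff_distrib sum_subtractf diff_divide_distrib)
  qed
  moreover have "\<bar>dyadic_sum (\<lambda>j. 1 / sqrt (real n) * block_sum n ?x k j) f k - dyadic_sum (\<lambda>j. A / sqrt (real n) * block_sum n ?e k j) f k\<bar>
     \<le> (\<Sum>j<2^k. B / sqrt (real n) * \<bar>\<Sum>i=block_start n k j..<block_start n k (Suc j). ?x i - A * ?e i\<bar>)"
  proof -
    have "1 / sqrt (real n) * block_sum n ?x k j - A / sqrt (real n) * block_sum n ?e k j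
       = (\<Sum>i=block_start n k j..<block_start n k (Suc j). ?x i - A * ?e i) / sqrt (real n)" for j
      unfolding block_sum_def by (simp add: sum_subtractf sum_distrib_left[symmetric] diff_divide_distrib)
    then show ?thesis using dyadic_sum_diff_le[OF f, of "\<lambda>j. 1 / sqrt (real n) * block_sum n ?x k j" k "\<lambda>j. A / sqrt (real n) * block_sum n ?e k j"]
      by (simp add: sum_distrib_left)
  qed
  moreover have "\<bar>(\<Sum>i<n. ?x i * (f (real (Suc i) / real n) - f (cell_point n k (Suc i)))) / sqrt (real n)\<bar>
     = \<bar>\<Sum>i<n. ?x i * (f (real (Suc i) / real n) - f (cell_point n k (Suc i)))\<bar> / sqrt (real n)"
    by (rule abs_div_pos[symmetric]) (use n in simp)
  ultimately show ?thesis by linarith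
qed

end

lemma (in prob_space) outer_expectation_between:
  assumes u: "integrable M u" and r: "integrable M r" and T: "\<And>x. x \<in> space M \<Longrightarrow> \<bar>T x\<bar> \<le> b"
    and ae: "AE x in M. \<bar>T x - u x\<bar> \<le> r x"
  shows "ereal (expectation u - expectation r) \<le> outer_expectation M T"
    "outer_expectation M T \<le> ereal (expectation u + expectation r)"
proof -
  have "outer_expectation M T \<le> ereal (expectation (\<lambda>x. u x + r x))"
    by (rule outer_expectation_le[OF _ T]) (use u r ae in \<open>auto elim!: eventually_mono\<close>)
  then show "outer_expectation M T \<le> ereal (expectation u + expectation r)" using u r by simp
  have "ereal (expectation (\<lambda>x. u x - r x)) \<le> outer_expectation M T"
    by (rule outer_expectation_ge) (use u r ae in \<open>auto elim!: eventually_mono\<close>)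
  then show "ereal (expectation u - expectation r) \<le> outer_expectation M T" using u r by simp
qed

context bounded_var_family
begin

text \<open>The level \<open>k\<close> is fixed first, from the chaining bound that is uniform in
  \<open>n \<ge> 2^k\<close>; only then is \<open>N\<close> taken, depending on \<open>k\<close>,
  for the \<open>2^k\<close> blocks. The distance itself need not be measurable, so \<open>r\<close>
  is an integrable majorant.\<close>

lemma process_element_approx:
  assumes M: "prob_space M" and X: "short_memory_linear_process M \<eta> \<psi> X" and e: "0 < e"
  defines "A \<equiv> \<Sum>j. \<psi> j"
  shows "\<exists>k0. \<forall>k\<ge>k0. \<exists>N. \<forall>n\<ge>N. \<exists>r. integrable M r \<and> (\<integral>\<omega>. r \<omega> \<partial>M) \<le> e \<and>
    (AE \<omega> in M. mdist (linfty F) (process_element X n \<omega>)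
        (step_functional F k (\<lambda>j. A / sqrt (real n) * block_sum n (\<lambda>i. \<eta> (int (Suc i)) \<omega>) k j)) \<le> r \<omega>)"
proof -
  interpret prob_space M by fact
  have iid: "iid_innovations M \<eta>" and Xm[measurable]: "\<And>i. X i \<in> borel_measurable M"
    using X unfolding short_memory_linear_process_def by auto
  note [measurable] = iid_innovationsD(2)[OF iid]
  have e2: "0 < e / 2" using e by simp
  obtain k0 where k0: "\<And>k n. k \<ge> k0 \<Longrightarrow> n \<ge> 2^k \<Longrightarrow> \<exists>R\<in>borel_measurable M. (\<integral>\<^sup>+\<omega>. R \<omega> \<partial>M) \<le> ennreal (e / 2) \<and>
    (AE \<omega> in M. \<forall>f\<in>var_class q B.
       ennreal \<bar>\<Sum>i<n. X (int (Suc i)) \<omega> * (f (real (Suc i) / real n) - f (cell_point n k (Suc i)))\<bar>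
         \<le> ennreal (sqrt (real n)) * R \<omega>)"
    using process_sums_approx[OF X q B e2] by blast
  show ?thesis
  proof (rule exI[of _ k0], intro allI impI)
    fix k assume k: "k0 \<le> k"
    \<comment> \<open>The \<open>2^k\<close> block errors, each with weight \<open>B\<close>, then
      add up to at most \<open>e / 2\<close>.\<close>
    define d where "d = e / (2 * (B + 1) * 2^k)"
    have d: "0 < d" unfolding d_def using e B by simp
    obtain N where N: "\<And>n a b. n \<ge> N \<Longrightarrow> a \<le> b \<Longrightarrow> b \<le> n \<Longrightarrow>
      (\<integral>\<^sup>+\<omega>. ennreal \<bar>\<Sum>i=a..<b. X (int (Suc i)) \<omega> - A * \<eta> (int (Suc i)) \<omega>\<bar> \<partial>M) \<le> ennreal (d * sqrt (real n))"
      using process_block_approx[OF X d] unfolding A_def by blast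
    show "\<exists>N. \<forall>n\<ge>N. \<exists>r. integrable M r \<and> (\<integral>\<omega>. r \<omega> \<partial>M) \<le> e \<and>
      (AE \<omega> in M. mdist (linfty F) (process_element X n \<omega>)
        (step_functional F k (\<lambda>j. A / sqrt (real n) * block_sum n (\<lambda>i. \<eta> (int (Suc i)) \<omega>) k j)) \<le> r \<omega>)"
    proof (intro exI[of _ "max N (2^k)"] allI impI)
      fix n assume n: "max N (2^k) \<le> n"
      then have nN: "n \<ge> N" "n \<ge> 2^k" by auto
      have npos: "0 < n" using nN(2) by (metis gr0I not_one_le_zero one_le_numeral one_le_power order_trans)
      obtain R where [measurable]: "R \<in> borel_measurable M" and R: "(\<integral>\<^sup>+\<omega>. R \<omega> \<partial>M) \<le> ennreal (e / 2)"
        "AE \<omega> in M. \<forall>f\<in>var_class q B.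
           ennreal \<bar>\<Sum>i<n. X (int (Suc i)) \<omega> * (f (real (Suc i) / real n) - f (cell_point n k (Suc i)))\<bar>
             \<le> ennreal (sqrt (real n)) * R \<omega>" using k0[OF k nN(2)] by blast
      let ?b = "\<lambda>j \<omega>. \<bar>\<Sum>i=block_start n k j..<block_start n k (Suc j). X (int (Suc i)) \<omega> - A * \<eta> (int (Suc i)) \<omega>\<bar>"
      define Q where "Q \<omega> = R \<omega> + (\<Sum>j<2^k. ennreal (B / sqrt (real n)) * ennreal (?b j \<omega>))" for \<omega>
      have [measurable]: "Q \<in> borel_measurable M" unfolding Q_def by measurable
      have "(\<integral>\<^sup>+\<omega>. Q \<omega> \<partial>M) = (\<integral>\<^sup>+\<omega>. R \<omega> \<partial>M) + (\<Sum>j<2^k. ennreal (B / sqrt (real n)) * (\<integral>\<^sup>+\<omega>. ennreal (?b j \<omega>) \<partial>M))"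
        unfolding Q_def by (simp add: nn_integral_add nn_integral_sum nn_integral_cmult)
      also have "\<dots> \<le> ennreal (e / 2) + (\<Sum>j<(2::nat)^k. ennreal (B / sqrt (real n)) * ennreal (d * sqrt (real n)))"
      proof (intro add_mono R sum_mono mult_left_mono N nN block_start_mono)
        fix j assume "j \<in> {..<(2::nat)^k}"
        then show "block_start n k (Suc j) \<le> n" using block_start_mono[of "Suc j" "2^k" n k] by simp
      qed auto
      also have "\<dots> = ennreal (e / 2) + (\<Sum>j<(2::nat)^k. ennreal (B * d))"
        using B d npos by (simp add: ennreal_mult[symmetric])
      also have "\<dots> = ennreal (e / 2 + 2^k * (B * d))"
        using e B d by (subst sum_ennreal) (auto simp: ennreal_plus[symmetric] simp del: ennreal_plus)
      also have "\<dots> \<le> ennreal e"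
      proof (rule ennreal_leI)
        have "2^k * (B * d) = e / 2 * (B / (B + 1))" unfolding d_def using B by simp
        also have "\<dots> \<le> e / 2" using e B by (simp add: field_simps)
        finally show "e / 2 + 2^k * (B * d) \<le> e" by simp
      qed
      finally have QI: "(\<integral>\<^sup>+\<omega>. Q \<omega> \<partial>M) \<le> ennreal e" .
      then have "(\<integral>\<^sup>+\<omega>. Q \<omega> \<partial>M) < \<infinity>" by (rule le_less_trans) simp
      \<comment> \<open>The majorant may be infinite on a null set, so it is made real only after
        being seen to be finite almost surely.\<close>
      then have Qfin: "AE \<omega> in M. Q \<omega> \<noteq> \<infinity>" by (intro nn_integral_PInf_AE) auto
      have Qr: "(\<integral>\<^sup>+\<omega>. ennreal (enn2real (Q \<omega>)) \<partial>M) \<le> ennreal e"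
        using QI Qfin by (subst nn_integral_cong_AE[of _ Q]) (auto elim!: eventually_mono simp: less_top)
      have int: "integrable M (\<lambda>\<omega>. enn2real (Q \<omega>))"
        by (rule integrableI_nonneg) (use Qr in \<open>auto simp: le_less_trans\<close>)
      have "ennreal (expectation (\<lambda>\<omega>. enn2real (Q \<omega>))) \<le> ennreal e"
        using Qr int by (subst (asm) nn_integral_eq_integral) auto
      then have Er: "expectation (\<lambda>\<omega>. enn2real (Q \<omega>)) \<le> e" using e by (simp add: ennreal_le_iff)
      have "AE \<omega> in M. mdist (linfty F) (process_element X n \<omega>)
        (step_functional F k (\<lambda>j. A / sqrt (real n) * block_sum n (\<lambda>i. \<eta> (int (Suc i)) \<omega>) k j)) \<le> enn2real (Q \<omega>)"
        using R(2) Qfin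
      proof eventually_elim
        case (elim \<omega>)
        show ?case
        proof (rule mdist_linfty_le[OF process_element_mspace step_functional_mspace])
          fix f assume f: "f \<in> F"
          let ?s = "\<bar>\<Sum>i<n. X (int (Suc i)) \<omega> * (f (real (Suc i) / real n) - f (cell_point n k (Suc i)))\<bar>"
          have "ennreal (?s / sqrt (real n)) \<le> R \<omega>"
          proof -
            have "ennreal (1 / sqrt (real n)) * ennreal ?s \<le> ennreal (1 / sqrt (real n)) * (ennreal (sqrt (real n)) * R \<omega>)"
              using elim(1) f F by (intro mult_left_mono) auto
            also have "\<dots> = R \<omega>" using npos by (simp add: mult.assoc[symmetric] ennreal_mult[symmetric])
            finally show ?thesis by (simp add: ennreal_mult[symmetric])
          qed
          moreover have "ennreal (\<Sum>j<2^k. B / sqrt (real n) * ?b j \<omega>) = (\<Sum>j<2^k. ennreal (B / sqrt (real n)) * ennreal (?b j \<omega>))"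
            using B by (simp only: ennreal_mult[symmetric] divide_nonneg_nonneg real_sqrt_ge_zero of_nat_0_le_iff abs_ge_zero)
              (intro sum_ennreal[symmetric] mult_nonneg_nonneg divide_nonneg_nonneg, auto)
          ultimately have "ennreal (?s / sqrt (real n) + (\<Sum>j<2^k. B / sqrt (real n) * ?b j \<omega>)) \<le> Q \<omega>"
            unfolding Q_def using B by (subst ennreal_plus) (auto intro!: sum_nonneg add_mono)
          then have "enn2real (ennreal (?s / sqrt (real n) + (\<Sum>j<2^k. B / sqrt (real n) * ?b j \<omega>))) \<le> enn2real (Q \<omega>)"
            using elim(2) by (intro enn2real_mono) (auto simp: less_top)
          moreover have "0 \<le> ?s / sqrt (real n) + (\<Sum>j<2^k. B / sqrt (real n) * ?b j \<omega>)"
            using B by (intro add_nonneg_nonneg sum_nonneg mult_nonneg_nonneg divide_nonneg_nonneg) auto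
          ultimately have "?s / sqrt (real n) + (\<Sum>j<2^k. B / sqrt (real n) * ?b j \<omega>) \<le> enn2real (Q \<omega>)"
            by (simp only: enn2real_ennreal)
          with process_element_diff[OF f npos, of X \<omega> A \<eta> k] f
          show "\<bar>process_element X n \<omega> f - step_functional F k (\<lambda>j. A / sqrt (real n) * block_sum n (\<lambda>i. \<eta> (int (Suc i)) \<omega>) k j) f\<bar> \<le> enn2real (Q \<omega>)"
            unfolding process_element_def step_functional_def by simp
        qed simp
      qed
      then show "\<exists>r. integrable M r \<and> expectation r \<le> e \<and> (AE \<omega> in M. mdist (linfty F) (process_element X n \<omega>)
        (step_functional F k (\<lambda>j. A / sqrt (real n) * block_sum n (\<lambda>i. \<eta> (int (Suc i)) \<omega>) k j)) \<le> r \<omega>)"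
        using int Er by (intro exI[of _ "\<lambda>\<omega>. enn2real (Q \<omega>)"]) auto
    qed
  qed
qed

text \<open>Where the tail is finite, that is almost surely, the distance between the limit and its
  level-\<open>k\<close> version is at most \<open>\<bar>c\<bar>\<close> times the noise tail, whose
  mean decays geometrically.\<close>

lemma limit_element_approx:
  assumes l: "0 \<le> l" and h: "\<And>x. x \<in> mspace (linfty F) \<Longrightarrow> \<bar>h x\<bar> \<le> b"
    "\<And>x y. x \<in> mspace (linfty F) \<Longrightarrow> y \<in> mspace (linfty F) \<Longrightarrow> \<bar>h x - h y\<bar> \<le> l * mdist (linfty F) x y"
  shows "(\<lambda>k. \<integral>x. h (step_functional F k (\<lambda>j. c * noise k j x)) \<partial>gauss_space) \<longlonglongrightarrow> (\<integral>x. h (limit_element c x) \<partial>gauss_space)"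
proof (rule LIM_zero_cancel, rule Lim_null_comparison)
  have hc: "continuous_map (mtopology_of (linfty F)) euclideanreal h" by (rule lipschitz_continuous_map[OF h(2) l])
  let ?H = "B + 2 * B\<^sup>2 + 1 + 2 * B * 1"
  let ?u = "\<lambda>k. ?H * level_rate q ^ k / (1 - level_rate q)"
  have mZ: "(\<lambda>x. h (limit_element c x)) \<in> borel_measurable gauss_space"
    by (rule separably_valued_borel_compose[OF limit_element_borel hc])
  have mT: "(\<lambda>x. h (step_functional F k (\<lambda>j. c * noise k j x))) \<in> borel_measurable gauss_space" for k
  proof (rule measurable_compose[OF measurable_nat_fun_borel borel_measurable_continuous_onI[OF continuous_on_step_functional[OF hc]]])
    show "(\<lambda>x. c * noise k j x) \<in> borel_measurable gauss_space" for j by measurable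
  qed
  have iZ: "integrable gauss_space (\<lambda>x. h (limit_element c x))"
    by (rule G.integrable_bounded[OF mZ]) (rule h(1)[OF limit_element_mspace])
  have iT: "integrable gauss_space (\<lambda>x. h (step_functional F k (\<lambda>j. c * noise k j x)))" for k
    by (rule G.integrable_bounded[OF mT]) (rule h(1)[OF step_functional_mspace])
  have r: "0 < level_rate q" "level_rate q < 1" using level_rate[OF q(2)] by auto
  have "norm ((\<integral>x. h (step_functional F k (\<lambda>j. c * noise k j x)) \<partial>gauss_space) - (\<integral>x. h (limit_element c x) \<partial>gauss_space)) \<le> l * \<bar>c\<bar> * ?u k" for k
  proof -
    have u0: "0 \<le> ?u k" using B r by simp
    let ?t = "\<lambda>x. enn2real (noise_tail q B k x)"
    have "(\<integral>\<^sup>+x. ennreal (?t x) \<partial>gauss_space) = (\<integral>\<^sup>+x. noise_tail q B k x \<partial>gauss_space)"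
      using noise_tail_finite[OF q B, of k] by (intro nn_integral_cong_AE) (auto elim!: eventually_mono simp: less_top)
    also have "\<dots> \<le> ennreal (?u k)" by (rule noise_tail_integral[OF q B])
    finally have tI: "(\<integral>\<^sup>+x. ennreal (?t x) \<partial>gauss_space) \<le> ennreal (?u k)" .
    have ti: "integrable gauss_space ?t" by (rule integrableI_nonneg) (use tI in \<open>auto simp: le_less_trans\<close>)
    have "ennreal (\<integral>x. ?t x \<partial>gauss_space) \<le> ennreal (?u k)" using tI ti by (subst (asm) nn_integral_eq_integral) auto
    then have tE: "(\<integral>x. ?t x \<partial>gauss_space) \<le> ?u k" using u0 by (simp only: ennreal_le_iff)
    have "(\<integral>x. h (step_functional F k (\<lambda>j. c * noise k j x)) \<partial>gauss_space) - (\<integral>x. h (limit_element c x) \<partial>gauss_space)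
      = (\<integral>x. h (step_functional F k (\<lambda>j. c * noise k j x)) - h (limit_element c x) \<partial>gauss_space)"
      by (rule Bochner_Integration.integral_diff[symmetric, OF iT iZ])
    also have "norm \<dots> \<le> (\<integral>x. norm (h (step_functional F k (\<lambda>j. c * noise k j x)) - h (limit_element c x)) \<partial>gauss_space)"
      by (rule integral_norm_bound)
    also have "\<dots> \<le> (\<integral>x. l * \<bar>c\<bar> * ?t x \<partial>gauss_space)"
    proof (rule integral_mono_AE)
      show "integrable gauss_space (\<lambda>x. norm (h (step_functional F k (\<lambda>j. c * noise k j x)) - h (limit_element c x)))"
        by (intro integrable_norm Bochner_Integration.integrable_diff iT iZ)
      show "integrable gauss_space (\<lambda>x. l * \<bar>c\<bar> * ?t x)" by (intro integrable_mult_right ti)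
      show "AE x in gauss_space. norm (h (step_functional F k (\<lambda>j. c * noise k j x)) - h (limit_element c x)) \<le> l * \<bar>c\<bar> * ?t x"
        using noise_tail_finite[OF q B, of 0]
      proof eventually_elim
        case (elim x)
        have eq: "limit_coords c k x = (\<lambda>j. c * noise k j x)" unfolding limit_coords_def[abs_def] using elim by simp
        have "norm (h (step_functional F k (\<lambda>j. c * noise k j x)) - h (limit_element c x)) \<le> l * mdist (linfty F) (limit_element c x) (step_functional F k (\<lambda>j. c * noise k j x))"
          using h(2)[OF limit_element_mspace[of c x] step_functional_mspace[of k "\<lambda>j. c * noise k j x"]] by (simp add: abs_minus_commute)
        also have "\<dots> \<le> l * (\<bar>c\<bar> * ?t x)" using limit_element_dist[of c x k] elim l unfolding eq by (intro mult_left_mono) auto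
        finally show ?case by (simp add: mult.assoc)
      qed
    qed
    also have "\<dots> = l * \<bar>c\<bar> * (\<integral>x. ?t x \<partial>gauss_space)" by simp
    also have "\<dots> \<le> l * \<bar>c\<bar> * ?u k" using l by (intro mult_left_mono tE mult_nonneg_nonneg) auto
    finally show ?thesis .
  qed
  then show "eventually (\<lambda>k. norm ((\<integral>x. h (step_functional F k (\<lambda>j. c * noise k j x)) \<partial>gauss_space) - (\<integral>x. h (limit_element c x) \<partial>gauss_space)) \<le> l * \<bar>c\<bar> * ?u k) sequentially"
    by (rule always_eventually[OF allI])
  have "(\<lambda>k. l * \<bar>c\<bar> * ?u k) \<longlonglongrightarrow> l * \<bar>c\<bar> * (?H * 0 / (1 - level_rate q))"
    using r by (intro tendsto_intros LIMSEQ_realpow_zero) auto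
  then show "(\<lambda>k. l * \<bar>c\<bar> * ?u k) \<longlonglongrightarrow> 0" by simp
qed

text \<open>Three errors of \<open>e / 3\<close> for a Lipschitz \<open>h\<close>: from the process
  to a step functional of innovation block sums in mean, from these to the noise of level
  \<open>k\<close> by the central limit theorem, and from that noise to the limit. Choosing
  \<open>k\<close> for the first and the last leaves a fixed dimension for the middle one.\<close>

lemma process_converges:
  assumes M: "prob_space M" and X: "short_memory_linear_process M \<eta> \<psi> X"
  defines "c \<equiv> sqrt (\<integral>\<omega>. (\<eta> 1 \<omega>)\<^sup>2 \<partial>M) * (\<Sum>j. \<psi> j)"
  shows "converges_in_outer_distribution (linfty F) (\<lambda>_. M) (process_element X) gauss_space (limit_element c)"
proof (rule converges_in_outer_distributionI[OF M process_element_mspace prob_space_gauss_space limit_element_borel])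
  interpret prob_space M by fact
  have iid: "iid_innovations M \<eta>" using X unfolding short_memory_linear_process_def by auto
  note [measurable] = iid_innovationsD(2)[OF iid]
  fix h :: "((real \<Rightarrow> real) \<Rightarrow> real) \<Rightarrow> real" and l b
  assume hb: "\<And>x. x \<in> mspace (linfty F) \<Longrightarrow> \<bar>h x\<bar> \<le> b" and l: "0 \<le> l"
    and hl: "\<And>x y. x \<in> mspace (linfty F) \<Longrightarrow> y \<in> mspace (linfty F) \<Longrightarrow> \<bar>h x - h y\<bar> \<le> l * mdist (linfty F) x y"
  have hc: "continuous_map (mtopology_of (linfty F)) euclideanreal h" by (rule lipschitz_continuous_map[OF hl l])
  define A where "A = (\<Sum>j. \<psi> j)"
  define I where "I = (\<integral>x. h (limit_element c x) \<partial>gauss_space)"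
  let ?Y = "\<lambda>n k \<omega> j. A / sqrt (real n) * block_sum n (\<lambda>i. \<eta> (int (Suc i)) \<omega>) k j"
  let ?O = "\<lambda>n. outer_expectation M (\<lambda>\<omega>. h (process_element X n \<omega>))"
  have key: "eventually (\<lambda>n. ereal (I - e) \<le> ?O n \<and> ?O n \<le> ereal (I + e)) sequentially" if e: "0 < e" for e
  proof -
    \<comment> \<open>Multiplied by the Lipschitz constant \<open>l\<close> this is at most
      \<open>e / 3\<close>; \<open>l + 1\<close> avoids division by 0.\<close>
    define d where "d = e / (3 * (l + 1))"
    have d: "0 < d" "l * d \<le> e / 3" unfolding d_def using e l by (auto simp: field_simps)
    obtain k0 where k0: "\<And>k. k \<ge> k0 \<Longrightarrow> \<exists>N. \<forall>n\<ge>N. \<exists>r. integrable M r \<and> expectation r \<le> d \<and>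
      (AE \<omega> in M. mdist (linfty F) (process_element X n \<omega>) (step_functional F k (?Y n k \<omega>)) \<le> r \<omega>)"
      using process_element_approx[OF M X d(1)] unfolding A_def by blast
    have e3: "0 < e / 3" using e by simp
    from LIMSEQ_D[OF limit_element_approx[OF l hb hl, of c] e3]
    obtain k1 where k1: "\<And>k. k \<ge> k1 \<Longrightarrow> \<bar>(\<integral>x. h (step_functional F k (\<lambda>j. c * noise k j x)) \<partial>gauss_space) - I\<bar> < e / 3"
      unfolding I_def real_norm_def by blast
    define k where "k = max k0 k1"
    define \<phi> where "\<phi> y = h (step_functional F k y)" for y
    have \<phi>c: "continuous_on UNIV \<phi>" unfolding \<phi>_def by (rule continuous_on_step_functional[OF hc])
    have \<phi>b: "\<bar>\<phi> y\<bar> \<le> b" for y unfolding \<phi>_def by (rule hb[OF step_functional_mspace])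
    have \<phi>m: "\<phi> \<in> borel_measurable borel" by (rule borel_measurable_continuous_onI[OF \<phi>c])
    have \<phi>z: "\<phi> (zero_beyond (2^k) y) = \<phi> y" for y unfolding \<phi>_def step_functional_zero_beyond ..
    \<comment> \<open>The limit in \<open>block_sums_clt\<close> is written with independent
      coordinates; \<open>standard_noise k\<close> preserves their law and turns them into the noise
      of level \<open>k\<close>, which is tied to the limit process.\<close>
    have "(\<integral>x. \<phi> (zero_beyond (2^k) (\<lambda>j. A * sqrt (expectation (\<lambda>\<omega>. (\<eta> 1 \<omega>)\<^sup>2)) * sqrt (1/2^k) * x j)) \<partial>gauss_space)
      = (\<integral>x. \<phi> (zero_beyond (2^k) (\<lambda>j. c * (sqrt (1/2^k) * standard_noise k x j))) \<partial>gauss_space)"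
    proof -
      have "(\<lambda>x. \<phi> (zero_beyond (2^k) (\<lambda>j. c * (sqrt (1/2^k) * x j)))) \<in> borel_measurable gauss_space"
        using measurable_gauss_coord by (intro measurable_compose[OF measurable_zero_beyond \<phi>m] borel_measurable_times) auto
      from integral_standard_noise(2)[OF this, of k] show ?thesis unfolding c_def A_def by (simp add: mult_ac)
    qed
    also have "\<dots> = (\<integral>x. \<phi> (\<lambda>j. c * noise k j x) \<partial>gauss_space)"
    proof -
      have "zero_beyond (2^k) (\<lambda>j. c * (sqrt (1/2^k) * standard_noise k x j)) = zero_beyond (2^k) (\<lambda>j. c * noise k j x)" for x
        unfolding zero_beyond_def using noise_standard[of _ k x] by auto
      then show ?thesis by (simp add: \<phi>z)
    qed
    finally have "(\<lambda>n. expectation (\<lambda>\<omega>. \<phi> (?Y n k \<omega>))) \<longlonglongrightarrow> (\<integral>x. \<phi> (\<lambda>j. c * noise k j x) \<partial>gauss_space)"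
      using block_sums_clt[OF iid \<phi>c \<phi>b, of k A] unfolding \<phi>z gauss_space_def[symmetric] by simp
    from LIMSEQ_D[OF this e3] obtain N1 where N1: "\<And>n. n \<ge> N1 \<Longrightarrow> \<bar>expectation (\<lambda>\<omega>. \<phi> (?Y n k \<omega>)) - (\<integral>x. \<phi> (\<lambda>j. c * noise k j x) \<partial>gauss_space)\<bar> < e / 3"
      unfolding real_norm_def by blast
    obtain N2 where N2: "\<And>n. n \<ge> N2 \<Longrightarrow> \<exists>r. integrable M r \<and> expectation r \<le> d \<and>
      (AE \<omega> in M. mdist (linfty F) (process_element X n \<omega>) (step_functional F k (?Y n k \<omega>)) \<le> r \<omega>)"
      using k0[of k] unfolding k_def by auto
    show ?thesis
    proof (rule eventually_sequentiallyI[of "max N1 N2"])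
      fix n assume n: "max N1 N2 \<le> n"
      then obtain r where r: "integrable M r" "expectation r \<le> d"
        "AE \<omega> in M. mdist (linfty F) (process_element X n \<omega>) (step_functional F k (?Y n k \<omega>)) \<le> r \<omega>" using N2[of n] by auto
      have Ym: "(\<lambda>\<omega>. \<phi> (?Y n k \<omega>)) \<in> borel_measurable M"
      proof (rule measurable_compose[OF measurable_nat_fun_borel \<phi>m])
        show "(\<lambda>\<omega>. ?Y n k \<omega> j) \<in> borel_measurable M" for j unfolding block_sum_def by measurable
      qed
      have Yi: "integrable M (\<lambda>\<omega>. \<phi> (?Y n k \<omega>))" by (rule integrable_bounded[OF Ym \<phi>b])
      have "AE \<omega> in M. \<bar>h (process_element X n \<omega>) - \<phi> (?Y n k \<omega>)\<bar> \<le> l * r \<omega>"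
        using r(3)
      proof eventually_elim
        case (elim \<omega>)
        have "\<bar>h (process_element X n \<omega>) - \<phi> (?Y n k \<omega>)\<bar> \<le> l * mdist (linfty F) (process_element X n \<omega>) (step_functional F k (?Y n k \<omega>))"
          unfolding \<phi>_def by (rule hl[OF process_element_mspace step_functional_mspace])
        also have "\<dots> \<le> l * r \<omega>" using elim l by (rule mult_left_mono)
        finally show ?case .
      qed
      note ob = outer_expectation_between[OF Yi integrable_mult_right[OF r(1), of l] hb[OF process_element_mspace] this]
      have lr: "expectation (\<lambda>\<omega>. l * r \<omega>) \<le> e / 3"
        using mult_left_mono[OF r(2) l] d(2) by simp
      have "\<bar>(\<integral>x. \<phi> (\<lambda>j. c * noise k j x) \<partial>gauss_space) - I\<bar> < e / 3"
        unfolding \<phi>_def by (rule k1) (simp add: k_def)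
      moreover have "\<bar>expectation (\<lambda>\<omega>. \<phi> (?Y n k \<omega>)) - (\<integral>x. \<phi> (\<lambda>j. c * noise k j x) \<partial>gauss_space)\<bar> < e / 3"
        by (rule N1) (use n in simp)
      ultimately have "\<bar>expectation (\<lambda>\<omega>. \<phi> (?Y n k \<omega>)) - I\<bar> < 2 * e / 3" by linarith
      then have "I - e \<le> expectation (\<lambda>\<omega>. \<phi> (?Y n k \<omega>)) - expectation (\<lambda>\<omega>. l * r \<omega>)"
        "expectation (\<lambda>\<omega>. \<phi> (?Y n k \<omega>)) + expectation (\<lambda>\<omega>. l * r \<omega>) \<le> I + e" using lr by linarith+
      then show "ereal (I - e) \<le> ?O n \<and> ?O n \<le> ereal (I + e)"
        using ob by (meson ereal_less_eq(3) order_trans)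
    qed
  qed
  show "?O \<longlonglongrightarrow> ereal (\<integral>x. h (limit_element c x) \<partial>gauss_space)"
    unfolding I_def[symmetric]
  proof (rule order_tendstoI)
    fix a assume "a < ereal I"
    then obtain s where s: "a < ereal s" "s < I" by (metis ereal_dense2 less_ereal.simps(1))
    from key[of "I - s"] s(2) show "eventually (\<lambda>n. a < ?O n) sequentially"
      by (auto elim!: eventually_mono intro: less_le_trans[OF s(1)])
  next
    fix a assume "ereal I < a"
    then obtain s where s: "ereal s < a" "I < s" by (metis ereal_dense2 less_ereal.simps(1))
    from key[of "s - I"] s(2) show "eventually (\<lambda>n. ?O n < a) sequentially"
      by (auto elim!: eventually_mono intro: le_less_trans[OF _ s(1)])
  qed
qed

end

theorem theorem1:
  fixes M :: "'a measure" and \<eta> X :: "int \<Rightarrow> 'a \<Rightarrow> real" and \<psi> :: "nat \<Rightarrow> real"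
    and q :: real and F :: "(real \<Rightarrow> real) set"
  assumes "prob_space M"
    and "short_memory_linear_process M \<eta> \<psi> X"
    and "1 \<le> q" and "q < 2"
    and "Wq_bounded q F"
  shows "\<exists>(N :: (nat \<Rightarrow> real) measure) W \<nu>.
           isonormal_process N W \<and>
           (\<forall>f\<in>F. f \<in> L2_unit \<and> (AE x in N. \<nu> x f = W f x)) \<and>
           separably_valued_borel (linfty F) N \<nu> \<and>
           converges_in_outer_distribution (linfty F)
             (\<lambda>_. M) (\<lambda>n \<omega>. \<lambda>f\<in>F. real n powr (-1/2) * weighted_sum X n f \<omega>)
             N (\<lambda>x. \<lambda>f\<in>F. sqrt (\<integral>\<omega>. (\<eta> 1 \<omega>)\<^sup>2 \<partial>M) * (\<Sum>j. \<psi> j) * \<nu> x f)"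
proof -
  obtain B where B: "1 \<le> B" "F \<subseteq> var_class q B" using Wq_bounded_var_class[OF assms(5,3)] by blast
  interpret bounded_var_family F q B using B assms(3,4) by unfold_locales auto
  \<comment> \<open>The isonormal family is \<open>white_noise\<close>; \<open>?\<nu>\<close> is its
    version with bounded paths in a separable set, equal to it almost surely for each
    \<open>f\<close>.\<close>
  let ?\<nu> = "limit_element 1"
  have "f \<in> L2_unit \<and> (AE x in gauss_space. ?\<nu> x f = white_noise f x)" if f: "f \<in> F" for f
  proof -
    have f': "f \<in> var_class q B" using f F by auto
    have sq: "sq_int unit_leb f" by (rule var_class_sq_int[OF f' q(1)])
    have "f \<in> extensional {0..1}" using f assms(5) unfolding Wq_bounded_def Wq_def by auto
    then have "f \<in> L2_unit" using sq unfolding L2_unit_def sq_int_def by auto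
    moreover have "AE x in gauss_space. limit_process q B f x = white_noise f x"
      by (rule wiener_rep_unique[OF wiener_rep_limit_process[OF f' q] wiener_rep_white_noise[OF sq]]) (use B in simp)
    ultimately show ?thesis using f unfolding limit_element_def by simp
  qed
  moreover have "(\<lambda>x. \<lambda>f\<in>F. c * ?\<nu> x f) = limit_element c" for c
    unfolding limit_element_def by (auto simp: fun_eq_iff)
  moreover have "process_element X = (\<lambda>n \<omega>. \<lambda>f\<in>F. real n powr (-1/2) * weighted_sum X n f \<omega>)"
    unfolding process_element_def by (auto simp: fun_eq_iff)
  ultimately show ?thesis
    using isonormal_white_noise limit_element_borel[of 1] process_converges[OF assms(1,2)]
    by (intro exI[of _ gauss_space] exI[of _ white_noise] exI[of _ ?\<nu>]) simp
qed

end
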